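(* Let $F:\mathcal P_2(\mathbb R^d)\to\mathbb R$ be a functional with linear functional derivative $\frac{\delta F}{\delta m}$ and intrinsic derivative $D_mF=\nabla\frac{\delta F}{\delta m}$, and assume that there are constants $M^F_{mm}\ge 0$, $M^F_{mx}\ge 0$, $\rho>0$ such that: (1) $F((1-t)m+tm')\le(1-t)F(m)+tF(m')$ for all $t\in[0,1]$, $m,m'\in\mathcal P_2(\mathbb R^d)$; (2) $|D_mF(m,x)-D_mF(m',x)|\le M^F_{mm}W_1(m,m')$ for all $x\in\mathbb R^d$, $m,m'\in\mathcal P_2(\mathbb R^d)$; (3) for every $m\in\mathcal P_2(\mathbb R^d)$, $\int\exp(-\frac{\delta F}{\delta m}(m,x))\,dx<\infty$ and the probability measure $\hat m(dx)\propto\exp(-\frac{\delta F}{\delta m}(m,x))\,dx$ satisfies $\rho\,\mathrm{Ent}_{\hat m}(f^2)\le\mathbb E_{\hat m}[|\nabla f|^2]$ for all $f\in C^1_b(\mathbb R^d)$; (4) $\sup_{m}\sup_{x}|\nabla D_mF(m,x)|\le M^F_{mx}$; (5) $x\mapsto D_mF(m,x)$ is $C^3$ and $\sup_{m}\sup_{x}|\nabla^kD_mF(m,x)|<\infty$ for $k=2,3$. Let $(m_t)_{t\ge0}$ be a solution of $\partial_t m_t=\Delta m_t+\nabla\cdot(D_mF(m_t,\cdot)m_t)$, let $h_0=\frac{dm_0}{dm_\infty}$, and suppose $h_0\in L^{p_0}(m_\infty)$ for some $p_0>1$. Then for every $\rho'\in(0,\rho)$ there exist constants $C_{\rho'}=C_{\rho'}(\rho,M^F_{mm},p_0,\|h_0\|_{L^{p_0}(m_\infty)})$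 and $\tau_{\rho'}=\tau_{\rho'}(\rho,p_0)$ such that for every $1$-Lipschitz function $f:\mathbb R^d\to\mathbb R$, every $t\ge\tau_{\rho'}$ and every $r\ge0$, $$m_t\bigl[|f-\mathbb E_{m_t}f|\ge r\bigr]\le2\exp\bigl(-\rho'r^2+C_{\rho'}e^{-4\rho't}(r+1)\bigr).$$
   Context: $\mathcal P_2(\mathbb R^d)$ is the set of probability measures on $\mathbb R^d$ with finite second moment; $W_p$ is the $L^p$-Wasserstein distance. The linear functional derivative of $F$ is a function $\frac{\delta F}{\delta m}:\mathcal P_2(\mathbb R^d)\times\mathbb R^d\to\mathbb R$, jointly continuous, of at most quadratic growth in $x$ uniformly for $m$ in bounded subsets of $\mathcal P_2$, with $F(m')-F(m)=\int_0^1\int\frac{\delta F}{\delta m}((1-t)m+tm',x)(m'-m)(dx)\,dt$. $\mathrm{Ent}_m f=\mathbb E_m[f\log f]-\mathbb E_m[f]\log\mathbb E_m[f]$. Solutions of the Fokker–Planck equation are weak solutions in $C([0,\infty);(\mathcal P_2(\mathbb R^d),W_2))$. $H(m)=\int m\log m$ and $\mathcal F(m)=F(m)+H(m)$. Under (1)–(4), $\mathcal F$ has a unique minimizer $m_\infty\in\mathcal P_2(\mathbb R^d)$; it is also the unique solution in $\mathcal P_2(\mathbb R^d)$ of $m_\infty=\hat m_\infty$ and the unique invariant measure of the equation. The notation $C_{\rho'}(\cdots)$, $\tau_{\rho'}(\cdots)$ means the constants depend only on $\rho'$ and the listed quantities. *)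

theory Defs
  imports "HOL-Probability.Probability"
begin

section \<open>Euclidean space with an explicit dimension\<close>

text \<open>
  The constants in the theorem must not depend on the dimension \<open>d\<close>, so \<open>d\<close> has to be quantified
  inside the scope of the constants and cannot be the cardinality of an index type.  Hence
  \<open>\<real>\<^sup>d\<close> is the set of functions on \<open>{..<d}\<close>, extended by \<^const>\<open>undefined\<close>.
  The product topology of \<^typ>\<open>nat \<Rightarrow> real\<close> restricted to this set is the usual topology.
\<close>

definition Rd :: "nat \<Rightarrow> (nat \<Rightarrow> real) set" where
  "Rd d = ({..<d} \<rightarrow>\<^sub>E UNIV)"

definition borel_Rd :: "nat \<Rightarrow> (nat \<Rightarrow> real) measure" where
  "borel_Rd d = (\<Pi>\<^sub>M i\<in>{..<d}. borel)"

definition lborel_Rd :: "nat \<Rightarrow> (nat \<Rightarrow> real) measure" where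
  "lborel_Rd d = (\<Pi>\<^sub>M i\<in>{..<d}. lborel)"

definition norm_Rd :: "nat \<Rightarrow> (nat \<Rightarrow> real) \<Rightarrow> real" where
  "norm_Rd d x = L2_set x {..<d}"

definition dist_Rd :: "nat \<Rightarrow> (nat \<Rightarrow> real) \<Rightarrow> (nat \<Rightarrow> real) \<Rightarrow> real" where
  "dist_Rd d x y = norm_Rd d (\<lambda>i. x i - y i)"

lemma space_borel_Rd: "space (borel_Rd d) = Rd d"
  by (simp add: borel_Rd_def Rd_def space_PiM)

lemma space_lborel_Rd: "space (lborel_Rd d) = Rd d"
  by (simp add: lborel_Rd_def Rd_def space_PiM)

lemma sets_lborel_Rd: "sets (lborel_Rd d) = sets (borel_Rd d)"
  unfolding lborel_Rd_def borel_Rd_def by (intro sets_PiM_cong) simp_all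


section \<open>Differential calculus\<close>

definition pd :: "nat \<Rightarrow> ((nat \<Rightarrow> real) \<Rightarrow> real) \<Rightarrow> (nat \<Rightarrow> real) \<Rightarrow> real" where
  "pd i f x = deriv (\<lambda>s. f (x(i := s))) (x i)"

fun C_k :: "nat \<Rightarrow> nat \<Rightarrow> ((nat \<Rightarrow> real) \<Rightarrow> real) \<Rightarrow> bool" where
  "C_k d 0 f \<longleftrightarrow> continuous_on (Rd d) f"
| "C_k d (Suc k) f \<longleftrightarrow> continuous_on (Rd d) f \<and>
     (\<forall>i<d. (\<forall>x\<in>Rd d. (\<lambda>s. f (x(i := s))) differentiable (at (x i))) \<and> C_k d k (pd i f))"

definition grad :: "nat \<Rightarrow> ((nat \<Rightarrow> real) \<Rightarrow> real) \<Rightarrow> (nat \<Rightarrow> real) \<Rightarrow> (nat \<Rightarrow> real)" where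
  "grad d f x = (\<lambda>i\<in>{..<d}. pd i f x)"

definition laplacian :: "nat \<Rightarrow> ((nat \<Rightarrow> real) \<Rightarrow> real) \<Rightarrow> (nat \<Rightarrow> real) \<Rightarrow> real" where
  "laplacian d f x = (\<Sum>i<d. pd i (pd i f) x)"

text \<open>Operator norm of the \<open>k\<close>-linear map \<open>\<nabla>\<^sup>k G(x)\<close> for a vector field \<open>G\<close> of class \<open>C\<^sup>k\<close>:
  the supremum of \<open>|\<nabla>\<^sup>k G(x)[v\<^sub>0, \<dots>, v\<^sub>k\<^sub>-\<^sub>1]|\<close> over vectors of norm at most 1.
  The list \<open>js\<close> selects one iterated partial derivative.\<close>

definition deriv_norm ::
  "nat \<Rightarrow> nat \<Rightarrow> ((nat \<Rightarrow> real) \<Rightarrow> (nat \<Rightarrow> real)) \<Rightarrow> (nat \<Rightarrow> real) \<Rightarrow> real" where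
  "deriv_norm d k G x =
     (SUP v\<in>{v :: nat \<Rightarrow> nat \<Rightarrow> real. \<forall>l<k. norm_Rd d (v l) \<le> 1}.
        norm_Rd d (\<lambda>i. \<Sum>js | set js \<subseteq> {..<d} \<and> length js = k.
          (\<Prod>l<k. v l (js ! l)) * foldr pd js (\<lambda>y. G y i) x))"

definition C1_bounded :: "nat \<Rightarrow> ((nat \<Rightarrow> real) \<Rightarrow> real) \<Rightarrow> bool" where
  "C1_bounded d f \<longleftrightarrow> C_k d 1 f \<and> (\<exists>B. \<forall>x\<in>Rd d. \<bar>f x\<bar> \<le> B \<and> norm_Rd d (grad d f x) \<le> B)"

definition test_function :: "nat \<Rightarrow> ((nat \<Rightarrow> real) \<Rightarrow> real) \<Rightarrow> bool" where
  "test_function d \<phi> \<longleftrightarrow>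
     (\<forall>k. C_k d k \<phi>) \<and> (\<exists>R. \<forall>x\<in>Rd d. R < norm_Rd d x \<longrightarrow> \<phi> x = 0)"


section \<open>Probability measures\<close>

definition P2 :: "nat \<Rightarrow> (nat \<Rightarrow> real) measure set" where
  "P2 d = {m. prob_space m \<and> sets m = sets (borel_Rd d) \<and> integrable m (\<lambda>x. (norm_Rd d x)\<^sup>2)}"

definition couplings :: "'a measure \<Rightarrow> 'b measure \<Rightarrow> ('a \<times> 'b) measure set" where
  "couplings m m' =
     {\<pi>. sets \<pi> = sets (m \<Otimes>\<^sub>M m') \<and> distr \<pi> m fst = m \<and> distr \<pi> m' snd = m'}"

definition wasserstein ::
  "nat \<Rightarrow> real \<Rightarrow> (nat \<Rightarrow> real) measure \<Rightarrow> (nat \<Rightarrow> real) measure \<Rightarrow> real" where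
  "wasserstein d p m m' =
     enn2real (INF \<pi>\<in>couplings m m'. \<integral>\<^sup>+ z. ennreal (dist_Rd d (fst z) (snd z) powr p) \<partial>\<pi>) powr (1 / p)"

text \<open>The convex combination \<open>(1 - t) m + t m'\<close>, for \<open>t \<in> [0,1]\<close> and \<open>sets m = sets m'\<close>.\<close>

definition mix :: "real \<Rightarrow> 'a measure \<Rightarrow> 'a measure \<Rightarrow> 'a measure" where
  "mix t m m' = measure_of (space m) (sets m)
     (\<lambda>A. ennreal (1 - t) * emeasure m A + ennreal t * emeasure m' A)"

lemma emeasure_mix:
  assumes "sets m = sets m'" "A \<in> sets m"
  shows "emeasure (mix t m m') A = ennreal (1 - t) * emeasure m A + ennreal t * emeasure m' A"
proof (rule emeasure_measure_of[OF mix_def])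
  show "countably_additive (sets (mix t m m'))
      (\<lambda>A. ennreal (1 - t) * emeasure m A + ennreal t * emeasure m' A)"
  proof (rule countably_additiveI)
    fix A :: "nat \<Rightarrow> 'a set"
    assume "range A \<subseteq> sets (mix t m m')" "disjoint_family A"
    moreover have "sets (mix t m m') = sets m"
      by (simp add: mix_def)
    ultimately have "range A \<subseteq> sets m" "range A \<subseteq> sets m'" "disjoint_family A"
      using assms(1) by simp_all
    then show "(\<Sum>i. ennreal (1 - t) * emeasure m (A i) + ennreal t * emeasure m' (A i)) =
        ennreal (1 - t) * emeasure m (\<Union>i. A i) + ennreal t * emeasure m' (\<Union>i. A i)"
      by (simp flip: suminf_add suminf_emeasure)
  qed
qed (use assms sets.space_closed[of m] in \<open>auto simp: mix_def positive_def\<close>)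

definition Ent :: "'a measure \<Rightarrow> ('a \<Rightarrow> real) \<Rightarrow> real" where
  "Ent m f = (\<integral>x. f x * ln (f x) \<partial>m) - (\<integral>x. f x \<partial>m) * ln (\<integral>x. f x \<partial>m)"

definition in_Lp :: "real \<Rightarrow> 'a measure \<Rightarrow> ('a \<Rightarrow> real) \<Rightarrow> bool" where
  "in_Lp p m f \<longleftrightarrow> f \<in> borel_measurable m \<and> integrable m (\<lambda>x. \<bar>f x\<bar> powr p)"

definition Lp_norm :: "real \<Rightarrow> 'a measure \<Rightarrow> ('a \<Rightarrow> real) \<Rightarrow> real" where
  "Lp_norm p m f = (\<integral>x. \<bar>f x\<bar> powr p \<partial>m) powr (1 / p)"


section \<open>Functionals on the space of probability measures\<close>

text \<open>The topology and the bounded sets of \<open>P2\<close> are those of the distance \<open>W\<^sub>2\<close>.\<close>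

definition linear_functional_derivative ::
  "nat \<Rightarrow> ((nat \<Rightarrow> real) measure \<Rightarrow> real) \<Rightarrow>
   ((nat \<Rightarrow> real) measure \<Rightarrow> (nat \<Rightarrow> real) \<Rightarrow> real) \<Rightarrow> bool" where
  "linear_functional_derivative d F \<delta>F \<longleftrightarrow>
     (\<forall>m\<in>P2 d. \<forall>x\<in>Rd d. \<forall>\<epsilon>>0. \<exists>\<eta>>0. \<forall>m'\<in>P2 d. \<forall>x'\<in>Rd d.
        wasserstein d 2 m m' < \<eta> \<and> dist_Rd d x x' < \<eta> \<longrightarrow> \<bar>\<delta>F m' x' - \<delta>F m x\<bar> < \<epsilon>) \<and>
     (\<forall>m0\<in>P2 d. \<forall>R. \<exists>c. \<forall>m\<in>P2 d. wasserstein d 2 m0 m \<le> R \<longrightarrow>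
        (\<forall>x\<in>Rd d. \<bar>\<delta>F m x\<bar> \<le> c * (1 + (norm_Rd d x)\<^sup>2))) \<and>
     (\<forall>m\<in>P2 d. \<forall>m'\<in>P2 d.
        ((\<lambda>t. (\<integral>x. \<delta>F (mix t m m') x \<partial>m') - (\<integral>x. \<delta>F (mix t m m') x \<partial>m))
          has_integral (F m' - F m)) {0..1})"

definition intrinsic_derivative ::
  "nat \<Rightarrow> ((nat \<Rightarrow> real) measure \<Rightarrow> (nat \<Rightarrow> real) \<Rightarrow> real) \<Rightarrow>
   (nat \<Rightarrow> real) measure \<Rightarrow> (nat \<Rightarrow> real) \<Rightarrow> (nat \<Rightarrow> real)" where
  "intrinsic_derivative d \<delta>F m = grad d (\<delta>F m)"

definition hat ::
  "nat \<Rightarrow> ((nat \<Rightarrow> real) measure \<Rightarrow> (nat \<Rightarrow> real) \<Rightarrow> real) \<Rightarrow>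
   (nat \<Rightarrow> real) measure \<Rightarrow> (nat \<Rightarrow> real) measure" where
  "hat d \<delta>F m = density (lborel_Rd d)
     (\<lambda>x. ennreal (exp (- \<delta>F m x) / (\<integral>y. exp (- \<delta>F m y) \<partial>lborel_Rd d)))"

text \<open>\<open>H(m) = \<integral> m log m\<close>, with value \<open>\<infinity>\<close> if \<open>m\<close> has no density.  The two summands are the
  integrals of the positive and the negative part; the latter is finite for \<open>m \<in> P2 d\<close>.\<close>

definition neg_entropy :: "nat \<Rightarrow> (nat \<Rightarrow> real) measure \<Rightarrow> ereal" where
  "neg_entropy d m =
     (if absolutely_continuous (lborel_Rd d) m then
        (let h = (\<lambda>x. enn2real (RN_deriv (lborel_Rd d) m x)) in
           enn2ereal (\<integral>\<^sup>+ x. ennreal (h x * ln (h x)) \<partial>lborel_Rd d)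
         - enn2ereal (\<integral>\<^sup>+ x. ennreal (- (h x * ln (h x))) \<partial>lborel_Rd d))
      else \<infinity>)"

definition free_energy ::
  "nat \<Rightarrow> ((nat \<Rightarrow> real) measure \<Rightarrow> real) \<Rightarrow> (nat \<Rightarrow> real) measure \<Rightarrow> ereal" where
  "free_energy d F m = ereal (F m) + neg_entropy d m"

definition free_energy_minimizer ::
  "nat \<Rightarrow> ((nat \<Rightarrow> real) measure \<Rightarrow> real) \<Rightarrow> (nat \<Rightarrow> real) measure \<Rightarrow> bool" where
  "free_energy_minimizer d F \<mu> \<longleftrightarrow>
     \<mu> \<in> P2 d \<and> (\<forall>m\<in>P2 d. free_energy d F \<mu> \<le> free_energy d F m)"

text \<open>Weak solutions of \<open>\<partial>\<^sub>t m\<^sub>t = \<Delta> m\<^sub>t + \<nabla> \<cdot> (b(m\<^sub>t, \<cdot>) m\<^sub>t)\<close> that are continuous for \<open>W\<^sub>2\<close>;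
  only the values \<open>m t\<close> with \<open>t \<ge> 0\<close> matter.\<close>

definition fokker_planck_solution ::
  "nat \<Rightarrow> ((nat \<Rightarrow> real) measure \<Rightarrow> (nat \<Rightarrow> real) \<Rightarrow> (nat \<Rightarrow> real)) \<Rightarrow>
   (real \<Rightarrow> (nat \<Rightarrow> real) measure) \<Rightarrow> bool" where
  "fokker_planck_solution d b m \<longleftrightarrow>
     (\<forall>t\<ge>0. m t \<in> P2 d) \<and>
     (\<forall>t\<ge>0. ((\<lambda>s. wasserstein d 2 (m s) (m t)) \<longlongrightarrow> 0) (at t within {0..})) \<and>
     (\<forall>\<phi>. test_function d \<phi> \<longrightarrow> (\<forall>t\<ge>0.
        ((\<lambda>s. \<integral>x. laplacian d \<phi> x - (\<Sum>i<d. b (m s) x i * grad d \<phi> x i) \<partial>m s)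
          has_integral ((\<integral>x. \<phi> x \<partial>m t) - (\<integral>x. \<phi> x \<partial>m 0))) {0..t}))"

end

theory Submission
 imports Defs
begin

type_synonym vec = "nat => real"

notation LIMSEQ ("((_)/ ----> (_))" [60, 60] 60)

text \<open>
 No regularity theory for the Fokker--Planck equation is used.  Over a short interval \<open>[a, b]\<close> around
 \<open>t\<close>, the weak equation shows that integrals against \<open>m b\<close> agree up to \<open>o(b - a)\<close> with integrals
 against \<open>m a\<close> of the test function after one Euler step with drift \<open>DF (m t)\<close>.  With respect to any
 Gibbs measure \<open>hat d dF mu\<close>, one Euler step satisfies Gross's hypercontractive inequality up to an error
 controlled by \<open>|DF (m t) - DF mu|^2\<close>, and bisection glues the steps.  Sending the exponents to infinity
 turns hypercontractivity into decay of the relative entropy in its dual form; with \<open>mu = m b\<close> and the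
 convexity of \<open>F\<close> this becomes exponential decay of the free energy, hence of \<open>W\<^sub>1(m t, minf)\<close> by the
 Herbst argument and Kantorovich--Rubinstein duality.  Now hypercontractivity with respect to
 \<open>minf = hat d dF minf\<close> has an exponentially small error and bounds exponential moments under \<open>m t\<close>
 by those under \<open>minf\<close>; Chernoff's bound and a shift of the mean by at most \<open>W\<^sub>1\<close> conclude.
\<close>

section \<open>Calculus on \<open>Rd\<close>\<close>

text \<open>The constants must not see the dimension, the test function or the partition. Everything
  qualitative (third derivatives, the size of \<open>d\<close>, mollification scales) may therefore
  enter only errors that are small compared with the step length and vanish under refinement; what
  survives are the logarithmic Sobolev constant and the mismatch of the drifts. The flow has no
  fixed generator, so a reference measure is frozen: its own generator is reversible for it, and the
  mismatch is paid for by a fraction \<open>eta\<close> of the Dirichlet form. With reference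
  \<open>m b\<close> the mismatch is small together with \<open>b - a\<close>, hence its square
  disappears under bisection, and convexity gives the correction terms from changing references the
  right sign. With reference \<open>minf\<close> the mismatch is only of order
  \<open>exp (- 2 * rho * t)\<close> and has to be weighed against the growth of the exponent. The
  gap between \<open>rho\<close> and \<open>rho'\<close> is halved: one half pays for
  \<open>eta\<close> and for ending the exponents at some \<open>qb > 1\<close>, the other for a
  factor \<open>t\<close> and for moving the mean.\<close>

lemma Rd_upd [simp]: "x : Rd d ==> i < d ==> x(i := s) : Rd d"
 by (auto simp: Rd_def PiE_def extensional_def)

lemma Rd_restrict [simp]: "restrict f {..<d} : Rd d"
 by (auto simp: Rd_def)

lemma Rd_eqI: "x : Rd d ==> y : Rd d ==> (!!i. i < d ==> x i = y i) ==> x = y"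
 unfolding Rd_def by (rule PiE_ext) auto

lemma Rd_restrict_id [simp]: "x : Rd d ==> restrict x {..<d} = x"
 by (intro Rd_eqI[of _ d]) auto

lemma Rd_undefined: "x : Rd d ==> ~ i < d ==> x i = undefined"
 by (auto simp: Rd_def PiE_def extensional_def)

text \<open>On \<open>Rd d\<close> all coordinates with index at least \<open>d\<close> are frozen
  at \<open>undefined\<close>, so convergence of the first \<open>d\<close> coordinates is already
  convergence in the product topology.\<close>

lemma tendsto_Rd:
 fixes X :: "'a => nat => real"
 assumes f: "continuous_on (Rd d) f" and x: "x : Rd d"
  and X: "eventually (%z. X z : Rd d) F" and lim: "!!i. i < d ==> ((%z. X z i) \<longlongrightarrow> x i) F"
 shows "((%z. f (X z)) \<longlongrightarrow> f x) F"
proof (rule continuous_on_tendsto_compose[OF f _ x X])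
 have "((%z. X z i) \<longlongrightarrow> x i) F" for i
 proof (cases "i < d")
  case False
  have "eventually (%z. X z i = x i) F"
   using X by eventually_elim (use False x in \<open>simp add: Rd_undefined\<close>)
  thus ?thesis by (simp add: tendsto_eventually)
 qed (use lim in auto)
 hence "limitin (product_topology (%i. euclidean) UNIV) X x F"
  by (simp add: limitin_componentwise)
 thus "(X \<longlongrightarrow> x) F"
  by (simp add: euclidean_product_topology)
qed

lemma continuous_on_RdI:
 assumes "!!X x. (!!n. X n : Rd d) ==> x : Rd d ==> (!!i. i < d ==> (%n. X n i) ----> x i) ==>
  (%n. f (X n)) ----> f x"
 shows "continuous_on (Rd d) f"
 unfolding continuous_on_sequentially
proof (intro allI ballI impI, elim conjE)
 fix X :: "nat => nat => real" and x
 assume x: "x : Rd d" and X: "ALL n. X n : Rd d" and lim: "X ----> x"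
 have "(%n. X n i) ----> x i" for i
  using continuous_on_tendsto_compose[OF continuous_on_product_coordinates lim] by simp
 with x X assms show "(f \<circ> X) ----> f x" by (simp add: o_def)
qed

lemma continuous_on_Rd_coord: "i < d ==> continuous_on (Rd d) (%x. x i)"
 by (rule continuous_on_RdI) auto

lemma continuous_on_Rd_comp:
 assumes f: "continuous_on (Rd d) f" and T: "!!x. x : Rd d ==> T x : Rd d"
  and c: "!!i. i < d ==> continuous_on (Rd d) (%x. T x i)"
 shows "continuous_on (Rd d) (%x. f (T x))"
proof (rule continuous_on_RdI)
 fix X :: "nat => nat => real" and x
 assume X: "!!n. X n : Rd d" and x: "x : Rd d" and l: "!!i. i < d ==> (%n. X n i) ----> x i"
 have "(%n. T (X n) i) ----> T x i" if "i < d" for i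
  using tendsto_Rd[OF c[OF that] x _ l] X by auto
 thus "(%n. f (T (X n))) ----> f (T x)"
  by (intro tendsto_Rd[OF f T[OF x]]) (simp_all add: X T)
qed

text \<open>Nothing is known about \<open>f\<close> off \<open>Rd d\<close>. Composed with
  \<open>restrict\<close> it becomes continuous on the whole function space, whose Borel sets are
  the product sets; on \<open>Rd d\<close> the composition changes nothing.\<close>

lemma measurable_Rd:
 assumes "continuous_on (Rd d) f"
 shows "f : borel_measurable (borel_Rd d)"
proof -
 have c: "continuous_on UNIV (%x. f (restrict x {..<d}))"
 proof (rule continuous_on_compose2[OF assms])
  show "continuous_on UNIV (%x :: nat => real. restrict x {..<d})"
   proof (intro continuous_on_coordinatewise_then_product)
   fix i show "continuous_on UNIV (%x :: nat => real. restrict x {..<d} i)"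
    by (cases "i < d") (simp_all add: restrict_def)
  qed
 qed auto
 have m: "(%x. x) : measurable (borel_Rd d) (borel :: vec measure)"
 proof (subst measurable_cong_sets[OF refl sets_PiM_equal_borel[symmetric]], rule measurable_PiM_single')
  fix i :: nat
  show "(%x. x i) : borel_measurable (borel_Rd d)"
  proof (cases "i < d")
   case True
   thus ?thesis unfolding borel_Rd_def by (intro measurable_component_singleton) auto
  next
   case False
   hence "x i = undefined" if "x : space (borel_Rd d)" for x
    using that by (simp add: space_borel_Rd Rd_undefined)
   thus ?thesis by (subst measurable_cong[where g="%_. undefined"]) auto
  qed
 qed auto
 have "(%x. f (restrict x {..<d})) : borel_measurable (borel_Rd d)"
  using measurable_compose[OF m borel_measurable_continuous_onI[OF c]] by simp
 thus ?thesis
  by (rule measurable_cong[THEN iffD1, rotated]) (auto simp: space_borel_Rd)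
qed

text \<open>\<open>pd\<close> always returns some number, so an equation for it carries no
  differentiability. This relation does, it obeys the usual calculus rules, and it gives back
  \<open>pd\<close> through \<open>has_pd_imp_pd\<close>.\<close>

definition has_pd :: "nat => nat => (vec => real) => (vec => real) => bool" where
 "has_pd d i f g \<longleftrightarrow> (ALL x:Rd d. ((%s. f (x(i := s))) has_real_derivative g x) (at (x i)))"

lemma has_pdD:
 assumes "has_pd d i f g" "x : Rd d" "i < d"
 shows "((%s. f (x(i := s))) has_real_derivative g (x(i := t))) (at t)"
 using assms(1)[unfolded has_pd_def, rule_format, of "x(i := t)"] assms(2,3) by simp

lemma has_pd_imp_pd:
 assumes "has_pd d i f g" "x : Rd d"
 shows "pd i f x = g x"
 unfolding pd_def using assms by (auto simp: has_pd_def intro: DERIV_imp_deriv)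

lemma has_pd_cong:
 assumes "has_pd d i f g" "i < d" "!!x. x : Rd d ==> f x = f' x" "!!x. x : Rd d ==> g x = g' x"
 shows "has_pd d i f' g'"
 unfolding has_pd_def
proof
 fix x assume x: "x : Rd d"
 hence "(%s. f (x(i := s))) = (%s. f' (x(i := s)))" using assms(2,3) by simp
 thus "((%s. f' (x(i := s))) has_real_derivative g' x) (at (x i))"
  using assms(1,4) x by (auto simp: has_pd_def)
qed

lemma has_pd_pd:
 assumes "!!x. x : Rd d ==> (%s. f (x(i := s))) differentiable (at (x i))"
 shows "has_pd d i f (pd i f)"
 using assms by (auto simp: has_pd_def pd_def DERIV_deriv_iff_real_differentiable)

text \<open>The points \<open>\<zeta> k\<close> come from changing one coordinate at a time.\<close>

lemma mvt_Rd:
 assumes pd: "!!i. i < d ==> has_pd d i f (g i)" and x: "x : Rd d" and y: "y : Rd d"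
 obtains \<zeta> where "!!k. k < d ==> \<zeta> k : Rd d"
  "!!k i. k < d ==> i < d ==> abs (\<zeta> k i - x i) <= abs (y i - x i)"
  "f y - f x = (\<Sum>k<d. g k (\<zeta> k) * (y k - x k))"
proof -
 define p where "p k = (%i. if i < k then y i else x i)" for k
 have p: "p k : Rd d" if "k <= d" for k
  using x y that unfolding Rd_def p_def by (auto simp: PiE_def extensional_def)
 have p_upd: "p (Suc k) = (p k)(k := y k)" "(p k)(k := x k) = p k" for k
  unfolding p_def by (auto simp: less_Suc_eq)
 have "EX z. abs (z - x k) <= abs (y k - x k) & f (p (Suc k)) - f (p k) = g k ((p k)(k := z)) * (y k - x k)"
  if k: "k < d" for k
 proof -
  let ?h = "%s. f ((p k)(k := s))"
  have D: "(?h has_real_derivative g k ((p k)(k := s))) (at s)" for s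
   using has_pdD[OF pd[OF k] p] k by simp
  have eq: "f (p (Suc k)) = ?h (y k)" "f (p k) = ?h (x k)"
   using p_upd[of k] by auto
  consider "x k < y k" | "x k = y k" | "y k < x k" by linarith
  thus ?thesis
  proof cases
   case 1
   from MVT2[OF 1, of ?h "%s. g k ((p k)(k := s))"] D
   obtain z where "x k < z" "z < y k" "?h (y k) - ?h (x k) = (y k - x k) * g k ((p k)(k := z))" by auto
   thus ?thesis using eq by (intro exI[of _ z]) (auto simp: mult.commute)
  next
   case 2
   thus ?thesis using eq by (intro exI[of _ "x k"]) simp
  next
   case 3
   from MVT2[OF 3, of ?h "%s. g k ((p k)(k := s))"] D
   obtain z where z: "y k < z" "z < x k" "?h (x k) - ?h (y k) = (x k - y k) * g k ((p k)(k := z))" by auto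
   thus ?thesis using eq by (intro exI[of _ z]) (auto simp: algebra_simps)
  qed
 qed
 hence "ALL k. EX z. k < d --> abs (z - x k) <= abs (y k - x k) & f (p (Suc k)) - f (p k) = g k ((p k)(k := z)) * (y k - x k)"
  by blast
 from choice[OF this] obtain z where z: "!!k. k < d ==> abs (z k - x k) <= abs (y k - x k)"
  "!!k. k < d ==> f (p (Suc k)) - f (p k) = g k ((p k)(k := z k)) * (y k - x k)"
  by blast
 show thesis
 proof (rule that[of "%k. (p k)(k := z k)"])
  show "(p k)(k := z k) : Rd d" if "k < d" for k using p that by auto
  show "abs (((p k)(k := z k)) i - x i) <= abs (y i - x i)" if "k < d" "i < d" for k i
   using z(1) that by (auto simp: p_def)
  have "(\<Sum>k<d. g k ((p k)(k := z k)) * (y k - x k)) = (\<Sum>k<d. f (p (Suc k)) - f (p k))"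
   using z(2) by (intro sum.cong) auto
  also have "... = f (p d) - f (p 0)" by (rule sum_lessThan_telescope)
  also have "p d = y" using x y by (auto simp: p_def Rd_undefined)
  also have "p 0 = x" by (auto simp: p_def)
  finally show "f y - f x = (\<Sum>k<d. g k ((p k)(k := z k)) * (y k - x k))" ..
 qed
qed

text \<open>The increment of \<open>f\<close> along the curve is expanded by \<open>mvt_Rd\<close>.
  The intermediate points are squeezed towards \<open>gamma s0\<close>, so continuity of the partial
  derivatives suffices in place of total differentiability.\<close>

lemma chain_rule_Rd:
 assumes pd: "!!i. i < d ==> has_pd d i f (g i)"
  and cont: "!!i. i < d ==> continuous_on (Rd d) (g i)"
  and gamma: "!!s. gamma s : Rd d" and D: "!!i. i < d ==> ((%s. gamma s i) has_real_derivative gamma' i) (at s0)"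
 shows "((%s. f (gamma s)) has_real_derivative (\<Sum>i<d. g i (gamma s0) * gamma' i)) (at s0)"
proof -
 have "EX \<zeta>. (ALL k<d. \<zeta> k : Rd d & (ALL i<d. abs (\<zeta> k i - gamma s0 i) <= abs (gamma s i - gamma s0 i))) &
  f (gamma s) - f (gamma s0) = (\<Sum>k<d. g k (\<zeta> k) * (gamma s k - gamma s0 k))" for s
  by (rule mvt_Rd[OF pd gamma[of s0] gamma[of s]]) blast+
 hence "ALL s. EX \<zeta>. (ALL k<d. \<zeta> k : Rd d & (ALL i<d. abs (\<zeta> k i - gamma s0 i) <= abs (gamma s i - gamma s0 i))) &
  f (gamma s) - f (gamma s0) = (\<Sum>k<d. g k (\<zeta> k) * (gamma s k - gamma s0 k))" by blast
 from choice[OF this] obtain \<zeta> where \<zeta>: "!!s k. k < d ==> \<zeta> s k : Rd d"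
   "!!s k i. k < d ==> i < d ==> abs (\<zeta> s k i - gamma s0 i) <= abs (gamma s i - gamma s0 i)"
   "!!s. f (gamma s) - f (gamma s0) = (\<Sum>k<d. g k (\<zeta> s k) * (gamma s k - gamma s0 k))"
  by blast
 have lim: "((%s. \<zeta> s k i) \<longlongrightarrow> gamma s0 i) (at s0)" if "k < d" "i < d" for k i
 proof -
  have "((%s. gamma s i) \<longlongrightarrow> gamma s0 i) (at s0)"
   using DERIV_isCont[OF D[OF that(2)]] by (simp add: isCont_def)
  hence "((%s. abs (gamma s i - gamma s0 i)) \<longlongrightarrow> 0) (at s0)"
   by (intro tendsto_rabs_zero) (simp add: LIM_zero)
  hence "((%s. \<zeta> s k i - gamma s0 i) \<longlongrightarrow> 0) (at s0)"
   by (rule Lim_null_comparison[rotated]) (use \<zeta>(2) that in auto)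
  thus ?thesis by (simp add: LIM_zero_iff)
 qed
 have "((%s. \<Sum>k<d. g k (\<zeta> s k) * ((gamma s k - gamma s0 k) / (s - s0))) \<longlongrightarrow> (\<Sum>k<d. g k (gamma s0) * gamma' k)) (at s0)"
 proof (intro tendsto_sum tendsto_mult)
  fix k assume k: "k : {..<d}"
  thus "((%s. g k (\<zeta> s k)) \<longlongrightarrow> g k (gamma s0)) (at s0)"
   using tendsto_Rd[OF cont gamma[of s0], of k "%s. \<zeta> s k"] \<zeta>(1) lim by auto
  show "((%s. (gamma s k - gamma s0 k) / (s - s0)) \<longlongrightarrow> gamma' k) (at s0)"
   using D k by (simp add: has_field_derivative_iff)
 qed
 moreover have "(\<Sum>k<d. g k (\<zeta> s k) * ((gamma s k - gamma s0 k) / (s - s0))) = (f (gamma s) - f (gamma s0)) / (s - s0)" for s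
  by (simp add: \<zeta>(3) sum_divide_distrib)
 ultimately show ?thesis by (simp add: has_field_derivative_iff)
qed

lemma has_pd_const: "has_pd d i (%_. c) (%_. 0)"
 by (simp add: has_pd_def)

lemma has_pd_add: "has_pd d i f f' ==> has_pd d i g g' ==> has_pd d i (%x. f x + g x) (%x. f' x + g' x)"
 by (simp add: has_pd_def DERIV_add)

lemma has_pd_diff: "has_pd d i f f' ==> has_pd d i g g' ==> has_pd d i (%x. f x - g x) (%x. f' x - g' x)"
 by (simp add: has_pd_def DERIV_diff)

lemma has_pd_cmult: "has_pd d i f f' ==> has_pd d i (%x. c * f x) (%x. c * f' x)"
 by (simp add: has_pd_def DERIV_cmult)

lemma has_pd_mult:
 assumes "has_pd d i f f'" "has_pd d i g g'"
 shows "has_pd d i (%x. f x * g x) (%x. f' x * g x + f x * g' x)"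
 unfolding has_pd_def
proof
 fix x assume "x : Rd d"
 with assms show "((%s. f (x(i := s)) * g (x(i := s))) has_real_derivative f' x * g x + f x * g' x) (at (x i))"
  using DERIV_mult[of "%s. f (x(i := s))" "f' x" "x i" UNIV "%s. g (x(i := s))" "g' x"]
  by (simp add: has_pd_def algebra_simps)
qed

lemma has_pd_comp1:
 assumes f: "has_pd d i f f'" and F: "!!x. x : Rd d ==> (F has_real_derivative F' (f x)) (at (f x))"
 shows "has_pd d i (%x. F (f x)) (%x. F' (f x) * f' x)"
 unfolding has_pd_def
proof
 fix x assume x: "x : Rd d"
 have "(F has_real_derivative F' (f x)) (at ((%s. f (x(i := s))) (x i)))"
  using F[OF x] by simp
 from DERIV_chain2[OF this f[unfolded has_pd_def, rule_format, OF x]]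
 show "((%s. F (f (x(i := s)))) has_real_derivative F' (f x) * f' x) (at (x i))" .
qed

lemma has_pd_comp:
 assumes i: "i < d" and f: "!!j. j < d ==> has_pd d j f (g j)"
  and cont: "!!j. j < d ==> continuous_on (Rd d) (g j)"
  and T: "!!x. x : Rd d ==> T x : Rd d"
  and T': "!!j. j < d ==> has_pd d i (%x. T x j) (T' j)"
 shows "has_pd d i (%x. f (T x)) (%x. \<Sum>j<d. g j (T x) * T' j x)"
 unfolding has_pd_def
proof
 fix x assume x: "x : Rd d"
 have "((%s. f (T (x(i := s)))) has_real_derivative (\<Sum>j<d. g j (T (x(i := x i))) * T' j x)) (at (x i))"
  by (rule chain_rule_Rd[OF f cont]) (use x i T T' in \<open>auto simp: has_pd_def\<close>)
 thus "((%s. f (T (x(i := s)))) has_real_derivative (\<Sum>j<d. g j (T x) * T' j x)) (at (x i))"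
  by simp
qed

lemma has_pd_coord: "j < d ==> has_pd d i (%x. x j) (%x. if i = j then 1 else 0)"
 unfolding has_pd_def by (cases "i = j") simp_all


section \<open>Functions with bounded derivatives\<close>

text \<open>Functions of class C^k whose values and partial derivatives up to order \<open>k\<close>
  are bounded by the single number \<open>K\<close>. The number is kept explicit because Euler steps
  are composed over arbitrarily fine partitions and it must not blow up.\<close>

fun CB :: "nat => nat => real => (vec => real) => bool" where
 "CB d 0 K f \<longleftrightarrow> continuous_on (Rd d) f & (ALL x:Rd d. abs (f x) <= K)"
| "CB d (Suc k) K f \<longleftrightarrow> continuous_on (Rd d) f & (ALL x:Rd d. abs (f x) <= K) &
   (ALL i<d. EX g. has_pd d i f g & CB d k K g)"

text \<open>The same as \<open>CB d (Suc k) K\<close> without the bound on \<open>f\<close> itself,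
  see \<open>CB_Suc_LB\<close>: drifts and Lipschitz test functions are unbounded while their
  derivatives are not.\<close>

definition LB :: "nat => nat => real => (vec => real) => bool" where
 "LB d k K f \<longleftrightarrow> continuous_on (Rd d) f & (ALL i<d. EX g. has_pd d i f g & CB d k K g)"

declare CB.simps(2) [simp del]

lemma CB_SucI:
 assumes "continuous_on (Rd d) f" "!!x. x : Rd d ==> abs (f x) <= K"
  "!!i. i < d ==> EX g. has_pd d i f g & CB d k K g"
 shows "CB d (Suc k) K f"
 using assms by (simp add: CB.simps(2))

lemma CB_Suc_LB: "CB d (Suc k) K f \<longleftrightarrow> LB d k K f & (ALL x:Rd d. abs (f x) <= K)"
 unfolding LB_def CB.simps(2) by blast

lemma CB_cont: "CB d k K f ==> continuous_on (Rd d) f"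
 by (cases k) (auto simp: CB.simps(2))

lemma CB_bound: "CB d k K f ==> x : Rd d ==> abs (f x) <= K"
 by (cases k) (auto simp: CB.simps(2))

lemma CB_nonneg: "CB d k K f ==> 0 <= K"
 using CB_bound[of d k K f "restrict (%_. 0) {..<d}"] by (meson Rd_restrict abs_ge_zero order_trans)

lemma CB_cong:
 assumes f: "CB d k K f" and eq: "!!x. x : Rd d ==> f x = g x"
 shows "CB d k K g"
proof -
 have c: "continuous_on (Rd d) g"
  using continuous_on_cong[of "Rd d" "Rd d" f g] CB_cont[OF f] eq by simp
 show ?thesis
 proof (cases k)
  case 0
  with f eq c show ?thesis by simp
 next
  case (Suc l)
  show ?thesis unfolding Suc
  proof (rule CB_SucI[OF c])
   show "abs (g x) <= K" if "x : Rd d" for x using CB_bound[OF f that] eq[OF that] by simp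
   fix i assume i: "i < d"
   then obtain h where "has_pd d i f h" "CB d l K h" using f Suc by (auto simp: CB.simps(2))
   thus "EX h. has_pd d i g h & CB d l K h" using has_pd_cong[of d i f h g h] i eq by blast
  qed
 qed
qed

lemma CB_pd:
 assumes "CB d (Suc k) K f" "i < d"
 shows "has_pd d i f (pd i f)" "CB d k K (pd i f)"
proof -
 obtain g where g: "has_pd d i f g" "CB d k K g" using assms by (auto simp: CB.simps(2))
 thus "CB d k K (pd i f)" by (auto intro: CB_cong simp: has_pd_imp_pd)
 show "has_pd d i f (pd i f)" using g(1) assms(2) by (rule has_pd_cong) (auto simp: has_pd_imp_pd[OF g(1)])
qed

lemma LB_pd:
 assumes "LB d k K f" "i < d"
 shows "has_pd d i f (pd i f)" "CB d k K (pd i f)"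
proof -
 obtain g where g: "has_pd d i f g" "CB d k K g" using assms by (auto simp: LB_def)
 thus "CB d k K (pd i f)" by (auto intro: CB_cong simp: has_pd_imp_pd)
 show "has_pd d i f (pd i f)" using g(1) assms(2) by (rule has_pd_cong) (auto simp: has_pd_imp_pd[OF g(1)])
qed

lemma CB_mono_const: "CB d k K f ==> K <= K' ==> CB d k K' f"
proof (induction k arbitrary: f)
 case (Suc k)
 show ?case
  using Suc.prems CB_pd[OF Suc.prems(1)] Suc.IH
  by (intro CB_SucI) (auto simp: CB_cont intro: order_trans[OF CB_bound])
qed fastforce

lemma CB_Suc_imp: "CB d (Suc k) K f ==> CB d k K f"
proof (induction k arbitrary: f)
 case (Suc k)
 show ?case
  using CB_pd[OF Suc.prems] Suc.IH
  by (intro CB_SucI CB_cont[OF Suc.prems] CB_bound[OF Suc.prems]) blast+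
qed (simp add: CB.simps(2))

lemma CB_mono: 
 assumes "CB d k K f" "l <= k" "K <= K'" shows "CB d l K' f"
proof -
 have "CB d l K f" using assms(2,1) by (induction rule: inc_induct) (auto dest: CB_Suc_imp)
 thus ?thesis using assms(3) by (rule CB_mono_const)
qed

lemma LB_mono: "LB d k K f ==> l <= k ==> K <= K' ==> LB d l K' f"
 unfolding LB_def using CB_mono by blast

lemma CB_imp_LB: "CB d (Suc k) K f ==> LB d k K f"
 by (simp add: CB_Suc_LB)

lemma CB_const: "abs c <= K ==> CB d k K (%_. c)"
proof (induction k arbitrary: c)
 case (Suc k)
 have "CB d k K (%_. 0)" using Suc.prems by (intro Suc.IH) simp
 with Suc.prems show ?case by (intro CB_SucI) (auto intro: has_pd_const)
qed simp

lemma CB_add: "CB d k K f ==> CB d k L g ==> CB d k (K + L) (%x. f x + g x)"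
proof (induction k arbitrary: f g)
 case (Suc k)
 show ?case
 proof (rule CB_SucI)
  show "abs (f x + g x) <= K + L" if "x : Rd d" for x
   using CB_bound[OF Suc.prems(1) that] CB_bound[OF Suc.prems(2) that] by linarith
  show "EX h. has_pd d i (%x. f x + g x) h & CB d k (K + L) h" if "i < d" for i
   using CB_pd[OF Suc.prems(1) that] CB_pd[OF Suc.prems(2) that] Suc.IH[of "pd i f" "pd i g"]
    has_pd_add[of d i f "pd i f" g "pd i g"] by blast
 qed (intro continuous_intros CB_cont[OF Suc.prems(1)] CB_cont[OF Suc.prems(2)])
qed (auto intro!: continuous_intros abs_triangle_ineq[THEN order_trans] add_mono)

lemma CB_cmult: "CB d k K f ==> CB d k (abs c * K) (%x. c * f x)"
proof (induction k arbitrary: f)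
 case (Suc k)
 show ?case
 proof (rule CB_SucI)
  show "abs (c * f x) <= abs c * K" if "x : Rd d" for x
   using CB_bound[OF Suc.prems that] by (simp add: abs_mult mult_left_mono)
  show "EX h. has_pd d i (%x. c * f x) h & CB d k (abs c * K) h" if "i < d" for i
   using CB_pd[OF Suc.prems that] Suc.IH[of "pd i f"] has_pd_cmult[of d i f "pd i f" c] by blast
 qed (intro continuous_intros CB_cont[OF Suc.prems])
qed (auto intro!: continuous_intros mult_left_mono simp: abs_mult)

text \<open>The factor \<open>2 ^ k\<close> counts the terms of the Leibniz rule, which double with
  every differentiation.\<close>

lemma CB_mult: "CB d k K f ==> CB d k L g ==> CB d k (2 ^ k * K * L) (%x. f x * g x)"
proof (induction k arbitrary: f g)
 case 0
 have "abs (f x * g x) <= K * L" if "x : Rd d" for x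
   using CB_bound[OF "0.prems"(1) that] CB_bound[OF "0.prems"(2) that] CB_nonneg[OF "0.prems"(1)]
   by (auto simp: abs_mult intro!: mult_mono)
 with 0 show ?case by (auto intro!: continuous_intros)
next
 case (Suc k)
 have nn: "0 <= K" "0 <= L" using Suc.prems by (blast intro: CB_nonneg)+
 show ?case
 proof (rule CB_SucI)
  fix i assume i: "i < d"
  have "CB d k (2 ^ k * K * L + 2 ^ k * K * L) (%x. pd i f x * g x + f x * pd i g x)"
   using CB_pd(2)[OF Suc.prems(1) i] CB_pd(2)[OF Suc.prems(2) i] Suc.prems[THEN CB_Suc_imp]
   by (intro CB_add Suc.IH)
  moreover have "has_pd d i (%x. f x * g x) (%x. pd i f x * g x + f x * pd i g x)"
   using CB_pd(1)[OF Suc.prems(1) i] CB_pd(1)[OF Suc.prems(2) i] by (rule has_pd_mult)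
  ultimately show "EX h. has_pd d i (%x. f x * g x) h & CB d k (2 ^ Suc k * K * L) h"
   by (intro exI[of _ "%x. pd i f x * g x + f x * pd i g x"]) (simp add: ac_simps)
 next
  fix x assume x: "x : Rd d"
  have "abs (f x * g x) <= K * L"
   using CB_bound[OF Suc.prems(1) x] CB_bound[OF Suc.prems(2) x] nn
   by (auto simp: abs_mult intro!: mult_mono)
  also have "... <= 2 ^ Suc k * (K * L)"
   using mult_right_mono[OF one_le_power[of 2 "Suc k"], of "K * L"] nn by simp
  finally show "abs (f x * g x) <= 2 ^ Suc k * K * L" by (simp add: ac_simps)
 qed (intro continuous_intros CB_cont[OF Suc.prems(1)] CB_cont[OF Suc.prems(2)])
qed

lemma CB_sum:
 assumes "finite A" "!!j. j : A ==> CB d k (K j) (f j)"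
 shows "CB d k (\<Sum>j\<in>A. K j) (%x. \<Sum>j\<in>A. f j x)"
 using assms by (induction A rule: finite_induct) (auto intro: CB_add CB_const)

lemma CB_diff: "CB d k K f ==> CB d k L g ==> CB d k (K + L) (%x. f x - g x)"
 using CB_add[of d k K f L "%x. (-1) * g x"] CB_cmult[of d k L g "-1"] by simp

text \<open>\<open>F j\<close> plays the role of the \<open>j\<close>-th derivative of the outer
  function. By the chain rule \<open>f\<close> enters only through its derivatives, so
  \<open>LB\<close> is enough, and boundedness comes from \<open>M\<close>. The induction applies
  the claim to the shifted sequence that starts with \<open>F 1\<close>.\<close>

lemma CB_comp1:
 assumes F: "!!j y. j <= k ==> y : S ==> (F j has_real_derivative F (Suc j) y) (at y)"
  and bd: "!!j y. j <= Suc k ==> y : S ==> abs (F j y) <= M"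
  and cF: "continuous_on S (F (Suc k))"
  and S: "!!x. x : Rd d ==> f x : S" and f: "LB d k K f"
 shows "EX K'. CB d (Suc k) K' (%x. F 0 (f x))"
 using F bd cF f
proof (induction k arbitrary: F)
 case 0
 note F = "0.prems"(1) and bd = "0.prems"(2) and cF = "0.prems"(3) and f = "0.prems"(4)
 have cf: "continuous_on (Rd d) f" using f by (simp add: LB_def)
 have c0: "continuous_on S (F 0)"
  by (intro continuous_at_imp_continuous_on ballI DERIV_isCont[OF F]) auto
 have c: "continuous_on (Rd d) (%x. F 0 (f x))" "continuous_on (Rd d) (%x. F (Suc 0) (f x))"
  using continuous_on_compose2[OF c0 cf] continuous_on_compose2[OF cF cf] S by auto
 have "0 <= M" using bd[of 0 "f (restrict (%_. 0) {..<d})"] S by (metis Rd_restrict abs_ge_zero le0 order_trans)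
 have bd1: "abs (F (Suc 0) (f x) * pd i f x) <= M * abs K" if "i < d" "x : Rd d" for i x
  using bd[of 1 "f x"] S[OF that(2)] CB_bound[OF LB_pd(2)[OF f that(1)] that(2)] \<open>0 <= M\<close>
  by (auto simp: abs_mult intro!: mult_mono)
 have "CB d (Suc 0) (M + M * abs K) (%x. F 0 (f x))"
 proof (rule CB_SucI[OF c(1)])
  show "abs (F 0 (f x)) <= M + M * abs K" if "x : Rd d" for x
   using bd[of 0 "f x"] S[OF that] \<open>0 <= M\<close> by (simp add: add_increasing2)
  fix i assume i: "i < d"
  show "EX g. has_pd d i (%x. F 0 (f x)) g & CB d 0 (M + M * abs K) g"
  proof (intro exI conjI)
   show "has_pd d i (%x. F 0 (f x)) (%x. F (Suc 0) (f x) * pd i f x)"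
    using LB_pd(1)[OF f i] F[of 0] S by (intro has_pd_comp1) auto
   show "CB d 0 (M + M * abs K) (%x. F (Suc 0) (f x) * pd i f x)"
    using bd1[OF i] c(2) CB_cont[OF LB_pd(2)[OF f i]] \<open>0 <= M\<close>
    by (auto intro!: continuous_intros simp: add_increasing)
  qed
 qed
 thus ?case by blast
next
 case (Suc k)
 note F = Suc.prems(1) and bd = Suc.prems(2) and f = Suc.prems(4)
 have "EX K'. CB d (Suc k) K' (%x. F (Suc 0) (f x))"
  by (rule Suc.IH[of "%j. F (Suc j)"]) (use F bd f Suc.prems(3) in \<open>auto intro: LB_mono\<close>)
 then obtain K1 where K1: "CB d (Suc k) K1 (%x. F (Suc 0) (f x))" by blast
 define K' where "K' = M + 2 ^ Suc k * K1 * K"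
 show ?case
 \<comment> \<open>Without coordinates \<open>LB\<close> contains no bound, so \<open>0 <= K\<close>
   can be extracted only when \<open>d\<close> is positive.\<close>
 proof (cases "d = 0")
  case True
  have c0: "continuous_on S (F 0)"
   by (intro continuous_at_imp_continuous_on ballI DERIV_isCont[OF F]) auto
  have "CB d (Suc (Suc k)) M (%x. F 0 (f x))"
   using True bd[of 0] S continuous_on_compose2[OF c0, of "Rd d" f] f
   by (intro CB_SucI) (auto simp: LB_def)
  thus ?thesis by blast
 next
  case False
  hence K: "0 <= K" using CB_nonneg[OF LB_pd(2)[OF f]] by blast
  have "0 <= M" using bd[of 0 "f (restrict (%_. 0) {..<d})"] S by (metis Rd_restrict abs_ge_zero le0 order_trans)
  have "CB d (Suc (Suc k)) K' (%x. F 0 (f x))"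
  proof (rule CB_SucI)
   have c0: "continuous_on S (F 0)"
    by (intro continuous_at_imp_continuous_on ballI DERIV_isCont[OF F]) auto
   show "continuous_on (Rd d) (%x. F 0 (f x))"
    using continuous_on_compose2[OF c0, of "Rd d" f] f S by (auto simp: LB_def)
   show "abs (F 0 (f x)) <= K'" if "x : Rd d" for x
    using bd[of 0 "f x"] S[OF that] K CB_nonneg[OF K1] by (simp add: K'_def add_increasing2)
   fix i assume i: "i < d"
   show "EX g. has_pd d i (%x. F 0 (f x)) g & CB d (Suc k) K' g"
   proof (intro exI conjI)
    show "has_pd d i (%x. F 0 (f x)) (%x. F (Suc 0) (f x) * pd i f x)"
     using LB_pd(1)[OF f i] F[of 0] S by (intro has_pd_comp1) auto
    show "CB d (Suc k) K' (%x. F (Suc 0) (f x) * pd i f x)"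
     using CB_mult[OF K1 LB_pd(2)[OF f i]] by (rule CB_mono_const) (simp add: K'_def \<open>0 <= M\<close>)
   qed
  qed
  thus ?thesis by blast
 qed
qed

section \<open>The Euclidean norm, Lipschitz bounds and gradients\<close>

lemma abs_le_norm_Rd: "i < d ==> abs (x i) <= norm_Rd d x"
proof -
 assume "i < d"
 hence "(abs (x i)) <= L2_set (%i. abs (x i)) {..<d}" by (intro member_le_L2_set) auto
 thus ?thesis by (simp add: norm_Rd_def L2_set_def)
qed

lemma norm_Rd_nonneg [simp]: "0 <= norm_Rd d x"
 by (simp add: norm_Rd_def)

lemma norm_Rd_le_sum: "norm_Rd d x <= (\<Sum>i<d. abs (x i))"
 unfolding norm_Rd_def by (rule L2_set_le_sum_abs)

lemma sum_le_norm_Rd: "(\<Sum>i<d. abs (x i)) <= real d * norm_Rd d x"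
 using sum_mono[of "{..<d}" "%i. abs (x i)" "%_. norm_Rd d x"] abs_le_norm_Rd by simp

lemma norm_Rd_cong: "(!!i. i < d ==> abs (x i) = abs (y i)) ==> norm_Rd d x = norm_Rd d y"
proof -
 assume *: "!!i. i < d ==> abs (x i) = abs (y i)"
 hence "(x i)^2 = (y i)^2" if "i < d" for i by (metis that power2_abs)
 thus ?thesis by (simp add: norm_Rd_def L2_set_def)
qed

lemma norm_Rd_triangle: "norm_Rd d (%i. x i + y i) <= norm_Rd d x + norm_Rd d y"
 unfolding norm_Rd_def by (rule L2_set_triangle_ineq)

lemma dist_Rd_nonneg [simp]: "0 <= dist_Rd d x y"
 by (simp add: dist_Rd_def)

lemma dist_Rd_commute: "dist_Rd d x y = dist_Rd d y x"
 unfolding dist_Rd_def by (rule norm_Rd_cong) (simp add: abs_minus_commute)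

lemma dist_Rd_self [simp]: "dist_Rd d x x = 0"
 by (simp add: dist_Rd_def norm_Rd_def L2_set_def)

lemma dist_Rd_triangle: "dist_Rd d x z <= dist_Rd d x y + dist_Rd d y z"
 using norm_Rd_triangle[of d "%i. x i - y i" "%i. y i - z i"] by (simp add: dist_Rd_def)

lemma norm_Rd_lipschitz: "abs (norm_Rd d x - norm_Rd d y) <= dist_Rd d x y"
 using norm_Rd_triangle[of d "%i. x i - y i" y] norm_Rd_triangle[of d "%i. y i - x i" x]
  dist_Rd_commute[of d x y] by (simp add: dist_Rd_def)

lemma Cauchy_Schwarz_Rd: "abs (\<Sum>i<d. x i * y i) <= norm_Rd d x * norm_Rd d y"
proof -
 have "abs (\<Sum>i<d. x i * y i) <= (\<Sum>i<d. abs (x i) * abs (y i))"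
  using sum_abs[of "%i. x i * y i" "{..<d}"] by (simp add: abs_mult)
 also have "... <= norm_Rd d x * norm_Rd d y"
  unfolding norm_Rd_def by (rule L2_set_mult_ineq)
 finally show ?thesis .
qed

lemma norm_Rd_power2: "(norm_Rd d x)^2 = (\<Sum>i<d. (x i)^2)"
 by (simp add: norm_Rd_def L2_set_def sum_nonneg)

lemma norm_Rd_grad_power2: "(norm_Rd d (grad d f x))^2 = (\<Sum>i<d. (pd i f x)^2)"
 by (simp add: norm_Rd_power2 grad_def)

lemma norm_Rd_cmult: "norm_Rd d (%i. c * x i) = abs c * norm_Rd d x"
 using L2_set_right_distrib[of "abs c" "%i. abs (x i)" "{..<d}"]
 by (simp add: norm_Rd_def L2_set_def power_mult_distrib)

lemma continuous_on_norm_Rd: "continuous_on (Rd d) (norm_Rd d)"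
 unfolding norm_Rd_def L2_set_def
 by (intro continuous_intros continuous_on_Rd_coord) simp

lemma continuous_on_Rd_dist: 
 assumes "!!x y. x : Rd d ==> y : Rd d ==> abs (f x - f y) <= L * dist_Rd d x y"
 shows "continuous_on (Rd d) f"
proof (rule continuous_on_RdI)
 fix X :: "nat => nat => real" and x
 assume X: "!!n. X n : Rd d" and x: "x : Rd d" and l: "!!i. i < d ==> (%n. X n i) ----> x i"
 have "(%n. abs L * (\<Sum>i<d. abs (X n i - x i))) ----> \<bar>L\<bar> * (\<Sum>i<d. abs (x i - x i))"
  by (intro tendsto_intros) (use l in auto)
 moreover have "abs (f (X n) - f x) <= abs L * (\<Sum>i<d. abs (X n i - x i))" for n
 proof -
  have "abs (f (X n) - f x) <= abs L * dist_Rd d (X n) x"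
   using assms[OF X x, of n] mult_right_mono[OF abs_ge_self[of L], of "dist_Rd d (X n) x"] by force
  also have "... <= abs L * (\<Sum>i<d. abs (X n i - x i))"
   unfolding dist_Rd_def by (intro mult_left_mono norm_Rd_le_sum) auto
  finally show ?thesis .
 qed
 ultimately have "(%n. f (X n) - f x) ----> 0"
  by (intro Lim_null_comparison[of "%n. f (X n) - f x"]) auto
 thus "(%n. f (X n)) ----> f x" by (simp add: LIM_zero_iff)
qed

lemma LB_lipschitz_sum:
 assumes f: "LB d k K f" and x: "x : Rd d" and y: "y : Rd d"
 shows "abs (f y - f x) <= K * (\<Sum>i<d. abs (y i - x i))"
proof -
 obtain \<zeta> where \<zeta>: "!!k. k < d ==> \<zeta> k : Rd d" "f y - f x = (\<Sum>k<d. pd k f (\<zeta> k) * (y k - x k))"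
  by (rule mvt_Rd[OF LB_pd(1)[OF f] x y]) blast+
 have "abs (f y - f x) <= (\<Sum>k<d. abs (pd k f (\<zeta> k) * (y k - x k)))"
  unfolding \<zeta>(2) by (rule sum_abs)
 also have "... <= (\<Sum>k<d. K * abs (y k - x k))"
  using CB_bound[OF LB_pd(2)[OF f]] \<zeta>(1) by (intro sum_mono) (auto simp: abs_mult intro!: mult_right_mono)
 finally show ?thesis by (simp add: sum_distrib_left)
qed

lemma LB_taylor:
 assumes f: "LB d (Suc k) K f" and x: "x : Rd d" and y: "y : Rd d"
 shows "abs (f y - f x - (\<Sum>i<d. pd i f x * (y i - x i))) <= K * (\<Sum>i<d. abs (y i - x i))^2"
proof (cases "d = 0")
 case True
 thus ?thesis using x y Rd_eqI[OF x y] by simp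
next
 case False
 have K: "0 <= K" using CB_nonneg[OF LB_pd(2)[OF f]] False by blast
 obtain \<zeta> where \<zeta>: "!!k. k < d ==> \<zeta> k : Rd d"
  "!!k i. k < d ==> i < d ==> abs (\<zeta> k i - x i) <= abs (y i - x i)"
  "f y - f x = (\<Sum>k<d. pd k f (\<zeta> k) * (y k - x k))"
  by (rule mvt_Rd[OF LB_pd(1)[OF f] x y]) blast+
 let ?S = "\<Sum>i<d. abs (y i - x i)"
 have "abs (f y - f x - (\<Sum>i<d. pd i f x * (y i - x i))) = abs (\<Sum>i<d. (pd i f (\<zeta> i) - pd i f x) * (y i - x i))"
  by (simp add: \<zeta>(3) left_diff_distrib sum_subtractf)
 also have "... <= (\<Sum>i<d. abs ((pd i f (\<zeta> i) - pd i f x) * (y i - x i)))" by (rule sum_abs)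
 also have "... <= (\<Sum>i<d. (K * ?S) * abs (y i - x i))"
 proof (rule sum_mono)
  fix i assume i: "i : {..<d}"
  have "abs (pd i f (\<zeta> i) - pd i f x) <= K * (\<Sum>j<d. abs (\<zeta> i j - x j))"
   by (rule LB_lipschitz_sum[OF CB_imp_LB[OF LB_pd(2)[OF f]] x]) (use i \<zeta>(1) in auto)
  also have "... <= K * ?S" using i K \<zeta>(2) by (intro mult_left_mono sum_mono) auto
  finally show "abs ((pd i f (\<zeta> i) - pd i f x) * (y i - x i)) <= (K * ?S) * abs (y i - x i)"
   by (simp add: abs_mult mult_right_mono)
 qed
 also have "... = K * ?S^2" by (simp add: sum_distrib_left[symmetric] power2_eq_square)
 finally show ?thesis .
qed

text \<open>Along the direction of the gradient the derivative at 0 equals the square of its norm,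
  while the Lipschitz bound allows at most \<open>L\<close> times the norm. Cancelling one factor
  gives \<open>L\<close> without a dimensional loss.\<close>

lemma lipschitz_imp_grad:
 assumes f: "LB d k K f" and x: "x : Rd d" and L: "0 <= L"
  and lip: "!!x y. x : Rd d ==> y : Rd d ==> abs (f x - f y) <= L * dist_Rd d x y"
 shows "norm_Rd d (grad d f x) <= L"
proof -
 let ?v = "grad d f x" and ?g = "%s. (\<lambda>i\<in>{..<d}. x i + s * grad d f x i)"
 let ?n = "norm_Rd d ?v"
 have "((%s. f (?g s)) has_real_derivative (\<Sum>i<d. pd i f (?g 0) * ?v i)) (at 0)"
  by (rule chain_rule_Rd[OF LB_pd(1)[OF f] CB_cont[OF LB_pd(2)[OF f]]])
   (auto intro!: derivative_eq_intros)
 moreover have "?g 0 = x" using x by (auto intro: Rd_eqI)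
 ultimately have "((%s. f (?g s)) has_real_derivative ?n^2) (at 0)"
  by (simp only: norm_Rd_grad_power2) (simp add: grad_def power2_eq_square)
 hence lim: "((%h. (f (?g h) - f x) / h) \<longlongrightarrow> ?n^2) (at 0)"
  using \<open>?g 0 = x\<close> by (simp add: DERIV_def)
 have "\<forall>\<^sub>F h in at 0. (f (?g h) - f x) / h <= L * ?n"
 proof (rule eventually_at_filter[THEN iffD2, OF always_eventually], intro allI impI)
  fix h :: real assume h: "h ~= 0"
  have "dist_Rd d (?g h) x = abs h * ?n"
   unfolding dist_Rd_def norm_Rd_cmult[symmetric] by (rule norm_Rd_cong) simp
  hence "abs (f (?g h) - f x) <= L * ?n * abs h" using lip[of "?g h" x] x by (simp add: mult_ac)
  hence "abs ((f (?g h) - f x) / h) <= L * ?n" using h by (simp add: divide_le_eq)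
  thus "(f (?g h) - f x) / h <= L * ?n" by (rule order_trans[OF abs_ge_self])
 qed
 hence "?n^2 <= L * ?n" using lim by (intro tendsto_upperbound[OF lim]) auto
 hence "?n * ?n <= L * ?n" by (simp add: power2_eq_square)
 thus ?thesis
  using L by (cases "?n = 0") (auto simp: mult_le_cancel_right)
qed

lemma grad_imp_lipschitz:
 assumes f: "LB d k K f" and x: "x : Rd d" and y: "y : Rd d"
  and L: "!!x. x : Rd d ==> norm_Rd d (grad d f x) <= L"
 shows "abs (f x - f y) <= L * dist_Rd d x y"
proof -
 let ?g = "%s. (\<lambda>i\<in>{..<d}. x i + s * (y i - x i))"
 have D: "((%s. f (?g s)) has_real_derivative (\<Sum>i<d. pd i f (?g s) * (y i - x i))) (at s)" for s
  by (rule chain_rule_Rd[OF LB_pd(1)[OF f] CB_cont[OF LB_pd(2)[OF f]]])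
   (auto intro!: derivative_eq_intros)
 obtain z where "f (?g 1) - f (?g 0) = (1 - 0) * (\<Sum>i<d. pd i f (?g z) * (y i - x i))"
  using MVT2[of 0 1 "%s. f (?g s)", OF _ D] by auto
 moreover have "?g 0 = x" "?g 1 = y" using x y by (auto intro: Rd_eqI)
 ultimately have "abs (f x - f y) = abs (\<Sum>i<d. grad d f (?g z) i * (y i - x i))"
  by (simp add: grad_def abs_minus_commute)
 also have "... <= norm_Rd d (grad d f (?g z)) * norm_Rd d (%i. y i - x i)"
  by (rule Cauchy_Schwarz_Rd)
 also have "... <= L * dist_Rd d y x"
  unfolding dist_Rd_def by (intro mult_right_mono L) auto
 finally show ?thesis by (simp add: dist_Rd_commute)
qed

section \<open>Relation to \<open>C_k\<close> and \<open>deriv_norm\<close>\<close>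

lemma CB_imp_C_k: "CB d k K f ==> C_k d k f"
proof (induction k arbitrary: f)
 case (Suc k)
 have "(%s. f (x(i := s))) differentiable (at (x i))" if "i < d" "x : Rd d" for i x
  using CB_pd(1)[OF Suc.prems that(1)] that(2) by (auto simp: has_pd_def real_differentiable_def)
 with Suc show ?case using CB_cont[OF Suc.prems] CB_pd(2)[OF Suc.prems] by auto
qed simp

lemma C_k_cont: "C_k d k f ==> continuous_on (Rd d) f"
 by (cases k) auto

lemma C_k_pd: "C_k d (Suc k) f ==> i < d ==> has_pd d i f (pd i f)"
 by (rule has_pd_pd) auto

lemma C_k_imp_CB:
 assumes "C_k d k f" "!!js x. set js \<subseteq> {..<d} ==> length js <= k ==> x : Rd d ==> abs (foldr pd js f x) <= K"
 shows "CB d k K f"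
 using assms
proof (induction k arbitrary: f)
 case 0
 thus ?case using "0.prems"(2)[of "[]"] by simp
next
 case (Suc k)
 show ?case
 proof (rule CB_SucI)
  show "abs (f x) <= K" if "x : Rd d" for x using Suc.prems(2)[of "[]" x] that by simp
  fix i assume i: "i < d"
  have "CB d k K (pd i f)"
  proof (rule Suc.IH)
   show "abs (foldr pd js (pd i f) x) <= K" if "set js \<subseteq> {..<d}" "length js <= k" "x : Rd d" for js x
    using Suc.prems(2)[of "js @ [i]" x] that i by simp
  qed (use Suc.prems(1) i in auto)
  with C_k_pd[OF Suc.prems(1) i] show "EX g. has_pd d i f g & CB d k K g" by blast
 qed (use Suc.prems(1) in auto)
qed

text \<open>Inserting the standard basis vectors picked by \<open>js\<close> into the multilinear
  map kills every term of the sum but one; the \<open>i\<close>-th component of what remains is the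
  partial derivative.\<close>

lemma foldr_pd_le_deriv_norm:
 assumes i: "i < d" and js: "set js \<subseteq> {..<d}" "length js = k"
 shows "abs (foldr pd js (%y. G y i) x) <= deriv_norm d k G x"
proof -
 let ?J = "{js. set js \<subseteq> {..<d} & length js = k}"
 let ?V = "{v :: nat => nat => real. ALL l<k. norm_Rd d (v l) <= 1}"
 let ?H = "%v i. \<Sum>js\<in>?J. (\<Prod>l<k. v l (js ! l)) * foldr pd js (%y. G y i) x"
 have fin: "finite ?J" using finite_lists_length_eq[of "{..<d}" k] by simp
 \<comment> \<open>A supremum of reals bounds its members only if the set is bounded above; vectors
   of norm at most 1 make each product of coordinates at most 1.\<close>
 have bdd: "bdd_above ((%v. norm_Rd d (?H v)) ` ?V)"
 proof (rule bdd_aboveI2)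
  fix v assume v: "v : ?V"
  have "norm_Rd d (?H v) <= (\<Sum>i<d. abs (?H v i))" by (rule norm_Rd_le_sum)
  also have "... <= (\<Sum>i<d. \<Sum>js\<in>?J. abs (foldr pd js (%y. G y i) x))"
  proof (intro sum_mono order_trans[OF sum_abs])
   fix i js assume js: "js : ?J"
   have "(\<Prod>l<k. abs (v l (js ! l))) <= 1"
   proof (rule prod_le_1)
    fix l assume l: "l : {..<k}"
    hence "js ! l : set js" using js by simp
    hence "js ! l < d" using js by blast
    from abs_le_norm_Rd[OF this, of "v l"] show "0 <= abs (v l (js ! l)) & abs (v l (js ! l)) <= 1"
     using v l by (auto intro: order_trans)
   qed
   thus "abs ((\<Prod>l<k. v l (js ! l)) * foldr pd js (%y. G y i) x) <= abs (foldr pd js (%y. G y i) x)"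
    by (simp add: abs_mult abs_prod mult_left_le_one_le prod_nonneg)
  qed
  finally show "norm_Rd d (?H v) <= (\<Sum>i<d. \<Sum>js\<in>?J. abs (foldr pd js (%y. G y i) x))" .
 qed
 define v where "v = (%l j. if l < k & j = js ! l then 1 else (0::real))"
 have "v : ?V"
 proof safe
  fix l assume l: "l < k"
  have "norm_Rd d (v l) <= (\<Sum>j<d. abs (v l j))" by (rule norm_Rd_le_sum)
  also have "... = (\<Sum>j<d. if j = js ! l then 1 else 0)" using l by (intro sum.cong) (auto simp: v_def)
  also have "... <= 1" by simp
  finally show "norm_Rd d (v l) <= 1" .
 qed
 have prod: "(\<Prod>l<k. v l (js' ! l)) = (if js' = js then 1 else 0)" if "js' : ?J" for js'
 proof (cases "js' = js")
  case False
  moreover have "length js' = k" using that by simp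
  ultimately obtain l where "l < k" "js' ! l ~= js ! l" using js(2) nth_equalityI[of js' js] by metis
  hence "(\<Prod>l<k. v l (js' ! l)) = 0" by (intro prod_zero) (auto simp: v_def)
  with False show ?thesis by simp
 qed (auto simp: v_def)
 have "?H v i = foldr pd js (%y. G y i) x"
 proof -
  have "?H v i = (\<Sum>js'\<in>?J. if js' = js then foldr pd js' (%y. G y i) x else 0)"
   using prod by (intro sum.cong) auto
  thus ?thesis using fin js by simp
 qed
 hence "abs (foldr pd js (%y. G y i) x) <= norm_Rd d (?H v)"
  using abs_le_norm_Rd[OF i, of "?H v"] by simp
 also have "... <= (SUP v\<in>?V. norm_Rd d (?H v))"
  using \<open>v : ?V\<close> bdd by (rule cSUP_upper)
 finally show ?thesis by (simp add: deriv_norm_def)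
qed

section \<open>The Euler step\<close>

text \<open>One step of the explicit Euler scheme for the generator \<open>\<Delta> - B \<cdot> \<nabla>\<close>, with the Gaussian
 increment replaced by a uniformly chosen signed multiple of a coordinate vector.\<close>

definition euler_pt :: "nat => (vec => vec) => real => vec =>
  vec => vec" where
 "euler_pt d B delta c x = (\<lambda>j\<in>{..<d}. x j - delta * B x j + c j)"

definition euler_step :: "nat => (vec => vec) => real =>
  (vec => real) => vec => real" where
 "euler_step d B delta phi x =
   (\<Sum>i<d. phi (euler_pt d B delta (%j. if j = i then sqrt (2 * real d * delta) else 0) x) +
       phi (euler_pt d B delta (%j. if j = i then - sqrt (2 * real d * delta) else 0) x)) / (2 * real d)"

definition generator :: "nat => (vec => vec) => (vec => real) =>
  vec => real" where
 "generator d B phi x = laplacian d phi x - (\<Sum>i<d. B x i * pd i phi x)"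

text \<open>A single \<open>M\<close> bounds the derivatives of orders one to three and the linear
  growth. The drift itself is unbounded, which is why powers of \<open>1 + norm_Rd d x\<close>, to
  be integrated with second moments, appear in the estimates below.\<close>

definition drift :: "nat => real => (vec => vec) => bool" where
 "drift d M B \<longleftrightarrow> 0 <= M & (ALL j<d. LB d 2 M (%x. B x j) & (ALL x:Rd d. abs (B x j) <= M * (1 + norm_Rd d x)))"

lemma euler_pt_Rd [simp]: "euler_pt d B delta c x : Rd d"
 by (simp add: euler_pt_def)

text \<open>Stability of the scheme: the constant is multiplied by \<open>1 + A * delta\<close>,
  with the same \<open>A\<close> for all functions, shifts and drifts with constant
  \<open>M\<close>, so over a partition of an interval the factors stay below an exponential of its
  length. The reason is that the Jacobian of \<open>euler_pt\<close> is the identity minus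
  \<open>delta\<close> times a bounded matrix.\<close>

lemma CB_euler_pt:
 assumes M: "0 <= M"
 shows "n <= Suc k ==> EX A>=0. ALL B. (ALL j<d. LB d k M (%x. B x j)) --> (ALL phi K c delta. CB d n K phi --> 0 <= delta --> delta <= 1 -->
  CB d n (K * (1 + A * delta)) (%x. phi (euler_pt d B delta c x)))"
proof (induction n)
 case 0
 have "CB d 0 K (%x. phi (euler_pt d B delta c x))" 
  if "CB d 0 K phi" and B: "!!j. j < d ==> LB d k M (%x. B x j)" for phi K c delta B
 proof -
  have "continuous_on (Rd d) (%x. phi (euler_pt d B delta c x))"
  proof (rule continuous_on_Rd_comp[OF CB_cont[OF that(1)]])
   show "continuous_on (Rd d) (%x. euler_pt d B delta c x i)" if "i < d" for i
    using that B[OF that] unfolding euler_pt_def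
    by (auto intro!: continuous_intros continuous_on_Rd_coord simp: LB_def)
  qed auto
  thus ?thesis using that(1) by simp
 qed
 thus ?case by (intro exI[of _ 0]) auto
next
 case (Suc n)
 then obtain A where A: "A >= 0"
  "!!B phi K c delta. (!!j. j < d ==> LB d k M (%x. B x j)) ==> CB d n K phi ==> 0 <= delta ==> delta <= 1 ==>
  CB d n (K * (1 + A * delta)) (%x. phi (euler_pt d B delta c x))" by auto
 define A' where "A' = A + real d * (2 ^ n * (1 + A) * M)"
 have A': "A <= A'" using A M by (simp add: A'_def)
 have "CB d (Suc n) (K * (1 + A' * delta)) (%x. phi (euler_pt d B delta c x))"
  if phi: "CB d (Suc n) K phi" and delta: "0 <= delta" "delta <= 1"
   and B: "!!j. j < d ==> LB d k M (%x. B x j)" for B phi K c delta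
 proof (rule CB_SucI)
  have K: "0 <= K" using phi by (rule CB_nonneg)
  let ?T = "euler_pt d B delta c"
  show "continuous_on (Rd d) (%x. phi (?T x))"
   by (rule CB_cont[OF A(2)[OF B CB_Suc_imp[OF phi] delta]])
  show "abs (phi (?T x)) <= K * (1 + A' * delta)" for x
   using CB_bound[OF phi, of "?T x"] K A' A(1) delta
   by (auto intro: order_trans simp: algebra_simps)
  fix i assume i: "i < d"
  have T': "has_pd d i (%x. ?T x j) (%x. (if i = j then 1 else 0) - delta * pd i (%x. B x j) x)" if "j < d" for j
  proof -
   have "has_pd d i (%x. x j - delta * B x j + c j) (%x. (if i = j then 1 else 0) - delta * pd i (%x. B x j) x + 0)"
    by (intro has_pd_add has_pd_diff has_pd_cmult has_pd_coord[OF that] has_pd_const LB_pd(1)[OF B[OF that] i])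
   thus ?thesis using that by (simp add: euler_pt_def)
  qed
  have "has_pd d i (%x. phi (?T x))
    (%x. \<Sum>j<d. pd j phi (?T x) * ((if i = j then 1 else 0) - delta * pd i (%x. B x j) x))"
   by (rule has_pd_comp[OF i CB_pd(1)[OF phi] CB_cont[OF CB_pd(2)[OF phi]]]) (use T' in auto)
  \<comment> \<open>The identity part of the Jacobian returns \<open>pd i phi\<close> at the new
    point with its old constant; every other term carries a factor \<open>delta\<close>.\<close>
  moreover have "(\<Sum>j<d. pd j phi (?T x) * ((if i = j then 1 else 0) - delta * pd i (%x. B x j) x)) =
    pd i phi (?T x) + (\<Sum>j<d. (- delta) * (pd j phi (?T x) * pd i (%x. B x j) x))" for x
  proof -
   have "(\<Sum>j<d. pd j phi (?T x) * ((if i = j then 1 else 0) - delta * pd i (%x. B x j) x)) =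
    (\<Sum>j<d. (if i = j then pd j phi (?T x) else 0) + (- delta) * (pd j phi (?T x) * pd i (%x. B x j) x))"
    by (intro sum.cong) (auto simp: algebra_simps)
   thus ?thesis using i by (simp add: sum.distrib sum_subtractf sum_negf)
  qed
  moreover have "CB d n (K * (1 + A * delta) + (\<Sum>j<d. abs (- delta) * (2 ^ n * (K * (1 + A * delta)) * M)))
    (%x. pd i phi (?T x) + (\<Sum>j<d. (- delta) * (pd j phi (?T x) * pd i (%x. B x j) x)))"
  proof (intro CB_add CB_sum CB_cmult CB_mult A(2) B delta CB_pd(2)[OF phi] i)
   fix j assume "j : {..<d}"
   thus "j < d" by simp
   from LB_pd(2)[OF B[OF this] i] show "CB d n M (pd i (%x. B x j))"
    using Suc.prems by (auto intro: CB_mono)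
  qed auto
  hence "CB d n (K * (1 + A' * delta))
    (%x. pd i phi (?T x) + (\<Sum>j<d. (- delta) * (pd j phi (?T x) * pd i (%x. B x j) x)))"
  proof (rule CB_mono_const)
   have "K * (1 + A * delta) <= K * (1 + A)"
    using mult_left_mono[OF delta(2) A(1)] K by (intro mult_left_mono) simp_all
   moreover have ineq: "real d * (delta * (2 ^ n * X * M)) <= real d * (delta * (2 ^ n * Y * M))" if "X <= Y" for X Y :: real
    using that delta M by (intro mult_left_mono mult_right_mono) auto
   ultimately have "real d * (delta * (2 ^ n * (K * (1 + A * delta)) * M)) <= real d * (delta * (2 ^ n * (K * (1 + A)) * M))"
    using delta M ineq by blast
   thus "K * (1 + A * delta) + (\<Sum>j<d. abs (- delta) * (2 ^ n * (K * (1 + A * delta)) * M)) <= K * (1 + A' * delta)"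
    using delta by (simp add: A'_def algebra_simps)
  qed
  ultimately show "EX g. has_pd d i (%x. phi (?T x)) g & CB d n (K * (1 + A' * delta)) g"
   by auto
 qed
 thus ?case using A(1) A' by (intro exI[of _ A']) auto
qed

text \<open>Symmetrization removes the odd orders: one mean value theorem in the step size and one
  for \<open>g'\<close> between \<open>- s\<close> and \<open>s\<close> leave \<open>g''\<close> at
  an intermediate point, to be compared with \<open>g'' 0\<close>.\<close>

lemma second_difference:
 fixes g :: "real => real"
 assumes g: "!!s. (g has_real_derivative g' s) (at s)" and g': "!!s. (g' has_real_derivative g'' s) (at s)"
  and lip: "!!s. abs (g'' s - g'' 0) <= K * abs s" and e: "0 <= e" and K: "0 <= K"
 shows "abs (g e + g (- e) - 2 * g 0 - e^2 * g'' 0) <= 2 * K * e ^ 3"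
proof (cases "e = 0")
 case False
 with e have e: "0 < e" by simp
 let ?h = "%s. g s + g (- s) - 2 * g 0 - s^2 * g'' 0"
 have gm: "((%s. g (- s)) has_real_derivative - g' (- s)) (at s)" for s
  using DERIV_chain2[OF g[of "- s"] DERIV_minus[OF DERIV_ident]] by simp
 have "(?h has_real_derivative g' s - g' (- s) - 2 * s * g'' 0) (at s)" for s
  by (rule derivative_eq_intros g gm | simp)+
 from MVT2[OF e, of ?h, OF this] obtain s where s: "0 < s" "s < e"
  "?h e - ?h 0 = (e - 0) * (g' s - g' (- s) - 2 * s * g'' 0)" by auto
 from MVT2[of "- s" s g', OF _ g'] s(1) obtain z where z: "- s < z" "z < s"
  "g' s - g' (- s) = (s - (- s)) * g'' z" by auto
 have "abs (?h e) = e * (2 * s * abs (g'' z - g'' 0))"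
 proof -
  have eq: "?h e = e * (2 * s * (g'' z - g'' 0))" using s(3) z(3) by (simp add: algebra_simps)
  show ?thesis unfolding eq using e s by (simp add: abs_mult)
 qed
 also have "... <= e * (2 * e * (K * e))"
 proof (intro mult_left_mono mult_mono)
  show "abs (g'' z - g'' 0) <= K * e"
   using lip[of z] z s K mult_left_mono[of "abs z" e K] by (auto intro: order_trans)
 qed (use e s K in auto)
 finally show ?thesis by (simp add: power3_eq_cube mult_ac)
qed simp

lemma second_difference_bound:
 fixes g :: "real => real"
 assumes g: "!!s. (g has_real_derivative g' s) (at s)" and g': "!!s. (g' has_real_derivative g'' s) (at s)"
  and bd: "!!s. abs (g'' s) <= K" and e: "0 <= e"
 shows "abs (g e + g (- e) - 2 * g 0) <= 2 * K * e^2"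
proof (cases "e = 0")
 case False
 with e have e: "0 < e" by simp
 have K: "0 <= K" using bd[of 0] by simp
 let ?h = "%s. g s + g (- s) - 2 * g 0"
 have gm: "((%s. g (- s)) has_real_derivative - g' (- s)) (at s)" for s
  using DERIV_chain2[OF g[of "- s"] DERIV_minus[OF DERIV_ident]] by simp
 have "(?h has_real_derivative g' s - g' (- s)) (at s)" for s
  by (rule derivative_eq_intros g gm | simp)+
 from MVT2[OF e, of ?h, OF this] obtain s where s: "0 < s" "s < e"
  "?h e - ?h 0 = (e - 0) * (g' s - g' (- s))" by auto
 from MVT2[of "- s" s g', OF _ g'] s(1) obtain z where z: "- s < z" "z < s"
  "g' s - g' (- s) = (s - (- s)) * g'' z" by auto
 have "abs (?h e) = e * (2 * s * abs (g'' z))"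
 proof -
  have eq: "?h e = e * (2 * s * (g'' z))" using s(3) z(3) by (simp add: algebra_simps)
  show ?thesis unfolding eq using e s by (simp add: abs_mult)
 qed
 also have "... <= e * (2 * e * K)"
  using e s K bd by (intro mult_left_mono mult_mono) auto
 finally show ?thesis by (simp add: power2_eq_square mult_ac)
qed simp

lemma CB_second_difference:
 assumes phi: "CB d 3 K phi" and z: "z : Rd d" and i: "i < d" and e: "0 <= e"
 shows "abs (phi (z(i := z i + e)) + phi (z(i := z i - e)) - 2 * phi z - e^2 * pd i (pd i phi) z) <= 2 * K * e ^ 3"
  and "abs (phi (z(i := z i + e)) + phi (z(i := z i - e)) - 2 * phi z) <= 2 * K * e^2"
proof -
 have 3: "(3::nat) = Suc (Suc (Suc 0))" by simp
 note phi' = phi[unfolded 3]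
 let ?z = "%s. z(i := z i + s)"
 have D: "((%s. f (?z s)) has_real_derivative f' (?z s)) (at s)" if "has_pd d i f f'" for f f' s
 proof -
  have "((%s. z i + s) has_real_derivative 1) (at s)" by (auto intro!: derivative_eq_intros)
  from DERIV_chain2[OF has_pdD[OF that z i] this] show ?thesis by simp
 qed
 have D1: "((%s. phi (?z s)) has_real_derivative pd i phi (?z s)) (at s)" for s
  by (rule D[OF CB_pd(1)[OF phi' i]])
 have D2: "((%s. pd i phi (?z s)) has_real_derivative pd i (pd i phi) (?z s)) (at s)" for s
  by (rule D[OF CB_pd(1)[OF CB_pd(2)[OF phi' i] i]])
 have bd: "abs (pd i (pd i phi) (?z s)) <= K" for s
  by (rule CB_bound[OF CB_pd(2)[OF CB_pd(2)[OF phi' i] i]]) (use z i in simp)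
 have lip: "abs (pd i (pd i phi) (?z s) - pd i (pd i phi) (?z 0)) <= K * abs s" for s
 proof -
  have "abs (pd i (pd i phi) (?z s) - pd i (pd i phi) (?z 0)) <= K * (\<Sum>j<d. abs (?z s j - ?z 0 j))"
   by (rule LB_lipschitz_sum[OF CB_imp_LB[OF CB_pd(2)[OF CB_pd(2)[OF phi' i] i]]]) (use z i in auto)
  also have "(\<Sum>j<d. abs (?z s j - ?z 0 j)) = (\<Sum>j<d. if j = i then \<bar>s\<bar> else 0)" by (intro sum.cong) auto
  finally show ?thesis using i by (simp add: fun_upd_def)
 qed
 show "abs (phi (z(i := z i + e)) + phi (z(i := z i - e)) - 2 * phi z - e^2 * pd i (pd i phi) z) <= 2 * K * e ^ 3"
  using second_difference[OF D1 D2 lip e CB_nonneg[OF phi]] by simp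
 show "abs (phi (z(i := z i + e)) + phi (z(i := z i - e)) - 2 * phi z) <= 2 * K * e^2"
  using second_difference_bound[OF D1 D2 bd e] by simp
qed

lemma euler_pt_coord: 
 "i < d ==> euler_pt d B delta (%j. if j = i then c else 0) x =
  (euler_pt d B delta (%_. 0) x)(i := euler_pt d B delta (%_. 0) x i + c)"
 by (auto simp: euler_pt_def restrict_def)

lemma euler_step_eq:
 "euler_step d B delta phi x = (let z = euler_pt d B delta (%_. 0) x; e = sqrt (2 * real d * delta) in
   (\<Sum>i<d. phi (z(i := z i + e)) + phi (z(i := z i - e))) / (2 * real d))"
 unfolding euler_step_def Let_def
 by (intro arg_cong2[where f="(/)"] sum.cong arg_cong2[where f="(+)"] arg_cong[where f=phi] refl)
  (simp_all add: euler_pt_coord)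

lemma CB_euler_step:
 assumes d: "d >= 1"
 shows "EX A>=0. ALL B phi K delta. drift d M B --> CB d 3 K phi --> 0 <= delta --> delta <= 1 -->
  CB d 3 (K * (1 + A * delta)) (euler_step d B delta phi)"
proof (cases "0 <= M")
 case True
 let ?P = "%A. (ALL B. (ALL j<d. LB d 2 M (%x. B x j)) --> (ALL phi K c delta. CB d 3 K phi --> 0 <= delta --> delta <= 1 -->
   CB d 3 (K * (1 + A * delta)) (%x. phi (euler_pt d B delta c x))))"
 have "EX A>=0. ?P A" by (rule CB_euler_pt[OF True]) simp
 then obtain A where "A >= 0 & ?P A" by (rule exE)
 hence A: "A >= 0" "?P A" by (rule conjunct1, rule conjunct2)
 have "CB d 3 (K * (1 + A * delta)) (euler_step d B delta phi)"
  if B: "drift d M B" and phi: "CB d 3 K phi" and delta: "0 <= delta" "delta <= 1" for B phi K delta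
 proof -
  let ?K = "K * (1 + A * delta)"
  have "CB d 3 ?K (%x. phi (euler_pt d B delta c x))" for c
   by (rule A(2)[rule_format]) (use B phi delta in \<open>simp_all add: drift_def\<close>)
  hence "CB d 3 (abs (1 / (2 * real d)) * (\<Sum>i<d. ?K + ?K)) (%x. (1 / (2 * real d)) *
   (\<Sum>i<d. phi (euler_pt d B delta (%j. if j = i then sqrt (2 * real d * delta) else 0) x) +
       phi (euler_pt d B delta (%j. if j = i then - sqrt (2 * real d * delta) else 0) x)))"
   by (intro CB_cmult CB_sum CB_add) auto
  moreover have "abs (1 / (2 * real d)) * (\<Sum>i<d. ?K + ?K) = ?K" using d by (simp add: field_simps)
  ultimately show ?thesis by (simp add: euler_step_def[abs_def])
 qed
 thus ?thesis using A(1) by (intro exI[of _ A] conjI allI impI) simp_all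
next
 case False
 thus ?thesis by (intro exI[of _ 0]) (simp add: drift_def)
qed

text \<open>The step is an average of values of \<open>phi\<close>, so this is a discrete maximum
  principle. It keeps functions between two positive bounds along a chain of steps, so that their
  logarithms stay bounded.\<close>

lemma euler_step_range:
 assumes "d >= 1" "!!x. x : Rd d ==> a <= phi x & phi x <= b"
 shows "a <= euler_step d B delta phi x & euler_step d B delta phi x <= b"
proof -
 have "real d * (2 * a) <= (\<Sum>i<d. phi (y i) + phi (z i)) & (\<Sum>i<d. phi (y i) + phi (z i)) <= real d * (2 * b)"
  if y: "!!i. y i : Rd d" and z: "!!i. z i : Rd d" for y z
 proof -
  have "2 * a <= phi (y i) + phi (z i) & phi (y i) + phi (z i) <= 2 * b" for i
   using assms(2)[OF y[of i]] assms(2)[OF z[of i]] by linarith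
  thus ?thesis
   using sum_mono[of "{..<d}" "%_. 2 * a" "%i. phi (y i) + phi (z i)"]
    sum_mono[of "{..<d}" "%i. phi (y i) + phi (z i)" "%_. 2 * b"] by simp
 qed
 moreover have "a <= S / (2 * real d) & S / (2 * real d) <= b" if "real d * (2 * a) <= S & S <= real d * (2 * b)" for S
  using that assms(1) by (simp add: le_divide_eq divide_le_eq mult_ac)
 ultimately show ?thesis unfolding euler_step_def by simp
qed

text \<open>The order 3/2 comes from the jump length \<open>e\<close>, which is of order
  \<open>sqrt delta\<close>: symmetric second differences have a remainder \<open>e ^ 3\<close>
  (\<open>t2\<close>). Shifting by the drift costs \<open>delta^2\<close> in the Taylor formula
  (\<open>t1\<close>) and again \<open>delta^2\<close> for evaluating the Laplacian at the shifted
  point (\<open>t3\<close>).\<close>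

lemma euler_step_consistency:
 assumes d: "d >= 1" and B: "drift d M B" and phi: "CB d 3 K phi" and delta: "0 <= delta" "delta <= 1" and x: "x : Rd d"
 shows "abs (euler_step d B delta phi x - phi x) <= (real d * M + 2 * real d) * K * delta * (1 + norm_Rd d x)" (is ?A)
  and "abs (euler_step d B delta phi x - phi x - delta * generator d B phi x)
   <= ((real d * M)^2 + 4 * (real d)^2 + (real d)^2 * M) * K * (delta * sqrt delta) * (1 + norm_Rd d x)^2" (is ?B)
proof -
 define z where "z = euler_pt d B delta (%_. 0) x"
 define e where "e = sqrt (2 * real d * delta)"
 define N where "N = 1 + norm_Rd d x"
 have N: "1 <= N" by (simp add: N_def)
 have K: "0 <= K" using phi by (rule CB_nonneg)
 have M: "0 <= M" using B by (simp add: drift_def)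
 have z: "z : Rd d" by (simp add: z_def)
 have e: "0 <= e" "e^2 = 2 * real d * delta" using delta by (auto simp: e_def)
 have 3: "(3::nat) = Suc (Suc (Suc 0))" by simp
 note phi' = phi[unfolded 3]
 have zx: "(\<Sum>j<d. abs (z j - x j)) <= delta * (real d * M * N)"
 proof -
  have "(\<Sum>j<d. abs (z j - x j)) <= (\<Sum>j<d. delta * (M * N))"
   using B x delta by (intro sum_mono) (auto simp: z_def euler_pt_def drift_def abs_mult N_def intro!: mult_left_mono)
  thus ?thesis by (simp add: mult_ac)
 qed
 have zx0: "0 <= (\<Sum>j<d. abs (z j - x j))" by (intro sum_nonneg) auto
 let ?D = "%i. phi (z(i := z i + e)) + phi (z(i := z i - e)) - 2 * phi z"
 have Q: "euler_step d B delta phi x = phi z + (\<Sum>i<d. ?D i) / (2 * real d)"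
  unfolding euler_step_eq Let_def z_def[symmetric] e_def[symmetric]
  using d by (simp add: sum_subtractf diff_divide_distrib)
 have "abs (phi z - phi x) <= K * (delta * (real d * M * N))"
  using LB_lipschitz_sum[OF CB_imp_LB[OF phi'] x z] mult_left_mono[OF zx K] by linarith
 moreover have "abs ((\<Sum>i<d. ?D i) / (2 * real d)) <= 2 * K * (real d * delta)"
 proof -
  have "abs (\<Sum>i<d. ?D i) <= (\<Sum>i<d. 2 * K * (2 * real d * delta))"
   using CB_second_difference(2)[OF phi z _ e(1)] e(2) by (intro order_trans[OF sum_abs] sum_mono) auto
  thus ?thesis using d by (simp add: field_simps)
 qed
 moreover have "2 * K * (real d * delta) <= 2 * K * (real d * delta) * N"
  using N K delta mult_left_mono[of 1 N "2 * K * (real d * delta)"] by simp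
 ultimately have "abs (phi z + (\<Sum>i<d. ?D i) / (2 * real d) - phi x) <= K * (delta * (real d * M * N)) + 2 * K * (real d * delta) * N"
  by linarith
 thus ?A unfolding Q N_def[symmetric] by (simp add: algebra_simps)

 have t1: "abs (phi z - phi x + delta * (\<Sum>i<d. B x i * pd i phi x)) <= K * (delta * (real d * M * N))^2"
 proof -
  have "(\<Sum>i<d. pd i phi x * (z i - x i)) = - delta * (\<Sum>i<d. B x i * pd i phi x)"
   unfolding sum_distrib_left by (intro sum.cong) (auto simp: z_def euler_pt_def)
  hence "abs (phi z - phi x + delta * (\<Sum>i<d. B x i * pd i phi x)) <= K * (\<Sum>j<d. abs (z j - x j))^2"
   using LB_taylor[OF CB_imp_LB[OF phi'] x z] by simp
  also have "... <= K * (delta * (real d * M * N))^2" using zx zx0 K by (intro mult_left_mono power_mono)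
  finally show ?thesis .
 qed
 have t2: "abs ((\<Sum>i<d. ?D i) / (2 * real d) - delta * laplacian d phi z) <= K * e ^ 3"
 proof -
  have "abs ((\<Sum>i<d. ?D i) - (\<Sum>i<d. e^2 * pd i (pd i phi) z)) <= (\<Sum>i<d. 2 * K * e ^ 3)"
   unfolding sum_subtractf[symmetric]
   using CB_second_difference(1)[OF phi z _ e(1)] by (intro order_trans[OF sum_abs] sum_mono) auto
  moreover have "(\<Sum>i<d. e^2 * pd i (pd i phi) z) = 2 * real d * (delta * laplacian d phi z)"
   by (simp add: laplacian_def e sum_distrib_left mult_ac)
  ultimately have "abs ((\<Sum>i<d. ?D i) - 2 * real d * (delta * laplacian d phi z)) / (2 * real d) <= (2 * real d * (K * e ^ 3)) / (2 * real d)"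
   by (intro divide_right_mono) auto
  thus ?thesis using d by (simp add: diff_divide_distrib[symmetric] abs_divide field_simps)
 qed
 have t3: "abs (delta * laplacian d phi z - delta * laplacian d phi x) <= delta * (real d * (K * (delta * (real d * M * N))))"
 proof -
  have "abs (laplacian d phi z - laplacian d phi x) <= (\<Sum>i<d. K * (delta * (real d * M * N)))"
   unfolding laplacian_def sum_subtractf[symmetric]
  proof (intro order_trans[OF sum_abs] sum_mono)
   fix i assume "i : {..<d}" hence i: "i < d" by simp
   show "abs (pd i (pd i phi) z - pd i (pd i phi) x) <= K * (delta * (real d * M * N))"
    using LB_lipschitz_sum[OF CB_imp_LB[OF CB_pd(2)[OF CB_pd(2)[OF phi' i] i]] x z] mult_left_mono[OF zx K] by linarith
  qed
  hence "delta * abs (laplacian d phi z - laplacian d phi x) <= delta * (real d * (K * (delta * (real d * M * N))))"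
   using delta by (intro mult_left_mono) auto
  thus ?thesis using delta by (simp add: right_diff_distrib[symmetric] abs_mult)
 qed
 have sq: "delta * delta <= delta * sqrt delta"
 proof -
  have "delta <= sqrt delta" using delta by (intro real_le_rsqrt) (simp add: power2_eq_square mult_left_le)
  thus ?thesis using delta by (intro mult_left_mono)
 qed
 have NN: "1 <= N^2" "N <= N^2" using N one_le_power[OF N, of 2] by (auto simp: power2_eq_square)
 have s0: "0 <= delta * sqrt delta" using delta by simp
 have b1: "K * (delta * (real d * M * N))^2 <= K * (real d * M)^2 * (delta * sqrt delta) * N^2"
 proof -
  have "K * (delta * (real d * M * N))^2 = (delta * delta) * (K * (real d * M)^2 * N^2)" by (simp add: power2_eq_square mult_ac)
  also have "... <= (delta * sqrt delta) * (K * (real d * M)^2 * N^2)" using sq K by (intro mult_right_mono) auto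
  finally show ?thesis by (simp add: mult_ac)
 qed
 have b2: "K * e ^ 3 <= K * (4 * (real d)^2) * (delta * sqrt delta) * N^2"
 proof -
  have r: "sqrt (2 * real d) <= 2 * real d" using d by (intro real_le_lsqrt) (auto simp: power2_eq_square)
  have "e ^ 3 = e^2 * e" by (simp add: power2_eq_square power3_eq_cube)
  also have "... = (2 * real d * sqrt (2 * real d)) * (delta * sqrt delta)" unfolding e(2) by (simp add: e_def real_sqrt_mult)
  also have "... <= (2 * real d * (2 * real d)) * (delta * sqrt delta)"
   using mult_left_mono[OF r, of "2 * real d"] s0 by (intro mult_right_mono) simp_all
  finally have "K * e ^ 3 <= K * ((2 * real d * (2 * real d)) * (delta * sqrt delta))" using K by (intro mult_left_mono)
  also have "... <= K * ((2 * real d * (2 * real d)) * (delta * sqrt delta)) * N^2"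
   using mult_left_mono[OF NN(1), of "K * ((2 * real d * (2 * real d)) * (delta * sqrt delta))"] K s0 by simp
  finally show ?thesis by (simp add: power2_eq_square mult_ac)
 qed
 have b3: "delta * (real d * (K * (delta * (real d * M * N)))) <= K * ((real d)^2 * M) * (delta * sqrt delta) * N^2"
 proof -
  have "delta * (real d * (K * (delta * (real d * M * N)))) = (delta * delta) * (K * ((real d)^2 * M) * N)"
   by (simp add: power2_eq_square mult_ac)
  also have "... <= (delta * sqrt delta) * (K * ((real d)^2 * M) * N^2)"
   using sq K M N NN s0 by (intro mult_mono[OF sq] mult_left_mono) auto
  finally show ?thesis by (simp add: mult_ac)
 qed
 have "abs (euler_step d B delta phi x - phi x - delta * generator d B phi x) =
   abs ((phi z - phi x + delta * (\<Sum>i<d. B x i * pd i phi x)) + ((\<Sum>i<d. ?D i) / (2 * real d) - delta * laplacian d phi z)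
    + (delta * laplacian d phi z - delta * laplacian d phi x))"
  unfolding Q generator_def by (simp add: algebra_simps)
 also have "... <= K * (real d * M)^2 * (delta * sqrt delta) * N^2 + K * (4 * (real d)^2) * (delta * sqrt delta) * N^2
   + K * ((real d)^2 * M) * (delta * sqrt delta) * N^2"
  using t1 t2 t3 b1 b2 b3 by linarith
 finally show ?B unfolding N_def[symmetric] by (simp add: algebra_simps)
qed

section \<open>Lebesgue measure and integration by parts on \<open>Rd\<close>\<close>

interpretation lborel_product: product_sigma_finite "%_ :: nat. lborel :: real measure"
 by standard

lemma space_lborel_Rd_eq [simp]: "space (lborel_Rd d) = Rd d" "space (borel_Rd d) = Rd d"
 by (simp_all add: space_lborel_Rd space_borel_Rd)

lemma sigma_finite_lborel_Rd: "sigma_finite_measure (lborel_Rd d)"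
 unfolding lborel_Rd_def by (rule lborel_product.sigma_finite) simp

lemma measurable_lborel_Rd: "f : borel_measurable (borel_Rd d) ==> f : borel_measurable (lborel_Rd d)"
 by (subst measurable_cong_sets[OF sets_lborel_Rd refl])

lemma measurable_RdI:
 assumes "!!z. z : space M ==> T z : Rd d" "!!i. i < d ==> (%z. T z i) : borel_measurable M"
 shows "T : measurable M (borel_Rd d)"
 unfolding borel_Rd_def by (rule measurable_PiM_single') (use assms in \<open>auto simp: Rd_def space_PiM\<close>)

lemma measurable_coord_Rd: "i < d ==> (%x. x i) : borel_measurable (borel_Rd d)"
 by (rule measurable_Rd[OF continuous_on_Rd_coord])

lemma measurable_affine_Rd:
 "(%x. \<lambda>i\<in>{..<d}. v i + c * x i) : measurable (borel_Rd d) (borel_Rd d)"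
 using measurable_coord_Rd by (intro measurable_RdI) auto

lemma distr_lborel_pm:
 assumes "abs c = (1 :: real)"
 shows "distr lborel borel (%x. t + c * x) = lborel"
proof -
 have "c ~= 0" using assms by auto
 from lborel_real_affine[OF this, of t] assms show ?thesis
  by (simp add: density_1)
qed

text \<open>Translations serve integration by parts; translations composed with the reflection serve
  the change of variables in a convolution.\<close>

lemma lborel_Rd_affine:
 assumes c: "abs c = (1 :: real)"
 shows "distr (lborel_Rd d) (borel_Rd d) (%x. \<lambda>i\<in>{..<d}. v i + c * x i) = lborel_Rd d"
 unfolding lborel_Rd_def
proof (rule lborel_product.PiM_eqI)
 let ?T = "%x. \<lambda>i\<in>{..<d}. v i + c * x i"
 show "sets (distr (Pi\<^sub>M {..<d} (%_. lborel)) (borel_Rd d) ?T) = sets (Pi\<^sub>M {..<d} (%_. lborel))"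
  using sets_lborel_Rd[of d] by (simp add: lborel_Rd_def)
 fix A :: "nat => real set" assume A: "!!i. i : {..<d} ==> A i : sets lborel"
 have m: "?T : measurable (lborel_Rd d) (borel_Rd d)"
  using measurable_affine_Rd by (subst measurable_cong_sets[OF sets_lborel_Rd refl])
 have "Pi\<^sub>E {..<d} A : sets (borel_Rd d)" unfolding borel_Rd_def
  using A by (intro sets_PiM_I_finite) auto
 hence "emeasure (distr (lborel_Rd d) (borel_Rd d) ?T) (Pi\<^sub>E {..<d} A) =
   emeasure (lborel_Rd d) (?T -` (Pi\<^sub>E {..<d} A) \<inter> Rd d)"
  using m by (subst emeasure_distr) auto
 also have "?T -` (Pi\<^sub>E {..<d} A) \<inter> Rd d = Pi\<^sub>E {..<d} (%i. (%y. v i + c * y) -` A i)"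
  by (auto simp: Rd_def PiE_def Pi_def)
 also have "emeasure (lborel_Rd d) ... = (\<Prod>i<d. emeasure lborel ((%y. v i + c * y) -` A i))"
  unfolding lborel_Rd_def
 proof (rule lborel_product.emeasure_PiM)
  fix i assume "i : {..<d}"
  hence "A i : sets borel" using A by simp
  hence "(%y. v i + c * y) -` A i \<inter> space borel : sets borel"
   by (intro measurable_sets[of _ borel borel]) auto
  thus "(%y. v i + c * y) -` A i : sets lborel" by simp
 qed simp
 also have "... = (\<Prod>i<d. emeasure lborel (A i))"
 proof (rule prod.cong[OF refl])
  fix i assume "i : {..<d}"
  hence "A i : sets borel" using A by simp
  hence "emeasure (distr lborel borel (%x. v i + c * x)) (A i) = emeasure lborel ((%y. v i + c * y) -` A i)"
   by (subst emeasure_distr) auto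
  thus "emeasure lborel ((%y. v i + c * y) -` A i) = emeasure lborel (A i)"
   by (simp add: distr_lborel_pm[OF c])
 qed
 finally have "emeasure (distr (lborel_Rd d) (borel_Rd d) ?T) (Pi\<^sub>E {..<d} A) = (\<Prod>i<d. emeasure lborel (A i))" .
 thus "emeasure (distr (Pi\<^sub>M {..<d} (%_. lborel)) (borel_Rd d) ?T) (Pi\<^sub>E {..<d} A)
   = (\<Prod>i<d. emeasure lborel (A i))" unfolding lborel_Rd_def .
qed simp

lemma integral_lborel_Rd_affine:
 fixes f :: "vec => real"
 assumes c: "abs c = (1 :: real)" and f: "f : borel_measurable (borel_Rd d)"
 shows "(LINT x|lborel_Rd d. f (\<lambda>i\<in>{..<d}. v i + c * x i)) = (LINT x|lborel_Rd d. f x)"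
  and "integrable (lborel_Rd d) (%x. f (\<lambda>i\<in>{..<d}. v i + c * x i)) \<longleftrightarrow> integrable (lborel_Rd d) f"
proof -
 have m: "(%x. \<lambda>i\<in>{..<d}. v i + c * x i) : measurable (lborel_Rd d) (borel_Rd d)"
  using measurable_affine_Rd by (subst measurable_cong_sets[OF sets_lborel_Rd refl])
 show "(LINT x|lborel_Rd d. f (\<lambda>i\<in>{..<d}. v i + c * x i)) = (LINT x|lborel_Rd d. f x)"
  by (subst (2) lborel_Rd_affine[OF c, of d v, symmetric], subst integral_distr[OF m f]) simp
 show "integrable (lborel_Rd d) (%x. f (\<lambda>i\<in>{..<d}. v i + c * x i)) \<longleftrightarrow> integrable (lborel_Rd d) f"
  by (subst (2) lborel_Rd_affine[OF c, of d v, symmetric], subst integrable_distr_eq[OF m f]) simp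
qed

text \<open>Boundary terms at infinity are avoided: by translation invariance the integral of
  \<open>g'\<close> equals its average over shifts of length \<open>s\<close> in
  \<open>[0, 1]\<close> in direction \<open>i\<close>. Fubini turns this into the integral of the
  increment of \<open>g\<close> over a unit shift, which vanishes by the same invariance.\<close>

lemma integral_pd_eq_0:
 assumes i: "i < d" and pd: "has_pd d i g g'" and cg: "continuous_on (Rd d) g" and cg': "continuous_on (Rd d) g'"
  and ig: "integrable (lborel_Rd d) g" and ig': "integrable (lborel_Rd d) g'"
 shows "(LINT x|lborel_Rd d. g' x) = 0"
proof -
 interpret L: sigma_finite_measure "lborel_Rd d" by (rule sigma_finite_lborel_Rd)
 let ?I = "density lborel (indicator {0..1 :: real})"
 interpret I: prob_space ?I
  by (rule prob_spaceI) (simp add: emeasure_density)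
 interpret P: pair_sigma_finite ?I "lborel_Rd d" ..
 let ?u = "%x s. x(i := x i + s)"
 have u_eq: "?u x s = (\<lambda>j\<in>{..<d}. (if j = i then s else 0) + 1 * x j)" if "x : Rd d" for x s
  using that i by (intro Rd_eqI[of _ d]) auto
 have mg: "g : borel_measurable (borel_Rd d)" "g' : borel_measurable (borel_Rd d)"
  using cg cg' by (auto intro: measurable_Rd)
 have shift: "(LINT x|lborel_Rd d. f (?u x s)) = (LINT x|lborel_Rd d. f x)"
  "integrable (lborel_Rd d) (%x. f (?u x s)) \<longleftrightarrow> integrable (lborel_Rd d) f"
  if "f : borel_measurable (borel_Rd d)" for s and f :: "_ => real"
 proof -
  have "(LINT x|lborel_Rd d. f (?u x s)) = (LINT x|lborel_Rd d. f (\<lambda>j\<in>{..<d}. (if j = i then s else 0) + 1 * x j))"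
   by (intro Bochner_Integration.integral_cong refl arg_cong[where f=f] u_eq) simp
  also have "... = (LINT x|lborel_Rd d. f x)" by (rule integral_lborel_Rd_affine(1)[OF _ that]) simp
  finally show "(LINT x|lborel_Rd d. f (?u x s)) = (LINT x|lborel_Rd d. f x)" .
  have "integrable (lborel_Rd d) (%x. f (?u x s)) \<longleftrightarrow>
    integrable (lborel_Rd d) (%x. f (\<lambda>j\<in>{..<d}. (if j = i then s else 0) + 1 * x j))"
   by (intro Bochner_Integration.integrable_cong refl arg_cong[where f=f] u_eq) simp
  also have "... \<longleftrightarrow> integrable (lborel_Rd d) f" by (rule integral_lborel_Rd_affine(2)[OF _ that]) simp
  finally show "integrable (lborel_Rd d) (%x. f (?u x s)) \<longleftrightarrow> integrable (lborel_Rd d) f" .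
 qed
 have mu: "(%(s, x). ?u x s) : measurable (?I \<Otimes>\<^sub>M lborel_Rd d) (borel_Rd d)"
 proof (rule measurable_RdI)
  show "(case z of (s, x) => ?u x s) : Rd d" if "z : space (?I \<Otimes>\<^sub>M lborel_Rd d)" for z
   using that i by (auto simp: space_pair_measure)
  have c: "(%z. snd z k) : borel_measurable (?I \<Otimes>\<^sub>M lborel_Rd d)" if "k < d" for k
   by (rule measurable_compose[OF measurable_snd measurable_lborel_Rd[OF measurable_coord_Rd[OF that]]])
  have s: "(%z. fst z) : borel_measurable (?I \<Otimes>\<^sub>M lborel_Rd d)"
   by (rule measurable_compose[OF measurable_fst]) simp
  fix k assume k: "k < d"
  show "(%z. (case z of (s, x) => ?u x s) k) : borel_measurable (?I \<Otimes>\<^sub>M lborel_Rd d)"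
   using c[OF k] c[OF i] s by (cases "k = i") (auto simp: case_prod_beta)
 qed
 let ?F = "%(s, x). g' (?u x s)"
 have "integrable (?I \<Otimes>\<^sub>M lborel_Rd d) ?F"
 proof (rule P.Fubini_integrable)
  show "?F : borel_measurable (?I \<Otimes>\<^sub>M lborel_Rd d)"
   using measurable_compose[OF mu mg(2)] by (simp add: case_prod_beta)
  have "(LINT x|lborel_Rd d. abs (g' (?u x s))) = (LINT x|lborel_Rd d. abs (g' x))" for s
   using shift(1)[of "%x. abs (g' x)"] mg by simp
  thus "integrable ?I (%s. \<integral>x. norm (?F (s, x)) \<partial>lborel_Rd d)" by simp
  show "AE s in ?I. integrable (lborel_Rd d) (%x. ?F (s, x))"
   using shift(2)[OF mg(2)] ig' by simp
 qed
 from P.Fubini_integral[OF this]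
 have "(LINT x|lborel_Rd d. (LINT s|?I. g' (?u x s))) = (LINT s|?I. (LINT x|lborel_Rd d. g' (?u x s)))"
  by simp
 also have "... = (LINT x|lborel_Rd d. g' x)"
  using I.prob_space by (simp add: shift(1)[OF mg(2)])
 also have "(LINT x|lborel_Rd d. (LINT s|?I. g' (?u x s))) = (LINT x|lborel_Rd d. g (?u x 1) - g x)"
 proof (rule Bochner_Integration.integral_cong[OF refl])
  fix x assume "x : space (lborel_Rd d)" hence x: "x : Rd d" by simp
  have D: "((%s. g (?u x s)) has_real_derivative g' (?u x s)) (at s)" for s
  proof -
   have "((%s. x i + s) has_real_derivative 1) (at s)" by (auto intro!: derivative_eq_intros)
   from DERIV_chain2[OF has_pdD[OF pd x i] this] show ?thesis by simp
  qed
  have cs: "continuous_on UNIV (%s. g' (?u x s))"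
  proof (rule continuous_on_compose2[OF cg', of UNIV "%s. ?u x s"])
   show "continuous_on UNIV (?u x)"
   proof (rule continuous_on_coordinatewise_then_product)
    show "continuous_on UNIV (%s. ?u x s k)" for k
     by (cases "k = i") (simp_all add: continuous_intros)
   qed
  qed (use x i in auto)
  have "(LINT s|?I. g' (?u x s)) = (LINT s|lborel. indicator {0..1} s *\<^sub>R g' (?u x s))"
  proof -
   have "(%s. ennreal (indicator {0..1 :: real} s)) = indicator {0..1}" by (auto split: split_indicator)
   hence "?I = density lborel (%s. ennreal (indicator {0..1 :: real} s))" by simp
   moreover have "(%s. g' (?u x s)) : borel_measurable lborel"
    using borel_measurable_continuous_onI[OF cs] by simp
   ultimately show ?thesis by (simp only:) (subst integral_density, auto)
  qed
  also have "... = g (?u x 1) - g (?u x 0)"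
  proof (rule integral_FTC_atLeastAtMost)
   show "((%s. g (?u x s)) has_vector_derivative g' (?u x s)) (at s within {0..1})" for s
    by (rule has_vector_derivative_at_within, fold has_real_derivative_iff_has_vector_derivative, rule D)
  qed (use continuous_on_subset[OF cs] in auto)
  finally show "(LINT s|?I. g' (?u x s)) = g (?u x 1) - g x" by simp
 qed
 also have "... = 0"
  using shift[OF mg(1), of 1] ig by simp
 finally show ?thesis by simp
qed

section \<open>Gibbs measures\<close>

definition gibbs :: "nat => (vec => real) => vec measure" where
 "gibbs d V = density (lborel_Rd d) (%x. ennreal (exp (- V x) / (LINT y|lborel_Rd d. exp (- V y))))"

locale gibbs_measure =
 fixes d :: nat and V :: "vec => real"
 assumes cV: "continuous_on (Rd d) V" and iV: "integrable (lborel_Rd d) (%x. exp (- V x))"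
begin

definition "Z = (LINT y|lborel_Rd d. exp (- V y))"

abbreviation "nu \<equiv> gibbs d V"

lemma mV: "(%x. exp (- V x)) : borel_measurable (lborel_Rd d)"
 using iV by (rule borel_measurable_integrable)

lemma Z_pos: "0 < Z"
proof -
 have "Z ~= 0"
 proof
  assume "Z = 0"
  hence "AE x in lborel_Rd d. exp (- V x) = 0"
   unfolding Z_def by (subst (asm) integral_nonneg_eq_0_iff_AE[OF iV]) auto
  hence "AE x in lborel_Rd d. False" by simp
  hence "emeasure (lborel_Rd d) (Rd d) = 0"
   using AE_iff_null[of "lborel_Rd d" "%_. False"] sets.top[of "lborel_Rd d"] by (simp add: null_sets_def)
  moreover have "emeasure (lborel_Rd d) (Rd d) = (\<Prod>i<d. emeasure lborel (UNIV :: real set))"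
   unfolding lborel_Rd_def Rd_def by (rule lborel_product.emeasure_PiM) auto
  ultimately show False by simp
 qed
 moreover have "0 <= Z" unfolding Z_def by (rule Bochner_Integration.integral_nonneg) simp
 ultimately show ?thesis by simp
qed

lemma gibbs_alt: "nu = density (lborel_Rd d) (%x. ennreal (exp (- V x) / Z))"
 by (simp add: gibbs_def Z_def)

lemma sets_gibbs [simp]: "sets nu = sets (borel_Rd d)"
 by (simp add: gibbs_def sets_lborel_Rd)

lemma space_gibbs [simp]: "space nu = Rd d"
 by (simp add: gibbs_def)

lemma prob_space_gibbs: "prob_space nu"
proof (rule prob_spaceI)
 have "emeasure nu (space nu) = (\<integral>\<^sup>+ x. ennreal (exp (- V x) / Z) \<partial>lborel_Rd d)"
  unfolding gibbs_alt using mV sets.top[of "lborel_Rd d"]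
  by (subst emeasure_density) (auto intro!: nn_integral_cong)
 also have "... = ennreal (LINT x|lborel_Rd d. exp (- V x) / Z)"
  using iV Z_pos by (intro nn_integral_eq_integral) auto
 also have "(LINT x|lborel_Rd d. exp (- V x) / Z) = 1"
  using Z_pos by (simp add: Z_def)
 finally show "emeasure nu (space nu) = 1" by simp
qed

lemma integral_gibbs:
 assumes "f : borel_measurable (borel_Rd d)"
 shows "(LINT x|nu. f x) = (LINT x|lborel_Rd d. exp (- V x) / Z * f x)"
 unfolding gibbs_alt using assms mV Z_pos
 by (subst integral_density) (auto intro: measurable_lborel_Rd)

lemma integrable_gibbs:
 fixes f :: "vec => real"
 assumes "f : borel_measurable (borel_Rd d)"
 shows "integrable nu f \<longleftrightarrow> integrable (lborel_Rd d) (%x. exp (- V x) / Z * f x)"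
 unfolding gibbs_alt using assms mV Z_pos
 by (subst integrable_density) (auto intro: measurable_lborel_Rd)

lemma measurable_gibbs: "continuous_on (Rd d) f ==> f : borel_measurable nu"
 using measurable_Rd by (subst measurable_cong_sets[OF sets_gibbs refl])

lemma integrable_bounded:
 fixes f :: "vec => real"
 assumes "continuous_on (Rd d) f" "!!x. x : Rd d ==> abs (f x) <= K"
 shows "integrable nu f"
proof -
 interpret prob_space nu by (rule prob_space_gibbs)
 show ?thesis using assms measurable_gibbs by (intro integrable_const_bound[of _ K]) auto
qed

text \<open>This is \<open>integral_pd_eq_0\<close> for the product of \<open>w\<close> with the
  normalized density, whose derivative produces the factor \<open>- V'\<close>.\<close>

lemma gibbs_ibp:
 assumes i: "i < d" and V: "has_pd d i V V'" "continuous_on (Rd d) V'" "integrable nu V'"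
  and w: "has_pd d i w w'" "continuous_on (Rd d) w" "continuous_on (Rd d) w'"
  and bd: "!!x. x : Rd d ==> abs (w x) <= K" "!!x. x : Rd d ==> abs (w' x) <= K"
 shows "(LINT x|nu. w' x) = (LINT x|nu. V' x * w x)"
proof -
 let ?g = "%x. exp (- V x) / Z * w x" and ?g' = "%x. exp (- V x) / Z * (w' x - V' x * w x)"
 have i1: "integrable nu w" "integrable nu w'" using w bd by (auto intro: integrable_bounded)
 have i2: "integrable nu (%x. V' x * w x)"
 proof (rule Bochner_Integration.integrable_bound[of _ "%x. K * V' x"])
  show "AE x in nu. norm (V' x * w x) <= norm (K * V' x)"
  proof (rule AE_I2)
   fix x assume "x : space nu"
   hence "abs (w x) <= abs K" using bd(1)[of x] by simp
   thus "norm (V' x * w x) <= norm (K * V' x)"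
    by (simp add: abs_mult mult.commute[of "abs K"] mult_left_mono)
  qed
 qed (use V w in \<open>auto intro!: measurable_gibbs continuous_intros\<close>)
 have i3: "integrable nu (%x. w' x - V' x * w x)" using i1 i2 by simp
 have c: "continuous_on (Rd d) (%x. w' x - V' x * w x)" using V w by (intro continuous_intros)
 have "(LINT x|lborel_Rd d. ?g' x) = 0"
 proof (rule integral_pd_eq_0[OF i, of ?g])
  have "has_pd d i (%x. exp (- V x) / Z) (%x. (- (exp (- V x) / Z)) * V' x)"
  proof (rule has_pd_comp1[OF V(1), of "%y. exp (- y) / Z" "%y. - (exp (- y) / Z)"])
   show "((%y. exp (- y) / Z) has_real_derivative - (exp (- V x) / Z)) (at (V x))" for x
    by (auto intro!: derivative_eq_intros simp: Z_pos[THEN less_imp_neq, symmetric])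
  qed
  from has_pd_mult[OF this w(1)] show "has_pd d i ?g ?g'" by (simp add: algebra_simps diff_divide_distrib)
  show "integrable (lborel_Rd d) ?g" using i1(1) integrable_gibbs[OF measurable_Rd[OF w(2)]] by simp
  show "integrable (lborel_Rd d) ?g'" using i3 integrable_gibbs[OF measurable_Rd[OF c]] by simp
 qed (use V w cV Z_pos in \<open>auto intro!: continuous_intros\<close>)
 hence "(LINT x|nu. w' x - V' x * w x) = 0"
  using integral_gibbs[OF measurable_Rd[OF c]] by simp
 thus ?thesis using i1(2) i2 by simp
qed

end

section \<open>Logarithmic Sobolev inequalities and the Herbst argument\<close>

lemma DERIV_integral:
 fixes G :: "real => 'a => real"
 assumes D: "!!z s. z : space M ==> abs (s - s0) < 1 ==> ((%s. G s z) has_real_derivative G' s z) (at s)"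
  and iG: "!!s. integrable M (G s)" and mG': "G' s0 : borel_measurable M"
  and ib: "integrable M b" and b: "!!z s. z : space M ==> abs (s - s0) < 1 ==> abs (G' s z) <= b z"
 shows "((%s. \<integral>z. G s z \<partial>M) has_real_derivative (LINT z|M. G' s0 z)) (at s0)"
proof -
 have "((%h. ((LINT z|M. G (s0 + h) z) - (LINT z|M. G s0 z)) / h) \<longlongrightarrow> (LINT z|M. G' s0 z)) (at 0)"
  unfolding tendsto_at_iff_sequentially
 proof (intro allI impI)
  fix X :: "nat => real" assume X0: "ALL i. X i : UNIV - {0}" and X: "X ----> 0"
  have Xn: "X i ~= 0" for i using X0 by auto
  have "\<forall>\<^sub>F n in sequentially. abs (X n) < 1"
   using tendstoD[OF X, of 1] by (simp add: dist_real_def)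
  then obtain n0 where n0: "!!n. n >= n0 ==> abs (X n) < 1" by (auto simp: eventually_sequentially)
  let ?Y = "%n. X (n + n0)"
  have Y: "?Y ----> 0" using X by (rule LIMSEQ_ignore_initial_segment)
  have "(%n. \<integral>z. (G (s0 + ?Y n) z - G s0 z) / ?Y n \<partial>M) ----> (LINT z|M. G' s0 z)"
  proof (rule integral_dominated_convergence[where w=b])
   show "AE z in M. (%n. (G (s0 + ?Y n) z - G s0 z) / ?Y n) ----> G' s0 z"
   proof (rule AE_I2)
    fix z assume "z : space M"
    from D[OF this, of s0] have "((%h. (G (s0 + h) z - G s0 z) / h) \<longlongrightarrow> G' s0 z) (at 0)"
     by (simp add: DERIV_def)
    thus "(%n. (G (s0 + ?Y n) z - G s0 z) / ?Y n) ----> G' s0 z"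
     unfolding tendsto_at_iff_sequentially using Y Xn by (auto simp: o_def)
   qed
   show "AE z in M. norm ((G (s0 + ?Y n) z - G s0 z) / ?Y n) <= b z" for n
   proof (rule AE_I2)
    fix z assume z: "z : space M"
    have "abs (?Y n) < 1" using n0 by simp
    have "EX t. abs (t - s0) < 1 & G (s0 + ?Y n) z - G s0 z = ?Y n * G' t z"
    proof (cases "?Y n > 0")
     case True
     have "EX t>s0. t < s0 + ?Y n & G (s0 + ?Y n) z - G s0 z = (s0 + ?Y n - s0) * G' t z"
      by (rule MVT2) (use True \<open>abs (?Y n) < 1\<close> D[OF z] in auto)
     then obtain t where "t > s0" "t < s0 + ?Y n" "G (s0 + ?Y n) z - G s0 z = (s0 + ?Y n - s0) * G' t z" by auto
     thus ?thesis using True \<open>abs (?Y n) < 1\<close> by (intro exI[of _ t]) auto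
    next
     case False
     have "EX t>s0 + ?Y n. t < s0 & G s0 z - G (s0 + ?Y n) z = (s0 - (s0 + ?Y n)) * G' t z"
      by (rule MVT2) (use False Xn[of "n + n0"] \<open>abs (?Y n) < 1\<close> D[OF z] in auto)
     then obtain t where "t > s0 + ?Y n" "t < s0" "G s0 z - G (s0 + ?Y n) z = (s0 - (s0 + ?Y n)) * G' t z" by auto
     thus ?thesis using False \<open>abs (?Y n) < 1\<close> by (intro exI[of _ t]) (auto simp: algebra_simps)
    qed
    then obtain t where "abs (t - s0) < 1" "G (s0 + ?Y n) z - G s0 z = ?Y n * G' t z" by blast
    thus "norm ((G (s0 + ?Y n) z - G s0 z) / ?Y n) <= b z" using b[OF z, of t] Xn[of "n + n0"] by simp
   qed
  qed (use iG mG' ib in auto)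
  moreover have "(LINT z|M. (G (s0 + h) z - G s0 z) / h) = ((LINT z|M. G (s0 + h) z) - (LINT z|M. G s0 z)) / h" for h
   using iG by (simp add: Bochner_Integration.integral_diff[OF iG iG])
  ultimately have "(%n. ((LINT z|M. G (s0 + ?Y n) z) - (LINT z|M. G s0 z)) / ?Y n) ----> (LINT z|M. G' s0 z)" by (simp only:)
  from LIMSEQ_offset[OF this]
  show "((%h. ((LINT z|M. G (s0 + h) z) - (LINT z|M. G s0 z)) / h) \<circ> X) ----> (LINT z|M. G' s0 z)"
   by (simp add: o_def)
 qed
 thus ?thesis by (simp add: DERIV_def)
qed

lemma CB_comp_compact:
 assumes F: "!!j y. j <= Suc k ==> y : S ==> (F j has_real_derivative F (Suc j) y) (at y)"
  and S: "compact S" "!!x. x : Rd d ==> f x : S" and f: "LB d k K f"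
 shows "EX K'. CB d (Suc k) K' (%x. F 0 (f x))"
proof -
 have c: "continuous_on S (F j)" if "j <= Suc k" for j
  using F[OF that] by (intro continuous_at_imp_continuous_on ballI DERIV_isCont)
 have "EX M. ALL y:S. abs (F j y) <= M" if "j <= Suc k" for j
 proof -
  have "bounded (F j ` S)" using c[OF that] S(1) by (intro compact_imp_bounded compact_continuous_image)
  thus ?thesis by (auto simp: bounded_iff)
 qed
 hence "ALL j. EX M. j <= Suc k --> (ALL y:S. abs (F j y) <= M)" by blast
 from choice[OF this] obtain M where M: "!!j y. j <= Suc k ==> y : S ==> abs (F j y) <= M j" by blast
 have "abs (F j y) <= (\<Sum>j\<le>Suc k. abs (M j))" if "j <= Suc k" "y : S" for j y
  using M[OF that] member_le_sum[of j "{..Suc k}" "%j. abs (M j)"] that by auto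
 thus ?thesis
  by (intro CB_comp1[of k S F "\<Sum>j\<le>Suc k. abs (M j)"]) (use F c S(2) f in auto)
qed

section \<open>Exponential moments from the logarithmic Sobolev inequality\<close>

definition LSI :: "nat => real => vec measure => bool" where
 "LSI d rho mu \<longleftrightarrow> (ALL f. C1_bounded d f -->
   rho * Ent mu (%x. (f x)^2) <= (LINT x|mu. (norm_Rd d (grad d f x))^2))"

lemma CB_C1_bounded:
 assumes f: "CB d (Suc k) K f" shows "C1_bounded d f"
proof -
 have f1: "CB d 1 K f" using CB_mono[OF f, of 1] by simp
 have "norm_Rd d (grad d f x) <= real d * K" if "x : Rd d" for x
 proof -
  have "norm_Rd d (grad d f x) <= (\<Sum>i<d. abs (grad d f x i))" by (rule norm_Rd_le_sum)
  also have "... <= (\<Sum>i<d. K)"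
   using CB_bound[OF CB_pd(2)[OF f] that] by (intro sum_mono) (simp add: grad_def)
  finally show ?thesis by simp
 qed
 moreover have "K <= K + real d * K" "real d * K <= K + real d * K" using CB_nonneg[OF f] by auto
 ultimately have "ALL x:Rd d. abs (f x) <= K + real d * K & norm_Rd d (grad d f x) <= K + real d * K"
  using CB_bound[OF f] by (meson order_trans)
 thus ?thesis using CB_imp_C_k[OF f1] by (auto simp: C1_bounded_def)
qed

locale lsi_gibbs = gibbs_measure +
 fixes rho :: real
 assumes rho: "0 < rho" and lsi: "LSI d rho (gibbs d V)"
begin

interpretation prob_space nu by (rule prob_space_gibbs)

text \<open>The logarithmic Sobolev inequality for \<open>exp (g / 2)\<close>, whose square is
  \<open>exp g\<close>; the half in the exponent is the source of the factor 1/4.\<close>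

lemma lsi_exp:
 assumes g: "CB d (Suc k) K g"
 shows "rho * ((LINT x|nu. g x * exp (g x)) - (LINT x|nu. exp (g x)) * ln (LINT x|nu. exp (g x)))
  <= (LINT x|nu. exp (g x) * (norm_Rd d (grad d g x))^2) / 4"
proof -
 let ?f = "%x. exp (g x / 2)"
 have g0: "CB d (Suc 0) K g" using g by (rule CB_mono) auto
 have "EX K'. CB d (Suc 0) K' (%x. (%j y. exp (y / 2) / 2 ^ j) 0 (g x))"
 proof (rule CB_comp_compact[where S="{-K..K}" and K=K and f=g])
  show "((%y. exp (y / 2) / 2 ^ j) has_real_derivative exp (y / 2) / 2 ^ Suc j) (at y)" for j and y :: real
   by (auto intro!: derivative_eq_intros)
  show "g x : {-K..K}" if "x : Rd d" for x using CB_bound[OF g that] by (auto simp: abs_le_iff)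
  show "LB d 0 K g" using CB_imp_LB[OF g0] .
 qed simp
 then obtain K' where K': "CB d (Suc 0) K' ?f" by auto
 have sq: "(?f x)^2 = exp (g x)" for x by (simp add: power2_eq_square exp_add[symmetric])
 have grad: "(norm_Rd d (grad d ?f x))^2 = exp (g x) * (norm_Rd d (grad d g x))^2 / 4" if x: "x : Rd d" for x
 proof -
  have "pd i ?f x = exp (g x / 2) / 2 * pd i g x" if "i < d" for i
  proof (rule has_pd_imp_pd[OF has_pd_comp1[OF CB_pd(1)[OF g that], of "%y. exp (y / 2)" "%y. exp (y / 2) / 2"] x])
   show "((%y. exp (y / 2)) has_real_derivative exp (g x / 2) / 2) (at (g x))" for x
    by (auto intro!: derivative_eq_intros)
  qed
  hence "(norm_Rd d (grad d ?f x))^2 = (\<Sum>i<d. (exp (g x / 2) / 2 * pd i g x)^2)"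
   unfolding norm_Rd_grad_power2 by (intro sum.cong refl arg_cong[where f="%z. z^2"]) simp
  also have "... = (\<Sum>i<d. exp (g x) / 4 * (pd i g x)^2)"
   by (intro sum.cong refl) (simp add: power_mult_distrib power_divide sq)
  also have "... = exp (g x) * (norm_Rd d (grad d g x))^2 / 4"
   by (simp add: norm_Rd_grad_power2 sum_distrib_left sum_divide_distrib)
  finally show ?thesis .
 qed
 have "rho * Ent nu (%x. (?f x)^2) <= (LINT x|nu. (norm_Rd d (grad d ?f x))^2)"
  using lsi CB_C1_bounded[OF K'] by (auto simp: LSI_def)
 also have "... = (LINT x|nu. exp (g x) * (norm_Rd d (grad d g x))^2 / 4)"
  using grad by (intro Bochner_Integration.integral_cong) auto
 finally show ?thesis by (simp add: Ent_def sq mult.commute)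
qed

lemma exp_moment_deriv:
 assumes c: "continuous_on (Rd d) g" and bd: "!!x. x : Rd d ==> abs (g x) <= K"
 shows "((%q. \<integral>x. exp (q * g x) \<partial>nu) has_real_derivative (LINT x|nu. g x * exp (q0 * g x))) (at q0)"
proof (rule DERIV_integral[where b="%_. abs K * exp ((abs q0 + 1) * abs K)"])
 fix q x assume x: "x : space nu" and q: "abs (q - q0) < 1"
 have "q * g x <= abs q * abs (g x)" by (simp add: abs_mult[symmetric])
 also have "... <= (abs q0 + 1) * abs K" using q bd[of x] x by (intro mult_mono) auto
 finally show "abs (g x * exp (q * g x)) <= abs K * exp ((abs q0 + 1) * abs K)"
  using bd[of x] x by (auto simp: abs_mult intro!: mult_mono)
next
 fix q
 show "integrable nu (%x. exp (q * g x))"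
 proof (rule integrable_bounded)
  fix x assume "x : Rd d"
  hence "abs (q * g x) <= abs q * abs K" using bd[of x] by (auto simp: abs_mult intro!: mult_left_mono)
  thus "abs (exp (q * g x)) <= exp (abs q * abs K)" by auto
 qed (intro continuous_intros c)
next
 show "(%x. g x * exp (q0 * g x)) : borel_measurable nu"
  by (intro measurable_gibbs continuous_intros c)
qed (auto intro!: derivative_eq_intros)

lemma exp_moment_pos:
 assumes g: "CB d k K g"
 shows "0 < (LINT x|nu. exp (g x))" "integrable nu (%x. exp (g x))"
proof -
 have K: "exp (g x) <= exp K" "exp (- K) <= exp (g x)" if "x : Rd d" for x
  using CB_bound[OF g that] by (auto simp: abs_le_iff)
 show i: "integrable nu (%x. exp (g x))"
  by (rule integrable_bounded[where K="exp K"]) (use K CB_cont[OF g] in \<open>auto intro!: continuous_intros\<close>)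
 have "(LINT x|nu. exp (- K)) <= (LINT x|nu. exp (g x))"
  using K i by (intro integral_mono) auto
 moreover have "(LINT x|nu. exp (- K)) = exp (- K)" using prob_space by simp
 ultimately show "0 < (LINT x|nu. exp (g x))" using exp_gt_zero[of "- K"] by linarith
qed

text \<open>With \<open>N q\<close> the exponential moment, \<open>lsi_exp\<close> for
  \<open>q * g\<close> says precisely that \<open>ln (N q) / q - q / (4 * rho)\<close> has a
  nonpositive derivative in \<open>q\<close>; its limit at 0 is the mean of
  \<open>g\<close>.\<close>

lemma herbst_pos:
 assumes g: "CB d (Suc k) K g" and grad: "!!x. x : Rd d ==> norm_Rd d (grad d g x) <= 1" and theta: "0 < theta"
 shows "(LINT x|nu. exp (theta * g x)) <= exp (theta * (LINT x|nu. g x) + theta^2 / (4 * rho))"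
proof -
 define N where "N q = (LINT x|nu. exp (q * g x))" for q
 define N' where "N' q = (LINT x|nu. g x * exp (q * g x))" for q
 have DN: "(N has_real_derivative N' q) (at q)" for q
  unfolding N_def[abs_def] N'_def by (rule exp_moment_deriv[OF CB_cont[OF g] CB_bound[OF g]])
 have qg: "CB d (Suc k) (abs q * K) (%x. q * g x)" for q by (rule CB_cmult[OF g])
 have Npos: "0 < N q" for q unfolding N_def by (rule exp_moment_pos(1)[OF qg])
 have key: "q * N' q - N q * ln (N q) <= q^2 / (4 * rho) * N q" for q
 proof -
  have "pd i (%x. q * g x) x = q * pd i g x" if "i < d" "x : Rd d" for i x
   by (rule has_pd_imp_pd[OF has_pd_cmult[OF CB_pd(1)[OF g that(1)]] that(2)])
  hence "(norm_Rd d (grad d (%x. q * g x) x))^2 = q^2 * (norm_Rd d (grad d g x))^2" if "x : Rd d" for x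
   using that by (simp add: norm_Rd_grad_power2 power_mult_distrib sum_distrib_left)
  moreover have "(norm_Rd d (grad d g x))^2 <= 1" if "x : Rd d" for x
   using grad[OF that] by (simp add: power_le_one)
  ultimately have le: "exp (q * g x) * (norm_Rd d (grad d (%x. q * g x) x))^2 <= q^2 * exp (q * g x)" if "x : Rd d" for x
   using that by (simp add: mult_left_le mult.commute[of "exp _"] mult.assoc mult_left_mono)
  have "(LINT x|nu. exp (q * g x) * (norm_Rd d (grad d (%x. q * g x) x))^2) <= (LINT x|nu. q^2 * exp (q * g x))"
  proof (rule integral_mono')
   show "integrable nu (%x. q^2 * exp (q * g x))"
    by (intro integrable_mult_right exp_moment_pos(2)[OF qg])
  qed (use le in auto)
  also have "... = q^2 * N q" by (simp add: N_def)
  finally have "rho * (q * N' q - N q * ln (N q)) <= q^2 * N q / 4"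
   using lsi_exp[OF qg, of q] by (simp add: N_def N'_def mult.assoc)
  thus ?thesis using rho by (simp add: field_simps)
 qed
 define phi where "phi q = ln (N q) / q - q / (4 * rho)" for q
 have mono: "phi theta <= phi eps" if eps: "0 < eps" "eps <= theta" for eps
 proof (rule DERIV_nonpos_imp_nonincreasing[OF eps(2)])
  fix q assume "eps <= q" "q <= theta"
  hence q: "0 < q" using eps by simp
  let ?D = "((N' q / N q) * q - ln (N q)) / (q * q) - 1 / (4 * rho)"
  have "(phi has_real_derivative ?D) (at q)"
   unfolding phi_def[abs_def]
   by (rule derivative_eq_intros DN refl | use q Npos[of q] rho in \<open>simp; fail\<close>)+
  moreover have "?D <= 0"
  proof -
   have "q * N' q - N q * ln (N q) = N q * ((N' q / N q) * q - ln (N q))"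
    using Npos[of q] by (simp add: field_simps)
   hence "(N' q / N q) * q - ln (N q) <= q^2 / (4 * rho)"
    using key[of q] Npos[of q] mult_le_cancel_left_pos[of "N q"]
    by (simp only: mult.commute[of "q^2 / (4 * rho)"])
   hence "((N' q / N q) * q - ln (N q)) / (q * q) <= q^2 / (4 * rho) / (q * q)"
    using q by (intro divide_right_mono) auto
   thus ?thesis using q by (simp add: power2_eq_square)
  qed
  ultimately show "EX y. (phi has_real_derivative y) (at q) & y <= 0" by blast
 qed
 have N0: "N 0 = 1" using prob_space by (simp add: N_def)
 have "((%q. ln (N q)) has_real_derivative N' 0 / N 0) (at 0)"
  using DERIV_chain2[OF DERIV_ln_divide[OF Npos] DN, of 0] by simp
 hence "((%q. ln (N q) / q) \<longlongrightarrow> N' 0) (at 0)" by (simp add: DERIV_def N0)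
 hence "((%q. ln (N q) / q) \<longlongrightarrow> N' 0) (at_right 0)" by (rule filterlim_mono) (simp_all add: at_le)
 hence "(phi \<longlongrightarrow> N' 0 - 0 / (4 * rho)) (at_right 0)"
  unfolding phi_def[abs_def] by (intro tendsto_intros) (use rho in auto)
 hence lim: "(phi \<longlongrightarrow> (LINT x|nu. g x)) (at_right 0)" by (simp add: N'_def)
 have "\<forall>\<^sub>F eps in at_right 0. phi theta <= phi eps"
  using mono theta by (auto simp: eventually_at_right_field intro!: exI[of _ theta])
 hence "phi theta <= (LINT x|nu. g x)" by (intro tendsto_lowerbound[OF lim]) auto
 hence "ln (N theta) <= theta * (LINT x|nu. g x) + theta^2 / (4 * rho)"
  using theta by (simp add: phi_def field_simps power2_eq_square)
 hence "N theta <= exp (theta * (LINT x|nu. g x) + theta^2 / (4 * rho))"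
  using Npos[of theta] by (metis exp_le_cancel_iff exp_ln)
 thus ?thesis by (simp add: N_def)
qed

lemma herbst_CB:
 assumes g: "CB d (Suc k) K g" and grad: "!!x. x : Rd d ==> norm_Rd d (grad d g x) <= 1"
 shows "(LINT x|nu. exp (theta * g x)) <= exp (theta * (LINT x|nu. g x) + theta^2 / (4 * rho))"
proof (cases theta "0 :: real" rule: linorder_cases)
 case greater
 show ?thesis by (rule herbst_pos[OF g grad greater])
next
 case equal
 thus ?thesis using prob_space by simp
next
 case less
 have m: "CB d (Suc k) K (%x. (-1) * g x)" using CB_cmult[OF g, of "-1"] by simp
 have "norm_Rd d (grad d (%x. (-1) * g x) x) <= 1" if "x : Rd d" for x
 proof -
  have "pd i (%x. (-1) * g x) x = (-1) * pd i g x" if "i < d" for i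
   by (rule has_pd_imp_pd[OF has_pd_cmult[OF CB_pd(1)[OF g that]] \<open>x : Rd d\<close>])
  hence "norm_Rd d (grad d (%x. (-1) * g x) x) = norm_Rd d (grad d g x)"
   by (intro norm_Rd_cong) (simp add: grad_def)
  thus ?thesis using grad[OF that] by simp
 qed
 from herbst_pos[OF m this, of "- theta"] less show ?thesis by simp
qed

end

section \<open>Mollification\<close>

lemma power_div_fact_le_exp: "0 <= x ==> x ^ n / fact n <= exp (x :: real)"
proof -
 assume x: "0 <= x"
 have "(\<Sum>i\<in>{n}. x ^ i /\<^sub>R fact i) <= (\<Sum>i. x ^ i /\<^sub>R fact i)"
  by (rule sum_le_suminf[OF sums_summable[OF exp_converges]]) (use x in auto)
 also have "... = exp x" using exp_converges sums_unique by metis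
 finally show ?thesis by (simp add: divide_inverse mult.commute)
qed

text \<open>\<open>flat 0\<close> is the standard smooth function that vanishes to infinite order at
  0. The extra powers of \<open>1 / x\<close> make the family closed under differentiation up to
  linear combinations, see \<open>DERIV_flat\<close>.\<close>

definition flat :: "nat => real => real" where
 "flat n x = (if 0 < x then (1 / x) ^ n * exp (- (1 / x)) else 0)"

text \<open>A quadratic bound makes the difference quotients at 0 vanish. It comes from the single
  term of degree \<open>n + 2\<close> in the exponential series of \<open>1 / x\<close>.\<close>

lemma flat_bound: "0 <= flat n x & flat n x <= fact (n + 2) * x^2"
proof (cases "0 < x")
 case True
 let ?t = "1 / x"
 have t: "0 < ?t" using True by simp
 have "?t ^ (n + 2) <= fact (n + 2) * exp ?t"
  using power_div_fact_le_exp[of ?t "n + 2"] t by (simp only: divide_le_eq) (simp add: mult.commute)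
 hence "?t ^ (n + 2) * exp (- ?t) <= fact (n + 2) * exp ?t * exp (- ?t)"
  by (rule mult_right_mono) simp
 also have "... = fact (n + 2)" by (simp add: exp_minus)
 finally have "(?t ^ n * exp (- ?t)) * ?t^2 <= fact (n + 2)"
  by (simp only: power_add mult_ac)
 hence "(?t ^ n * exp (- ?t)) * ?t^2 * x^2 <= fact (n + 2) * x^2" by (rule mult_right_mono) simp
 moreover have "?t^2 * x^2 = 1" using True by (simp add: power_mult_distrib[symmetric])
 ultimately have "?t ^ n * exp (- ?t) <= fact (n + 2) * x^2" by (simp only: mult.assoc mult_1_right)
 thus ?thesis using True by (simp add: flat_def)
qed (simp add: flat_def)

lemma DERIV_flat: "(flat n has_real_derivative flat (n + 2) x - n * flat (n + 1) x) (at x)"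
proof (cases x "0 :: real" rule: linorder_cases)
 case less
 have "((%_. 0) has_real_derivative 0) (at x)" by simp
 hence "(flat n has_real_derivative 0) (at x)"
  by (rule has_field_derivative_transform_within_open[of _ _ _ "{..<0}"]) (use less in \<open>auto simp: flat_def\<close>)
 thus ?thesis using less by (simp add: flat_def)
next
 case equal
 have "((%h. (flat n (0 + h) - flat n 0) / h) \<longlongrightarrow> 0) (at 0)"
 proof (rule Lim_null_comparison[where g="%h. fact (n + 2) * abs h"])
  show "\<forall>\<^sub>F h in at 0. norm ((flat n (0 + h) - flat n 0) / h) <= fact (n + 2) * abs h"
  proof (rule always_eventually, rule allI)
   fix h :: real
   show "norm ((flat n (0 + h) - flat n 0) / h) <= fact (n + 2) * abs h"
   proof (cases "h = 0")
    case False
    have "abs (flat n h) <= fact (n + 2) * abs h * abs h"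
     using flat_bound[of n h] by (simp add: power2_eq_square mult.assoc)
    hence "abs (flat n h) / abs h <= fact (n + 2) * abs h" using False by (subst divide_le_eq) simp
    thus ?thesis by (simp add: flat_def[of n 0] abs_divide del: fact_Suc)
   qed simp
  qed
  have "((%h :: real. fact (n + 2) * abs h) \<longlongrightarrow> fact (n + 2) * abs 0) (at 0)" by (intro tendsto_intros)
  thus "((%h :: real. fact (n + 2) * abs h) \<longlongrightarrow> 0) (at 0)" by simp
 qed
 hence "(flat n has_real_derivative 0) (at 0)" by (simp add: DERIV_def)
 thus ?thesis using equal by (simp add: flat_def)
next
 case greater
 have "((%x. (1 / x) ^ n * exp (- (1 / x))) has_real_derivative
   (1 / x) ^ (n + 2) * exp (- (1 / x)) - n * ((1 / x) ^ (n + 1) * exp (- (1 / x)))) (at x)"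
 proof (cases n)
  case 0
  thus ?thesis using greater by (auto intro!: derivative_eq_intros simp: power2_eq_square field_simps)
 next
  case (Suc m)
  have "((%x. (1 / x) ^ Suc m) has_real_derivative (Suc m * (1 / x) ^ m * (- (1 / x^2)))) (at x)"
  proof -
   have "((%x. 1 / x) has_real_derivative - (1 / x^2)) (at x)"
    using greater by (auto intro!: derivative_eq_intros simp: power2_eq_square)
   from DERIV_power[OF this, of "Suc m"] show ?thesis by (simp add: mult_ac)
  qed
  moreover have "((%x. exp (- (1 / x))) has_real_derivative (exp (- (1 / x)) * (1 / x^2))) (at x)"
   using greater by (auto intro!: derivative_eq_intros simp: power2_eq_square field_simps)
  ultimately have "((%x. (1 / x) ^ Suc m * exp (- (1 / x))) has_real_derivative
   (Suc m * (1 / x) ^ m * (- (1 / x^2))) * exp (- (1 / x)) + (exp (- (1 / x)) * (1 / x^2)) * (1 / x) ^ Suc m) (at x)"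
   by (rule DERIV_mult)
  moreover have "(Suc m * (1 / x) ^ m * (- (1 / x^2))) * exp (- (1 / x)) + (exp (- (1 / x)) * (1 / x^2)) * (1 / x) ^ Suc m
   = (1 / x) ^ (n + 2) * exp (- (1 / x)) - n * ((1 / x) ^ (n + 1) * exp (- (1 / x)))"
  proof -
   have eq: "1 / x^2 = (1 / x)^2" by (simp add: power_divide)
   show ?thesis unfolding Suc eq by (simp add: algebra_simps power2_eq_square add_divide_distrib del: power_one_over)
  qed
  ultimately show ?thesis by (simp add: Suc)
 qed
 hence "(flat n has_real_derivative
   (1 / x) ^ (n + 2) * exp (- (1 / x)) - n * ((1 / x) ^ (n + 1) * exp (- (1 / x)))) (at x)"
  by (rule has_field_derivative_transform_within_open[of _ _ _ "{0<..}"]) (use greater in \<open>auto simp: flat_def\<close>)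
 thus ?thesis using greater by (simp add: flat_def)
qed

text \<open>A linear space of functions supported in \<open>[-1, 1]\<close> that contains the
  derivatives of its members, so smoothness of every order follows from the single rule
  \<open>bump_kernels_DERIV\<close>.\<close>

inductive_set bump_kernels :: "(real => real) set" where
 base: "(%x. flat m (1 + x) * flat n (1 - x)) : bump_kernels"
| add: "f : bump_kernels ==> g : bump_kernels ==> (%x. f x + g x) : bump_kernels"
| scale: "f : bump_kernels ==> (%x. c * f x) : bump_kernels"

lemma bump_kernels_support: "f : bump_kernels ==> 1 <= abs x ==> f x = 0"
 by (induction rule: bump_kernels.induct) (auto simp: flat_def)

lemma bump_kernels_DERIV:
 assumes "f : bump_kernels"
 obtains f' where "f' : bump_kernels" "!!x. (f has_real_derivative f' x) (at x)"
 using assms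
proof (induction arbitrary: thesis rule: bump_kernels.induct)
 case (base m n)
 let ?f = "%m n x. flat m (1 + x) * flat n (1 - x)"
 let ?f' = "%x. (?f (m + 2) n x + (- real m) * ?f (m + 1) n x) + (-1) * (?f m (n + 2) x + (- real n) * ?f m (n + 1) x)"
 have "?f' : bump_kernels" by (intro bump_kernels.intros)
 moreover have "(?f m n has_real_derivative ?f' x) (at x)" for x
 proof -
  have "((%x. flat m (1 + x)) has_real_derivative (flat (m + 2) (1 + x) - m * flat (m + 1) (1 + x)) * 1) (at x)"
   by (rule DERIV_chain2[OF DERIV_flat]) (auto intro!: derivative_eq_intros)
  moreover have "((%x. flat n (1 - x)) has_real_derivative (flat (n + 2) (1 - x) - n * flat (n + 1) (1 - x)) * (-1)) (at x)"
   by (rule DERIV_chain2[OF DERIV_flat]) (auto intro!: derivative_eq_intros)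
  ultimately have "(?f m n has_real_derivative
    (flat (m + 2) (1 + x) - m * flat (m + 1) (1 + x)) * 1 * flat n (1 - x) +
    (flat (n + 2) (1 - x) - n * flat (n + 1) (1 - x)) * (-1) * flat m (1 + x)) (at x)"
   by (rule DERIV_mult)
  thus ?thesis by (simp add: algebra_simps)
 qed
 ultimately show ?case by (rule base)
next
 case (add f g)
 obtain f' where f': "f' : bump_kernels" "!!x. (f has_real_derivative f' x) (at x)" using add.IH(1) by blast
 obtain g' where g': "g' : bump_kernels" "!!x. (g has_real_derivative g' x) (at x)" using add.IH(2) by blast
 show ?case by (rule add.prems[OF bump_kernels.add[OF f'(1) g'(1)] DERIV_add[OF f'(2) g'(2)]])
next
 case (scale f c)
 obtain f' where f': "f' : bump_kernels" "!!x. (f has_real_derivative f' x) (at x)" using scale.IH by blast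
 show ?case by (rule scale.prems[OF bump_kernels.scale[OF f'(1)] DERIV_cmult[OF f'(2)]])
qed

definition scaled_kernels :: "nat => (real => real) set" where
 "scaled_kernels n = {%x. f (real (Suc n) * x) |f. f : bump_kernels}"

lemma scaled_kernels_support: "f : scaled_kernels n ==> 1 / Suc n <= abs x ==> f x = 0"
proof -
 assume "f : scaled_kernels n" and x: "1 / Suc n <= abs x"
 then obtain g where g: "g : bump_kernels" "f = (%x. g (real (Suc n) * x))" by (auto simp: scaled_kernels_def)
 have "1 <= abs (real (Suc n) * x)" using x by (simp add: divide_le_eq abs_mult mult.commute)
 thus ?thesis using bump_kernels_support[OF g(1)] g(2) by simp
qed

lemma scaled_kernels_DERIV:
 assumes "f : scaled_kernels n"
 obtains f' where "f' : scaled_kernels n" "!!x. (f has_real_derivative f' x) (at x)"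
proof -
 obtain g where g: "g : bump_kernels" "f = (%x. g (real (Suc n) * x))"
  using assms by (auto simp: scaled_kernels_def)
 obtain g' where g': "g' : bump_kernels" "!!x. (g has_real_derivative g' x) (at x)"
  using bump_kernels_DERIV[OF g(1)] by blast
 have "(f has_real_derivative g' (real (Suc n) * x) * real (Suc n)) (at x)" for x
  unfolding g(2) by (rule DERIV_chain2[OF g'(2)]) (auto intro!: derivative_eq_intros)
 moreover have "(%x. g' (real (Suc n) * x) * real (Suc n)) : scaled_kernels n"
  unfolding scaled_kernels_def
  using bump_kernels.scale[OF g'(1), of "real (Suc n)"] by (auto simp: mult.commute intro!: exI[of _ "%x. real (Suc n) * g' x"])
 ultimately show thesis by (intro that)
qed

lemma scaled_kernels_cont: "f : scaled_kernels n ==> continuous_on A f"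
 using scaled_kernels_DERIV by (metis DERIV_isCont continuous_at_imp_continuous_on)

lemma scaled_kernels_bounded:
 assumes "f : scaled_kernels n" obtains M where "0 <= M" "!!x. abs (f x) <= M"
proof -
 have "bounded (f ` {-1..1})"
  using scaled_kernels_cont[OF assms] by (intro compact_imp_bounded compact_continuous_image) auto
 then obtain M where "ALL y:f ` {-1..1}. norm y <= M" unfolding bounded_iff by blast
 hence M: "!!x. x : {-1..1} ==> abs (f x) <= M" by simp
 have "abs (f x) <= abs M" for x
 proof (cases "abs x <= 1")
  case False
  have "1 / real (Suc n) <= 1" by simp
  hence "f x = 0" using False by (intro scaled_kernels_support[OF assms]) linarith
  thus ?thesis by simp
 qed (use M[of x] in \<open>auto simp: abs_le_iff\<close>)
 thus thesis by (intro that[of "abs M"]) auto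
qed

section \<open>Convolution of Lipschitz functions with product kernels\<close>

definition tensor :: "nat => (nat => real => real) => vec => real" where
 "tensor d k z = (\<Prod>i<d. k i (z i))"

definition conv :: "nat => (nat => real => real) => (vec => real) => vec => real" where
 "conv d k f x = (LINT z|lborel_Rd d. f (\<lambda>i\<in>{..<d}. x i - z i) * tensor d k z)"

definition box_Rd :: "nat => real => vec set" where
 "box_Rd d r = Pi\<^sub>E {..<d} (%_. {-r..r})"

definition lip :: "nat => real => (vec => real) => bool" where
 "lip d L f \<longleftrightarrow> 0 <= L & (ALL x:Rd d. ALL y:Rd d. abs (f x - f y) <= L * dist_Rd d x y)"

lemma lip_cont: "lip d L f ==> continuous_on (Rd d) f"
 by (rule continuous_on_Rd_dist[of d f L]) (auto simp: lip_def)

lemma LB_imp_lip: 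
 assumes "LB d k K f" "0 <= K" shows "lip d (K * d) f"
proof -
 have "abs (f x - f y) <= K * d * dist_Rd d x y" if "x : Rd d" "y : Rd d" for x y
 proof -
  have "abs (f x - f y) <= K * (\<Sum>i<d. abs (x i - y i))" by (rule LB_lipschitz_sum[OF assms(1) that(2,1)])
  also have "... <= K * (d * dist_Rd d x y)"
   unfolding dist_Rd_def using assms(2) by (intro mult_left_mono sum_le_norm_Rd)
  finally show ?thesis by simp
 qed
 thus ?thesis using assms(2) by (simp add: lip_def)
qed

lemma box_Rd_sets [measurable]: "box_Rd d r : sets (lborel_Rd d)"
 unfolding box_Rd_def lborel_Rd_def by (intro sets_PiM_I_finite) auto

lemma integrable_box_Rd: "integrable (lborel_Rd d) (%z. c * indicator (box_Rd d r) z :: real)"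
proof (cases "c = 0")
 case False
 have "emeasure (lborel_Rd d) (box_Rd d r) = (\<Prod>i<d. emeasure lborel {-r..r})"
  unfolding box_Rd_def lborel_Rd_def by (rule lborel_product.emeasure_PiM) auto
 also have "... < \<infinity>" by (simp add: emeasure_lborel_Icc_eq ennreal_power power_less_top_ennreal)
 finally show ?thesis by (intro integrable_mult_right) simp
qed simp

lemma norm_le_box: "z : box_Rd d r ==> norm_Rd d z <= d * r"
proof -
 assume "z : box_Rd d r"
 hence "(\<Sum>i<d. abs (z i)) <= (\<Sum>i<d. r)" by (intro sum_mono) (force simp: box_Rd_def PiE_iff abs_le_iff)
 thus ?thesis using norm_Rd_le_sum[of d z] by simp
qed

context
 fixes n :: nat
begin

definition kernels :: "(nat => real => real) set" where
 "kernels = {k. ALL i. k i : scaled_kernels n}"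

lemma tensor_support:
 assumes "k : kernels" "z : Rd d" "z \<notin> box_Rd d (1 / Suc n)" shows "tensor d k z = 0"
proof -
 obtain i where "i < d" "z i \<notin> {- (1 / Suc n)..1 / Suc n}"
  using assms(2,3) by (auto simp: box_Rd_def Rd_def PiE_iff)
 hence "k i (z i) = 0"
  using assms(1) by (intro scaled_kernels_support[of _ n]) (auto simp: kernels_def)
 with \<open>i < d\<close> show ?thesis by (auto simp: tensor_def intro!: prod_zero)
qed

lemma tensor_cont: "k : kernels ==> continuous_on (Rd d) (tensor d k)"
 unfolding tensor_def
proof (rule continuous_on_prod)
 fix i assume k: "k : kernels" and i: "i : {..<d}"
 hence "k i : scaled_kernels n" by (simp add: kernels_def)
 thus "continuous_on (Rd d) (%z. k i (z i))"
  using i by (intro continuous_on_compose2[OF scaled_kernels_cont continuous_on_Rd_coord]) auto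
qed

lemma tensor_bounded:
 assumes "k : kernels" obtains M where "0 <= M" "!!z. abs (tensor d k z) <= M"
proof -
 have "ALL i. EX M. ALL x. abs (k i x) <= M"
  using assms scaled_kernels_bounded unfolding kernels_def by blast
 from choice[OF this] obtain M where M: "!!i x. abs (k i x) <= M i" by blast
 have "abs (tensor d k z) <= (\<Prod>i<d. M i)" for z
  unfolding tensor_def abs_prod by (rule prod_mono) (use M in auto)
 moreover have "0 <= (\<Prod>i<d. M i)" using M by (intro prod_nonneg) (meson abs_ge_zero order_trans)
 ultimately show thesis by (intro that)
qed

lemma tensor_le_box:
 assumes "k : kernels"
 obtains M where "0 <= M" "!!z. z : Rd d ==> abs (tensor d k z) <= M * indicator (box_Rd d (1 / Suc n)) z"
proof -
 obtain M where M: "0 <= M" "!!z. abs (tensor d k z) <= M" using tensor_bounded[OF assms] by blast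
 show thesis
 proof (rule that[OF M(1)])
  show "abs (tensor d k z) <= M * indicator (box_Rd d (1 / Suc n)) z" if "z : Rd d" for z
   using M(2)[of z] tensor_support[OF assms that] by (cases "z : box_Rd d (1 / Suc n)") auto
 qed
qed

lemma integrable_tensor: "k : kernels ==> integrable (lborel_Rd d) (tensor d k)"
proof -
 assume k: "k : kernels"
 obtain M where "0 <= M" "!!z. z : Rd d ==> abs (tensor d k z) <= M * indicator (box_Rd d (1 / Suc n)) z"
  using tensor_le_box[OF k] by blast
 thus ?thesis
  using measurable_lborel_Rd[OF measurable_Rd[OF tensor_cont[OF k]]]
  by (intro Bochner_Integration.integrable_bound[OF integrable_box_Rd[of d M "1 / Suc n"]]) (auto intro!: AE_I2)
qed

lemma lip_shift:
 assumes "lip d L f" "x : Rd d" "y : Rd d"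
 shows "abs (f (\<lambda>i\<in>{..<d}. x i - z i) - f (\<lambda>i\<in>{..<d}. y i - z i)) <= L * dist_Rd d x y"
proof -
 have "dist_Rd d (\<lambda>i\<in>{..<d}. x i - z i) (\<lambda>i\<in>{..<d}. y i - z i) = dist_Rd d x y"
  unfolding dist_Rd_def by (rule norm_Rd_cong) simp
 thus ?thesis using assms(1)[unfolded lip_def] Rd_restrict by metis
qed

lemma lip_shift0:
 assumes "lip d L f" "x : Rd d"
 shows "abs (f (\<lambda>i\<in>{..<d}. x i - z i) - f x) <= L * norm_Rd d z"
proof -
 have "dist_Rd d (\<lambda>i\<in>{..<d}. x i - z i) x = norm_Rd d z"
  unfolding dist_Rd_def by (rule norm_Rd_cong) simp
 thus ?thesis using assms(1)[unfolded lip_def] Rd_restrict assms(2) by metis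
qed

lemma shift_measurable:
 assumes "continuous_on (Rd d) f"
 shows "(%z. f (\<lambda>i\<in>{..<d}. x i - z i)) : borel_measurable (lborel_Rd d)"
proof -
 have "(%z. f (\<lambda>i\<in>{..<d}. x i + (-1) * z i)) : borel_measurable (borel_Rd d)"
  by (rule measurable_compose[OF measurable_affine_Rd measurable_Rd[OF assms]])
 thus ?thesis using measurable_lborel_Rd by simp
qed

lemma conv_integrand:
 assumes k: "k : kernels" and f: "lip d L f" and x: "x : Rd d"
 shows "integrable (lborel_Rd d) (%z. f (\<lambda>i\<in>{..<d}. x i - z i) * tensor d k z)"
proof -
 obtain M where M: "0 <= M" "!!z. z : Rd d ==> abs (tensor d k z) <= M * indicator (box_Rd d (1 / Suc n)) z"
  using tensor_le_box[OF k] by blast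
 let ?C = "abs (f x) + L * (d * (1 / Suc n))"
 have L: "0 <= L" using f by (simp add: lip_def)
 show ?thesis
 proof (rule Bochner_Integration.integrable_bound[OF integrable_box_Rd[of d "?C * M" "1 / Suc n"]])
  show "(%z. f (\<lambda>i\<in>{..<d}. x i - z i) * tensor d k z) : borel_measurable (lborel_Rd d)"
   using shift_measurable[OF lip_cont[OF f]] measurable_lborel_Rd[OF measurable_Rd[OF tensor_cont[OF k]]] by simp
  show "AE z in lborel_Rd d. norm (f (\<lambda>i\<in>{..<d}. x i - z i) * tensor d k z)
    <= norm (?C * M * indicator (box_Rd d (1 / Suc n)) z :: real)"
  proof (rule AE_I2)
   fix z assume "z : space (lborel_Rd d)"
   hence z: "z : Rd d" by simp
   show "norm (f (\<lambda>i\<in>{..<d}. x i - z i) * tensor d k z) <= norm (?C * M * indicator (box_Rd d (1 / Suc n)) z :: real)"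
   proof (cases "z : box_Rd d (1 / Suc n)")
    case True
    have "L * norm_Rd d z <= L * (d * (1 / Suc n))" using norm_le_box[OF True] L by (rule mult_left_mono)
    hence "abs (f (\<lambda>i\<in>{..<d}. x i - z i)) <= ?C" using lip_shift0[OF f x, of z] by linarith
    moreover have "abs (tensor d k z) <= M" using M(2)[OF z] True by simp
    ultimately have "abs (f (\<lambda>i\<in>{..<d}. x i - z i) * tensor d k z) <= ?C * M"
     unfolding abs_mult by (rule mult_mono) (use L in auto)
    thus ?thesis using True by simp
   next
    case False
    thus ?thesis using tensor_support[OF k z] by simp
   qed
  qed
 qed
qed

lemma conv_lip:
 assumes k: "k : kernels" and f: "lip d L f"
 shows "lip d (L * (LINT z|lborel_Rd d. abs (tensor d k z))) (conv d k f)"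
 unfolding lip_def
proof (intro conjI ballI)
 have L: "0 <= L" using f by (simp add: lip_def)
 thus "0 <= L * (LINT z|lborel_Rd d. abs (tensor d k z))" by simp
 fix x y assume x: "x : Rd d" and y: "y : Rd d"
 have "abs (conv d k f x - conv d k f y) =
  abs (\<integral>z. (f (\<lambda>i\<in>{..<d}. x i - z i) - f (\<lambda>i\<in>{..<d}. y i - z i)) * tensor d k z \<partial>lborel_Rd d)"
  unfolding conv_def left_diff_distrib
  using conv_integrand[OF k f x] conv_integrand[OF k f y] by simp
 also have "... <= (LINT z|lborel_Rd d. (L * dist_Rd d x y) * abs (tensor d k z))"
 proof (rule integral_abs_bound[THEN order_trans], rule integral_mono')
  show "integrable (lborel_Rd d) (%z. (L * dist_Rd d x y) * abs (tensor d k z))"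
   using integrable_tensor[OF k] by simp
 qed (use lip_shift[OF f x y] L in \<open>auto simp: abs_mult intro!: mult_right_mono\<close>)
 also have "... = L * (LINT z|lborel_Rd d. abs (tensor d k z)) * dist_Rd d x y" by simp
 finally show "abs (conv d k f x - conv d k f y) <= L * (LINT z|lborel_Rd d. abs (tensor d k z)) * dist_Rd d x y" .
qed

lemma conv_alt:
 assumes k: "k : kernels" and f: "continuous_on (Rd d) f" and x: "x : Rd d"
 shows "conv d k f x = (LINT z|lborel_Rd d. f z * tensor d k (%i. x i - z i))"
proof -
 let ?F = "%z. f (\<lambda>i\<in>{..<d}. x i - z i) * tensor d k z"
 have m: "?F : borel_measurable (borel_Rd d)"
  using shift_measurable[OF f] measurable_Rd[OF tensor_cont[OF k]]
  by (intro borel_measurable_times) (simp_all add: measurable_cong_sets[OF sets_lborel_Rd refl])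
 have "conv d k f x = (LINT z|lborel_Rd d. ?F (\<lambda>i\<in>{..<d}. x i + (-1) * z i))"
  unfolding conv_def by (rule integral_lborel_Rd_affine(1)[OF _ m, symmetric]) simp
 also have "... = (LINT z|lborel_Rd d. f z * tensor d k (%i. x i - z i))"
 proof (rule Bochner_Integration.integral_cong[OF refl])
  fix z assume "z : space (lborel_Rd d)"
  hence "(\<lambda>i\<in>{..<d}. x i - (\<lambda>i\<in>{..<d}. x i + (-1) * z i) i) = z" by (intro Rd_eqI[of _ d]) auto
  moreover have "tensor d k (\<lambda>i\<in>{..<d}. x i + (-1) * z i) = tensor d k (%i. x i - z i)"
   unfolding tensor_def by (rule prod.cong) auto
  ultimately show "?F (\<lambda>i\<in>{..<d}. x i + (-1) * z i) = f z * tensor d k (%i. x i - z i)" by simp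
 qed
 finally show ?thesis .
qed

lemma tensor_upd:
 "j < d ==> tensor d k z = k j (z j) * (\<Prod>i\<in>{..<d} - {j}. k i (z i))"
 by (simp add: tensor_def prod.remove)

text \<open>In the form \<open>conv_alt\<close> the variable \<open>x\<close> sits only in the
  kernel, so the derivative falls on one factor of the kernel and a Lipschitz \<open>f\<close> is
  good enough.\<close>

lemma conv_has_pd:
 assumes k: "k : kernels" and f: "lip d L f" and j: "j < d"
  and kj': "kj' : scaled_kernels n" "!!x. (k j has_real_derivative kj' x) (at x)"
 shows "has_pd d j (conv d k f) (conv d (k(j := kj')) f)"
 unfolding has_pd_def
proof
 fix x assume x: "x : Rd d"
 have k': "k(j := kj') : kernels" using k kj'(1) by (auto simp: kernels_def)
 note cf = lip_cont[OF f]
 obtain M where M: "0 <= M" "!!z. abs (tensor d (k(j := kj')) z) <= M" using tensor_bounded[OF k'] by blast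
 have L: "0 <= L" using f by (simp add: lip_def)
 let ?G = "%s z. f z * tensor d k (%i. (x(j := s)) i - z i)"
 let ?G' = "%s z. f z * tensor d (k(j := kj')) (%i. (x(j := s)) i - z i)"
 \<comment> \<open>The half-width 2 is the kernel radius, at most 1, plus the range, below 1, in
   which \<open>s\<close> moves around \<open>x j\<close>; off this cube the integrand
   vanishes.\<close>
 let ?B = "{z\<in>Rd d. ALL i<d. abs (z i - x i) <= 2}"
 let ?b = "%z. (abs (f x) + L * (2 * d)) * M * indicator ?B z"
 have m_shift: "(%z. f z * tensor d k' (%i. (x(j := s)) i - z i)) : borel_measurable (lborel_Rd d)"
  if "k' : kernels" for k' s
 proof -
  have "(%z. tensor d k' (%i. (x(j := s)) i - z i)) = (%z. tensor d k' (\<lambda>i\<in>{..<d}. (x(j := s)) i - z i))"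
   by (simp add: tensor_def)
  thus ?thesis
   using shift_measurable[OF tensor_cont[OF that], of d "x(j := s)"] measurable_lborel_Rd[OF measurable_Rd[OF cf]]
   by (simp only: borel_measurable_times)
 qed
 have "((%s. \<integral>z. ?G s z \<partial>lborel_Rd d) has_real_derivative (LINT z|lborel_Rd d. ?G' (x j) z)) (at (x j))"
 proof (rule DERIV_integral[where b="?b"])
  fix z s
  have rest: "(\<Prod>i\<in>{..<d} - {j}. (k(j := kj')) i ((x(j := s)) i - z i)) = (\<Prod>i\<in>{..<d} - {j}. k i (x i - z i))"
   "(\<Prod>i\<in>{..<d} - {j}. k i ((x(j := s)) i - z i)) = (\<Prod>i\<in>{..<d} - {j}. k i (x i - z i))" for s
   by (intro prod.cong; simp)+
  have "((%s. k j (s - z j)) has_real_derivative kj' (s - z j) * 1) (at s)"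
   by (rule DERIV_chain2[OF kj'(2)]) (auto intro!: derivative_eq_intros)
  hence "((%s. f z * (k j (s - z j) * (\<Prod>i\<in>{..<d} - {j}. k i (x i - z i)))) has_real_derivative
    f z * (kj' (s - z j) * (\<Prod>i\<in>{..<d} - {j}. k i (x i - z i)))) (at s)"
   by (auto intro!: derivative_eq_intros)
  thus "((%s. ?G s z) has_real_derivative ?G' s z) (at s)"
   unfolding tensor_upd[OF j] rest by simp
 next
  fix s
  have "integrable (lborel_Rd d) (%z. f (\<lambda>i\<in>{..<d}. (x(j := s)) i - z i) * tensor d k z)"
   by (rule conv_integrand[OF k f Rd_upd[OF x j]])
  hence "integrable (lborel_Rd d) (%z. f (\<lambda>i\<in>{..<d}. (x(j := s)) i - (\<lambda>i\<in>{..<d}. (x(j := s)) i + (-1) * z i) i) *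
    tensor d k (\<lambda>i\<in>{..<d}. (x(j := s)) i + (-1) * z i))"
   using shift_measurable[OF cf] measurable_Rd[OF tensor_cont[OF k]]
   by (subst integral_lborel_Rd_affine(2)[of "-1" "%z. f (\<lambda>i\<in>{..<d}. (x(j := s)) i - z i) * tensor d k z"])
    (auto intro!: borel_measurable_times simp: measurable_cong_sets[OF sets_lborel_Rd refl])
  moreover have "f (\<lambda>i\<in>{..<d}. (x(j := s)) i - (\<lambda>i\<in>{..<d}. (x(j := s)) i + (-1) * z i) i) *
    tensor d k (\<lambda>i\<in>{..<d}. (x(j := s)) i + (-1) * z i) = ?G s z" if "z : Rd d" for z
  proof -
   have "(\<lambda>i\<in>{..<d}. (x(j := s)) i - (\<lambda>i\<in>{..<d}. (x(j := s)) i + (-1) * z i) i) = z"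
    using that by (intro Rd_eqI[of _ d]) auto
   moreover have "tensor d k (\<lambda>i\<in>{..<d}. (x(j := s)) i + (-1) * z i) = tensor d k (%i. (x(j := s)) i - z i)"
    unfolding tensor_def by (rule prod.cong) auto
   ultimately show ?thesis by simp
  qed
  ultimately show "integrable (lborel_Rd d) (?G s)"
   by (subst Bochner_Integration.integrable_cong[OF refl]) auto
 next
  show "?G' (x j) : borel_measurable (lborel_Rd d)" by (rule m_shift[OF k'])
 next
  let ?T = "%z. \<lambda>i\<in>{..<d}. x i + (-1) * z i"
  have "integrable (lborel_Rd d) (%z. (abs (f x) + L * (2 * d)) * M * indicator (box_Rd d 2) z :: real)"
   by (rule integrable_box_Rd)
  moreover have "(%z. (abs (f x) + L * (2 * d)) * M * indicator (box_Rd d 2) z :: real) : borel_measurable (borel_Rd d)"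
   using box_Rd_sets[of d 2] by (simp add: sets_lborel_Rd)
  ultimately have "integrable (lborel_Rd d) (%z. (abs (f x) + L * (2 * d)) * M * indicator (box_Rd d 2) (?T z) :: real)"
   by (subst integral_lborel_Rd_affine(2)) auto
  moreover have "?T z : box_Rd d 2 \<longleftrightarrow> z : ?B" if "z : Rd d" for z
   using that by (force simp: box_Rd_def PiE_iff abs_le_iff)
  ultimately show "integrable (lborel_Rd d) ?b"
   by (subst Bochner_Integration.integrable_cong[OF refl, where g="%z. (abs (f x) + L * (2 * d)) * M * indicator (box_Rd d 2) (?T z)"])
    (auto simp: indicator_def)
 next
  fix z s assume "z : space (lborel_Rd d)" and s: "abs (s - x j) < 1"
  hence z: "z : Rd d" by simp
  show "abs (?G' s z) <= ?b z"
  proof (cases "z : ?B")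
   case True
   have "dist_Rd d z x <= 2 * d"
   proof -
    have "dist_Rd d z x <= (\<Sum>i<d. abs (z i - x i))" unfolding dist_Rd_def by (rule norm_Rd_le_sum)
    also have "... <= (\<Sum>i<d. 2)" using True by (intro sum_mono) auto
    finally show ?thesis by simp
   qed
   hence "L * dist_Rd d z x <= L * (2 * d)" using L by (rule mult_left_mono)
   moreover have "abs (f z - f x) <= L * dist_Rd d z x" using f z x by (simp add: lip_def)
   ultimately have "abs (f z) <= abs (f x) + L * (2 * d)" by linarith
   hence "abs (?G' s z) <= (abs (f x) + L * (2 * d)) * M"
    unfolding abs_mult by (rule mult_mono[OF _ M(2)]) (use L in auto)
   thus ?thesis using True by simp
  next
   case False
   then obtain i where i: "i < d" "2 < abs (z i - x i)" using z by (auto simp: not_le)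
   have "1 / Suc n <= abs ((x(j := s)) i - z i)"
   proof -
    have "1 / real (Suc n) <= 1" by simp
    also have "1 <= abs ((x(j := s)) i - z i)" using i s by (cases "i = j") (auto simp: abs_if split: if_splits)
    finally show ?thesis .
   qed
   moreover have "(k(j := kj')) i : scaled_kernels n" using k' by (simp add: kernels_def)
   ultimately have "(k(j := kj')) i ((x(j := s)) i - z i) = 0" by (intro scaled_kernels_support)
   hence "tensor d (k(j := kj')) (%i. (x(j := s)) i - z i) = 0"
    unfolding tensor_def using i(1) by (intro prod_zero bexI[of _ i]) simp_all
   thus ?thesis using False by simp
  qed
 qed
 moreover have "(LINT z|lborel_Rd d. ?G s z) = conv d k f (x(j := s))" for s
  by (rule conv_alt[OF k cf Rd_upd[OF x j], symmetric])
 moreover have "(LINT z|lborel_Rd d. ?G' (x j) z) = conv d (k(j := kj')) f x"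
  using conv_alt[OF k' cf x] by simp
 ultimately show "((%s. conv d k f (x(j := s))) has_real_derivative conv d (k(j := kj')) f x) (at (x j))"
  by simp
qed

end

lemma has_pd_bound:
 assumes g: "has_pd d j g g'" and j: "j < d" and x: "x : Rd d"
  and L: "!!s. abs (g (x(j := s)) - g x) <= L * abs (s - x j)"
 shows "abs (g' x) <= L"
proof -
 have "((%h. (g (x(j := x j + h)) - g x) / h) \<longlongrightarrow> g' x) (at 0)"
  using g x by (simp add: has_pd_def DERIV_def)
 hence lim: "((%h. abs ((g (x(j := x j + h)) - g x) / h)) \<longlongrightarrow> \<bar>g' x\<bar>) (at 0)"
  by (rule tendsto_rabs)
 have "\<forall>\<^sub>F h in at 0. abs ((g (x(j := x j + h)) - g x) / h) <= L"
 proof (rule eventually_at_filter[THEN iffD2, OF always_eventually], intro allI impI)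
  fix h :: real assume h: "h ~= 0"
  thus "abs ((g (x(j := x j + h)) - g x) / h) <= L" using L[of "x j + h"] by (simp add: divide_le_eq)
 qed
 thus ?thesis by (intro tendsto_upperbound[OF lim]) auto
qed

lemma dist_Rd_upd: 
 assumes "j < d" shows "dist_Rd d (x(j := s)) x = abs (s - x j)"
proof -
 have "(dist_Rd d (x(j := s)) x)^2 = (\<Sum>i<d. if i = j then (s - x j)^2 else 0)"
  unfolding dist_Rd_def norm_Rd_power2 by (intro sum.cong) auto
 also have "... = abs (s - x j)^2" using assms by simp
 finally show ?thesis by (rule power2_eq_imp_eq) simp_all
qed

lemma lip_has_pd_bound:
 assumes "lip d L g" "has_pd d j g g'" "j < d" "x : Rd d"
 shows "abs (g' x) <= L"
proof (rule has_pd_bound[OF assms(2-4)])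
 fix s
 have "abs (g (x(j := s)) - g x) <= L * dist_Rd d (x(j := s)) x"
  using assms(1,4) Rd_upd[OF assms(4,3)] unfolding lip_def by blast
 thus "abs (g (x(j := s)) - g x) <= L * abs (s - x j)" by (simp only: dist_Rd_upd[OF assms(3)])
qed

lemma kernels_upd:
 assumes "k : kernels n"
 obtains kj' where "kj' : scaled_kernels n" "!!x. (k j has_real_derivative kj' x) (at x)" "k(j := kj') : kernels n"
proof -
 obtain kj' where "kj' : scaled_kernels n" "!!x. (k j has_real_derivative kj' x) (at x)"
  using scaled_kernels_DERIV[of "k j" n] assms unfolding kernels_def by blast
 moreover from this(1) have "k(j := kj') : kernels n" using assms by (auto simp: kernels_def)
 ultimately show thesis by (rule that)
qed

text \<open>Derivatives of a convolution are convolutions with other members of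
  \<open>kernels n\<close>, and the Lipschitz constant of a convolution bounds its partial
  derivatives. So all orders follow although \<open>f\<close> is only Lipschitz and may be
  unbounded.\<close>

lemma conv_LB:
 assumes f: "lip d L f"
 shows "k : kernels n ==> EX K>=0. LB d m K (conv d k f)"
proof (induction m arbitrary: k)
 case 0
 let ?P = "%i K. EX g. has_pd d i (conv d k f) g & CB d 0 K g"
 have "EX K>=0. ?P i K" if i: "i < d" for i
 proof -
  obtain k' where k': "k' : scaled_kernels n" "!!x. (k i has_real_derivative k' x) (at x)" "k(i := k') : kernels n"
   using kernels_upd[OF 0] by blast
  have pd: "has_pd d i (conv d k f) (conv d (k(i := k')) f)" by (rule conv_has_pd[OF 0 f i k'(1,2)])
  from lip_has_pd_bound[OF conv_lip[OF 0 f] pd i] lip_cont[OF conv_lip[OF k'(3) f]]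
  have "CB d 0 (L * (LINT z|lborel_Rd d. abs (tensor d k z))) (conv d (k(i := k')) f)" by simp
  with pd f show ?thesis by (intro exI[of _ "L * (LINT z|lborel_Rd d. abs (tensor d k z))"]) (auto simp: lip_def)
 qed
 hence "ALL i. EX K. i < d --> 0 <= K & ?P i K" by blast
 from choice[OF this] obtain K where K: "!!i. i < d ==> 0 <= K i & ?P i (K i)" by blast
 have "LB d 0 (\<Sum>i<d. K i) (conv d k f)"
  unfolding LB_def
 proof (intro conjI allI impI lip_cont[OF conv_lip[OF 0 f]])
  fix i assume i: "i < d"
  have "K i <= (\<Sum>i<d. K i)" using K i by (intro member_le_sum) auto
  thus "?P i (\<Sum>i<d. K i)" using K[OF i] CB_mono_const by blast
 qed
 thus ?case using K by (intro exI[of _ "\<Sum>i<d. K i"] conjI sum_nonneg) auto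
next
 case (Suc m)
 let ?P = "%i K. EX g. has_pd d i (conv d k f) g & CB d (Suc m) K g"
 have "EX K>=0. ?P i K" if i: "i < d" for i
 proof -
  obtain k' where k': "k' : scaled_kernels n" "!!x. (k i has_real_derivative k' x) (at x)" "k(i := k') : kernels n"
   using kernels_upd[OF Suc.prems] by blast
  have pd: "has_pd d i (conv d k f) (conv d (k(i := k')) f)" by (rule conv_has_pd[OF Suc.prems f i k'(1,2)])
  let ?L = "L * (LINT z|lborel_Rd d. abs (tensor d k z))"
  have L: "0 <= ?L" using f by (simp add: lip_def)
  obtain K where K: "0 <= K" "LB d m K (conv d (k(i := k')) f)" using Suc.IH[OF k'(3)] by blast
  have "CB d (Suc m) (K + ?L) (conv d (k(i := k')) f)"
   unfolding CB_Suc_LB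
   using LB_mono[OF K(2), of m "K + ?L"] lip_has_pd_bound[OF conv_lip[OF Suc.prems f] pd i] L K(1)
   by (auto intro: add_increasing)
  with pd K(1) L show ?thesis by (intro exI[of _ "K + ?L"]) auto
 qed
 hence "ALL i. EX K. i < d --> 0 <= K & ?P i K" by blast
 from choice[OF this] obtain K where K: "!!i. i < d ==> 0 <= K i & ?P i (K i)" by blast
 have "LB d (Suc m) (\<Sum>i<d. K i) (conv d k f)"
  unfolding LB_def
 proof (intro conjI allI impI lip_cont[OF conv_lip[OF Suc.prems f]])
  fix i assume i: "i < d"
  have "K i <= (\<Sum>i<d. K i)" using K i by (intro member_le_sum) auto
  thus "?P i (\<Sum>i<d. K i)" using K[OF i] CB_mono_const by blast
 qed
 thus ?case using K by (intro exI[of _ "\<Sum>i<d. K i"] conjI sum_nonneg) auto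
qed

text \<open>Here the derivative falls on \<open>f\<close>, in contrast to
  \<open>conv_has_pd\<close>: this lets mollification commute with differentiation and keep the
  bounds of \<open>f\<close>.\<close>

lemma conv_pd:
 assumes f: "LB d (Suc m) K f" and K: "0 <= K" and k: "k : kernels n" and j: "j < d"
 shows "has_pd d j (conv d k f) (conv d k (pd j f))"
 unfolding has_pd_def
proof
 fix x assume x: "x : Rd d"
 note pdf = LB_pd[OF f j]
 have lf: "lip d (K * d) f" by (rule LB_imp_lip[OF f K])
 have lf': "lip d (K * d) (pd j f)" by (rule LB_imp_lip[OF CB_imp_LB[OF pdf(2)] K])
 let ?s = "%s z. \<lambda>i\<in>{..<d}. (x(j := s)) i - z i"
 have "((%s. \<integral>z. f (?s s z) * tensor d k z \<partial>lborel_Rd d) has_real_derivative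
   (LINT z|lborel_Rd d. pd j f (?s (x j) z) * tensor d k z)) (at (x j))"
 proof (rule DERIV_integral[where b="%z. K * abs (tensor d k z)"])
  fix z s
  let ?y = "\<lambda>i\<in>{..<d}. x i - z i"
  have y: "?s s z = ?y(j := s - z j)" for s
   using j by (intro ext) (simp add: restrict_def)
  have "((%s. s - z j) has_real_derivative 1) (at s)" by (auto intro!: derivative_eq_intros)
  from DERIV_chain2[OF has_pdD[OF pdf(1) Rd_restrict[of "%i. x i - z i" d] j] this]
  have "((%s. f (?y(j := s - z j))) has_real_derivative pd j f (?y(j := s - z j))) (at s)" by simp
  thus "((%s. f (?s s z) * tensor d k z) has_real_derivative pd j f (?s s z) * tensor d k z) (at s)"
   unfolding y by (rule DERIV_cmult_right)
 next
  show "integrable (lborel_Rd d) (%z. f (?s s z) * tensor d k z)" for s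
   by (rule conv_integrand[OF k lf Rd_upd[OF x j]])
  show "(%z. pd j f (?s (x j) z) * tensor d k z) : borel_measurable (lborel_Rd d)"
   using conv_integrand[OF k lf' Rd_upd[OF x j]] by (rule borel_measurable_integrable)
  show "integrable (lborel_Rd d) (%z. K * abs (tensor d k z))" using integrable_tensor[OF k] by simp
  show "abs (pd j f (?s s z) * tensor d k z) <= K * abs (tensor d k z)" for s z
   using CB_bound[OF pdf(2) Rd_restrict] by (simp only: abs_mult mult_right_mono abs_ge_zero)
 qed
 thus "((%s. conv d k f (x(j := s))) has_real_derivative conv d k (pd j f) x) (at (x j))"
  unfolding conv_def by simp
qed

section \<open>Normalized mollifiers\<close>

definition moll_kernel :: "nat => nat => real => real" where
 "moll_kernel n = (%_ x. flat 0 (1 + real (Suc n) * x) * flat 0 (1 - real (Suc n) * x))"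

definition moll :: "nat => nat => (vec => real) => vec => real" where
 "moll d n f x = 1 / (LINT z|lborel_Rd d. tensor d (moll_kernel n) z) * conv d (moll_kernel n) f x"

lemma moll_kernel: "moll_kernel n : kernels n"
proof -
 let ?f = "%x. flat 0 (1 + x) * flat 0 (1 - x)"
 have "(%x. ?f (real (Suc n) * x)) : scaled_kernels n"
  unfolding scaled_kernels_def by (rule CollectI, rule exI[of _ ?f], rule conjI[OF refl bump_kernels.base])
 thus ?thesis unfolding kernels_def moll_kernel_def by simp
qed

lemma moll_tensor_nonneg: "0 <= tensor d (moll_kernel n) z"
 unfolding tensor_def moll_kernel_def by (intro prod_nonneg ballI mult_nonneg_nonneg) (simp_all add: flat_bound)

lemma moll_tensor_pos: "0 < (LINT z|lborel_Rd d. tensor d (moll_kernel n) z)"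
proof -
 have "(LINT z|lborel_Rd d. tensor d (moll_kernel n) z) ~= 0"
 proof
  assume "(LINT z|lborel_Rd d. tensor d (moll_kernel n) z) = 0"
  hence AE: "AE z in lborel_Rd d. tensor d (moll_kernel n) z = 0"
   using integral_nonneg_eq_0_iff_AE[OF integrable_tensor[OF moll_kernel]] moll_tensor_nonneg by simp
  define r where "r = 1 / (2 * real (Suc n))"
  have pos: "0 < tensor d (moll_kernel n) z" if "z : box_Rd d r" for z
   unfolding tensor_def
  proof (rule prod_pos)
   fix i assume "i : {..<d}"
   hence "abs (z i) <= r" using that by (force simp: box_Rd_def PiE_iff abs_le_iff)
   hence "real (Suc n) * abs (z i) <= real (Suc n) * r" by (intro mult_left_mono) simp_all
   also have "... = 1 / 2" by (simp add: r_def)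
   finally have "abs (real (Suc n) * z i) <= 1 / 2" by (simp add: abs_mult)
   thus "0 < moll_kernel n i (z i)" unfolding moll_kernel_def flat_def by (auto simp: abs_le_iff)
  qed
  have "AE z in lborel_Rd d. z \<notin> box_Rd d r" using AE by eventually_elim (use pos in force)
  hence "emeasure (lborel_Rd d) (box_Rd d r) = 0"
   using AE_iff_null_sets[of "box_Rd d r" "lborel_Rd d"] by (simp add: null_sets_def)
  moreover have "emeasure (lborel_Rd d) (box_Rd d r) = (\<Prod>i<d. emeasure lborel {-r..r})"
   unfolding box_Rd_def lborel_Rd_def by (rule lborel_product.emeasure_PiM) auto
  ultimately show False by (simp add: r_def emeasure_lborel_Icc_eq)
 qed
 moreover have "0 <= (LINT z|lborel_Rd d. tensor d (moll_kernel n) z)" using moll_tensor_nonneg by simp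
 ultimately show ?thesis by simp
qed

text \<open>The normalized kernel is nonnegative, has mass 1 and lives in a small cube, so
  \<open>moll d n f x\<close> is a mean of values of \<open>f\<close> near \<open>x\<close>;
  \<open>moll_bound\<close> and \<open>moll_close\<close> are instances.\<close>

lemma moll_average:
 assumes f: "lip d L f" and x: "x : Rd d" and a: "!!z. z : box_Rd d (1 / Suc n) ==> a <= f (\<lambda>i\<in>{..<d}. x i - z i)"
  and b: "!!z. z : box_Rd d (1 / Suc n) ==> f (\<lambda>i\<in>{..<d}. x i - z i) <= b"
 shows "a <= moll d n f x & moll d n f x <= b"
proof -
 let ?m = "\<integral>z. tensor d (moll_kernel n) z \<partial>lborel_Rd d"
 note it = integrable_tensor[OF moll_kernel, of d n]
 have "a * tensor d (moll_kernel n) z <= f (\<lambda>i\<in>{..<d}. x i - z i) * tensor d (moll_kernel n) z &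
   f (\<lambda>i\<in>{..<d}. x i - z i) * tensor d (moll_kernel n) z <= b * tensor d (moll_kernel n) z" if "z : Rd d" for z
 proof (cases "z : box_Rd d (1 / Suc n)")
  case True
  thus ?thesis using a b moll_tensor_nonneg by (auto intro!: mult_right_mono)
 next
  case False
  thus ?thesis using tensor_support[OF moll_kernel that] by simp
 qed
 hence "(LINT z|lborel_Rd d. a * tensor d (moll_kernel n) z) <= conv d (moll_kernel n) f x"
  "conv d (moll_kernel n) f x <= (LINT z|lborel_Rd d. b * tensor d (moll_kernel n) z)"
  unfolding conv_def by (intro integral_mono integrable_mult_right it conv_integrand[OF moll_kernel f x]; simp)+
 hence "a * ?m <= conv d (moll_kernel n) f x" "conv d (moll_kernel n) f x <= b * ?m" by simp_all
 thus ?thesis using moll_tensor_pos[of d n] by (simp add: moll_def le_divide_eq divide_le_eq)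
qed

lemma moll_bound:
 assumes "lip d L f" "!!x. x : Rd d ==> abs (f x) <= K" "x : Rd d" shows "abs (moll d n f x) <= K"
proof -
 have "- K <= f (restrict y {..<d}) & f (restrict y {..<d}) <= K" for y
  using assms(2)[OF Rd_restrict[of y d]] by (simp add: abs_le_iff)
 thus ?thesis using moll_average[OF assms(1,3), of n "- K" K] by (auto simp: abs_le_iff)
qed

lemma moll_close:
 assumes f: "lip d L f" and x: "x : Rd d" shows "abs (moll d n f x - f x) <= L * (d / Suc n)"
proof -
 have c: "abs (f (\<lambda>i\<in>{..<d}. x i - z i) - f x) <= L * (d / Suc n)" if "z : box_Rd d (1 / Suc n)" for z
  using lip_shift0[OF f x, of z] mult_left_mono[OF norm_le_box[OF that], of L] f by (simp add: lip_def)
 have "f x - L * (d / Suc n) <= f (\<lambda>i\<in>{..<d}. x i - z i) & f (\<lambda>i\<in>{..<d}. x i - z i) <= f x + L * (d / Suc n)"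
  if "z : box_Rd d (1 / Suc n)" for z
  using c[OF that] by linarith
 hence "f x - L * (d / Suc n) <= moll d n f x & moll d n f x <= f x + L * (d / Suc n)"
  using moll_average[OF f x, of n "f x - L * (d / Suc n)" "f x + L * (d / Suc n)"] by (simp only: simp_thms)
 thus ?thesis by linarith
qed

lemma moll_lip:
 assumes f: "lip d L f" shows "lip d L (moll d n f)"
proof -
 let ?m = "\<integral>z. tensor d (moll_kernel n) z \<partial>lborel_Rd d"
 have "lip d (L * ?m) (conv d (moll_kernel n) f)"
  using conv_lip[OF moll_kernel f] moll_tensor_nonneg by simp
 hence "abs (conv d (moll_kernel n) f x - conv d (moll_kernel n) f y) / ?m <= L * ?m * dist_Rd d x y / ?m"
  if "x : Rd d" "y : Rd d" for x y
  using that moll_tensor_pos[of d n] by (intro divide_right_mono) (auto simp: lip_def)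
 thus ?thesis using f moll_tensor_pos[of d n] by (simp add: lip_def moll_def diff_divide_distrib[symmetric] abs_divide)
qed

lemma LB_cmult: "LB d k K f ==> LB d k (abs c * K) (%x. c * f x)"
proof -
 assume f: "LB d k K f"
 have "EX g. has_pd d i (%x. c * f x) g & CB d k (abs c * K) g" if "i < d" for i
  using has_pd_cmult[OF LB_pd(1)[OF f that], of c] CB_cmult[OF LB_pd(2)[OF f that], of c] by blast
 thus ?thesis using f unfolding LB_def by (intro conjI continuous_on_mult_left) auto
qed

lemma moll_LB: 
 assumes "lip d L f" shows "EX K>=0. LB d m K (moll d n f)"
proof -
 obtain K where "0 <= K" "LB d m K (conv d (moll_kernel n) f)" using conv_LB[OF assms moll_kernel] by blast
 hence "LB d m (abs (1 / (LINT z|lborel_Rd d. tensor d (moll_kernel n) z)) * K) (moll d n f)"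
  unfolding moll_def[abs_def] by (intro LB_cmult)
 moreover have "0 <= abs (1 / (LINT z|lborel_Rd d. tensor d (moll_kernel n) z)) * K" using \<open>0 <= K\<close> by simp
 ultimately show ?thesis by blast
qed

lemma moll_pd: "LB d (Suc m) K f ==> 0 <= K ==> j < d ==> has_pd d j (moll d n f) (moll d n (pd j f))"
 unfolding moll_def by (intro has_pd_cmult conv_pd[OF _ _ moll_kernel])

text \<open>The constant \<open>K\<close> is preserved. Above the lowest order mollification
  commutes with the derivative; at the lowest order the derivative of \<open>f\<close> is only
  continuous and bounded, and difference quotients are averaged instead.\<close>

lemma moll_CB: "CB d (Suc m) K f ==> CB d (Suc m) K (moll d n f)"
proof (induction m arbitrary: f)
 case 0
 have l: "lip d (K * d) f" by (rule LB_imp_lip[OF CB_imp_LB[OF 0] CB_nonneg[OF 0]])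
 obtain K' where K': "LB d 0 K' (moll d n f)" using moll_LB[OF l] by blast
 have bd: "abs (moll d n f x) <= K" if "x : Rd d" for x by (rule moll_bound[OF l CB_bound[OF 0] that])
 have "abs (pd j (moll d n f) x) <= K" if j: "j < d" and x: "x : Rd d" for j x
 proof (rule has_pd_bound[OF LB_pd(1)[OF K' j] j x])
  fix s
  have "abs (f (\<lambda>i\<in>{..<d}. (x(j := s)) i - z i) - f (\<lambda>i\<in>{..<d}. x i - z i)) <= K * abs (s - x j)" for z
  proof -
   have "abs (f (\<lambda>i\<in>{..<d}. (x(j := s)) i - z i) - f (\<lambda>i\<in>{..<d}. x i - z i))
    <= K * (\<Sum>i<d. abs ((\<lambda>i\<in>{..<d}. (x(j := s)) i - z i) i - (\<lambda>i\<in>{..<d}. x i - z i) i))"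
    by (rule LB_lipschitz_sum[OF CB_imp_LB[OF 0] Rd_restrict Rd_restrict])
   also have "(\<Sum>i<d. abs ((\<lambda>i\<in>{..<d}. (x(j := s)) i - z i) i - (\<lambda>i\<in>{..<d}. x i - z i) i)) = (\<Sum>i<d. if i = j then \<bar>s - x j\<bar> else 0)"
    by (intro sum.cong) auto
   also have "... = abs (s - x j)" using j by simp
   finally show ?thesis .
  qed
  hence le: "abs (f (\<lambda>i\<in>{..<d}. (x(j := s)) i - z i) * t - f (\<lambda>i\<in>{..<d}. x i - z i) * t) <= K * abs (s - x j) * t"
   if "0 <= t" for z t
   using that by (simp add: left_diff_distrib[symmetric] abs_mult mult_right_mono)
  let ?m = "\<integral>z. tensor d (moll_kernel n) z \<partial>lborel_Rd d"
  have i1: "integrable (lborel_Rd d) (%z. f (\<lambda>i\<in>{..<d}. (x(j := s)) i - z i) * tensor d (moll_kernel n) z)"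
   by (rule conv_integrand[OF moll_kernel l Rd_upd[OF x j]])
  have i2: "integrable (lborel_Rd d) (%z. f (\<lambda>i\<in>{..<d}. x i - z i) * tensor d (moll_kernel n) z)"
   by (rule conv_integrand[OF moll_kernel l x])
  have "abs (conv d (moll_kernel n) f (x(j := s)) - conv d (moll_kernel n) f x) <=
   (LINT z|lborel_Rd d. K * abs (s - x j) * tensor d (moll_kernel n) z)"
   unfolding conv_def Bochner_Integration.integral_diff[OF i1 i2, symmetric]
   by (rule integral_abs_bound[THEN order_trans], rule integral_mono)
    (use i1 i2 integrable_tensor[OF moll_kernel, of d n] le moll_tensor_nonneg in auto)
  also have "... = K * abs (s - x j) * ?m" by simp
  finally have "abs (conv d (moll_kernel n) f (x(j := s)) - conv d (moll_kernel n) f x) / ?m <= K * abs (s - x j)"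
   using moll_tensor_pos[of d n] by (simp add: divide_le_eq)
  thus "abs (moll d n f (x(j := s)) - moll d n f x) <= K * abs (s - x j)"
   using moll_tensor_pos[of d n] by (simp add: moll_def diff_divide_distrib[symmetric] abs_divide)
 qed
 hence "EX g. has_pd d j (moll d n f) g & CB d 0 K g" if "j < d" for j
  using LB_pd(1)[OF K' that] CB_cont[OF LB_pd(2)[OF K' that]] that by (intro exI[of _ "pd j (moll d n f)"]) auto
 thus ?case
  by (intro CB_SucI bd lip_cont[OF moll_lip[OF l]]) auto
next
 case (Suc m)
 have l: "lip d (K * d) f" by (rule LB_imp_lip[OF CB_imp_LB[OF Suc.prems] CB_nonneg[OF Suc.prems]])
 show ?case
 proof (rule CB_SucI)
  show "abs (moll d n f x) <= K" if "x : Rd d" for x by (rule moll_bound[OF l CB_bound[OF Suc.prems] that])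
  show "EX g. has_pd d j (moll d n f) g & CB d (Suc m) K g" if j: "j < d" for j
   using moll_pd[OF CB_imp_LB[OF Suc.prems] CB_nonneg[OF Suc.prems] j] Suc.IH[OF CB_pd(2)[OF Suc.prems j]] by blast
 qed (rule lip_cont[OF moll_lip[OF l]])
qed

section \<open>Truncation and smooth approximation of Lipschitz functions\<close>

text \<open>Sending \<open>y\<close> to \<open>N * sin (y / N)\<close> is a truncation with all
  derivatives bounded that enlarges neither Lipschitz constants nor absolute values and tends to the
  identity for large \<open>N\<close>. Its derivatives are phase shifts by \<open>pi / 2\<close>,
  whence the formula for \<open>F\<close>.\<close>

lemma trunc_CB:
 assumes f: "LB d 2 K f" and N: "0 < N"
 shows "EX K'. CB d 3 K' (%x. N * sin (f x / N))"
proof -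
 define F where "F j y = N * (1 / N) ^ j * sin (y / N + j * (pi / 2))" for j :: nat and y
 have D: "(F j has_real_derivative F (Suc j) y) (at y)" for j y
 proof -
  have "((%y. sin (y / N + j * (pi / 2))) has_real_derivative cos (y / N + j * (pi / 2)) * (1 / N)) (at y)"
   using N by (auto intro!: derivative_eq_intros)
  from DERIV_cmult[OF this, of "N * (1 / N) ^ j"]
  have "(F j has_real_derivative N * (1 / N) ^ j * (cos (y / N + j * (pi / 2)) * (1 / N))) (at y)"
   by (simp add: F_def[abs_def])
  moreover have "cos (y / N + j * (pi / 2)) = sin (y / N + Suc j * (pi / 2))"
  proof -
   have "y / N + Suc j * (pi / 2) = (y / N + j * (pi / 2)) + pi / 2" by (simp add: algebra_simps add_divide_distrib)
   thus ?thesis by (simp only: sin_add) simp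
  qed
  ultimately show ?thesis by (simp only: F_def power_Suc mult_ac)
 qed
 have bd: "abs (F j y) <= N * (1 + 1 / N) ^ 3" if "j <= 3" for j y
 proof -
  have "(1 / N) ^ j <= (1 + 1 / N) ^ j" using N by (intro power_mono) auto
  also have "... <= (1 + 1 / N) ^ 3" using N that by (intro power_increasing) auto
  finally have "N * (1 / N) ^ j * abs (sin (y / N + j * (pi / 2))) <= N * (1 + 1 / N) ^ 3 * 1"
   using N by (intro mult_mono mult_left_mono) auto
  thus ?thesis using N by (simp add: F_def abs_mult)
 qed
 have "EX K'. CB d (Suc 2) K' (%x. F 0 (f x))"
 proof (rule CB_comp1[where S=UNIV and F=F and k=2 and M="N * (1 + 1 / N) ^ 3", OF D _ _ _ f])
  show "continuous_on UNIV (F (Suc 2))"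
   using D by (intro continuous_at_imp_continuous_on ballI DERIV_isCont)
 qed (use bd in auto)
 moreover have "Suc 2 = 3" by simp
 ultimately show ?thesis by (simp add: F_def)
qed

lemma trunc_le: "0 < (N :: real) ==> abs (N * sin (y / N)) <= abs y"
 using mult_left_mono[OF abs_sin_x_le_abs_x[of "y / N"], of N] by (simp add: abs_mult abs_divide)

lemma trunc_diff_le: "0 < (N :: real) ==> abs (N * sin (y / N) - N * sin (z / N)) <= abs (y - z)"
proof -
 assume N: "0 < N"
 have "abs (sin a - sin b) <= abs (a - b)" for a b :: real
 proof -
  have "abs (sin a - sin b) = 2 * abs (sin ((a - b) / 2)) * abs (cos ((a + b) / 2))"
   by (simp add: sin_diff_sin abs_mult)
  also have "... <= 2 * abs ((a - b) / 2) * 1"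
   by (intro mult_mono mult_left_mono abs_sin_x_le_abs_x) auto
  finally show ?thesis by simp
 qed
 from mult_left_mono[OF this[of "y / N" "z / N"], of N] N show ?thesis
  by (simp add: right_diff_distrib[symmetric] diff_divide_distrib[symmetric] abs_mult abs_divide)
qed

lemma trunc_close: "0 < (N :: real) ==> abs (N * sin (y / N) - y) <= y^2 / N"
proof -
 assume N: "0 < (N :: real)"
 have "abs (sin t - t) <= t^2" for t :: real
 proof -
  have "abs (sin t - (\<Sum>m<2. sin_coeff m * t ^ m)) <= inverse (fact 2) * abs t ^ 2" by (rule Maclaurin_sin_bound)
  moreover have "(\<Sum>m<2. sin_coeff m * t ^ m) = t" by (simp add: numeral_2_eq_2 sin_coeff_def)
  ultimately have "abs (sin t - t) <= t^2 / 2" by (simp add: fact_2)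
  thus ?thesis using zero_le_power2[of t] by linarith
 qed
 from this[of "y / N"] have "N * abs (sin (y / N) - y / N) <= N * (y / N)^2" using N by (intro mult_left_mono) auto
 also have "N * abs (sin (y / N) - y / N) = abs (N * (sin (y / N) - y / N))" using N by (simp add: abs_mult)
 finally show ?thesis using N by (simp add: right_diff_distrib power2_eq_square)
qed

lemma trunc_lip: "lip d L f ==> 0 < N ==> lip d L (%x. N * sin (f x / N))"
 unfolding lip_def using order_trans[OF trunc_diff_le] by blast

text \<open>Mollify, then truncate: neither operation raises the Lipschitz constant 1, so the
  gradient bound has no dimensional factor. The domination by \<open>abs (f x) + 1\<close> serves
  later limits under integrals.\<close>

lemma lip_approx:
 assumes f: "lip d 1 f"
 shows "EX g K. ALL n. CB d 3 (K n) (g n) & lip d 1 (g n) &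
  (ALL x:Rd d. norm_Rd d (grad d (g n) x) <= 1 & abs (g n x) <= abs (f x) + 1 & (%n. g n x) ----> f x)"
proof -
 \<comment> \<open>The index \<open>d * Suc n\<close> absorbs the dimension in
   \<open>moll_close\<close> and leaves an error of at most \<open>1 / Suc n\<close>.\<close>
 define h where "h n = moll d (d * Suc n) f" for n
 define g where "g n x = real (Suc n) * sin (h n x / real (Suc n))" for n x
 have close: "abs (h n x - f x) <= 1 / Suc n" if "x : Rd d" for n x
 proof -
  have "abs (h n x - f x) <= 1 * (d / Suc (d * Suc n))" unfolding h_def by (rule moll_close[OF f that])
  also have "... <= 1 / Suc n"
  proof -
   have "real d * real (Suc n) <= real (Suc (d * Suc n))" by (simp only: of_nat_mult[symmetric] of_nat_le_iff)
   thus ?thesis by (simp only: mult_1 pos_divide_le_eq of_nat_0_less_iff zero_less_Suc times_divide_eq_left pos_le_divide_eq)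
  qed
  finally show ?thesis .
 qed
 have "EX K. CB d 3 K (g n)" for n
 proof -
  obtain K where "LB d 2 K (h n)" using moll_LB[OF f] unfolding h_def by blast
  from trunc_CB[OF this, of "Suc n"] show ?thesis by (simp add: g_def[abs_def])
 qed
 hence "ALL n. EX K. CB d 3 K (g n)" by blast
 from choice[OF this] obtain K where K: "!!n. CB d 3 (K n) (g n)" by blast
 have l: "lip d 1 (g n)" for n unfolding g_def h_def by (intro trunc_lip moll_lip f) simp
 have K': "CB d (Suc 2) (K n) (g n)" for n using K by (simp add: eval_nat_numeral)
 have gr: "norm_Rd d (grad d (g n) x) <= 1" if "x : Rd d" for n x
  by (rule lipschitz_imp_grad[OF CB_imp_LB[OF K'] that]) (use l in \<open>auto simp: lip_def\<close>)
 have bd: "abs (g n x) <= abs (f x) + 1" if "x : Rd d" for n x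
 proof -
  have "abs (g n x) <= abs (h n x)" unfolding g_def by (rule trunc_le) simp
  moreover have "1 / real (Suc n) <= 1" by simp
  ultimately show ?thesis using close[OF that, of n] by linarith
 qed
 have lim: "(%n. g n x) ----> f x" if x: "x : Rd d" for x
 proof -
  have "abs (g n x - f x) <= ((abs (f x) + 1)^2 + 1) * (1 / Suc n)" for n
  proof -
   have "1 / real (Suc n) <= 1" by simp
   hence "abs (h n x) <= abs (f x) + 1" using close[OF x, of n] by linarith
   hence "(h n x)^2 <= (abs (f x) + 1)^2" by (metis abs_ge_zero power2_abs power_mono)
   hence "(h n x)^2 / Suc n <= (abs (f x) + 1)^2 / Suc n" by (intro divide_right_mono) auto
   moreover have "abs (g n x - h n x) <= (h n x)^2 / Suc n" unfolding g_def by (rule trunc_close) simp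
   ultimately have "abs (g n x - f x) <= (abs (f x) + 1)^2 / Suc n + 1 / Suc n" using close[OF x, of n] by linarith
   thus ?thesis by (simp add: add_divide_distrib)
  qed
  moreover have "(%n. ((abs (f x) + 1)^2 + 1) * (1 / real (Suc n))) ----> ((abs (f x) + 1)^2 + 1) * 0"
   by (intro tendsto_intros LIMSEQ_Suc lim_1_over_n)
  ultimately have "(%n. g n x - f x) ----> 0"
   by (intro Lim_null_comparison[of "%n. g n x - f x"]) auto
  thus ?thesis by (simp add: LIM_zero_iff)
 qed
 show ?thesis
  by (intro exI[of _ g] exI[of _ K] allI conjI ballI K l gr bd lim)
qed

lemma fatou_bound:
 fixes u :: "nat => 'a => real"
 assumes iu: "!!n. integrable M (u n)" and nn: "!!n x. x : space M ==> 0 <= u n x"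
  and le: "!!n. (LINT x|M. u n x) <= c n" and c: "c ----> C"
  and lim: "!!x. x : space M ==> (%n. u n x) ----> v x" and v: "v : borel_measurable M"
 shows "integrable M v & (LINT x|M. v x) <= C"
proof -
 have nv: "0 <= v x" if "x : space M" for x
  using LIMSEQ_le_const[OF lim[OF that]] nn[OF that] by auto
 have C: "0 <= C"
 proof (rule LIMSEQ_le_const[OF c], intro exI allI impI)
  fix n
  have "0 <= (LINT x|M. u n x)" using nn by (intro Bochner_Integration.integral_nonneg) auto
  thus "0 <= c n" using le[of n] by simp
 qed
 have "(\<integral>\<^sup>+ x. ennreal (v x) \<partial>M) = (\<integral>\<^sup>+ x. liminf (%n. ennreal (u n x)) \<partial>M)"
  using lim by (intro nn_integral_cong lim_imp_Liminf[symmetric] tendsto_ennrealI) auto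
 also have "... <= liminf (%n. \<integral>\<^sup>+ x. ennreal (u n x) \<partial>M)"
  using iu by (intro nn_integral_liminf) auto
 also have "... <= liminf (%n. ennreal (c n))"
 proof (rule Liminf_mono, rule always_eventually, rule allI)
  fix n
  have "(\<integral>\<^sup>+ x. ennreal (u n x) \<partial>M) = ennreal (LINT x|M. u n x)"
   using iu nn by (intro nn_integral_eq_integral) auto
  thus "(\<integral>\<^sup>+ x. ennreal (u n x) \<partial>M) <= ennreal (c n)" using le by (simp add: ennreal_leI)
 qed
 also have "... = ennreal C" using c by (intro lim_imp_Liminf tendsto_ennrealI) auto
 finally have le': "(\<integral>\<^sup>+ x. ennreal (v x) \<partial>M) <= ennreal C" .
 have "(\<integral>\<^sup>+ x. ennreal (norm (v x)) \<partial>M) = (\<integral>\<^sup>+ x. ennreal (v x) \<partial>M)"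
  using nv by (intro nn_integral_cong) auto
 hence iv: "integrable M v"
  using le' v by (intro integrableI_bounded) (auto intro: le_less_trans)
 have "ennreal (LINT x|M. v x) <= ennreal C"
  using nn_integral_eq_integral[OF iv] nv le' by (simp add: AE_I2)
 thus ?thesis using iv C by (simp add: ennreal_le_iff)
qed

section \<open>Gaussian moments of Lipschitz functions under a Gibbs measure\<close>

context lsi_gibbs
begin

interpretation prob_space nu by (rule prob_space_gibbs)

lemma lip_ball_pos:
 assumes f: "lip d L f"
 obtains M where "0 < measure nu {x\<in>Rd d. abs (f x) <= M}"
proof -
 let ?A = "%n. {x\<in>Rd d. abs (f x) <= real n}"
 have mf: "f : borel_measurable nu" by (rule measurable_gibbs[OF lip_cont[OF f]])
 have sA: "?A n : sets nu" for n
 proof -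
  have "{x\<in>space nu. abs (f x) <= real n} : sets nu" using mf by measurable
  thus ?thesis by simp
 qed
 have "(%n. measure nu (?A n)) ----> measure nu (\<Union>n. ?A n)"
  by (rule finite_Lim_measure_incseq) (use sA in \<open>auto simp: incseq_def\<close>)
 moreover have "(\<Union>n. ?A n) = space nu" by (auto intro: real_arch_simple)
 ultimately have "(%n. measure nu (?A n)) ----> 1" using prob_space by simp
 hence "\<forall>\<^sub>F n in sequentially. 0 < measure nu (?A n)" by (rule order_tendstoD) simp
 then obtain n where "0 < measure nu (?A n)" by (auto simp: eventually_sequentially)
 thus thesis by (rule that)
qed

text \<open>The difficulty is that integrability of \<open>f\<close> is part of the claim, so the
  means \<open>e n\<close> of the approximations are not known to converge. They are first bounded
  with the help of a set of positive measure on which \<open>f\<close> is bounded; Fatou then gives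
  all exponential moments, and dominated convergence identifies the limit of
  \<open>e\<close>.\<close>

lemma herbst_lip:
 assumes f: "lip d 1 f"
 shows "integrable nu f" "integrable nu (%x. exp (theta * f x))"
  "(LINT x|nu. exp (theta * f x)) <= exp (theta * (LINT x|nu. f x) + theta^2 / (4 * rho))"
proof -
 obtain g K where gK: "ALL n. CB d 3 (K n) (g n) & lip d 1 (g n) &
  (ALL x:Rd d. norm_Rd d (grad d (g n) x) <= 1 & abs (g n x) <= abs (f x) + 1 & (%n. g n x) ----> f x)"
  using lip_approx[OF f] by blast
 have g: "CB d (Suc 2) (K n) (g n)" for n using gK by (simp add: eval_nat_numeral)
 have gr: "norm_Rd d (grad d (g n) x) <= 1" if "x : Rd d" for n x using gK that by blast
 have gb: "abs (g n x) <= abs (f x) + 1" if "x : Rd d" for n x using gK that by blast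
 have gl: "(%n. g n x) ----> f x" if "x : Rd d" for x using gK that by blast
 define e where "e n = (LINT x|nu. g n x)" for n
 have cf: "continuous_on (Rd d) f" by (rule lip_cont[OF f])
 have mf: "f : borel_measurable nu" by (rule measurable_gibbs[OF cf])
 have H: "(LINT x|nu. exp (t * g n x)) <= exp (t * e n + t^2 / (4 * rho))" for t :: real and n
  unfolding e_def by (rule herbst_CB[OF g gr])
 have ie: "integrable nu (%x. exp (t * g n x))" for t n
  by (rule exp_moment_pos(2)[OF CB_cmult[OF g]])
 obtain M where M: "0 < measure nu {x\<in>Rd d. abs (f x) <= M}" using lip_ball_pos[OF f] by blast
 define p where "p = measure nu {x\<in>Rd d. abs (f x) <= M}"
 have sA: "{x\<in>Rd d. abs (f x) <= M} : sets nu"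
 proof -
  have "{x\<in>space nu. abs (f x) <= M} : sets nu" using mf by measurable
  thus ?thesis by simp
 qed
 \<comment> \<open>The exponential moment is bounded below by its contribution on the set of measure
   \<open>p\<close> and above by \<open>H\<close>; the signs \<open>t = 1\<close> and
   \<open>t = -1\<close> bound \<open>e n\<close> from both sides.\<close>
 have low: "ln p - (M + 1) - 1 / (4 * rho) <= t * e n" if t: "abs t = 1" for t n
 proof -
  have "exp (- (M + 1)) * p = (LINT x|nu. exp (- (M + 1)) * indicator {x\<in>Rd d. abs (f x) <= M} x)"
   using sA sets.sets_into_space[OF sA] by (simp add: p_def Int_absorb2)
  also have "... <= (LINT x|nu. exp (t * g n x))"
  proof (rule integral_mono)
   show "integrable nu (%x. exp (- (M + 1)) * indicator {x\<in>Rd d. abs (f x) <= M} x :: real)"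
    using sA by (intro integrable_mult_right integrable_real_indicator) (auto simp: less_top[symmetric])
   fix x assume "x : space nu"
   hence x: "x : Rd d" by simp
   show "exp (- (M + 1)) * indicator {x\<in>Rd d. abs (f x) <= M} x <= exp (t * g n x)"
   proof (cases "abs (f x) <= M")
    case True
    have "abs (t * g n x) <= M + 1" using gb[OF x, of n] True t by (simp add: abs_mult)
    hence "- (M + 1) <= t * g n x" by (simp add: abs_le_iff)
    thus ?thesis using True x by simp
   qed simp
  qed (rule ie)
  also have "... <= exp (t * e n + t^2 / (4 * rho))" by (rule H)
  also have "t^2 = 1" using t by (metis one_power2 power2_abs)
  finally have "ln (exp (- (M + 1)) * p) <= ln (exp (t * e n + 1 / (4 * rho)))"
   using M by (subst ln_le_cancel_iff) (auto simp: p_def)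
  thus ?thesis using M by (simp add: ln_mult p_def)
 qed
 define E where "E = abs (ln p - (M + 1) - 1 / (4 * rho))"
 have E: "abs (e n) <= E" for n using low[of 1 n] low[of "-1" n] unfolding E_def by linarith
 have ief: "integrable nu (%x. exp (t * f x))" for t
 proof -
  have "integrable nu (%x. exp (t * f x)) & (LINT x|nu. exp (t * f x)) <= exp (abs t * E + t^2 / (4 * rho))"
  proof (rule fatou_bound[where u="%n x. exp (t * g n x)" and c="%_. exp (abs t * E + t^2 / (4 * rho))"])
   show "(LINT x|nu. exp (t * g n x)) <= exp (abs t * E + t^2 / (4 * rho))" for n
   proof -
    have "t * e n <= abs t * abs (e n)" by (simp add: abs_mult[symmetric])
    also have "... <= abs t * E" by (intro mult_left_mono E) simp
    finally have "exp (t * e n + t^2 / (4 * rho)) <= exp (abs t * E + t^2 / (4 * rho))" by simp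
    thus ?thesis using H[of t n] by linarith
   qed
   show "(%n. exp (t * g n x)) ----> exp (t * f x)" if "x : space nu" for x
    using gl that by (intro tendsto_intros) auto
   show "(%x. exp (t * f x)) : borel_measurable nu" using mf by simp
  qed (use ie in auto)
  thus ?thesis ..
 qed
 show i_f: "integrable nu f"
 proof (rule Bochner_Integration.integrable_bound[of _ "%x. exp (1 * f x) + exp ((-1) * f x)"])
  show "AE x in nu. norm (f x) <= norm (exp (1 * f x) + exp ((-1) * f x))"
  proof (rule AE_I2)
   fix x
   have "f x <= exp (f x)" "- f x <= exp (- f x)" using exp_ge_add_one_self[of "f x"] exp_ge_add_one_self[of "- f x"] by linarith+
   hence "abs (f x) <= exp (f x) + exp (- f x)" using exp_gt_zero[of "f x"] exp_gt_zero[of "- f x"] by linarith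
   thus "norm (f x) <= norm (exp (1 * f x) + exp ((-1) * f x))" by simp
  qed
 qed (intro Bochner_Integration.integrable_add ief mf)+
 show "integrable nu (%x. exp (theta * f x))" by (rule ief)
 have elim: "e ----> (LINT x|nu. f x)" unfolding e_def
 proof (rule integral_dominated_convergence[where w="%x. abs (f x) + 1"])
  show "integrable nu (%x. abs (f x) + 1)" using i_f by simp
  show "g n : borel_measurable nu" for n by (rule measurable_gibbs[OF CB_cont[OF g]])
 qed (use mf gl gb in auto)
 have "integrable nu (%x. exp (theta * f x)) & (LINT x|nu. exp (theta * f x)) <= exp (theta * (LINT x|nu. f x) + theta^2 / (4 * rho))"
 proof (rule fatou_bound[where u="%n x. exp (theta * g n x)" and c="%n. exp (theta * e n + theta^2 / (4 * rho))"])
  show "(%n. exp (theta * e n + theta^2 / (4 * rho))) ----> exp (theta * (LINT x|nu. f x) + theta^2 / (4 * rho))"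
   using elim rho by (intro tendsto_intros) auto
  show "(%n. exp (theta * g n x)) ----> exp (theta * f x)" if "x : space nu" for x
   using gl that by (intro tendsto_intros) auto
  show "(%x. exp (theta * f x)) : borel_measurable nu" using mf by simp
 qed (use ie H in auto)
 thus "(LINT x|nu. exp (theta * f x)) <= exp (theta * (LINT x|nu. f x) + theta^2 / (4 * rho))" ..
qed

lemma lip_norm: "lip d 1 (norm_Rd d)"
 using norm_Rd_lipschitz by (simp add: lip_def)

lemma integrable_growth:
 assumes c: "continuous_on (Rd d) f" and bd: "!!x. x : Rd d ==> abs (f x) <= C * exp (a * norm_Rd d x)"
 shows "integrable nu f"
proof (rule Bochner_Integration.integrable_bound[of _ "%x. C * exp (a * norm_Rd d x)"])
 show "integrable nu (%x. C * exp (a * norm_Rd d x))"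
  by (intro integrable_mult_right herbst_lip(2) lip_norm)
 show "f : borel_measurable nu" by (rule measurable_gibbs[OF c])
 show "AE x in nu. norm (f x) <= norm (C * exp (a * norm_Rd d x))"
  using bd by (intro AE_I2) (force intro: order_trans[OF _ abs_ge_self])
qed

lemma integrable_quadratic:
 assumes c: "continuous_on (Rd d) f" and bd: "!!x. x : Rd d ==> abs (f x) <= C * (1 + norm_Rd d x)^2"
 shows "integrable nu f"
proof (rule integrable_growth[OF c, of C 2])
 fix x assume x: "x : Rd d"
 have "0 <= C * (1 + norm_Rd d x)^2" using bd[OF x] by linarith
 moreover have "0 < (1 + norm_Rd d x)^2" using norm_Rd_nonneg[of d x] by (intro zero_less_power) linarith
 ultimately have C: "0 <= C" by (simp add: zero_le_mult_iff)
 have "(1 + norm_Rd d x)^2 <= (exp (norm_Rd d x))^2"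
  by (intro power_mono exp_ge_add_one_self) simp
 also have "... = exp (2 * norm_Rd d x)" by (simp add: power2_eq_square exp_add[symmetric])
 finally show "abs (f x) <= C * exp (2 * norm_Rd d x)" using bd[OF x] C by (meson mult_left_mono order_trans)
qed

lemma integrable_norm_power2: "integrable nu (%x. (1 + norm_Rd d x)^2)" "integrable nu (%x. (norm_Rd d x)^2)"
proof -
 show "integrable nu (%x. (1 + norm_Rd d x)^2)"
  by (rule integrable_quadratic[of _ 1]) (auto intro!: continuous_intros continuous_on_norm_Rd)
 show "integrable nu (%x. (norm_Rd d x)^2)"
  by (rule integrable_quadratic[of _ 1])
   (auto intro!: continuous_intros continuous_on_norm_Rd power_mono)
qed

lemma gibbs_P2: "nu : P2 d"
 using prob_space_gibbs integrable_norm_power2 by (simp add: P2_def)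

end

section \<open>Integration by parts for the reversible generator\<close>

locale gibbs_flow = lsi_gibbs +
 fixes b :: "vec => vec" and Mb :: real
 assumes bV: "!!i. i < d ==> has_pd d i V (%x. b x i)"
  and cb: "!!i. i < d ==> continuous_on (Rd d) (%x. b x i)"
  and gb: "!!i x. i < d ==> x : Rd d ==> abs (b x i) <= Mb * (1 + norm_Rd d x)"
begin

interpretation prob_space nu by (rule prob_space_gibbs)

lemma Mb_nonneg: "d >= 1 ==> 0 <= Mb"
proof -
 assume "d >= 1"
 hence "0 <= Mb * (1 + norm_Rd d (restrict (%_. 0) {..<d}))"
  using gb[of 0 "restrict (%_. 0) {..<d}"] by (auto intro: order_trans[OF abs_ge_zero])
 moreover have "0 < 1 + norm_Rd d (restrict (%_. 0) {..<d})" by (simp add: add_pos_nonneg)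
 ultimately show "0 <= Mb" by (simp add: zero_le_mult_iff)
qed

lemma integrable_drift: "i < d ==> integrable nu (%x. b x i)"
proof (rule integrable_quadratic[OF cb, of i Mb])
 fix x assume i: "i < d" and x: "x : Rd d"
 have "1 + norm_Rd d x <= (1 + norm_Rd d x)^2"
  using mult_left_mono[of 1 "1 + norm_Rd d x" "1 + norm_Rd d x"] by (simp add: power2_eq_square)
 moreover have "0 <= Mb" using i by (intro Mb_nonneg) simp
 ultimately show "abs (b x i) <= Mb * (1 + norm_Rd d x)^2"
  using gb[OF i x] by (meson mult_left_mono order_trans)
qed

lemma integrable_drift_mult:
 assumes i: "i < d" and w: "continuous_on (Rd d) w" "!!x. x : Rd d ==> abs (w x) <= K"
 shows "integrable nu (%x. b x i * w x)"
proof (rule Bochner_Integration.integrable_bound[of _ "%x. K * b x i"])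
 show "AE x in nu. norm (b x i * w x) <= norm (K * b x i)"
 proof (rule AE_I2)
  fix x assume "x : space nu"
  hence "abs (w x) <= abs K" using w(2)[of x] by simp
  thus "norm (b x i * w x) <= norm (K * b x i)"
   by (simp add: abs_mult mult.commute[of "abs K"] mult_left_mono)
 qed
qed (use integrable_drift[OF i] cb[OF i] w in \<open>auto intro!: measurable_gibbs continuous_intros\<close>)

text \<open>Since \<open>b\<close> is the gradient of \<open>V\<close>, the operator
  \<open>generator d b\<close> is reversible for \<open>nu\<close>, and integrating by parts against
  \<open>F (u x)\<close> in each coordinate leaves the Dirichlet form. \<open>F\<close> matters only
  on a set \<open>S\<close> containing the values of \<open>u\<close>, later a compact interval away
  from 0.\<close>

lemma generator_ibp:
 assumes u: "CB d 3 K u" and c: "!!x. x : Rd d ==> u x : S"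
  and F: "!!y. y : S ==> (F has_real_derivative F' y) (at y)"
  and cF': "continuous_on S F'" and bd: "!!y. y : S ==> abs (F y) <= M & abs (F' y) <= M"
 shows "(LINT x|nu. F (u x) * generator d b u x) = - (LINT x|nu. F' (u x) * (norm_Rd d (grad d u x))^2)"
  and "integrable nu (%x. F (u x) * generator d b u x)"
  and "integrable nu (%x. F' (u x) * (norm_Rd d (grad d u x))^2)"
proof -
 have 3: "(3::nat) = Suc (Suc (Suc 0))" by simp
 note u' = u[unfolded 3]
 have cu: "continuous_on (Rd d) u" by (rule CB_cont[OF u])
 have cF: "continuous_on S F" by (intro continuous_at_imp_continuous_on ballI DERIV_isCont[OF F])
 have cFu: "continuous_on (Rd d) (%x. F (u x))" "continuous_on (Rd d) (%x. F' (u x))"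
  using continuous_on_compose2[OF cF cu] continuous_on_compose2[OF cF' cu] c by auto
 have K: "0 <= K" by (rule CB_nonneg[OF u])
 have M: "0 <= M" using bd[OF c[OF Rd_restrict]] by (meson abs_ge_zero order_trans)
 have p1: "has_pd d i u (pd i u)" "continuous_on (Rd d) (pd i u)" "!!x. x : Rd d ==> abs (pd i u x) <= K" if "i < d" for i
  using CB_pd(1)[OF u' that] CB_cont[OF CB_pd(2)[OF u' that]] CB_bound[OF CB_pd(2)[OF u' that]] by auto
 have p2: "has_pd d i (pd i u) (pd i (pd i u))" "continuous_on (Rd d) (pd i (pd i u))"
  "!!x. x : Rd d ==> abs (pd i (pd i u) x) <= K" if "i < d" for i
  using CB_pd(1)[OF CB_pd(2)[OF u' that] that] CB_cont[OF CB_pd(2)[OF CB_pd(2)[OF u' that] that]]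
   CB_bound[OF CB_pd(2)[OF CB_pd(2)[OF u' that] that]] by auto
 have main: "(LINT x|nu. F (u x) * pd i (pd i u) x) - (LINT x|nu. b x i * (F (u x) * pd i u x))
   = - (LINT x|nu. F' (u x) * (pd i u x)^2) & integrable nu (%x. F (u x) * pd i (pd i u) x) &
   integrable nu (%x. b x i * (F (u x) * pd i u x)) & integrable nu (%x. F' (u x) * (pd i u x)^2)"
  if i: "i < d" for i
 proof -
  let ?w = "%x. F (u x) * pd i u x" and ?w' = "%x. F' (u x) * (pd i u x)^2 + F (u x) * pd i (pd i u) x"
  have bw: "abs (?w x) <= M * K" if "x : Rd d" for x
   unfolding abs_mult using bd[OF c[OF that]] p1(3)[OF i that] M by (intro mult_mono) auto
  have b1: "abs (F' (u x) * (pd i u x)^2) <= M * K^2" if "x : Rd d" for x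
  proof -
   have "(pd i u x)^2 <= K^2" using p1(3)[OF i that] by (metis abs_ge_zero power2_abs power_mono)
   thus ?thesis unfolding abs_mult using bd[OF c[OF that]] M by (intro mult_mono) auto
  qed
  have b2: "abs (F (u x) * pd i (pd i u) x) <= M * K" if "x : Rd d" for x
   unfolding abs_mult using bd[OF c[OF that]] p2(3)[OF i that] M by (intro mult_mono) auto
  have c1: "continuous_on (Rd d) (%x. F' (u x) * (pd i u x)^2)" "continuous_on (Rd d) (%x. F (u x) * pd i (pd i u) x)"
   "continuous_on (Rd d) ?w"
   using cFu p1(2)[OF i] p2(2)[OF i] by (intro continuous_intros; simp)+
  have i1: "integrable nu (%x. F' (u x) * (pd i u x)^2)" "integrable nu (%x. F (u x) * pd i (pd i u) x)"
   using integrable_bounded[OF c1(1) b1] integrable_bounded[OF c1(2) b2] by simp_all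
  have i2: "integrable nu (%x. b x i * ?w x)"
   by (rule integrable_drift_mult[OF i c1(3) bw])
  have "has_pd d i (%x. F (u x)) (%x. F' (u x) * pd i u x)" by (rule has_pd_comp1[OF p1(1)[OF i] F[OF c]])
  from has_pd_mult[OF this p2(1)[OF i]] have w: "has_pd d i ?w ?w'" by (simp add: power2_eq_square mult.assoc)
  have "(LINT x|nu. ?w' x) = (LINT x|nu. b x i * ?w x)"
  proof (rule gibbs_ibp[OF i bV[OF i] cb[OF i] integrable_drift[OF i] w c1(3), where K="M * K + M * K^2"])
   show "continuous_on (Rd d) ?w'" by (rule continuous_on_add[OF c1(1,2)])
   show "abs (?w x) <= M * K + M * K^2" if "x : Rd d" for x using bw[OF that] M by (simp add: add_increasing2)
   show "abs (?w' x) <= M * K + M * K^2" if "x : Rd d" for x using b1[OF that] b2[OF that] by linarith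
  qed
  thus ?thesis using i1 i2 by simp
 qed
 have gen: "F (u x) * generator d b u x = (\<Sum>i<d. F (u x) * pd i (pd i u) x) - (\<Sum>i<d. b x i * (F (u x) * pd i u x))" for x
  by (simp add: generator_def laplacian_def right_diff_distrib sum_distrib_left mult_ac)
 have gr: "F' (u x) * (norm_Rd d (grad d u x))^2 = (\<Sum>i<d. F' (u x) * (pd i u x)^2)" for x
  by (simp add: norm_Rd_grad_power2 sum_distrib_left)
 show "integrable nu (%x. F (u x) * generator d b u x)"
  unfolding gen using main by (intro Bochner_Integration.integrable_diff Bochner_Integration.integrable_sum) auto
 show "integrable nu (%x. F' (u x) * (norm_Rd d (grad d u x))^2)"
  unfolding gr using main by (intro Bochner_Integration.integrable_sum) auto
 have "(LINT x|nu. F (u x) * generator d b u x) =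
   (\<Sum>i<d. \<integral>x. F (u x) * pd i (pd i u) x \<partial>nu) - (\<Sum>i<d. \<integral>x. b x i * (F (u x) * pd i u x) \<partial>nu)"
  unfolding gen using main by (subst Bochner_Integration.integral_diff) (auto intro!: Bochner_Integration.integrable_sum)
 also have "... = (\<Sum>i<d. - (LINT x|nu. F' (u x) * (pd i u x)^2))"
  using main by (simp add: sum_subtractf[symmetric])
 also have "... = - (LINT x|nu. F' (u x) * (norm_Rd d (grad d u x))^2)"
  unfolding gr using main by (subst Bochner_Integration.integral_sum) (auto simp: sum_negf)
 finally show "(LINT x|nu. F (u x) * generator d b u x) = - (LINT x|nu. F' (u x) * (norm_Rd d (grad d u x))^2)" .
qed

end

section \<open>One Euler step is almost hypercontractive\<close>

lemma exp_remainder: 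
 fixes h :: real assumes "0 <= h"
 shows "exp h - 1 <= h * exp h" "exp h - 1 - h <= h^2 * exp h"
proof -
 have "1 - h <= exp (- h)" using exp_ge_add_one_self[of "- h"] by simp
 hence "exp h * (1 - h) <= exp h * exp (- h)" by (rule mult_left_mono) simp
 thus 1: "exp h - 1 <= h * exp h" by (simp add: exp_minus algebra_simps)
 have "h * (exp h - 1) <= h * (h * exp h)" using 1 assms by (rule mult_left_mono)
 thus "exp h - 1 - h <= h^2 * exp h" using 1 by (simp add: algebra_simps power2_eq_square)
qed

lemma exp_taylor2:
 fixes z z' \<Lambda> :: real
 assumes "z <= \<Lambda>" "z' <= \<Lambda>"
 shows "exp z' <= exp z + exp z * (z' - z) + exp \<Lambda> * (z' - z)^2"
proof -
 have "EX \<xi>. \<xi> <= \<Lambda> & abs (\<xi> - z) <= abs (z' - z) & exp z' - exp z = exp \<xi> * (z' - z)" if "z <= \<Lambda>" "z' <= \<Lambda>" for z z' :: real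
 proof (cases z z' rule: linorder_cases)
  case less
  from MVT2[OF less, of exp exp] obtain \<xi> where "z < \<xi>" "\<xi> < z'" "exp z' - exp z = (z' - z) * exp \<xi>" by auto
  thus ?thesis using that by (intro exI[of _ \<xi>]) (auto simp: mult.commute)
 next
  case equal thus ?thesis using that by (intro exI[of _ z]) auto
 next
  case greater
  from MVT2[OF greater, of exp exp] obtain \<xi> where \<xi>: "z' < \<xi>" "\<xi> < z" "exp z - exp z' = (z - z') * exp \<xi>" by auto
  hence "exp z' - exp z = exp \<xi> * (z' - z)" by (simp add: algebra_simps)
  thus ?thesis using \<xi> that by (intro exI[of _ \<xi>]) auto
 qed
 note mvt = this
 obtain \<xi> where \<xi>: "\<xi> <= \<Lambda>" "abs (\<xi> - z) <= abs (z' - z)" "exp z' - exp z = exp \<xi> * (z' - z)" using mvt[OF assms] by blast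
 obtain \<zeta> where \<zeta>: "\<zeta> <= \<Lambda>" "exp \<xi> - exp z = exp \<zeta> * (\<xi> - z)" using mvt[OF assms(1) \<xi>(1)] by blast
 have "exp z' - exp z - exp z * (z' - z) = exp \<zeta> * ((\<xi> - z) * (z' - z))"
 proof -
  have "exp z' - exp z - exp z * (z' - z) = (exp \<xi> - exp z) * (z' - z)" using \<xi>(3) by (simp only: left_diff_distrib)
  thus ?thesis by (simp only: \<zeta>(2) mult.assoc)
 qed
 also have "... <= exp \<Lambda> * abs ((\<xi> - z) * (z' - z))"
  using \<zeta>(1) by (intro order_trans[OF mult_left_mono mult_right_mono]) auto
 also have "abs ((\<xi> - z) * (z' - z)) <= abs (z' - z) * abs (z' - z)" unfolding abs_mult using \<xi>(2) by (intro mult_right_mono) auto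
 hence "exp \<Lambda> * abs ((\<xi> - z) * (z' - z)) <= exp \<Lambda> * (z' - z)^2" by (intro mult_left_mono) (auto simp: power2_eq_square)
 finally show ?thesis by simp
qed

text \<open>Writing powers as \<open>exp (q * ln u)\<close> lets base and exponent move at once.
  Concavity of the logarithm, \<open>ln u' - ln u <= (u' - u) / u\<close>, bounds the linear term
  from above; quadratic terms share one crude constant, since they only produce errors of higher
  order in the step.\<close>

lemma power_step:
 fixes u u' q q' :: real
 assumes c: "0 < c" and u: "c <= u" "u <= C" and u': "c <= u'" "u' <= C" and q: "0 <= q" "q <= q2" "0 <= q'" "q' <= q2"
  and Y: "abs (ln u) <= Y" "abs (ln u') <= Y"
 shows "exp (q' * ln u') <= exp (q * ln u) + exp (q * ln u) * ((q' - q) * ln u) + q' * (exp (q * ln u) / u * (u' - u))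
  + exp (q2 * Y) * (2 * (q' - q)^2 * Y^2 + 2 * q2^2 * (u' - u)^2 / c^2)"
proof -
 have up: "0 < u" "0 < u'" using c u u' by auto
 have q2: "0 <= q2" using q by simp
 have Y0: "0 <= Y" using Y by linarith
 have le: "p * ln v <= q2 * Y" if "0 <= p" "p <= q2" "abs (ln v) <= Y" for p v
 proof -
  have "p * ln v <= p * abs (ln v)" using that by (intro mult_left_mono) auto
  also have "... <= q2 * Y" using that Y0 by (intro mult_mono) auto
  finally show ?thesis .
 qed
 let ?z = "q * ln u" and ?z' = "q' * ln u'"
 have 1: "exp ?z' <= exp ?z + exp ?z * (?z' - ?z) + exp (q2 * Y) * (?z' - ?z)^2"
  using exp_taylor2[OF le[OF q(1,2) Y(1)] le[OF q(3,4) Y(2)]] .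
 have dz: "?z' - ?z = (q' - q) * ln u + q' * (ln u' - ln u)" by (simp add: algebra_simps)
 have ln1: "ln u' - ln u <= (u' - u) / u"
 proof -
  have "ln (u' / u) <= u' / u - 1" using up by (intro ln_le_minus_one) simp
  thus ?thesis using up by (simp add: ln_div diff_divide_distrib)
 qed
 have ln2: "abs (ln u' - ln u) <= abs (u' - u) / c"
 proof -
  have "ln u - ln u' <= (u - u') / u'"
  proof -
   have "ln (u / u') <= u / u' - 1" using up by (intro ln_le_minus_one) simp
   thus ?thesis using up by (simp add: ln_div diff_divide_distrib)
  qed
  also have "... <= abs (u' - u) / c" using up c u' by (intro frac_le) auto
  finally have a: "ln u - ln u' <= abs (u' - u) / c" .
  have "(u' - u) / u <= abs (u' - u) / c" using up c u by (intro frac_le) auto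
  thus ?thesis using a ln1 by linarith
 qed
 have "exp ?z * (?z' - ?z) <= exp ?z * ((q' - q) * ln u + q' * ((u' - u) / u))"
  unfolding dz using ln1 q by (intro mult_left_mono add_left_mono) auto
 moreover have "(?z' - ?z)^2 <= 2 * (q' - q)^2 * Y^2 + 2 * q2^2 * (u' - u)^2 / c^2"
 proof -
  have "(?z' - ?z)^2 <= 2 * ((q' - q) * ln u)^2 + 2 * (q' * (ln u' - ln u))^2"
   unfolding dz using sum_squares_bound[of "(q' - q) * ln u" "q' * (ln u' - ln u)"] by (simp add: power2_sum)
  moreover have "((q' - q) * ln u)^2 <= (q' - q)^2 * Y^2"
  proof -
   have "(ln u)^2 <= Y^2" using Y(1) by (metis abs_ge_zero power2_abs power_mono)
   thus ?thesis by (simp add: power_mult_distrib mult_left_mono)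
  qed
  moreover have "(q' * (ln u' - ln u))^2 <= q2^2 * ((u' - u)^2 / c^2)"
  proof -
   have "(ln u' - ln u)^2 <= (abs (u' - u) / c)^2" using ln2 by (metis abs_ge_zero power2_abs power_mono)
   hence "(ln u' - ln u)^2 <= (u' - u)^2 / c^2" by (simp only: power_divide power2_abs)
   moreover have "q'^2 <= q2^2" using q by (intro power_mono) auto
   ultimately show ?thesis unfolding power_mult_distrib by (intro mult_mono) auto
  qed
  ultimately show ?thesis by (simp add: mult.assoc)
 qed
 hence "exp (q2 * Y) * (?z' - ?z)^2 <= exp (q2 * Y) * (2 * (q' - q)^2 * Y^2 + 2 * q2^2 * (u' - u)^2 / c^2)"
  by (intro mult_left_mono) auto
 ultimately show ?thesis using 1 by (simp add: algebra_simps)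
qed

lemma CB_ln:
 assumes u: "LB d k K u" and c: "0 < c" "!!x. x : Rd d ==> c <= u x & u x <= C"
 shows "EX K'. CB d (Suc k) K' (%x. ln (u x))"
proof -
 define F where "F j y = (case j of 0 => ln y | Suc i => (-1) ^ i * fact i * (1 / y) ^ Suc i)" for j :: nat and y :: real
 have D: "(F j has_real_derivative F (Suc j) y) (at y)" if "y : {c..C}" for j y
 proof (cases j)
  case 0
  thus ?thesis using that c(1) by (auto simp: F_def[abs_def] intro!: derivative_eq_intros)
 next
  case (Suc i)
  have y: "0 < y" using that c(1) by simp
  have "((%x. 1 / x) has_real_derivative - (1 / y^2)) (at y)"
   using y by (auto intro!: derivative_eq_intros simp: power2_eq_square)
  from DERIV_cmult[OF DERIV_power[OF this, of "Suc i"], of "(-1) ^ i * fact i"]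
  have "((%y. (-1) ^ i * fact i * (1 / y) ^ Suc i) has_real_derivative
   (-1) ^ i * fact i * (real (Suc i) * (- (1 / y^2) * (1 / y) ^ i))) (at y)" by simp
  moreover have "(-1) ^ i * fact i * (real (Suc i) * (- (1 / y^2) * (1 / y) ^ i)) = F (Suc (Suc i)) y"
  proof -
   have eq: "1 / y^2 = (1 / y)^2" by (simp add: power_divide)
   show ?thesis unfolding eq by (simp add: F_def power2_eq_square mult_ac del: power_one_over)
  qed
  ultimately show ?thesis using Suc by (simp add: F_def[abs_def])
 qed
 have "EX K'. CB d (Suc k) K' (%x. F 0 (u x))"
  by (rule CB_comp_compact[where S="{c..C}"]) (use D c u in auto)
 thus ?thesis by (simp add: F_def)
qed

context gibbs_flow
begin

interpretation prob_space nu by (rule prob_space_gibbs)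

text \<open>This is \<open>lsi_exp\<close> for \<open>q * ln u\<close>. Normalizing the
  \<open>q\<close>-th moment to 1 removes the logarithm of the mean; \<open>hc_step\<close> restores
  generality by homogeneity.\<close>

lemma lsi_power:
 assumes u: "CB d 3 K u" and c: "0 < c" "!!x. x : Rd d ==> c <= u x & u x <= C"
  and one: "(LINT x|nu. exp (q * ln (u x))) = 1"
 shows "rho * (q * (LINT x|nu. exp (q * ln (u x)) * ln (u x))) <=
  q^2 / 4 * (LINT x|nu. exp (q * ln (u x)) / (u x)^2 * (norm_Rd d (grad d u x))^2)"
proof -
 have u3: "CB d (Suc 2) K u" using u by (simp add: eval_nat_numeral)
 obtain K' where "CB d (Suc 2) K' (%x. ln (u x))" using CB_ln[OF CB_imp_LB[OF u3] c] by blast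
 hence g: "CB d (Suc 2) (abs q * K') (%x. q * ln (u x))" by (rule CB_cmult)
 have gr: "exp (q * ln (u x)) * (norm_Rd d (grad d (%x. q * ln (u x)) x))^2 =
   q^2 * (exp (q * ln (u x)) / (u x)^2 * (norm_Rd d (grad d u x))^2)" if x: "x : Rd d" for x
 proof -
  have "pd i (%x. q * ln (u x)) x = q / u x * pd i u x" if i: "i < d" for i
  proof -
   have "has_pd d i (%x. ln (u x)) (%x. 1 / u x * pd i u x)"
    by (rule has_pd_comp1[OF CB_pd(1)[OF u3 i], of ln "%y. 1 / y"])
     (use c in \<open>force intro!: derivative_eq_intros\<close>)
   from has_pd_imp_pd[OF has_pd_cmult[OF this] x] show ?thesis by simp
  qed
  hence "(norm_Rd d (grad d (%x. q * ln (u x)) x))^2 = (\<Sum>i<d. (q / u x)^2 * (pd i u x)^2)"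
   unfolding norm_Rd_grad_power2 by (intro sum.cong refl) (simp add: power_mult_distrib power_divide)
  thus ?thesis by (simp add: norm_Rd_grad_power2 sum_distrib_left sum_divide_distrib power_divide mult_ac)
 qed
 have "rho * ((LINT x|nu. (q * ln (u x)) * exp (q * ln (u x))) - 1 * ln 1)
   <= (LINT x|nu. exp (q * ln (u x)) * (norm_Rd d (grad d (%x. q * ln (u x)) x))^2) / 4"
  using lsi_exp[OF g] one by simp
 also have "(LINT x|nu. exp (q * ln (u x)) * (norm_Rd d (grad d (%x. q * ln (u x)) x))^2) =
   (LINT x|nu. q^2 * (exp (q * ln (u x)) / (u x)^2 * (norm_Rd d (grad d u x))^2))"
  by (intro Bochner_Integration.integral_cong refl gr) simp
 also have "... = q^2 * (LINT x|nu. exp (q * ln (u x)) / (u x)^2 * (norm_Rd d (grad d u x))^2)"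
  by (rule integral_mult_right_zero)
 also have "(LINT x|nu. (q * ln (u x)) * exp (q * ln (u x))) = (LINT x|nu. q * (exp (q * ln (u x)) * ln (u x)))"
  by (simp only: mult_ac)
 also have "... = q * (LINT x|nu. exp (q * ln (u x)) * ln (u x))" by (rule integral_mult_right_zero)
 finally show ?thesis by simp
qed

text \<open>The part of \<open>B - b\<close> in the generator is absorbed by the fraction \<open>eta\<close> of the Dirichlet form,
 which costs the factor \<open>1 - eta\<close> in the rate.\<close>

lemma hc_normalized:
 assumes d: "d >= 1" and c: "0 < c" "c <= C" and q2: "1 < q2" and eta: "0 < eta" "eta < 1" and M: "0 <= M" and K: "0 <= K"
 shows "EX A>=0. ALL delta B beta u q. 0 <= delta --> delta <= 1 --> drift d M B --> 0 <= beta -->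
  (ALL x:Rd d. norm_Rd d (%i. B x i - b x i) <= beta) --> CB d 3 K u --> (ALL x:Rd d. c <= u x & u x <= C) -->
  1 < q --> 1 + (q - 1) * exp (4 * rho * (1 - eta) * delta) <= q2 --> (LINT x|nu. exp (q * ln (u x))) = 1 -->
  (LINT x|nu. exp ((1 + (q - 1) * exp (4 * rho * (1 - eta) * delta)) * ln (euler_step d B delta u x)))
   <= 1 + delta * (q * beta^2 / (4 * eta * (q - 1))) + A * (delta * sqrt delta)"
proof -
 define a where "a = 4 * rho * (1 - eta)"
 have a: "0 <= a" using rho eta by (simp add: a_def)
 define Y where "Y = max \<bar>ln c\<bar> \<bar>ln C\<bar>"
 define W where "W = exp (q2 * Y)"
 define S1 where "S1 = (real d * M + 2 * real d) * K"
 define S2 where "S2 = ((real d * M)^2 + 4 * (real d)^2 + (real d)^2 * M) * K"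
 define a' where "a' = q2 * (a * exp a)"
 \<comment> \<open>The summands are the errors in \<open>point\<close>: linearizing the exponent
   (\<open>t1\<close>), replacing the step by the generator (\<open>t2\<close>, two summands), and
   the quadratic remainder of \<open>power_step\<close> (\<open>t3\<close>).\<close>
 define A0 where "A0 = W * Y * (q2 * (a^2 * exp a)) + a' * (W / c) * S1 + q2 * (W / c) * S2 +
  W * (2 * a'^2 * Y^2 + 2 * q2^2 * S1^2 / c^2)"
 define A where "A = A0 * (LINT x|nu. (1 + norm_Rd d x)^2)"
 have nn: "0 <= Y" "0 <= W" "0 <= S1" "0 <= S2" "0 <= a'" using M K a q2 by (auto simp: Y_def W_def S1_def S2_def a'_def)
 have A0: "0 <= A0" using nn c q2 by (simp add: A0_def)
 have lnY: "abs (ln v) <= Y" if "c <= v" "v <= C" for v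
 proof -
  have "ln c <= ln v" "ln v <= ln C" using that c by auto
  thus ?thesis by (auto simp: Y_def abs_le_iff max_def)
 qed
 show ?thesis
 proof (intro exI[of _ A] conjI allI impI)
  show "0 <= A" using A0 by (simp add: A_def)
  fix delta B beta u q
  assume delta: "0 <= delta" "delta <= 1" and B: "drift d M B" and beta: "0 <= beta"
   and Bb: "ALL x:Rd d. norm_Rd d (%i. B x i - b x i) <= beta" and u: "CB d 3 K u"
   and ur: "ALL x:Rd d. c <= u x & u x <= C" and q: "1 < q"
   and q'2: "1 + (q - 1) * exp (4 * rho * (1 - eta) * delta) <= q2" and one: "(LINT x|nu. exp (q * ln (u x))) = 1"
  define q' where "q' = 1 + (q - 1) * exp (a * delta)"
  define U where "U x = exp (q * ln (u x))" for x
  define u' where "u' = euler_step d B delta u"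
  define G where "G x = (norm_Rd d (grad d u x))^2" for x
  let ?N = "%x. 1 + norm_Rd d x"
  have u3: "CB d (Suc (Suc (Suc 0))) K u" using u by (simp add: numeral_3_eq_3)
  have cu: "continuous_on (Rd d) u" by (rule CB_cont[OF u])
  have "1 <= exp (a * delta)" using a delta by simp
  hence "(q - 1) * 1 <= (q - 1) * exp (a * delta)" using q by (intro mult_left_mono) auto
  hence q'q: "q <= q'" by (simp add: q'_def)
  have q'2: "q' <= q2" using q'2 by (simp add: q'_def a_def)
  have qs: "0 <= q" "q <= q2" "0 <= q'" using q q'q q'2 by auto
  have lnq: "q * ln v <= q2 * Y" if "c <= v" "v <= C" for v
  proof -
   have "q * ln v <= q * abs (ln v)" using qs by (intro mult_left_mono) auto
   also have "... <= q2 * Y" using lnY[OF that] qs by (intro mult_mono) auto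
   finally show ?thesis .
  qed
  have aexp: "exp (a * delta) <= exp a" "0 <= a * delta" using a delta by (auto simp: mult_left_le)
  have dq: "0 <= q' - q" "q' - q <= a' * delta"
  proof -
   show "0 <= q' - q" using q'q by simp
   have "q' - q = (q - 1) * (exp (a * delta) - 1)" by (simp add: q'_def algebra_simps)
   also have "... <= q2 * (a * delta * exp a)"
   proof (rule mult_mono)
    have "a * delta * exp (a * delta) <= a * delta * exp a" using aexp by (intro mult_left_mono) auto
    thus "exp (a * delta) - 1 <= a * delta * exp a" using exp_remainder(1)[OF aexp(2)] by linarith
   qed (use q qs aexp in auto)
   finally show "q' - q <= a' * delta" by (simp add: a'_def mult_ac)
  qed
  have dd: "delta * delta <= delta * sqrt delta" "0 <= delta * sqrt delta"
  proof -
   have "delta <= sqrt delta" using delta by (intro real_le_rsqrt) (simp add: power2_eq_square mult_left_le)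
   thus "delta * delta <= delta * sqrt delta" using delta by (intro mult_left_mono)
   show "0 <= delta * sqrt delta" using delta by simp
  qed
  have point: "exp (q' * ln (u' x)) <= U x + delta * (a * (q - 1) * (U x * ln (u x)) + q * (U x / u x * generator d b u x)
    + q * (eta * (q - 1)) * (U x / (u x)^2 * G x) + q * beta^2 / (4 * eta * (q - 1)) * U x)
    + A0 * (delta * sqrt delta) * (?N x)^2" if x: "x : Rd d" for x
  proof -
   have ux: "c <= u x" "u x <= C" using ur x by auto
   hence up: "0 < u x" using c by simp
   have u'x: "c <= u' x" "u' x <= C" using euler_step_range[OF d, of c u C B delta x] ur unfolding u'_def by auto
   note Yx = lnY[OF ux] lnY[OF u'x]
   have Ux: "0 <= U x" "U x <= W"
   proof -
    have "q * ln (u x) <= q2 * Y" by (rule lnq[OF ux])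
    thus "U x <= W" by (simp add: U_def W_def)
   qed (simp add: U_def)
   have UW: "0 <= U x / u x" "U x / u x <= W / c" using Ux ux c up by (auto intro!: frac_le)
   have N: "1 <= ?N x" "1 <= (?N x)^2" "?N x <= (?N x)^2" "0 <= (?N x)^2"
    using one_le_power[of "?N x" 2] mult_left_mono[of 1 "?N x" "?N x"] by (auto simp: power2_eq_square)
   have s1: "abs (u' x - u x) <= S1 * delta * ?N x" and s2: "abs (u' x - u x - delta * generator d B u x) <= S2 * (delta * sqrt delta) * (?N x)^2"
    using euler_step_consistency[OF d B u delta x] by (simp_all add: u'_def S1_def S2_def)
   define gamma where "gamma = delta * sqrt delta * (?N x)^2"
   have d2: "delta * delta <= gamma" "delta * delta * ?N x <= gamma" "delta * delta * (?N x)^2 <= gamma"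
   proof -
    show 3: "delta * delta * (?N x)^2 <= gamma" unfolding gamma_def using dd N by (intro mult_right_mono) auto
    have "0 <= delta * delta" by simp
    hence "delta * delta * 1 <= delta * delta * (?N x)^2" "delta * delta * ?N x <= delta * delta * (?N x)^2" using N by (intro mult_left_mono; simp)+
    thus "delta * delta <= gamma" "delta * delta * ?N x <= gamma" using 3 by linarith+
   qed
   have t0: "exp (q' * ln (u' x)) <= U x + U x * ((q' - q) * ln (u x)) + q' * (U x / u x * (u' x - u x))
    + W * (2 * (q' - q)^2 * Y^2 + 2 * q2^2 * (u' x - u x)^2 / c^2)"
    using power_step[OF c(1) ux u'x qs(1,2,3) q'2 Yx] by (simp add: U_def W_def)
   have t1: "U x * ((q' - q) * ln (u x)) <= delta * (a * (q - 1) * (U x * ln (u x))) + W * Y * (q2 * (a^2 * exp a)) * gamma"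
   proof -
    define r where "r = (q - 1) * (exp (a * delta) - 1 - a * delta)"
    have e0: "0 <= exp (a * delta) - 1 - a * delta" using exp_ge_add_one_self[of "a * delta"] by linarith
    have r0: "0 <= r" unfolding r_def using q e0 by (intro mult_nonneg_nonneg) auto
    have "exp (a * delta) - 1 - a * delta <= (a * delta)^2 * exp (a * delta)" by (rule exp_remainder(2)[OF aexp(2)])
    also have "... <= (a * delta)^2 * exp a" using aexp by (intro mult_left_mono) auto
    finally have "r <= q2 * ((a * delta)^2 * exp a)" unfolding r_def using q qs e0 by (intro mult_mono) linarith+
    hence r1: "r <= q2 * (a^2 * exp a) * (delta * delta)" by (simp add: power2_eq_square mult_ac)
    have "U x * ((q' - q) * ln (u x)) = delta * (a * (q - 1) * (U x * ln (u x))) + U x * ln (u x) * r"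
     by (simp add: q'_def r_def algebra_simps)
    moreover have "U x * ln (u x) * r <= W * Y * (q2 * (a^2 * exp a)) * gamma"
    proof -
     have "U x * ln (u x) <= U x * abs (ln (u x))" using Ux by (intro mult_left_mono) auto
     also have "... <= W * Y" using Ux Yx nn by (intro mult_mono) auto
     finally have "U x * ln (u x) * r <= W * Y * r" using r0 by (rule mult_right_mono)
     also have "... <= W * Y * (q2 * (a^2 * exp a) * (delta * delta))" using r1 nn by (intro mult_left_mono) auto
     also have "... = W * Y * (q2 * (a^2 * exp a)) * (delta * delta)" by (simp add: mult_ac)
     also have "... <= W * Y * (q2 * (a^2 * exp a)) * gamma" using d2(1) nn q2 by (intro mult_left_mono) auto
     finally show ?thesis .
    qed
    ultimately show ?thesis by linarith
   qed
   have t2: "q' * (U x / u x * (u' x - u x)) <= delta * (q * (U x / u x * generator d B u x)) +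
    a' * (W / c) * S1 * gamma + q2 * (W / c) * S2 * gamma"
   proof -
    have "q' * (U x / u x * (u' x - u x)) = (q' - q) * (U x / u x) * (u' x - u x) +
     q * (U x / u x) * (u' x - u x - delta * generator d B u x) + delta * (q * (U x / u x * generator d B u x))"
    proof -
     have "q' * (v * h) = (q' - q) * v * h + q * v * (h - delta * g) + delta * (q * (v * g))" for v h g
      by (simp add: algebra_simps)
     thus ?thesis .
    qed
    moreover have "(q' - q) * (U x / u x) * (u' x - u x) <= a' * (W / c) * S1 * gamma"
    proof -
     have "(q' - q) * (U x / u x) * (u' x - u x) <= (q' - q) * (U x / u x) * abs (u' x - u x)"
      by (rule mult_left_mono[OF abs_ge_self mult_nonneg_nonneg[OF dq(1) UW(1)]])
     also have "... <= (a' * delta) * (W / c) * (S1 * delta * ?N x)"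
      by (rule mult_mono[OF mult_mono[OF dq(2) UW(2) _ UW(1)] s1]) (use nn delta c in auto)
     also have "... = a' * (W / c) * S1 * (delta * delta * ?N x)" by (simp add: mult_ac)
     also have "... <= a' * (W / c) * S1 * gamma" using d2(2) nn c by (intro mult_left_mono) auto
     finally show ?thesis .
    qed
    moreover have "q * (U x / u x) * (u' x - u x - delta * generator d B u x) <= q2 * (W / c) * S2 * gamma"
    proof -
     have "q * (U x / u x) * (u' x - u x - delta * generator d B u x) <= q * (U x / u x) * abs (u' x - u x - delta * generator d B u x)"
      by (rule mult_left_mono[OF abs_ge_self mult_nonneg_nonneg[OF qs(1) UW(1)]])
     also have "... <= q2 * (W / c) * (S2 * (delta * sqrt delta) * (?N x)^2)"
      by (rule mult_mono[OF mult_mono[OF qs(2) UW(2) _ UW(1)] s2]) (use nn qs q2 c in auto)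
     also have "... = q2 * (W / c) * S2 * gamma" by (simp add: gamma_def mult_ac)
     finally show ?thesis .
    qed
    ultimately show ?thesis by linarith
   qed
   have t3: "W * (2 * (q' - q)^2 * Y^2 + 2 * q2^2 * (u' x - u x)^2 / c^2)
    <= W * (2 * a'^2 * Y^2 + 2 * q2^2 * S1^2 / c^2) * gamma"
   proof -
    have "(q' - q)^2 <= (a' * delta)^2" using dq by (intro power_mono) auto
    also have "... = a'^2 * (delta * delta)" by (simp add: power2_eq_square mult_ac)
    also have "... <= a'^2 * gamma" using d2(1) by (intro mult_left_mono) auto
    finally have x1: "2 * (q' - q)^2 * Y^2 <= 2 * (a'^2 * gamma) * Y^2" by (intro mult_right_mono mult_left_mono) auto
    have "(u' x - u x)^2 <= (S1 * delta * ?N x)^2" using s1 by (metis abs_ge_zero power2_abs power_mono)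
    also have "... = S1^2 * (delta * delta * (?N x)^2)" by (simp add: power2_eq_square mult_ac)
    also have "... <= S1^2 * gamma" using d2(3) by (intro mult_left_mono) auto
    finally have x2: "2 * q2^2 * (u' x - u x)^2 / c^2 <= 2 * q2^2 * (S1^2 * gamma) / c^2"
     by (intro divide_right_mono mult_left_mono) auto
    have "W * (2 * (q' - q)^2 * Y^2 + 2 * q2^2 * (u' x - u x)^2 / c^2) <=
     W * (2 * (a'^2 * gamma) * Y^2 + 2 * q2^2 * (S1^2 * gamma) / c^2)"
     using x1 x2 nn by (intro mult_left_mono add_mono)
    thus ?thesis by (simp add: algebra_simps)
   qed
   have t4: "U x / u x * generator d B u x <= U x / u x * generator d b u x
    + eta * (q - 1) * (U x / (u x)^2 * G x) + beta^2 / (4 * eta * (q - 1)) * U x"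
   proof -
    define s where "s = sqrt (G x)"
    have s: "0 <= s" "s = norm_Rd d (grad d u x)" "s^2 = G x" by (auto simp: s_def G_def)
    have "generator d B u x = generator d b u x - (\<Sum>i<d. (B x i - b x i) * pd i u x)"
     by (simp add: generator_def left_diff_distrib sum_subtractf)
    moreover have "abs (\<Sum>i<d. (B x i - b x i) * pd i u x) <= beta * s"
    proof -
     have "abs (\<Sum>i<d. (B x i - b x i) * grad d u x i) <= norm_Rd d (%i. B x i - b x i) * norm_Rd d (grad d u x)"
      by (rule Cauchy_Schwarz_Rd)
     also have "... <= beta * s" unfolding s(2) using Bb x by (intro mult_right_mono) auto
     finally show ?thesis by (simp add: grad_def)
    qed
    ultimately have "generator d B u x <= generator d b u x + beta * s" by linarith
    hence g1: "U x / u x * generator d B u x <= U x / u x * generator d b u x + U x / u x * (beta * s)"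
     using UW(1) mult_left_mono[of _ _ "U x / u x"] by (simp only: distrib_left[symmetric])
    \<comment> \<open>Young's inequality with weight \<open>eta * (q - 1)\<close>: the Dirichlet
      form enters the balance with the factor \<open>q - 1\<close>, so exactly the fraction
      \<open>eta\<close> of it is spent.\<close>
    define e where "e = eta * (q - 1)"
    have e: "0 < e" using eta q by (simp add: e_def)
    have "beta * (s / u x) <= e * (s / u x)^2 + beta^2 / (4 * e)"
    proof -
     have "0 <= (2 * e * (s / u x) - beta)^2" by simp
     also have "(2 * e * (s / u x) - beta)^2 = 4 * e * (e * (s / u x)^2 + beta^2 / (4 * e) - beta * (s / u x))"
      using e by (simp add: power2_eq_square algebra_simps)
     finally show ?thesis using e by (simp add: zero_le_mult_iff)
    qed
    hence "U x * (beta * (s / u x)) <= U x * (e * (s / u x)^2 + beta^2 / (4 * e))" using Ux(1) by (rule mult_left_mono)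
    hence "U x / u x * (beta * s) <= e * (U x / (u x)^2 * G x) + beta^2 / (4 * e) * U x"
     by (simp add: s(3)[symmetric] power_divide algebra_simps)
    thus ?thesis using g1 by (simp add: e_def mult.assoc)
   qed
   have "q * (U x / u x * generator d B u x) <= q * (U x / u x * generator d b u x)
    + q * (eta * (q - 1)) * (U x / (u x)^2 * G x) + q * beta^2 / (4 * eta * (q - 1)) * U x"
    using mult_left_mono[OF t4 qs(1)] by (simp add: distrib_left mult.assoc)
   hence "delta * (q * (U x / u x * generator d B u x)) <= delta * (q * (U x / u x * generator d b u x)
    + q * (eta * (q - 1)) * (U x / (u x)^2 * G x) + q * beta^2 / (4 * eta * (q - 1)) * U x)"
    using delta(1) by (rule mult_left_mono)
   moreover have "A0 * (delta * sqrt delta) * (?N x)^2 = W * Y * (q2 * (a^2 * exp a)) * gamma + a' * (W / c) * S1 * gamma + q2 * (W / c) * S2 * gamma +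
     W * (2 * a'^2 * Y^2 + 2 * q2^2 * S1^2 / c^2) * gamma"
    by (simp add: A0_def gamma_def algebra_simps)
   ultimately show ?thesis using t0 t1 t2 t3 by (simp only: distrib_left)
  qed
  note lsi = lsi_power[OF u c(1), of C q, OF _ one]
  let ?F = "%y. exp (q * ln y) / y" and ?F' = "%y. (q - 1) * (exp (q * ln y) / y^2)"
  have DF: "(?F has_real_derivative ?F' y) (at y)" if "y : {c..C}" for y
  proof -
   have y: "0 < y" using that c by simp
   thus ?thesis by (auto intro!: derivative_eq_intros simp: field_simps power2_eq_square)
  qed
  have cF: "continuous_on {c..C} ?F" "continuous_on {c..C} ?F'"
   using c by (intro continuous_intros; auto)+
  have "EX R. ALL y:{c..C}. abs (?F y) <= R & abs (?F' y) <= R"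
  proof -
   have "bounded (?F ` {c..C})" "bounded (?F' ` {c..C})"
    using cF by (intro compact_imp_bounded compact_continuous_image; simp)+
   then obtain R1 R2 where "ALL z:?F ` {c..C}. norm z <= R1" "ALL z:?F' ` {c..C}. norm z <= R2"
    unfolding bounded_iff by blast
   thus ?thesis by (intro exI[of _ "max R1 R2"]) (auto simp: le_max_iff_disj)
  qed
  then obtain R where R: "!!y. y : {c..C} ==> abs (?F y) <= R & abs (?F' y) <= R" by blast
  have uS: "u x : {c..C}" if "x : Rd d" for x using ur that by auto
  note ibp = generator_ibp[OF u uS DF cF(2) R]
  define X where "X = (LINT x|nu. U x / (u x)^2 * G x)"
  have iX: "integrable nu (%x. U x / (u x)^2 * G x)"
  proof -
   have "integrable nu (%x. 1 / (q - 1) * ((q - 1) * (U x / (u x)^2) * G x))"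
    using ibp(3) by (intro integrable_mult_right) (simp add: U_def G_def)
   thus ?thesis using q by simp
  qed
  have igen: "integrable nu (%x. U x / u x * generator d b u x)" using ibp(2) by (simp add: U_def)
  have gen: "(LINT x|nu. U x / u x * generator d b u x) = - ((q - 1) * X)"
  proof -
   have "(LINT x|nu. U x / u x * generator d b u x) = - (LINT x|nu. (q - 1) * (U x / (u x)^2 * G x))"
    using ibp(1) by (simp add: U_def G_def mult.assoc)
   also have "(LINT x|nu. (q - 1) * (U x / (u x)^2 * G x)) = (q - 1) * X"
    unfolding X_def by (rule integral_mult_right_zero)
   finally show ?thesis .
  qed
  have cU: "continuous_on (Rd d) U" unfolding U_def using cu ur c by (intro continuous_intros) (auto dest!: bspec)
  have bU: "abs (U x) <= W" and bUl: "abs (U x * ln (u x)) <= W * Y" if "x : Rd d" for x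
  proof -
   have ux: "c <= u x" "u x <= C" using ur that by auto
   have "q * ln (u x) <= q2 * Y" by (rule lnq[OF ux])
   thus 1: "abs (U x) <= W" by (simp add: U_def W_def)
   show "abs (U x * ln (u x)) <= W * Y" unfolding abs_mult using 1 lnY[OF ux] nn by (intro mult_mono) auto
  qed
  have iU: "integrable nu U" by (rule integrable_bounded[OF cU bU])
  have iUl: "integrable nu (%x. U x * ln (u x))"
  proof (rule integrable_bounded[OF _ bUl])
   have "continuous_on (Rd d) (%x. ln (u x))" using ur c by (intro continuous_on_ln cu) force
   thus "continuous_on (Rd d) (%x. U x * ln (u x))" by (intro continuous_on_mult cU)
  qed
  define L where "L = (LINT x|nu. U x * ln (u x))"
  \<comment> \<open>The rate \<open>a\<close> is chosen so that the entropy created by the growing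
    exponent is covered, through the logarithmic Sobolev inequality, by the remaining fraction
    \<open>1 - eta\<close> of the Dirichlet form.\<close>
  have L: "a * (q - 1) * L <= q * (q - 1) * (1 - eta) * X"
  proof -
   have "rho * (q * L) <= q^2 / 4 * X" using lsi ur by (simp add: L_def X_def U_def G_def)
   hence "q * (4 * rho * L) <= q * (q * X)" by (simp add: power2_eq_square mult_ac)
   hence "4 * rho * L <= q * X" using q by simp
   hence "((1 - eta) * (q - 1)) * (4 * rho * L) <= ((1 - eta) * (q - 1)) * (q * X)" using eta q by (intro mult_left_mono) auto
   moreover have "a * (q - 1) * L = ((1 - eta) * (q - 1)) * (4 * rho * L)" by (simp add: a_def)
   moreover have "q * (q - 1) * (1 - eta) * X = ((1 - eta) * (q - 1)) * (q * X)" by simp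
   ultimately show ?thesis by linarith
  qed
  have IU: "(LINT x|nu. U x) = 1" using one by (simp add: U_def)
  define rhs where "rhs x = U x + delta * (a * (q - 1) * (U x * ln (u x)) + q * (U x / u x * generator d b u x)
    + q * (eta * (q - 1)) * (U x / (u x)^2 * G x) + q * beta^2 / (4 * eta * (q - 1)) * U x)
    + A0 * (delta * sqrt delta) * (?N x)^2" for x
  have irhs: "integrable nu rhs" unfolding rhs_def
   using iU iUl igen iX integrable_norm_power2(1)
   by (intro Bochner_Integration.integrable_add integrable_mult_right) auto
  have "(LINT x|nu. exp (q' * ln (u' x))) <= (LINT x|nu. rhs x)"
  proof (rule integral_mono'[OF irhs])
   fix x assume "x : space nu"
   hence "exp (q' * ln (u' x)) <= rhs x" unfolding rhs_def by (intro point) simp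
   thus "exp (q' * ln (u' x)) <= rhs x" "0 <= rhs x" using exp_gt_zero[of "q' * ln (u' x)"] by linarith+
  qed
  also have "... = 1 + delta * (a * (q - 1) * L + q * (- ((q - 1) * X)) + q * (eta * (q - 1)) * X + q * beta^2 / (4 * eta * (q - 1)) * 1)
    + A * (delta * sqrt delta)"
  proof -
   have "(LINT x|nu. f0 x + delta * (k1 * f1 x + k2 * f2 x + k3 * f3 x + k4 * f0 x) + k5 * f5 x) =
    integral\<^sup>L nu f0 + delta * (k1 * integral\<^sup>L nu f1 + k2 * integral\<^sup>L nu f2 + k3 * integral\<^sup>L nu f3 + k4 * integral\<^sup>L nu f0) + k5 * integral\<^sup>L nu f5"
    if "integrable nu f0" "integrable nu f1" "integrable nu f2" "integrable nu f3" "integrable nu f5"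
    for f0 f1 f2 f3 f5 and k1 k2 k3 k4 k5 :: real
    using that by simp
   note lin = this[OF iU iUl igen iX integrable_norm_power2(1)]
   have "A * (delta * sqrt delta) = A0 * (delta * sqrt delta) * (LINT x|nu. (?N x)^2)" by (simp add: A_def)
   thus ?thesis unfolding rhs_def lin by (simp only: gen IU L_def X_def)
  qed
  also have "... <= 1 + delta * (q * beta^2 / (4 * eta * (q - 1))) + A * (delta * sqrt delta)"
  proof -
   have "a * (q - 1) * L + q * (- ((q - 1) * X)) + q * (eta * (q - 1)) * X <= 0"
    using L by (simp add: algebra_simps)
   hence "delta * (a * (q - 1) * L + q * (- ((q - 1) * X)) + q * (eta * (q - 1)) * X + q * beta^2 / (4 * eta * (q - 1)) * 1)
    <= delta * (q * beta^2 / (4 * eta * (q - 1)))" using delta(1) by (intro mult_left_mono) linarith+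
   thus ?thesis by linarith
  qed
  finally show "(LINT x|nu. exp ((1 + (q - 1) * exp (4 * rho * (1 - eta) * delta)) * ln (euler_step d B delta u x)))
   <= 1 + delta * (q * beta^2 / (4 * eta * (q - 1))) + A * (delta * sqrt delta)"
   by (simp add: q'_def u'_def a_def)
 qed
qed

text \<open>For positive \<open>u\<close> this is the logarithm of the norm of \<open>u\<close> in
  L^q with respect to \<open>nu\<close>.\<close>

definition log_norm :: "real => (vec => real) => real" where
 "log_norm q u = ln (LINT x|nu. exp (q * ln (u x))) / q"

lemma integrable_power:
 fixes u :: "vec => real" and q :: real
 assumes u: "continuous_on (Rd d) u" and c: "0 < c" "!!x. x : Rd d ==> c <= u x & u x <= C" and q: "0 <= q"
 shows "integrable nu (%x. exp (q * ln (u x)))"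
proof (rule integrable_bounded)
 show "continuous_on (Rd d) (%x. exp (q * ln (u x)))"
  using c by (intro continuous_intros u) force
 fix x assume "x : Rd d"
 hence "ln (u x) <= ln C" using c(1) c(2)[of x] by auto
 thus "abs (exp (q * ln (u x))) <= exp (q * ln C)" using q by (simp add: mult_left_mono)
qed

lemma power_mean_bounds:
 fixes u :: "vec => real" and q :: real
 assumes u: "continuous_on (Rd d) u" and c: "0 < c" "!!x. x : Rd d ==> c <= u x & u x <= C" and q: "0 <= q"
 shows "exp (q * ln c) <= (LINT x|nu. exp (q * ln (u x)))" "(LINT x|nu. exp (q * ln (u x))) <= exp (q * ln C)"
proof -
 note i = integrable_power[OF u c q]
 have b: "ln c <= ln (u x)" "ln (u x) <= ln C" if "x : Rd d" for x
  using c(1) c(2)[OF that] by auto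
 have "(LINT x|nu. exp (q * ln c)) <= (LINT x|nu. exp (q * ln (u x)))"
  using b q by (intro integral_mono i) (auto intro: mult_left_mono)
 thus "exp (q * ln c) <= (LINT x|nu. exp (q * ln (u x)))" using prob_space by simp
 have "(LINT x|nu. exp (q * ln (u x))) <= (LINT x|nu. exp (q * ln C))"
  using b q by (intro integral_mono i) (auto intro: mult_left_mono)
 thus "(LINT x|nu. exp (q * ln (u x))) <= exp (q * ln C)" using prob_space by simp
qed

text \<open>Both sides change by the same additive constant when \<open>u\<close> is scaled, so
  \<open>u\<close> is divided by its norm \<open>s\<close>. Because \<open>s\<close> lies in
  \<open>[c, C]\<close>, the scaled function obeys the bounds \<open>c / C\<close>,
  \<open>C / c\<close> and \<open>K / c\<close>, which do not depend on \<open>u\<close>, and one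
  \<open>A\<close> serves all functions.\<close>

lemma hc_step:
 assumes d: "d >= 1" and c: "0 < c" "c <= C" and q2: "1 < q2" and eta: "0 < eta" "eta < 1" and M: "0 <= M" and K: "0 <= K"
 shows "EX A>=0. ALL delta B beta u q. 0 <= delta --> delta <= 1 --> drift d M B --> 0 <= beta -->
  (ALL x:Rd d. norm_Rd d (%i. B x i - b x i) <= beta) --> CB d 3 K u --> (ALL x:Rd d. c <= u x & u x <= C) -->
  1 < q --> 1 + (q - 1) * exp (4 * rho * (1 - eta) * delta) <= q2 -->
  log_norm (1 + (q - 1) * exp (4 * rho * (1 - eta) * delta)) (euler_step d B delta u)
   <= log_norm q u + delta * (beta^2 / (4 * eta * (q - 1))) + A * (delta * sqrt delta)"
proof -
 have c': "0 < c / C" "c / C <= C / c"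
 proof -
  show "0 < c / C" using c by simp
  have "c / C <= 1" "1 <= C / c" using c by auto
  thus "c / C <= C / c" by linarith
 qed
 have K': "0 <= K / c" using K c by simp
 obtain A where A: "0 <= A" "!!delta B beta u q. 0 <= delta ==> delta <= 1 ==> drift d M B ==> 0 <= beta ==>
  (ALL x:Rd d. norm_Rd d (%i. B x i - b x i) <= beta) ==> CB d 3 (K / c) u ==> (ALL x:Rd d. c / C <= u x & u x <= C / c) ==>
  1 < q ==> 1 + (q - 1) * exp (4 * rho * (1 - eta) * delta) <= q2 ==> (LINT x|nu. exp (q * ln (u x))) = 1 ==>
  (LINT x|nu. exp ((1 + (q - 1) * exp (4 * rho * (1 - eta) * delta)) * ln (euler_step d B delta u x)))
   <= 1 + delta * (q * beta^2 / (4 * eta * (q - 1))) + A * (delta * sqrt delta)"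
  using hc_normalized[OF d c' q2 eta M K'] by blast
 show ?thesis
 proof (intro exI[of _ A] conjI allI impI A(1))
  fix delta B beta u q
  assume delta: "0 <= delta" "delta <= 1" and B: "drift d M B" and beta: "0 <= beta"
   and Bb: "ALL x:Rd d. norm_Rd d (%i. B x i - b x i) <= beta" and u: "CB d 3 K u"
   and ur: "ALL x:Rd d. c <= u x & u x <= C" and q: "1 < q"
   and q'2: "1 + (q - 1) * exp (4 * rho * (1 - eta) * delta) <= q2"
  define q' where "q' = 1 + (q - 1) * exp (4 * rho * (1 - eta) * delta)"
  have q': "q <= q'"
  proof -
   have "1 <= exp (4 * rho * (1 - eta) * delta)" using rho eta delta by simp
   hence "(q - 1) * 1 <= (q - 1) * exp (4 * rho * (1 - eta) * delta)" using q by (intro mult_left_mono) auto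
   thus ?thesis by (simp add: q'_def)
  qed
  define N where "N = (LINT x|nu. exp (q * ln (u x)))"
  define s where "s = exp (log_norm q u)"
  have cu: "continuous_on (Rd d) u" by (rule CB_cont[OF u])
  have urD: "c <= u x & u x <= C" if "x : Rd d" for x using ur that by blast
  have Nb: "exp (q * ln c) <= N" "N <= exp (q * ln C)"
   using power_mean_bounds[OF cu c(1) urD, of q] q by (auto simp: N_def)
  have N0: "0 < N" using Nb(1) exp_gt_zero[of "q * ln c"] by linarith
  have lnN: "q * ln c <= ln N" "ln N <= q * ln C"
   using Nb N0 by (metis exp_gt_zero ln_exp ln_le_cancel_iff)+
  have s: "0 < s" "c <= s" "s <= C" "ln s = ln N / q"
  proof -
   show "0 < s" by (simp add: s_def)
   show l: "ln s = ln N / q" by (simp add: s_def log_norm_def N_def)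
   have "ln c <= ln s" "ln s <= ln C" unfolding l using lnN q by (auto simp: field_simps)
   thus "c <= s" "s <= C" using \<open>0 < s\<close> c by (simp_all add: ln_le_cancel_iff)
  qed
  define v where "v x = (1 / s) * u x" for x
  have v: "CB d 3 (K / c) v"
  proof -
   have "CB d 3 (abs (1 / s) * K) v" unfolding v_def[abs_def] by (rule CB_cmult[OF u])
   moreover have "abs (1 / s) * K <= K / c" using s c K by (simp add: frac_le)
   ultimately show ?thesis by (rule CB_mono_const)
  qed
  have vr: "ALL x:Rd d. c / C <= v x & v x <= C / c"
  proof
   fix x assume "x : Rd d"
   hence "c <= u x" "u x <= C" using ur by auto
   thus "c / C <= v x & v x <= C / c" unfolding v_def using s c by (auto intro!: frac_le)
  qed
  have lnv: "ln (w / s) = ln w - ln s" if "0 < w" for w using that s by (simp add: ln_div)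
  have one: "(LINT x|nu. exp (q * ln (v x))) = 1"
  proof -
   have "(LINT x|nu. exp (q * ln (v x))) = (LINT x|nu. exp (q * ln (u x)) / N)"
   proof (rule Bochner_Integration.integral_cong[OF refl])
    fix x assume "x : space nu"
    hence "0 < u x" using urD[of x] c by simp
    hence "q * ln (v x) = q * ln (u x) - ln N" using q lnv[of "u x"] by (simp add: v_def s(4) right_diff_distrib)
    thus "exp (q * ln (v x)) = exp (q * ln (u x)) / N" using N0 by (simp add: exp_diff)
   qed
   also have "... = N / N" by (simp add: N_def)
   finally show ?thesis using N0 by simp
  qed
  have Qv: "euler_step d B delta v x = euler_step d B delta u x / s" for x
   by (simp add: euler_step_def v_def add_divide_distrib[symmetric] sum_divide_distrib[symmetric])
  have Qu: "c <= euler_step d B delta u x" for x using euler_step_range[OF d, of c u C B delta x] ur by auto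
  define I where "I = (LINT x|nu. exp (q' * ln (euler_step d B delta v x)))"
  have I: "I <= 1 + delta * (q * beta^2 / (4 * eta * (q - 1))) + A * (delta * sqrt delta)"
   unfolding I_def q'_def by (rule A(2)[OF delta B beta Bb v vr q q'2 one])
  have eq: "(LINT x|nu. exp (q' * ln (euler_step d B delta u x))) = exp (q' * ln s) * I"
  proof -
   have "exp (q' * ln (euler_step d B delta u x)) = exp (q' * ln s) * exp (q' * ln (euler_step d B delta v x))" for x
    using Qu[of x] c lnv[of "euler_step d B delta u x"] by (simp add: Qv exp_add[symmetric] right_diff_distrib)
   thus ?thesis by (simp add: I_def)
  qed
  have I0: "0 < I"
  proof -
   obtain Q where Q: "0 <= Q" "!!B phi K delta. drift d M B ==> CB d 3 K phi ==> 0 <= delta ==> delta <= 1 ==>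
    CB d 3 (K * (1 + Q * delta)) (euler_step d B delta phi)" using CB_euler_step[OF d, of M] by blast
   have cQ: "continuous_on (Rd d) (euler_step d B delta v)" by (rule CB_cont[OF Q(2)[OF B v delta]])
   have "exp (q' * ln (c / C)) <= I" unfolding I_def
    by (rule power_mean_bounds(1)[OF cQ c'(1), of "C / c"])
     (use euler_step_range[OF d, of "c / C" v "C / c" B delta] vr q q' in auto)
   thus ?thesis using exp_gt_zero[of "q' * ln (c / C)"] by linarith
  qed
  have "log_norm q' (euler_step d B delta u) = ln s + ln I / q'"
   unfolding log_norm_def eq using I0 q q' by (simp add: ln_mult add_divide_distrib)
  also have "ln I / q' <= (delta * (q * beta^2 / (4 * eta * (q - 1))) + A * (delta * sqrt delta)) / q"
  proof -
   have nn: "0 <= delta * (q * beta^2 / (4 * eta * (q - 1))) + A * (delta * sqrt delta)" using delta q eta A(1) by auto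
   have "ln I <= I - 1" by (rule ln_le_minus_one[OF I0])
   hence "ln I <= delta * (q * beta^2 / (4 * eta * (q - 1))) + A * (delta * sqrt delta)" using I by linarith
   hence "ln I / q' <= (delta * (q * beta^2 / (4 * eta * (q - 1))) + A * (delta * sqrt delta)) / q'"
    using q q' by (intro divide_right_mono) auto
   also have "... <= (delta * (q * beta^2 / (4 * eta * (q - 1))) + A * (delta * sqrt delta)) / q"
    using nn q q' by (intro divide_left_mono) auto
   finally show ?thesis .
  qed
  also have "... <= delta * (beta^2 / (4 * eta * (q - 1))) + A * (delta * sqrt delta)"
  proof -
   have "A * (delta * sqrt delta) / q <= A * (delta * sqrt delta) / 1" using q delta A(1) by (intro divide_left_mono) auto
   thus ?thesis using q by (simp add: add_divide_distrib)
  qed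
  finally show "log_norm (1 + (q - 1) * exp (4 * rho * (1 - eta) * delta)) (euler_step d B delta u)
   <= log_norm q u + delta * (beta^2 / (4 * eta * (q - 1))) + A * (delta * sqrt delta)"
   by (simp add: q'_def s_def)
 qed
qed

end

section \<open>Couplings and Wasserstein distances\<close>

lemma P2_D:
 assumes "mu : P2 d"
 shows "prob_space mu" "sets mu = sets (borel_Rd d)" "space mu = Rd d" "integrable mu (%x. (norm_Rd d x)^2)"
 using assms sets_eq_imp_space_eq[of mu "borel_Rd d"] by (auto simp: P2_def)

lemma P2_measurable: "mu : P2 d ==> continuous_on (Rd d) f ==> f : borel_measurable mu"
 using measurable_Rd[of d f] by (subst measurable_cong_sets[OF P2_D(2) refl])

lemma P2_integrable_quadratic:
 fixes f :: "vec => real"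
 assumes mu: "mu : P2 d" and c: "continuous_on (Rd d) f"
  and bd: "!!x. x : Rd d ==> abs (f x) <= C * (1 + norm_Rd d x)^2"
 shows "integrable mu f"
proof -
 interpret prob_space mu using P2_D(1)[OF mu] .
 show ?thesis
 proof (rule Bochner_Integration.integrable_bound[of _ "%x. abs C * (2 + 2 * (norm_Rd d x)^2)"])
  show "integrable mu (%x. abs C * (2 + 2 * (norm_Rd d x)^2))"
   by (intro integrable_mult_right Bochner_Integration.integrable_add integrable_const P2_D(4)[OF mu])
  show "f : borel_measurable mu" by (rule P2_measurable[OF mu c])
  show "AE x in mu. norm (f x) <= norm (abs C * (2 + 2 * (norm_Rd d x)^2))"
  proof (rule AE_I2)
   fix x assume "x : space mu"
   hence x: "x : Rd d" using P2_D(3)[OF mu] by simp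
   have "(1 + norm_Rd d x)^2 <= 2 + 2 * (norm_Rd d x)^2"
    using sum_squares_bound[of 1 "norm_Rd d x"] by (simp add: power2_sum)
   hence "abs C * (1 + norm_Rd d x)^2 <= abs C * (2 + 2 * (norm_Rd d x)^2)" by (rule mult_left_mono) simp
   moreover have "C * (1 + norm_Rd d x)^2 <= abs C * (1 + norm_Rd d x)^2" by (rule mult_right_mono) auto
   ultimately show "norm (f x) <= norm (abs C * (2 + 2 * (norm_Rd d x)^2))" using bd[OF x] by simp
  qed
 qed
qed

lemma P2_integrable_bounded:
 fixes f :: "vec => real"
 assumes mu: "mu : P2 d" and c: "continuous_on (Rd d) f" and bd: "!!x. x : Rd d ==> abs (f x) <= C"
 shows "integrable mu f"
proof -
 interpret prob_space mu using P2_D(1)[OF mu] .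
 show ?thesis using bd P2_D(3)[OF mu] P2_measurable[OF mu c] by (intro integrable_const_bound[of _ C]) auto
qed

lemma P2_integrable_CB: "mu : P2 d ==> CB d k K f ==> integrable mu f"
 by (rule P2_integrable_bounded[OF _ CB_cont CB_bound])

lemma one_plus_norm_le: "1 <= 1 + norm_Rd d x" "1 + norm_Rd d x <= (1 + norm_Rd d x)^2"
 using mult_left_mono[of 1 "1 + norm_Rd d x" "1 + norm_Rd d x"] by (auto simp: power2_eq_square)

lemma P2_integrable_linear:
 fixes f :: "vec => real"
 assumes mu: "mu : P2 d" and c: "continuous_on (Rd d) f"
  and bd: "!!x. x : Rd d ==> abs (f x) <= C * (1 + norm_Rd d x)"
 shows "integrable mu f"
proof (rule P2_integrable_quadratic[OF mu c])
 fix x assume x: "x : Rd d"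
 have "C * (1 + norm_Rd d x) <= abs C * (1 + norm_Rd d x)" by (rule mult_right_mono) auto
 also have "... <= abs C * (1 + norm_Rd d x)^2" using one_plus_norm_le(2) by (rule mult_left_mono) simp
 finally show "abs (f x) <= abs C * (1 + norm_Rd d x)^2" using bd[OF x] by simp
qed

lemma lip_growth:
 assumes f: "lip d L f" and x: "x : Rd d"
 shows "abs (f x) <= (abs (f (restrict (%_. 0) {..<d})) + L) * (1 + norm_Rd d x)"
proof -
 let ?o = "restrict (%_. 0) {..<d} :: nat => real"
 have "dist_Rd d x ?o = norm_Rd d x" unfolding dist_Rd_def by (rule norm_Rd_cong) simp
 hence "abs (f x - f ?o) <= L * norm_Rd d x" using f x Rd_restrict unfolding lip_def by metis
 moreover have "0 <= L" using f by (simp add: lip_def)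
 moreover have "0 <= abs (f ?o) * norm_Rd d x" by simp
 moreover have "(abs (f ?o) + L) * (1 + norm_Rd d x) = abs (f ?o) + L + abs (f ?o) * norm_Rd d x + L * norm_Rd d x"
  by (simp add: algebra_simps)
 ultimately show ?thesis by linarith
qed

lemma P2_integrable_lip: "mu : P2 d ==> lip d L f ==> integrable mu f"
 by (rule P2_integrable_linear[OF _ lip_cont lip_growth])

context
 fixes d :: nat and mu mu' :: "vec measure"
 assumes mu: "mu : P2 d" and mu': "mu' : P2 d"
begin

lemma sets_pair: "sets (mu \<Otimes>\<^sub>M mu') = sets (borel_Rd d \<Otimes>\<^sub>M borel_Rd d)"
 using P2_D(2)[OF mu] P2_D(2)[OF mu'] by (rule sets_pair_measure_cong)

lemma coupling_facts:
 assumes \<pi>: "\<pi> : couplings mu mu'"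
 shows "sets \<pi> = sets (borel_Rd d \<Otimes>\<^sub>M borel_Rd d)" "space \<pi> = Rd d \<times> Rd d" "fst : measurable \<pi> mu" "snd : measurable \<pi> mu'"
  "prob_space \<pi>"
proof -
 show s: "sets \<pi> = sets (borel_Rd d \<Otimes>\<^sub>M borel_Rd d)" using \<pi> sets_pair by (simp add: couplings_def)
 show "space \<pi> = Rd d \<times> Rd d" using sets_eq_imp_space_eq[OF s] by (simp add: space_pair_measure)
 have "measurable \<pi> mu = measurable (borel_Rd d \<Otimes>\<^sub>M borel_Rd d) (borel_Rd d)"
  by (rule measurable_cong_sets[OF s P2_D(2)[OF mu]])
 thus f: "fst : measurable \<pi> mu" by simp
 have "measurable \<pi> mu' = measurable (borel_Rd d \<Otimes>\<^sub>M borel_Rd d) (borel_Rd d)"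
  by (rule measurable_cong_sets[OF s P2_D(2)[OF mu']])
 thus "snd : measurable \<pi> mu'" by simp
 have "distr \<pi> mu fst = mu" using \<pi> by (simp add: couplings_def)
 thus "prob_space \<pi>" using prob_space_distrD[OF f] P2_D(1)[OF mu] by simp
qed

lemma coupling_integral:
 fixes f :: "vec => real"
 assumes \<pi>: "\<pi> : couplings mu mu'"
 shows "f : borel_measurable mu ==> (LINT z|\<pi>. f (fst z)) = (LINT x|mu. f x)"
  and "f : borel_measurable mu' ==> (LINT z|\<pi>. f (snd z)) = (LINT x|mu'. f x)"
  and "integrable mu f ==> integrable \<pi> (%z. f (fst z))"
  and "integrable mu' f ==> integrable \<pi> (%z. f (snd z))"
proof -
 note c = coupling_facts[OF \<pi>]
 have d1: "distr \<pi> mu fst = mu" and d2: "distr \<pi> mu' snd = mu'" using \<pi> by (auto simp: couplings_def)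
 show "(LINT z|\<pi>. f (fst z)) = (LINT x|mu. f x)" if "f : borel_measurable mu"
  using integral_distr[OF c(3) that] d1 by simp
 show "(LINT z|\<pi>. f (snd z)) = (LINT x|mu'. f x)" if "f : borel_measurable mu'"
  using integral_distr[OF c(4) that] d2 by simp
 show "integrable \<pi> (%z. f (fst z))" if "integrable mu f"
  using integrable_distr[OF c(3), of f] that d1 by simp
 show "integrable \<pi> (%z. f (snd z))" if "integrable mu' f"
  using integrable_distr[OF c(4), of f] that d2 by simp
qed

lemma coupling_dist:
 assumes \<pi>: "\<pi> : couplings mu mu'"
 shows "(%z. dist_Rd d (fst z) (snd z)) : borel_measurable \<pi>"
  "integrable \<pi> (%z. dist_Rd d (fst z) (snd z))"
  "integrable \<pi> (%z. (dist_Rd d (fst z) (snd z))^2)"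
proof -
 note c = coupling_facts[OF \<pi>]
 interpret prob_space \<pi> by (rule c(5))
 have m1: "(%z. fst z i) : borel_measurable \<pi>" if "i < d" for i
  by (rule measurable_compose[OF c(3) P2_measurable[OF mu continuous_on_Rd_coord[OF that]]])
 have m2: "(%z. snd z i) : borel_measurable \<pi>" if "i < d" for i
  by (rule measurable_compose[OF c(4) P2_measurable[OF mu' continuous_on_Rd_coord[OF that]]])
 show m: "(%z. dist_Rd d (fst z) (snd z)) : borel_measurable \<pi>"
 proof -
  have "(%z. \<Sum>i<d. (fst z i - snd z i)^2) : borel_measurable \<pi>"
   by (intro borel_measurable_sum borel_measurable_power borel_measurable_diff m1 m2) auto
  thus ?thesis unfolding dist_Rd_def norm_Rd_def L2_set_def by (rule measurable_compose[OF _ borel_measurable_sqrt])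
 qed
 have sq: "integrable \<pi> (%z. 2 * (norm_Rd d (fst z))^2 + 2 * (norm_Rd d (snd z))^2)"
  using coupling_integral(3)[OF \<pi> P2_D(4)[OF mu]] coupling_integral(4)[OF \<pi> P2_D(4)[OF mu']] by simp
 have le: "(dist_Rd d x y)^2 <= 2 * (norm_Rd d x)^2 + 2 * (norm_Rd d y)^2" for x y
 proof -
  have "dist_Rd d x y <= norm_Rd d x + norm_Rd d y"
   using norm_Rd_triangle[of d x "%i. - y i"] norm_Rd_cong[of d "%i. - y i" y] by (simp add: dist_Rd_def)
  hence "(dist_Rd d x y)^2 <= (norm_Rd d x + norm_Rd d y)^2" by (rule power_mono) simp
  thus ?thesis using sum_squares_bound[of "norm_Rd d x" "norm_Rd d y"] by (simp add: power2_sum)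
 qed
 show i2: "integrable \<pi> (%z. (dist_Rd d (fst z) (snd z))^2)"
  by (rule Bochner_Integration.integrable_bound[OF sq]) (use m le in auto)
 have "integrable \<pi> (%z. 1 + (dist_Rd d (fst z) (snd z))^2)" using i2 by simp
 thus "integrable \<pi> (%z. dist_Rd d (fst z) (snd z))"
 proof (rule Bochner_Integration.integrable_bound[OF _ m], intro AE_I2)
  fix z
  have "0 <= (dist_Rd d (fst z) (snd z) - 1)^2" by simp
  thus "norm (dist_Rd d (fst z) (snd z)) <= norm (1 + (dist_Rd d (fst z) (snd z))^2)"
   by (simp add: power2_diff) (smt (verit) dist_Rd_nonneg)
 qed
qed

text \<open>For the two exponents in use, \<open>nat \<lfloor>p\<rfloor>\<close> is the same
  exponent as a natural number, so a single statement covers the distances of order 1 and 2.\<close>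

lemma coupling_cost:
 assumes \<pi>: "\<pi> : couplings mu mu'" and p: "p = 1 | p = 2"
 shows "(\<integral>\<^sup>+ z. ennreal (dist_Rd d (fst z) (snd z) powr p) \<partial>\<pi>) = ennreal (LINT z|\<pi>. dist_Rd d (fst z) (snd z) ^ nat \<lfloor>p\<rfloor>)"
proof -
 have "dist_Rd d (fst z) (snd z) powr p = dist_Rd d (fst z) (snd z) ^ nat \<lfloor>p\<rfloor>" for z
  using p by (auto simp: powr_numeral)
 thus ?thesis
  using p coupling_dist[OF \<pi>] by (auto intro!: nn_integral_eq_integral)
qed

lemma product_coupling: "mu \<Otimes>\<^sub>M mu' : couplings mu mu'"
proof -
 interpret A: prob_space mu using P2_D(1)[OF mu] .
 interpret B: prob_space mu' using P2_D(1)[OF mu'] .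
 interpret P: pair_prob_space mu mu' ..
 have "distr (mu \<Otimes>\<^sub>M mu') mu fst = mu"
 proof (rule measure_eqI)
  fix A assume "A : sets (distr (mu \<Otimes>\<^sub>M mu') mu fst)"
  hence A: "A : sets mu" by simp
  have "fst -` A \<inter> space (mu \<Otimes>\<^sub>M mu') = A \<times> space mu'"
   using sets.sets_into_space[OF A] by (auto simp: space_pair_measure)
  thus "emeasure (distr (mu \<Otimes>\<^sub>M mu') mu fst) A = emeasure mu A"
   using A by (simp add: emeasure_distr B.emeasure_pair_measure_Times B.emeasure_space_1)
 qed simp
 moreover have "distr (mu \<Otimes>\<^sub>M mu') mu' snd = mu'"
 proof (rule measure_eqI)
  fix A assume "A : sets (distr (mu \<Otimes>\<^sub>M mu') mu' snd)"
  hence A: "A : sets mu'" by simp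
  have "snd -` A \<inter> space (mu \<Otimes>\<^sub>M mu') = space mu \<times> A"
   using sets.sets_into_space[OF A] by (auto simp: space_pair_measure)
  thus "emeasure (distr (mu \<Otimes>\<^sub>M mu') mu' snd) A = emeasure mu' A"
   using A by (simp add: emeasure_distr B.emeasure_pair_measure_Times A.emeasure_space_1)
 qed simp
 ultimately show ?thesis by (simp add: couplings_def)
qed

text \<open>Finiteness matters because \<open>wasserstein\<close> passes through
  \<open>enn2real\<close>, which sends infinity to 0. The product coupling is the witness.\<close>

lemma coupling_inf:
 assumes p: "p = 1 | p = 2"
 shows "(INF \<pi>\<in>couplings mu mu'. \<integral>\<^sup>+ z. ennreal (dist_Rd d (fst z) (snd z) powr p) \<partial>\<pi>) < \<top>"
proof -
 have "(INF \<pi>\<in>couplings mu mu'. \<integral>\<^sup>+ z. ennreal (dist_Rd d (fst z) (snd z) powr p) \<partial>\<pi>)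
   <= (\<integral>\<^sup>+ z. ennreal (dist_Rd d (fst z) (snd z) powr p) \<partial>(mu \<Otimes>\<^sub>M mu'))"
  by (rule INF_lower[OF product_coupling])
 also have "... < \<top>" unfolding coupling_cost[OF product_coupling p] by simp
 finally show ?thesis .
qed

lemma wasserstein_coupling:
 assumes p: "p = 1 | p = 2" and less: "wasserstein d p mu mu' < eps"
 obtains \<pi> where "\<pi> : couplings mu mu'" "(LINT z|\<pi>. dist_Rd d (fst z) (snd z) ^ nat \<lfloor>p\<rfloor>) < eps ^ nat \<lfloor>p\<rfloor>"
proof -
 let ?I = "INF \<pi>\<in>couplings mu mu'. \<integral>\<^sup>+ z. ennreal (dist_Rd d (fst z) (snd z) powr p) \<partial>\<pi>"
 have w: "wasserstein d p mu mu' = enn2real ?I powr (1 / p)" by (simp add: wasserstein_def)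
 have eps: "0 < eps" using less unfolding w by (meson le_less_trans powr_ge_zero)
 have "enn2real ?I < eps ^ nat \<lfloor>p\<rfloor>"
 proof -
  have "(enn2real ?I powr (1 / p)) ^ nat \<lfloor>p\<rfloor> = enn2real ?I"
   using p by (auto simp: powr_half_sqrt)
  moreover have "(enn2real ?I powr (1 / p)) ^ nat \<lfloor>p\<rfloor> < eps ^ nat \<lfloor>p\<rfloor>"
   using p less unfolding w by (intro power_strict_mono) auto
  ultimately show ?thesis by simp
 qed
 hence "ennreal (enn2real ?I) < ennreal (eps ^ nat \<lfloor>p\<rfloor>)"
  using eps by (intro ennreal_lessI) simp_all
 moreover have "ennreal (enn2real ?I) = ?I" by (rule ennreal_enn2real[OF coupling_inf[OF p]])
 ultimately have "?I < ennreal (eps ^ nat \<lfloor>p\<rfloor>)" by (simp only:)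
 then obtain \<pi> where \<pi>: "\<pi> : couplings mu mu'"
  "(\<integral>\<^sup>+ z. ennreal (dist_Rd d (fst z) (snd z) powr p) \<partial>\<pi>) < ennreal (eps ^ nat \<lfloor>p\<rfloor>)"
  by (rule INF_less_iff[THEN iffD1, THEN bexE])
 have "0 <= (LINT z|\<pi>. dist_Rd d (fst z) (snd z) ^ nat \<lfloor>p\<rfloor>)" by (intro Bochner_Integration.integral_nonneg) simp
 hence "(LINT z|\<pi>. dist_Rd d (fst z) (snd z) ^ nat \<lfloor>p\<rfloor>) < eps ^ nat \<lfloor>p\<rfloor>"
  using \<pi>(2) unfolding coupling_cost[OF \<pi>(1) p] by (simp add: ennreal_less_iff)
 with \<pi>(1) show thesis by (rule that)
qed

lemma wasserstein1_le:
 assumes \<pi>: "\<pi> : couplings mu mu'" shows "wasserstein d 1 mu mu' <= (LINT z|\<pi>. dist_Rd d (fst z) (snd z))"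
proof -
 let ?I = "INF \<pi>\<in>couplings mu mu'. \<integral>\<^sup>+ z. ennreal (dist_Rd d (fst z) (snd z) powr 1) \<partial>\<pi>"
 have "?I <= (\<integral>\<^sup>+ z. ennreal (dist_Rd d (fst z) (snd z) powr 1) \<partial>\<pi>)" by (rule INF_lower[OF \<pi>])
 also have "... = ennreal (LINT z|\<pi>. dist_Rd d (fst z) (snd z) ^ nat \<lfloor>1 :: real\<rfloor>)" by (rule coupling_cost[OF \<pi>]) simp
 finally have "enn2real ?I <= (LINT z|\<pi>. dist_Rd d (fst z) (snd z))"
  by (intro enn2real_leI) auto
 moreover have "wasserstein d 1 mu mu' = enn2real ?I" by (simp add: wasserstein_def)
 ultimately show ?thesis by simp
qed

lemma wasserstein_nonneg: "0 <= wasserstein d p mu mu'"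
 by (simp add: wasserstein_def)

text \<open>For the distance \<open>D\<close> one has \<open>2 * w * D <= D^2 + w^2\<close>; this is
  integrated over a coupling whose quadratic cost is below \<open>w^2\<close>.\<close>

lemma wasserstein1_le_2: "wasserstein d 1 mu mu' <= wasserstein d 2 mu mu'"
proof (rule field_le_epsilon)
 fix e :: real assume e: "0 < e"
 let ?w = "wasserstein d 2 mu mu' + e"
 have w: "0 < ?w" using e wasserstein_nonneg[of 2] by linarith
 obtain \<pi> where \<pi>: "\<pi> : couplings mu mu'" "(LINT z|\<pi>. dist_Rd d (fst z) (snd z) ^ 2) < ?w ^ 2"
  using wasserstein_coupling[of 2 ?w] e by auto
 interpret prob_space \<pi> by (rule coupling_facts(5)[OF \<pi>(1)])
 have "2 * ?w * dist_Rd d (fst z) (snd z) <= (dist_Rd d (fst z) (snd z))^2 + ?w^2" for z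
  using sum_squares_bound[of ?w "dist_Rd d (fst z) (snd z)"] by (simp add: algebra_simps)
 hence "(LINT z|\<pi>. 2 * ?w * dist_Rd d (fst z) (snd z)) <= (LINT z|\<pi>. (dist_Rd d (fst z) (snd z))^2 + ?w^2)"
  using coupling_dist[OF \<pi>(1)] by (intro integral_mono) auto
 also have "... = (LINT z|\<pi>. (dist_Rd d (fst z) (snd z))^2) + ?w^2"
  using coupling_dist[OF \<pi>(1)] prob_space by simp
 also have "... <= 2 * ?w * ?w"
 proof -
  have "2 * ?w * ?w = ?w^2 + ?w^2" by (simp add: power2_eq_square)
  thus ?thesis using \<pi>(2) by linarith
 qed
 finally have "2 * ?w * (LINT z|\<pi>. dist_Rd d (fst z) (snd z)) <= 2 * ?w * ?w" by simp
 hence "(LINT z|\<pi>. dist_Rd d (fst z) (snd z)) <= ?w" using w by simp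
 thus "wasserstein d 1 mu mu' <= ?w" using wasserstein1_le[OF \<pi>(1)] by linarith
qed

lemma lip_wasserstein:
 assumes f: "lip d L f"
 shows "abs ((LINT x|mu. f x) - (LINT x|mu'. f x)) <= L * wasserstein d 1 mu mu'"
proof -
 have L: "0 <= L" using f by (simp add: lip_def)
 have le: "abs ((LINT x|mu. f x) - (LINT x|mu'. f x)) <= L * (wasserstein d 1 mu mu' + e)" if e: "0 < e" for e
 proof -
  obtain \<pi> where \<pi>: "\<pi> : couplings mu mu'" "(LINT z|\<pi>. dist_Rd d (fst z) (snd z)) < wasserstein d 1 mu mu' + e"
   using wasserstein_coupling[of 1 "wasserstein d 1 mu mu' + e"] e by auto
  note i1 = P2_integrable_lip[OF mu f] and i2 = P2_integrable_lip[OF mu' f]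
  have "(LINT x|mu. f x) - (LINT x|mu'. f x) = (LINT z|\<pi>. f (fst z) - f (snd z))"
   using coupling_integral[OF \<pi>(1)] i1 i2 by simp
  also have "abs (...) <= (LINT z|\<pi>. L * dist_Rd d (fst z) (snd z))"
  proof (rule integral_abs_bound[THEN order_trans], rule integral_mono)
   show "integrable \<pi> (%z. abs (f (fst z) - f (snd z)))"
    using coupling_integral(3,4)[OF \<pi>(1)] i1 i2 by simp
   show "integrable \<pi> (%z. L * dist_Rd d (fst z) (snd z))" using coupling_dist(2)[OF \<pi>(1)] by simp
   show "abs (f (fst z) - f (snd z)) <= L * dist_Rd d (fst z) (snd z)" if "z : space \<pi>" for z
    using that f coupling_facts(2)[OF \<pi>(1)] by (auto simp: lip_def)
  qed
  also have "... <= L * (wasserstein d 1 mu mu' + e)" using \<pi>(2) L by (simp add: mult_left_mono)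
  finally show ?thesis .
 qed
 show ?thesis
 proof (rule field_le_epsilon)
  fix e :: real assume e: "0 < e"
  have "L * (wasserstein d 1 mu mu' + e / (L + 1)) <= L * wasserstein d 1 mu mu' + e"
   using L e by (simp add: distrib_left divide_le_eq mult_right_mono)
  thus "abs ((LINT x|mu. f x) - (LINT x|mu'. f x)) <= L * wasserstein d 1 mu mu' + e"
   using le[of "e / (L + 1)"] L e by simp
 qed
qed

end

section \<open>Approximation by test functions\<close>

lemma cut_has_pd:
 assumes j: "j < d" and k: "!!s. (k j has_real_derivative kj' s) (at s)"
 shows "has_pd d j (%x. tensor d k (%i. r * x i)) (%x. r * tensor d (k(j := kj')) (%i. r * x i))"
 unfolding has_pd_def
proof
 fix x :: "nat => real"
 have eq: "(\<Prod>i\<in>{..<d} - {j}. k i (r * (x(j := s)) i)) = (\<Prod>i\<in>{..<d} - {j}. k i (r * x i))"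
  "(\<Prod>i\<in>{..<d} - {j}. (k(j := kj')) i (r * x i)) = (\<Prod>i\<in>{..<d} - {j}. k i (r * x i))" for s
  by (intro prod.cong; simp)+
 have "((%s. k j (r * s)) has_real_derivative kj' (r * x j) * r) (at (x j))"
  by (rule DERIV_chain2[OF k]) (auto intro!: derivative_eq_intros)
 from DERIV_cmult_right[OF this, of "\<Prod>i\<in>{..<d} - {j}. k i (r * x i)"]
 show "((%s. tensor d k (%i. r * (x(j := s)) i)) has_real_derivative r * tensor d (k(j := kj')) (%i. r * x i)) (at (x j))"
  unfolding tensor_upd[OF j] eq by (simp add: mult_ac)
qed

lemma cut_cont: "k : kernels n ==> continuous_on (Rd d) (%x. tensor d k (%i. r * x i))"
 unfolding tensor_def
proof (rule continuous_on_prod)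
 fix i assume k: "k : kernels n" and i: "i : {..<d}"
 hence "k i : scaled_kernels n" by (simp add: kernels_def)
 thus "continuous_on (Rd d) (%x. k i (r * x i))"
  using i by (intro continuous_on_compose2[OF scaled_kernels_cont continuous_on_mult_left[OF continuous_on_Rd_coord]]) auto
qed

text \<open>Each derivative of a dilated cut-off carries a factor \<open>r\<close>, so the bounds
  are uniform for \<open>r\<close> between 0 and 1.\<close>

lemma cut_CB: "k : kernels n ==> EX K>=0. ALL r. 0 <= r --> r <= 1 --> CB d m K (%x. tensor d k (%i. r * x i))"
proof (induction m arbitrary: k)
 case 0
 obtain M where "0 <= M" "!!z. abs (tensor d k z) <= M" using tensor_bounded[OF 0] by blast
 thus ?case using cut_cont[OF 0] by (intro exI[of _ M]) auto
next
 case (Suc m)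
 obtain M where M: "0 <= M" "!!z. abs (tensor d k z) <= M" using tensor_bounded[OF Suc.prems] by blast
 have "EX K. 0 <= K & (ALL r. 0 <= r --> r <= 1 --> (EX g. has_pd d j (%x. tensor d k (%i. r * x i)) g & CB d m K g))" if j: "j < d" for j
 proof -
  obtain k' where k': "!!x. (k j has_real_derivative k' x) (at x)" "k(j := k') : kernels n"
   using kernels_upd[OF Suc.prems] by blast
  obtain K where K: "0 <= K" "!!r. 0 <= r ==> r <= 1 ==> CB d m K (%x. tensor d (k(j := k')) (%i. r * x i))"
   using Suc.IH[OF k'(2)] by blast
  have "CB d m K (%x. r * tensor d (k(j := k')) (%i. r * x i))" if r: "0 <= r" "r <= 1" for r
   using CB_cmult[OF K(2)[OF r], of r] by (rule CB_mono_const) (use r K in \<open>simp add: mult_left_le_one_le\<close>)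
  moreover have "has_pd d j (%x. tensor d k (%i. r * x i)) (%x. r * tensor d (k(j := k')) (%i. r * x i))" for r
   by (rule cut_has_pd[where k = k and kj' = k', OF j k'(1)])
  ultimately show ?thesis using K(1) by (intro exI[of _ K]) blast
 qed
 hence "ALL j. EX K. j < d --> 0 <= K & (ALL r. 0 <= r --> r <= 1 -->
   (EX g. has_pd d j (%x. tensor d k (%i. r * x i)) g & CB d m K g))" by blast
 from choice[OF this] obtain K where K: "!!j. j < d ==> 0 <= K j"
  "!!j r. j < d ==> 0 <= r ==> r <= 1 ==> EX g. has_pd d j (%x. tensor d k (%i. r * x i)) g & CB d m (K j) g" by blast
 let ?K = "M + (\<Sum>j<d. K j)"
 have le: "K j <= ?K" if "j < d" for j
  using that K(1) M(1) member_le_sum[of j "{..<d}" K] by (simp add: add_increasing)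
 have "CB d (Suc m) ?K (%x. tensor d k (%i. r * x i))" if r: "0 <= r" "r <= 1" for r
 proof (rule CB_SucI[OF cut_cont[OF Suc.prems]])
  have "0 <= (\<Sum>j<d. K j)" using K(1) by (intro sum_nonneg) auto
  thus "abs (tensor d k (%i. r * x i)) <= ?K" for x
   using M(2)[of "%i. r * x i"] by linarith
  show "EX g. has_pd d j (%x. tensor d k (%i. r * x i)) g & CB d m ?K g" if "j < d" for j
   using K(2)[OF that r] CB_mono_const[OF _ le[OF that]] by blast
 qed
 moreover have "0 <= ?K" using K(1) M(1) by (intro add_nonneg_nonneg sum_nonneg) auto
 ultimately show ?case by blast
qed

text \<open>The weak equation speaks about compactly supported smooth functions, while the chain of
  Euler steps needs the class \<open>CB d 3\<close>. Cut-offs of growing radius times mollifications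
  keep the third-order bounds up to the factor \<open>C\<close>, and every derivative occurring in
  the generator converges pointwise, as dominated convergence requires.\<close>

lemma test_approx:
 "EX C>=0. ALL K phi. CB d 3 K phi --> (EX psi. (ALL n. test_function d (psi n) & CB d 3 (C * K) (psi n)) &
  (ALL x:Rd d. (%n. psi n x) ----> phi x &
   (ALL i<d. (%n. pd i (psi n) x) ----> pd i phi x & (%n. pd i (pd i (psi n)) x) ----> pd i (pd i phi) x)))"
proof -
 let ?k = "moll_kernel 0"
 have k: "?k : kernels 0" by (rule moll_kernel)
 \<comment> \<open>The value of the cut-off at the origin; dividing by it makes \<open>ct n\<close>
   converge to 1.\<close>
 define T where "T = tensor d ?k (%_. 0)"
 have T: "0 < T" unfolding T_def tensor_def by (intro prod_pos) (auto simp: moll_kernel_def flat_def)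
 define ct where "ct n x = 1 / T * tensor d ?k (%i. (1 / real (Suc n)) * x i)" for n x
 have r0: "(%n. 1 / real (Suc n)) ----> 0" by (rule LIMSEQ_Suc[OF lim_1_over_n])
 have r: "0 <= 1 / real (Suc n)" "1 / real (Suc n) <= 1" for n by auto
 obtain Kc where Kc: "0 <= Kc" "!!r. 0 <= r ==> r <= 1 ==> CB d 3 Kc (%x. tensor d ?k (%i. r * x i))"
  using cut_CB[OF k] by blast
 have ct3: "CB d 3 (abs (1 / T) * Kc) (ct n)" for n unfolding ct_def[abs_def] by (intro CB_cmult Kc(2) r)
 have ctm: "EX K. CB d m K (ct n)" for m n
 proof -
  obtain K where "!!r. 0 <= r ==> r <= 1 ==> CB d m K (%x. tensor d ?k (%i. r * x i))" using cut_CB[OF k] by blast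
  thus ?thesis using CB_cmult[OF _, of d m K _ "1 / T"] r unfolding ct_def[abs_def] by blast
 qed
 define C where "C = 2 ^ 3 * (abs (1 / T) * Kc)"
 show ?thesis
 proof (intro exI[of _ C] conjI allI impI)
  show "0 <= C" using Kc by (simp add: C_def)
  fix K phi assume phi: "CB d 3 K phi"
  have 3: "(3::nat) = Suc (Suc (Suc 0))" by simp
  note phi' = phi[unfolded 3]
  note K = CB_nonneg[OF phi]
  have l: "lip d (K * d) phi" by (rule LB_imp_lip[OF CB_imp_LB[OF phi'] K])
  define psi where "psi n x = ct n x * moll d n phi x" for n x
  have mol: "(%n. moll d n f x) ----> f x" if f: "lip d L f" and x: "x : Rd d" for f L x
  proof -
   have "(%n. L * (d * (1 / real (Suc n)))) ----> L * (real d * 0)" by (intro tendsto_mult tendsto_const r0)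
   hence "(%n. moll d n f x - f x) ----> 0"
    using moll_close[OF f x] by (intro Lim_null_comparison[of "%n. moll d n f x - f x"]) auto
   thus ?thesis by (simp add: LIM_zero_iff)
  qed
  have ct1: "(%n. ct n x) ----> 1" for x
  proof -
   have "(%n. tensor d ?k (%i. (1 / real (Suc n)) * x i)) ----> T"
    unfolding tensor_def T_def
   proof (rule tendsto_prod)
    fix i assume "i : {..<d}"
    have "?k i : scaled_kernels 0" using k by (simp only: kernels_def mem_Collect_eq)
    hence "continuous_on UNIV (?k i)" by (rule scaled_kernels_cont)
    moreover have "(%n. (1 / real (Suc n)) * x i) ----> 0 * x i" by (intro tendsto_mult tendsto_const r0)
    ultimately show "(%n. ?k i ((1 / real (Suc n)) * x i)) ----> ?k i 0"
     unfolding mult_zero_left by (rule continuous_on_tendsto_compose) (simp_all only: UNIV_I eventually_True)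
   qed
   from tendsto_mult[OF tendsto_const[of "1 / T"] this]
   have "(%n. ct n x) ----> 1 / T * T" unfolding ct_def .
   moreover have "1 / T * T = 1" using T by simp
   ultimately show ?thesis by (simp only:)
  qed
  have CB3: "CB d 3 (C * K) (psi n)" for n
  proof -
   have "CB d 3 K (moll d n phi)" unfolding 3 by (rule moll_CB[OF phi'])
   from CB_mult[OF ct3 this] show ?thesis unfolding psi_def[abs_def] C_def .
  qed
  have "test_function d (psi n)" for n
   unfolding test_function_def
  proof (intro conjI allI exI[of _ "d * real (Suc n)"] ballI impI)
   fix m
   obtain K1 where K1: "CB d m K1 (ct n)" using ctm by blast
   obtain K2 where K2: "LB d m K2 (moll d n phi)" using moll_LB[OF l] by blast
   have "CB d (Suc m) (max K K2) (moll d n phi)" unfolding CB_Suc_LB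
    using LB_mono[OF K2, of m "max K K2"] moll_bound[OF l CB_bound[OF phi]] by (auto simp: le_max_iff_disj)
   hence "CB d m (max K K2) (moll d n phi)" by (rule CB_Suc_imp)
   from CB_imp_C_k[OF CB_mult[OF K1 this]] show "C_k d m (psi n)" unfolding psi_def[abs_def] .
  next
   fix x assume x: "x : Rd d" "d * real (Suc n) < norm_Rd d x"
   have "EX i<d. real (Suc n) <= abs (x i)"
   proof (rule ccontr)
    assume "~ (EX i<d. real (Suc n) <= abs (x i))"
    hence "(\<Sum>i<d. abs (x i)) <= (\<Sum>i<d. real (Suc n))" by (intro sum_mono) force
    thus False using norm_Rd_le_sum[of d x] x(2) by simp
   qed
   then obtain i where i: "i < d" "real (Suc n) <= abs (x i)" by blast
   have "?k i ((1 / real (Suc n)) * x i) = 0"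
    using i(2) k by (intro scaled_kernels_support[of _ 0]) (auto simp: kernels_def abs_mult le_divide_eq)
   hence "tensor d ?k (%i. (1 / real (Suc n)) * x i) = 0" unfolding tensor_def using i(1) by (intro prod_zero) auto
   thus "psi n x = 0" by (simp add: psi_def ct_def)
  qed
  moreover have "(%n. psi n x) ----> phi x" if "x : Rd d" for x
   using tendsto_mult[OF ct1 mol[OF l that]] by (simp add: psi_def)
  moreover have "(%n. pd j (psi n) x) ----> pd j phi x & (%n. pd j (pd j (psi n)) x) ----> pd j (pd j phi) x"
   if j: "j < d" and x: "x : Rd d" for j x
  proof -
   obtain k1 where k1: "!!x. (?k j has_real_derivative k1 x) (at x)" "?k(j := k1) : kernels 0"
    using kernels_upd[OF k] by blast
   obtain k2 where k2: "!!x. ((?k(j := k1)) j has_real_derivative k2 x) (at x)" "(?k(j := k1))(j := k2) : kernels 0"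
    using kernels_upd[OF k1(2)] by blast
   let ?r = "%n. 1 / real (Suc n)"
   let ?t = "%k n x. tensor d k (%i. ?r n * x i)"
   let ?k1 = "?k(j := k1)" and ?k2 = "(?k(j := k1))(j := k2)"
   have h1: "has_pd d j (ct n) (%x. 1 / T * (?r n * ?t ?k1 n x))" for n
    unfolding ct_def[abs_def] by (intro has_pd_cmult cut_has_pd[where k="?k" and kj'=k1, OF j k1(1)])
   have h2: "has_pd d j (%x. 1 / T * (?r n * ?t ?k1 n x)) (%x. 1 / T * (?r n * (?r n * ?t ?k2 n x)))" for n
    by (intro has_pd_cmult cut_has_pd[where k="?k(j := k1)" and kj'=k2, OF j k2(1)])
   note phi1 = CB_pd(2)[OF phi' j] and phi2 = CB_pd(2)[OF CB_pd(2)[OF phi' j] j]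
   have m1: "has_pd d j (moll d n phi) (moll d n (pd j phi))" for n by (rule moll_pd[OF CB_imp_LB[OF phi'] K j])
   have m2: "has_pd d j (moll d n (pd j phi)) (moll d n (pd j (pd j phi)))" for n
    by (rule moll_pd[OF CB_imp_LB[OF phi1] K j])
   let ?p1 = "%n x. 1 / T * (?r n * ?t ?k1 n x) * moll d n phi x + ct n x * moll d n (pd j phi) x"
   let ?p2 = "%n x. (1 / T * (?r n * (?r n * ?t ?k2 n x)) * moll d n phi x + 1 / T * (?r n * ?t ?k1 n x) * moll d n (pd j phi) x)
    + (1 / T * (?r n * ?t ?k1 n x) * moll d n (pd j phi) x + ct n x * moll d n (pd j (pd j phi)) x)"
   have p1: "has_pd d j (psi n) (?p1 n)" for n unfolding psi_def[abs_def] by (rule has_pd_mult[OF h1 m1])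
   have p2: "has_pd d j (?p1 n) (?p2 n)" for n
    by (intro has_pd_add has_pd_mult h1 h2 m1 m2)
   have pd1: "pd j (psi n) y = ?p1 n y" if "y : Rd d" for n y by (rule has_pd_imp_pd[OF p1 that])
   have "has_pd d j (pd j (psi n)) (?p2 n)" for n
    using p2 j by (rule has_pd_cong) (simp_all add: pd1)
   hence pd2: "pd j (pd j (psi n)) x = ?p2 n x" for n by (rule has_pd_imp_pd[OF _ x])
   have bd: "(%n. ?r n * ?t k' n x) ----> 0" if k': "k' : kernels 0" for k'
   proof -
    obtain M where M: "!!z. abs (tensor d k' z) <= M" using tensor_bounded[OF k'] by blast
    have "(%n. ?r n * M) ----> 0 * M" by (intro tendsto_mult tendsto_const r0)
    thus ?thesis
     by (intro Lim_null_comparison[of "%n. ?r n * ?t k' n x" "%n. ?r n * M"] always_eventually allI)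
      (simp_all only: real_norm_def abs_mult abs_of_nonneg[OF r(1)] mult_left_mono[OF M r(1)] mult_zero_left)
   qed
   have l1: "lip d (K * d) (pd j phi)" by (rule LB_imp_lip[OF CB_imp_LB[OF phi1] K])
   have l2: "lip d (K * d) (pd j (pd j phi))" by (rule LB_imp_lip[OF CB_imp_LB[OF phi2] K])
   have "(%n. ?p1 n x) ----> 1 / T * 0 * phi x + 1 * pd j phi x"
    by (intro tendsto_add tendsto_mult tendsto_const bd k1 mol[OF l x] mol[OF l1 x] ct1)
   moreover have "(%n. ?p2 n x) ----> (1 / T * (0 * 0) * phi x + 1 / T * 0 * pd j phi x)
    + (1 / T * 0 * pd j phi x + 1 * pd j (pd j phi) x)"
    by (intro tendsto_add tendsto_mult tendsto_const bd k1 k2 r0 mol[OF l x] mol[OF l1 x] mol[OF l2 x] ct1)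
   ultimately show ?thesis unfolding pd1[OF x] pd2 by simp
  qed
  ultimately show "EX psi. (ALL n. test_function d (psi n) & CB d 3 (C * K) (psi n)) &
  (ALL x:Rd d. (%n. psi n x) ----> phi x &
   (ALL i<d. (%n. pd i (psi n) x) ----> pd i phi x & (%n. pd i (pd i (psi n)) x) ----> pd i (pd i phi) x))"
   using CB3 by (intro exI[of _ psi]) simp
 qed
qed

section \<open>Weak consistency of Fokker--Planck solutions with Euler steps\<close>

lemma generator_props:
 assumes B: "drift d M B" and psi: "CB d 3 K psi"
 shows "continuous_on (Rd d) (generator d B psi)"
  "x : Rd d ==> abs (generator d B psi x) <= (d * K * (1 + M)) * (1 + norm_Rd d x)"
proof -
 have psi': "CB d (Suc (Suc (Suc 0))) K psi" using psi by (simp only: numeral_3_eq_3)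
 note psi1 = CB_pd(2)[OF psi'] and psi2 = CB_pd(2)[OF CB_pd(2)[OF psi']]
 have M: "0 <= M" and B': "!!j. j < d ==> continuous_on (Rd d) (%x. B x j)"
  "!!j x. j < d ==> x : Rd d ==> abs (B x j) <= M * (1 + norm_Rd d x)" using B by (auto simp: drift_def LB_def)
 show "continuous_on (Rd d) (generator d B psi)"
  unfolding generator_def[abs_def] laplacian_def
  by (intro continuous_intros B' CB_cont[OF psi1] CB_cont[OF psi2]) auto
 assume x: "x : Rd d"
 have "abs (generator d B psi x) <= (\<Sum>i<d. abs (pd i (pd i psi) x)) + (\<Sum>i<d. abs (B x i * pd i psi x))"
  unfolding generator_def laplacian_def by (intro order_trans[OF abs_triangle_ineq4] add_mono sum_abs)
 also have "... = (\<Sum>i<d. abs (pd i (pd i psi) x) + abs (B x i * pd i psi x))" by (simp add: sum.distrib)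
 also have "... <= (\<Sum>i<d. K * (1 + norm_Rd d x) + M * (1 + norm_Rd d x) * K)"
 proof (rule sum_mono)
  fix i assume "i : {..<d}"
  hence i: "i < d" by simp
  have "abs (pd i (pd i psi) x) <= K * 1" using CB_bound[OF psi2[OF i i] x] by simp
  also have "... <= K * (1 + norm_Rd d x)" using CB_nonneg[OF psi] by (intro mult_left_mono) auto
  finally have 1: "abs (pd i (pd i psi) x) <= K * (1 + norm_Rd d x)" .
  have "abs (B x i) * abs (pd i psi x) <= M * (1 + norm_Rd d x) * K"
   by (intro mult_mono B'(2) i x CB_bound[OF psi1[OF i] x]) (use M in auto)
  with 1 show "abs (pd i (pd i psi) x) + abs (B x i * pd i psi x) <= K * (1 + norm_Rd d x) + M * (1 + norm_Rd d x) * K"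
   by (simp add: abs_mult)
 qed
 also have "... = (d * K * (1 + M)) * (1 + norm_Rd d x)" by (simp add: algebra_simps)
 finally show "abs (generator d B psi x) <= (d * K * (1 + M)) * (1 + norm_Rd d x)" .
qed

text \<open>The drift \<open>B y\<close> grows linearly and multiplies a difference of gradients,
  which puts the weight \<open>1 + norm_Rd d y\<close> in front of the distance.\<close>

lemma generator_close:
 assumes d: "d >= 1" and B: "drift d M B" and psi: "CB d 3 K psi" and x: "x : Rd d" and y: "y : Rd d"
  and beta: "!!i. i < d ==> abs (B' x i - B x i) <= beta"
 shows "abs (generator d B' psi x - generator d B psi y)
  <= ((real d)^2 * K * (1 + 2 * M)) * ((1 + norm_Rd d y) * dist_Rd d x y + beta)"
proof -
 have psi': "CB d (Suc (Suc (Suc 0))) K psi" using psi by (simp only: numeral_3_eq_3)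
 note psi1 = CB_pd(2)[OF psi'] and psi2 = CB_pd(2)[OF CB_pd(2)[OF psi']]
 note K = CB_nonneg[OF psi]
 have beta0: "0 <= beta" using beta[of 0] d by simp
 have M: "0 <= M" and B': "!!j. j < d ==> LB d 2 M (%x. B x j)"
  "!!j x. j < d ==> x : Rd d ==> abs (B x j) <= M * (1 + norm_Rd d x)" using B by (auto simp: drift_def)
 let ?D = "dist_Rd d x y" and ?Y = "1 + norm_Rd d y"
 have lipD: "abs (f x - f y) <= L * d * ?D" if "LB d k L f" "0 <= L" for f L k
  using LB_imp_lip[OF that] x y by (auto simp: lip_def)
 have D: "?D <= ?Y * ?D" by (simp add: mult_le_cancel_right1 distrib_right)
 have t: "abs ((pd i (pd i psi) x - pd i (pd i psi) y) - (B' x i * pd i psi x - B y i * pd i psi y))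
   <= d * K * (1 + 2 * M) * (?Y * ?D + beta)" if i: "i < d" for i
 proof -
  have 1: "abs (pd i (pd i psi) x - pd i (pd i psi) y) <= K * d * ?D"
   by (rule lipD[OF CB_imp_LB[OF psi2[OF i i]] K])
  have e: "B' x i * pd i psi x - B y i * pd i psi y = (B' x i - B x i) * pd i psi x + (B x i - B y i) * pd i psi x
   + B y i * (pd i psi x - pd i psi y)" by (simp add: algebra_simps)
  have 2: "abs ((B' x i - B x i) * pd i psi x) <= beta * K"
   unfolding abs_mult by (intro mult_mono beta i CB_bound[OF psi1[OF i] x]) (use beta0 in auto)
  have 3: "abs ((B x i - B y i) * pd i psi x) <= M * d * ?D * K"
   unfolding abs_mult by (intro mult_mono lipD[OF B'(1)[OF i] M] CB_bound[OF psi1[OF i] x]) (use M in auto)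
  have 4: "abs (B y i * (pd i psi x - pd i psi y)) <= M * ?Y * (K * d * ?D)"
   unfolding abs_mult by (intro mult_mono B'(2) i y lipD[OF CB_imp_LB[OF psi1[OF i]] K]) (use M in auto)
  have "K * d * ?D <= K * d * (?Y * ?D)" using D K by (intro mult_left_mono) auto
  moreover have "M * d * ?D * K <= M * d * (?Y * ?D) * K" using D K M by (intro mult_left_mono mult_right_mono) auto
  moreover have "beta * K <= d * K * (1 + 2 * M) * beta"
  proof -
   have "1 * 1 <= d * (1 + 2 * M)" using d M by (intro mult_mono) auto
   from mult_right_mono[OF this, of "K * beta"] show ?thesis using K beta0 by (simp add: algebra_simps)
  qed
  ultimately show ?thesis unfolding e using 1 2 3 4 by (simp add: algebra_simps)
 qed
 let ?g = "%i. (pd i (pd i psi) x - pd i (pd i psi) y) - (B' x i * pd i psi x - B y i * pd i psi y)"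
 have g: "generator d B' psi x - generator d B psi y = (\<Sum>i<d. ?g i)"
  by (simp add: generator_def laplacian_def sum_subtractf)
 have "(\<Sum>i<d. abs (?g i)) <= (\<Sum>i<d. d * K * (1 + 2 * M) * (?Y * ?D + beta))"
 proof (rule sum_mono)
  fix i assume "i : {..<d}"
  hence "i < d" by simp
  thus "abs (?g i) <= d * K * (1 + 2 * M) * (?Y * ?D + beta)" by (rule t)
 qed
 also have "... = ((real d)^2 * K * (1 + 2 * M)) * (?Y * ?D + beta)"
  by (simp only: power2_eq_square sum_constant card_lessThan mult.assoc)
 finally show ?thesis unfolding g using sum_abs[of ?g "{..<d}"] by linarith
qed

lemma product_le_quadratic:
 fixes a b eta :: real
 assumes eta: "0 < eta" and ab: "0 <= a" "0 <= b" shows "a * b <= eta * a^2 + b^2 / eta"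
proof -
 have "2 * (eta * a) * b <= (eta * a)^2 + b^2" by (rule sum_squares_bound)
 moreover have "0 <= eta * a * b" using assms by simp
 ultimately have "eta * a * b <= (eta * a)^2 + b^2" by linarith
 hence "eta * (a * b) <= eta * (eta * a^2 + b^2 / eta)"
  using eta by (simp add: power2_eq_square mult_ac distrib_left)
 thus ?thesis using eta by simp
qed

lemma integral_combination:
 fixes f g :: "'a => real" and C eta beta :: real
 assumes "prob_space \<pi>" "integrable \<pi> f" "integrable \<pi> g"
 shows "integrable \<pi> (%z. C * ((eta * f z + g z / eta) + beta))"
  "(LINT z|\<pi>. C * ((eta * f z + g z / eta) + beta)) = C * ((eta * (LINT z|\<pi>. f z) + (LINT z|\<pi>. g z) / eta) + beta)"
proof -
 interpret prob_space \<pi> by fact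
 show "integrable \<pi> (%z. C * ((eta * f z + g z / eta) + beta))" using assms by simp
 show "(LINT z|\<pi>. C * ((eta * f z + g z / eta) + beta)) = C * ((eta * (LINT z|\<pi>. f z) + (LINT z|\<pi>. g z) / eta) + beta)"
  using assms by (simp add: prob_space)
qed

text \<open>The estimate \<open>generator_close\<close> is integrated over a coupling with quadratic
  cost below \<open>eta^2\<close>; \<open>product_le_quadratic\<close> splits weight and distance
  with parameter \<open>eta\<close>, which makes both pieces of order \<open>eta\<close>.\<close>

lemma wasserstein_moment:
 assumes mu: "mu : P2 d" and mu': "mu' : P2 d" and w: "wasserstein d 2 mu' mu < eta"
 shows "(LINT x|mu'. (1 + norm_Rd d x)^2) <= 2 * (LINT x|mu. (1 + norm_Rd d x)^2) + 2 * eta^2"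
  and "d >= 1 ==> drift d M B ==> drift d M' B' ==> CB d 3 K psi ==>
   (!!x i. x : Rd d ==> i < d ==> abs (B' x i - B x i) <= beta) ==>
   abs ((LINT x|mu'. generator d B' psi x) - (LINT x|mu. generator d B psi x))
    <= ((real d)^2 * K * (1 + 2 * M)) * (eta * ((LINT x|mu. (1 + norm_Rd d x)^2) + 1) + beta)"
proof -
 let ?Y = "%x. 1 + norm_Rd d x" and ?D = "%z. dist_Rd d (fst z) (snd z)"
 have eta: "0 < eta" using w wasserstein_nonneg[OF mu' mu, of 2] by linarith
 obtain \<pi> where \<pi>: "\<pi> : couplings mu' mu" "(LINT z|\<pi>. ?D z ^ nat \<lfloor>2::real\<rfloor>) < eta ^ nat \<lfloor>2::real\<rfloor>"
  by (rule wasserstein_coupling[OF mu' mu disjI2[OF refl] w])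
 have D2: "(LINT z|\<pi>. (?D z)^2) <= eta^2" using \<pi>(2) by simp
 note c = coupling_facts[OF mu' mu \<pi>(1)] and ci = coupling_integral[OF mu' mu \<pi>(1)] and cd = coupling_dist[OF mu' mu \<pi>(1)]
 interpret prob_space \<pi> by (rule c(5))
 have Yc: "continuous_on (Rd d) (%x. (?Y x)^2)" by (intro continuous_intros continuous_on_norm_Rd)
 have Yi: "integrable nu (%x. (?Y x)^2)" if "nu : P2 d" for nu
  by (rule P2_integrable_quadratic[OF that Yc, of 1]) simp
 note Y1 = ci(3)[OF Yi[OF mu']] and Y2 = ci(4)[OF Yi[OF mu]]
 let ?S = "\<integral>x. (?Y x)^2 \<partial>mu"
 have S: "(LINT z|\<pi>. (?Y (snd z))^2) = ?S" by (rule ci(2)[OF P2_measurable[OF mu Yc]])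
 have "(LINT x|mu'. (?Y x)^2) = (LINT z|\<pi>. (?Y (fst z))^2)" using ci(1)[OF P2_measurable[OF mu' Yc]] by simp
 also have "... <= (LINT z|\<pi>. 2 * (?Y (snd z))^2 + 2 * (?D z)^2)"
 proof (intro integral_mono Bochner_Integration.integrable_add integrable_mult_right Y1 Y2 cd(3))
  fix z
  have "?Y (fst z) <= ?Y (snd z) + ?D z" using norm_Rd_lipschitz[of d "fst z" "snd z"] by linarith
  hence "(?Y (fst z))^2 <= (?Y (snd z) + ?D z)^2" by (intro power_mono) (auto intro: add_nonneg_nonneg)
  thus "(?Y (fst z))^2 <= 2 * (?Y (snd z))^2 + 2 * (?D z)^2"
   using sum_squares_bound[of "?Y (snd z)" "?D z"] power2_sum[of "?Y (snd z)" "?D z"] by linarith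
 qed
 also have "... = 2 * ?S + 2 * (LINT z|\<pi>. (?D z)^2)" using Y2 cd(3) S by simp
 finally show "(LINT x|mu'. (?Y x)^2) <= 2 * ?S + 2 * eta^2" using D2 by linarith
 assume d: "d >= 1" and B: "drift d M B" and B': "drift d M' B'" and psi: "CB d 3 K psi"
  and beta: "!!x i. x : Rd d ==> i < d ==> abs (B' x i - B x i) <= beta"
 let ?C = "(real d)^2 * K * (1 + 2 * M)"
 have C: "0 <= ?C" using CB_nonneg[OF psi] B by (simp add: drift_def)
 have gi: "integrable mu' (generator d B' psi)" "integrable mu (generator d B psi)"
  by (rule P2_integrable_linear[OF mu' generator_props[OF B' psi]] P2_integrable_linear[OF mu generator_props[OF B psi]]; assumption)+
 note combo = integral_combination[OF c(5) Y2 cd(3), of ?C eta beta]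
 have eq: "(LINT x|mu'. generator d B' psi x) - (LINT x|mu. generator d B psi x) =
  (LINT z|\<pi>. generator d B' psi (fst z) - generator d B psi (snd z))"
  using ci gi by simp
 have "abs ((LINT x|mu'. generator d B' psi x) - (LINT x|mu. generator d B psi x)) <= (LINT z|\<pi>. ?C * ((eta * (?Y (snd z))^2 + (?D z)^2 / eta) + beta))"
  unfolding eq
 proof (rule integral_abs_bound[THEN order_trans], rule integral_mono)
  show "integrable \<pi> (%z. abs (generator d B' psi (fst z) - generator d B psi (snd z)))" using ci(3,4) gi by simp
  show "integrable \<pi> (%z. ?C * ((eta * (?Y (snd z))^2 + (?D z)^2 / eta) + beta))"
   by (rule combo(1))
  fix z assume "z : space \<pi>"
  hence z: "fst z : Rd d" "snd z : Rd d" by (simp_all only: c(2) mem_Times_iff)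
  have "?Y (snd z) * ?D z <= eta * (?Y (snd z))^2 + (?D z)^2 / eta"
   by (rule product_le_quadratic[OF eta]) (simp_all only: dist_Rd_nonneg add_nonneg_nonneg zero_le_one norm_Rd_nonneg)
  hence "?C * (?Y (snd z) * ?D z + beta) <= ?C * ((eta * (?Y (snd z))^2 + (?D z)^2 / eta) + beta)"
   using C by (intro mult_left_mono) auto
  thus "abs (generator d B' psi (fst z) - generator d B psi (snd z)) <= ?C * ((eta * (?Y (snd z))^2 + (?D z)^2 / eta) + beta)"
   using generator_close[where B' = B', OF d B psi z beta[OF z(1)]] by linarith
 qed
 also have "... = ?C * ((eta * ?S + (LINT z|\<pi>. (?D z)^2) / eta) + beta)"
  by (simp only: combo(2) S)
 also have "... <= ?C * (eta * (?S + 1) + beta)"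
 proof (rule mult_left_mono[OF _ C])
  have "(LINT z|\<pi>. (?D z)^2) / eta <= eta" 
   using D2 by (simp only: pos_divide_le_eq[OF eta] power2_eq_square)
  thus "(eta * ?S + (LINT z|\<pi>. (?D z)^2) / eta) + beta <= eta * (?S + 1) + beta" by (simp add: distrib_left)
 qed
 finally show "abs ((LINT x|mu'. generator d B' psi x) - (LINT x|mu. generator d B psi x)) <= ?C * (eta * (?S + 1) + beta)" .
qed

lemma wasserstein_self:
 assumes mu: "mu : P2 d" shows "wasserstein d p mu mu = 0"
proof -
 let ?\<pi> = "distr mu (mu \<Otimes>\<^sub>M mu) (%x. (x, x))"
 have [measurable]: "(%x. (x, x)) : measurable mu (mu \<Otimes>\<^sub>M mu)" by simp
 have "?\<pi> : couplings mu mu" by (simp add: couplings_def distr_distr comp_def)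
 hence "(INF \<pi>\<in>couplings mu mu. \<integral>\<^sup>+ z. ennreal (dist_Rd d (fst z) (snd z) powr p) \<partial>\<pi>) <=
  (\<integral>\<^sup>+ z. ennreal (dist_Rd d (fst z) (snd z) powr p) \<partial>?\<pi>)" by (rule INF_lower)
 also have "... = (\<integral>\<^sup>+ x. ennreal (dist_Rd d x x powr p) \<partial>mu)"
  using coupling_dist(1)[OF mu mu product_coupling[OF mu mu]] by (subst nn_integral_distr) simp_all
 also have "... = 0" by simp
 finally show ?thesis by (simp add: wasserstein_def)
qed

section \<open>The mean-field setting\<close>

locale mean_field =
 fixes d :: nat and F :: "vec measure => real"
  and dF :: "vec measure => vec => real"
  and DF :: "vec measure => vec => vec" and Mmm Mmx rho :: real
 assumes d: "d >= 1" and lfd: "linear_functional_derivative d F dF"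
  and C1: "ALL mu:P2 d. C_k d 1 (dF mu)" and DF: "DF = intrinsic_derivative d dF"
  and Mmm: "Mmm >= 0" and rho: "rho > 0"
  and convex: "ALL t:{0..1}. ALL mu:P2 d. ALL mu':P2 d. F (mix t mu mu') <= (1 - t) * F mu + t * F mu'"
  and DF_lip: "ALL x:Rd d. ALL mu:P2 d. ALL mu':P2 d. dist_Rd d (DF mu x) (DF mu' x) <= Mmm * wasserstein d 1 mu mu'"
  and LSI: "ALL mu:P2 d. integrable (lborel_Rd d) (%x. exp (- dF mu x)) &
     (ALL f. C1_bounded d f -->
      rho * Ent (hat d dF mu) (%x. (f x)^2) <= (LINT x|hat d dF mu. (norm_Rd d (grad d f x))^2))"
  and DF1: "ALL mu:P2 d. ALL x:Rd d. deriv_norm d 1 (DF mu) x <= Mmx"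
  and DF_C3: "ALL mu:P2 d. ALL i<d. C_k d 3 (%x. DF mu x i)"
  and DF23: "ALL k:{2, 3}. EX B. ALL mu:P2 d. ALL x:Rd d. deriv_norm d k (DF mu) x <= B"
begin

lemma hat_gibbs: "hat d dF mu = gibbs d (dF mu)"
 by (simp add: hat_def gibbs_def)

lemma DF_pd: "mu : P2 d ==> i < d ==> has_pd d i (dF mu) (%x. DF mu x i)"
 using C_k_pd[of d 0 "dF mu" i] C1 by (auto simp: DF intrinsic_derivative_def grad_def)

text \<open>One \<open>M\<close> for all measures, because the drift changes along the flow. The
  first derivative is bounded by \<open>Mmx\<close>, the next two by \<open>DF23\<close>, and
  \<open>foldr_pd_le_deriv_norm\<close> converts operator norms into partial derivatives.\<close>

lemma DF_LB: "EX M>=0. ALL mu:P2 d. ALL i<d. LB d 2 M (%x. DF mu x i)"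
proof -
 obtain B2 B3 where B: "!!mu x. mu : P2 d ==> x : Rd d ==> deriv_norm d 2 (DF mu) x <= B2"
  "!!mu x. mu : P2 d ==> x : Rd d ==> deriv_norm d 3 (DF mu) x <= B3" using DF23 by (metis insertCI)
 let ?M = "max 0 (max Mmx (max B2 B3))"
 have "LB d 2 ?M (%x. DF mu x i)" if mu: "mu : P2 d" and i: "i < d" for mu i
  unfolding LB_def
 proof (intro conjI allI impI)
  have c: "C_k d 3 (%x. DF mu x i)" using DF_C3 mu i by blast
  thus "continuous_on (Rd d) (%x. DF mu x i)" by (rule C_k_cont)
  fix j assume j: "j < d"
  have "C_k d (Suc 2) (%x. DF mu x i)" using c by (simp add: eval_nat_numeral)
  hence h: "has_pd d j (%x. DF mu x i) (pd j (%x. DF mu x i))" and c2: "C_k d 2 (pd j (%x. DF mu x i))"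
   using C_k_pd j by (blast, simp only: C_k.simps)
  have "CB d 2 ?M (pd j (%x. DF mu x i))"
  proof (rule C_k_imp_CB[OF c2])
   fix js x assume js: "set js \<subseteq> {..<d}" "length js <= 2" and x: "x : Rd d"
   have "abs (foldr pd (js @ [j]) (%y. DF mu y i) x) <= deriv_norm d (length (js @ [j])) (DF mu) x"
    by (rule foldr_pd_le_deriv_norm[OF i]) (use js j in auto)
   moreover have "length js = 0 | length js = 1 | length js = 2" using js(2) by linarith
   hence "length (js @ [j]) = 1 | length (js @ [j]) = 2 | length (js @ [j]) = 3" by auto
   hence "deriv_norm d (length (js @ [j])) (DF mu) x <= ?M"
    using B[OF mu x] DF1[rule_format, OF mu x] by (auto simp: le_max_iff_disj simp del: length_append)
   ultimately show "abs (foldr pd js (pd j (%x. DF mu x i)) x) <= ?M" by simp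
  qed
  with h show "EX g. has_pd d j (%x. DF mu x i) g & CB d 2 ?M g" by blast
 qed
 thus ?thesis by (intro exI[of _ ?M]) simp
qed

text \<open>Here \<open>M\<close> depends on \<open>mu\<close> through the value of
  \<open>DF mu\<close> at the origin, which may be unbounded over \<open>P2 d\<close>. On a time
  interval, uniformity is recovered in \<open>hc_chain\<close> by comparison with a fixed
  measure.\<close>

lemma drift_DF:
 assumes mu: "mu : P2 d" obtains M where "drift d M (DF mu)"
proof -
 obtain M where M: "0 <= M" "!!i. i < d ==> LB d 2 M (%x. DF mu x i)" using DF_LB mu by blast
 let ?K = "%i. abs (DF mu (restrict (%_. 0) {..<d}) i) + M * d"
 let ?M = "M + (\<Sum>i<d. ?K i)"
 have K: "0 <= ?K i" for i using M(1) by simp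
 have "abs (DF mu x j) <= ?M * (1 + norm_Rd d x)" if j: "j < d" and x: "x : Rd d" for j x
 proof -
  have "?K j <= ?M" using member_le_sum[of j "{..<d}" ?K] K j M(1) by (simp add: add_increasing)
  with lip_growth[OF LB_imp_lip[OF M(2)[OF j] M(1)] x] show ?thesis
   by (elim order_trans) (rule mult_right_mono, auto)
 qed
 moreover have S: "0 <= (\<Sum>i<d. ?K i)" by (rule sum_nonneg) (rule K)
 hence "0 <= ?M" using M(1) by linarith
 moreover have "LB d 2 ?M (%x. DF mu x j)" if "j < d" for j
  by (rule LB_mono[OF M(2)[OF that] order_refl]) (use S in linarith)
 ultimately have "drift d ?M (DF mu)" by (simp add: drift_def)
 thus thesis by (rule that)
qed

lemma lsi_gibbs: "mu : P2 d ==> lsi_gibbs d (dF mu) rho"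
proof (unfold_locales, unfold LSI_def hat_gibbs[symmetric])
 assume mu: "mu : P2 d"
 show "continuous_on (Rd d) (dF mu)" by (rule C_k_cont[OF C1[rule_format, OF mu]])
qed (use LSI rho in blast)+

lemma gibbs_flow:
 assumes mu: "mu : P2 d" obtains Mb where "gibbs_flow d (dF mu) rho (DF mu) Mb"
proof -
 obtain M where M: "drift d M (DF mu)" using drift_DF[OF mu] .
 interpret lsi_gibbs d "dF mu" rho by (rule lsi_gibbs[OF mu])
 have "gibbs_flow d (dF mu) rho (DF mu) M"
  using M by unfold_locales (simp_all add: DF_pd[OF mu] drift_def LB_def)
 thus thesis by (rule that)
qed

lemma hat_P2: "mu : P2 d ==> hat d dF mu : P2 d"
 unfolding hat_gibbs by (rule lsi_gibbs.gibbs_P2[OF lsi_gibbs])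

lemma DF_close:
 assumes "x : Rd d" "mu : P2 d" "mu' : P2 d"
 shows "norm_Rd d (%i. DF mu x i - DF mu' x i) <= Mmm * wasserstein d 1 mu mu'"
 using DF_lip assms by (simp add: dist_Rd_def)

end

locale mean_field_flow = mean_field +
 fixes m :: "real => vec measure"
 assumes sol: "fokker_planck_solution d DF m"
begin

lemma m_P2: "0 <= t ==> m t : P2 d"
 using sol by (simp add: fokker_planck_solution_def)

lemma m_continuous:
 assumes t: "0 <= t" and eta: "0 < eta"
 obtains delta where "0 < delta" "!!s. 0 <= s ==> abs (s - t) < delta ==> wasserstein d 2 (m s) (m t) < eta"
proof -
 have "((%s. wasserstein d 2 (m s) (m t)) \<longlongrightarrow> 0) (at t within {0..})"
  using sol t by (simp add: fokker_planck_solution_def)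
 from tendstoD[OF this eta] obtain delta where delta: "0 < delta"
  "!!s. s : {0..} ==> s ~= t ==> dist s t < delta ==> dist (wasserstein d 2 (m s) (m t)) 0 < eta"
  unfolding eventually_at by blast
 note self = wasserstein_self[OF m_P2[OF t], of 2]
 show thesis
 proof (rule that[OF delta(1)])
  fix s assume "0 <= s" "abs (s - t) < delta"
  thus "wasserstein d 2 (m s) (m t) < eta" using delta(2)[of s] self eta by (cases "s = t") (auto simp: dist_real_def)
 qed
qed

lemma generator_test: "generator d B phi x = laplacian d phi x - (\<Sum>i<d. B x i * grad d phi x i)"
 unfolding generator_def grad_def by (auto intro!: sum.cong)

lemma weak_equation:
 assumes phi: "test_function d phi" and a: "0 <= a" "a <= b"
 shows "((%s. \<integral>x. generator d (DF (m s)) phi x \<partial>m s) has_integral ((LINT x|m b. phi x) - (LINT x|m a. phi x))) {a..b}"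
proof -
 let ?f = "%s. \<integral>x. generator d (DF (m s)) phi x \<partial>m s"
 have h: "(?f has_integral ((LINT x|m t. phi x) - (LINT x|m 0. phi x))) {0..t}" if "0 <= t" for t
  unfolding generator_test using sol phi that by (simp add: fokker_planck_solution_def)
 have b: "0 <= b" using a by simp
 note ib = has_integral_integrable[OF h[OF b]]
 have "integral {0..a} ?f + integral {a..b} ?f = integral {0..b} ?f"
  by (rule Henstock_Kurzweil_Integration.integral_combine[OF a ib])
 hence "integral {a..b} ?f = (LINT x|m b. phi x) - (LINT x|m a. phi x)"
  using integral_unique[OF h[OF a(1)]] integral_unique[OF h[OF b]] by simp
 moreover have "?f integrable_on {a..b}" by (rule integrable_subinterval_real[OF ib]) (use a in auto)
 ultimately show ?thesis by (simp add: has_integral_integrable_integral)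
qed

text \<open>The mesh \<open>delta\<close> may depend on \<open>t\<close>, since the estimate is only fed into \<open>Bolzano\<close>.\<close>

lemma weak_consistency:
 assumes t: "0 <= t" and K: "0 <= K" and eps: "0 < eps"
 shows "EX delta>0. delta <= 1 & (ALL a b. 0 <= a & a <= t & t <= b & b - a < delta --> (ALL phi. CB d 3 K phi -->
  abs ((LINT x|m b. phi x) - (LINT x|m a. euler_step d (DF (m t)) (b - a) phi x)) <= eps * (b - a)))"
proof -
 note P = m_P2
 obtain M where B: "drift d M (DF (m t))" using drift_DF[OF P[OF t]] .
 hence M: "0 <= M" by (simp add: drift_def)
 obtain C where C: "0 <= C" "!!K phi. CB d 3 K phi ==> EX psi. (ALL n. test_function d (psi n) & CB d 3 (C * K) (psi n)) &
  (ALL x:Rd d. (%n. psi n x) ----> phi x &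
   (ALL i<d. (%n. pd i (psi n) x) ----> pd i phi x & (%n. pd i (pd i (psi n)) x) ----> pd i (pd i phi) x))"
  using test_approx[of d] by blast
 define K' where "K' = max K (C * K)"
 have K': "0 <= K'" "K <= K'" "C * K <= K'" using K by (auto simp: K'_def)
 define S where "S = (LINT x|m t. (1 + norm_Rd d x)^2)"
 have S: "0 <= S" unfolding S_def by (rule Bochner_Integration.integral_nonneg) simp
 \<comment> \<open>\<open>c1\<close> measures how the generator reacts to a displacement of the
   measure, \<open>c2\<close> the local error of the Euler step; \<open>eta\<close> and
   \<open>delta\<close> are then chosen so that each of the two takes half of
   \<open>eps\<close>.\<close>
 define c1 where "c1 = ((real d)^2 * K' * (1 + 2 * M)) * (S + 1 + Mmm)"
 define c2 where "c2 = ((real d * M)^2 + 4 * (real d)^2 + (real d)^2 * M) * K * (2 * S + 2)"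
 have c1: "0 <= c1" unfolding c1_def using M K' S Mmm by simp
 have c2: "0 <= c2" unfolding c2_def using M K S by simp
 define eta where "eta = min 1 (eps / (4 * (c1 + 1)))"
 have eta: "0 < eta" "eta <= 1" "2 * c1 * eta <= eps / 2"
 proof -
  show "0 < eta" "eta <= 1" using eps c1 by (auto simp: eta_def)
  have "2 * c1 * eta <= 2 * (c1 + 1) * (eps / (4 * (c1 + 1)))"
   using c1 eps by (intro mult_mono) (auto simp: eta_def)
  also have "... = eps / 2" using c1 by (simp add: field_simps)
  finally show "2 * c1 * eta <= eps / 2" .
 qed
 obtain delta0 where delta0: "0 < delta0" "!!s. 0 <= s ==> abs (s - t) < delta0 ==> wasserstein d 2 (m s) (m t) < eta"
  using m_continuous[OF t eta(1)] by blast
 define delta where "delta = min (min 1 delta0) ((eps / (2 * (c2 + 1)))^2)"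
 have delta: "0 < delta" "delta <= 1" "delta <= delta0" using delta0(1) eps c2 by (auto simp: delta_def)
 have sq: "c2 * sqrt h <= eps / 2" if "0 <= h" "h < delta" for h
 proof -
  have "sqrt h <= eps / (2 * (c2 + 1))" using that c2 eps by (intro real_le_lsqrt) (auto simp: delta_def)
  hence "c2 * sqrt h <= (c2 + 1) * (eps / (2 * (c2 + 1)))" using c2 that by (intro mult_mono) auto
  also have "... = eps / 2" using c2 by (simp add: field_simps)
  finally show ?thesis .
 qed
 \<comment> \<open>The measure moves from time \<open>t\<close> to \<open>s\<close>, and so does the
   drift if \<open>B'\<close> is \<open>DF (m s)\<close>. That case handles the weak equation; the
   case \<open>DF (m t)\<close> handles the Euler step, whose drift is frozen.\<close>
 have gen: "abs ((LINT x|m s. generator d B' psi x) - (LINT x|m t. generator d (DF (m t)) psi x)) <= c1 * eta"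
  if s: "0 <= s" "abs (s - t) < delta0" and psi: "CB d 3 K' psi" and B': "B' = DF (m s) | B' = DF (m t)" for s B' psi
 proof -
  note w = delta0(2)[OF s]
  obtain M' where M': "drift d M' B'" using B' drift_DF[OF P[OF t]] drift_DF[OF P[OF s(1)]] by metis
  have "abs (B' x i - DF (m t) x i) <= Mmm * eta" if x: "x : Rd d" and i: "i < d" for x i
  proof -
   have "abs (DF (m s) x i - DF (m t) x i) <= Mmm * wasserstein d 1 (m s) (m t)"
    using DF_close[OF x P[OF s(1)] P[OF t]] abs_le_norm_Rd[OF i, of "%i. DF (m s) x i - DF (m t) x i"] by linarith
   also have "... <= Mmm * eta" using wasserstein1_le_2[OF P[OF s(1)] P[OF t]] w Mmm by (intro mult_left_mono) auto
   finally show ?thesis using B' Mmm eta(1) by auto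
  qed
  from wasserstein_moment(2)[OF P[OF t] P[OF s(1)] w d B M' psi this]
  show ?thesis unfolding c1_def S_def by (simp add: algebra_simps)
 qed
 have main: "abs ((LINT x|m b. phi x) - (LINT x|m a. euler_step d (DF (m t)) (b - a) phi x)) <= eps * (b - a)"
  if a: "0 <= a" and at: "a <= t" and tb: "t <= b" and ab: "b - a < delta" and phi: "CB d 3 K phi" for a b phi
 proof -
  have le: "a <= b" using at tb by simp
  have b: "0 <= b" using a le by simp
  note Pa = P[OF a] and Pb = P[OF b] and Pt = P[OF t]
  interpret pa: prob_space "m a" by (rule P2_D(1)[OF Pa])
  interpret pb: prob_space "m b" by (rule P2_D(1)[OF Pb])
  let ?G = "%psi. \<integral>x. generator d (DF (m t)) psi x \<partial>m t"
  have win: "abs (s - t) < delta0" if "s : {a..b}" for s using that at tb ab delta(3) by auto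
  obtain psi where psi: "!!n. test_function d (psi n)" "!!n. CB d 3 (C * K) (psi n)"
   "!!x. x : Rd d ==> (%n. psi n x) ----> phi x"
   "!!x i. x : Rd d ==> i < d ==> (%n. pd i (psi n) x) ----> pd i phi x"
   "!!x i. x : Rd d ==> i < d ==> (%n. pd i (pd i (psi n)) x) ----> pd i (pd i phi) x"
   using C(2)[OF phi] by blast
  have step: "abs ((LINT x|m b. psi n x) - (LINT x|m a. psi n x) - (b - a) * ?G (psi n)) <= c1 * eta * (b - a)" for n
  proof -
   let ?f = "%s. \<integral>x. generator d (DF (m s)) (psi n) x \<partial>m s"
   have "((%s. ?f s - ?G (psi n)) has_integral ((LINT x|m b. psi n x) - (LINT x|m a. psi n x) - (b - a) * ?G (psi n))) (cbox a b)"
    using has_integral_diff[OF weak_equation[OF psi(1) a le] has_integral_const_real[of "?G (psi n)" a b]] le by simp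
   moreover have "norm (?f s - ?G (psi n)) <= c1 * eta" if "s : cbox a b" for s
    unfolding real_norm_def using that a
    by (intro gen win CB_mono_const[OF psi(2) K'(3)]) auto
   ultimately show ?thesis
    using has_integral_bound[of "c1 * eta" "%s. ?f s - ?G (psi n)" _ a b] c1 eta(1) le by simp
  qed
  have lim: "(%n. \<integral>x. psi n x \<partial>mu) ----> (LINT x|mu. phi x)" if mu: "mu : P2 d" for mu
  proof (rule integral_dominated_convergence[where w = "%_. C * K"])
   interpret prob_space mu by (rule P2_D(1)[OF mu])
   show "phi : borel_measurable mu" "!!n. psi n : borel_measurable mu"
    by (rule P2_measurable[OF mu] CB_cont[OF phi] CB_cont[OF psi(2)])+
   show "integrable mu (%_. C * K)" by simp
   show "AE x in mu. (%n. psi n x) ----> phi x" "!!n. AE x in mu. norm (psi n x) <= C * K"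
    by (rule AE_I2, use P2_D(3)[OF mu] psi(3) CB_bound[OF psi(2)] in auto)+
  qed
  have limG: "(%n. ?G (psi n)) ----> ?G phi"
  proof (rule integral_dominated_convergence[where w = "%x. (d * (C * K) * (1 + M)) * (1 + norm_Rd d x)"])
   show "generator d (DF (m t)) phi : borel_measurable (m t)" "!!n. generator d (DF (m t)) (psi n) : borel_measurable (m t)"
    by (rule P2_measurable[OF Pt] generator_props(1)[OF B phi] generator_props(1)[OF B psi(2)])+
   show "integrable (m t) (%x. (d * (C * K) * (1 + M)) * (1 + norm_Rd d x))"
    using C(1) K M by (intro P2_integrable_linear[OF Pt, where C = "d * (C * K) * (1 + M)"])
     (auto intro!: continuous_intros continuous_on_norm_Rd simp: abs_mult)
   show "AE x in m t. (%n. generator d (DF (m t)) (psi n) x) ----> generator d (DF (m t)) phi x"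
   proof (rule AE_I2)
    fix x assume "x : space (m t)"
    hence x: "x : Rd d" using P2_D(3)[OF Pt] by simp
    show "(%n. generator d (DF (m t)) (psi n) x) ----> generator d (DF (m t)) phi x"
     unfolding generator_def laplacian_def
     by (intro tendsto_diff tendsto_sum tendsto_mult tendsto_const psi(4,5)[OF x]) auto
   qed
   show "AE x in m t. norm (generator d (DF (m t)) (psi n) x) <= (d * (C * K) * (1 + M)) * (1 + norm_Rd d x)" for n
    using generator_props(2)[OF B psi(2)] P2_D(3)[OF Pt] by (intro AE_I2) auto
  qed
  \<comment> \<open>Only here does \<open>phi\<close> replace the test functions
    \<open>psi n\<close>, to which \<open>weak_equation\<close> is limited.\<close>
  have 1: "abs ((LINT x|m b. phi x) - (LINT x|m a. phi x) - (b - a) * ?G phi) <= c1 * eta * (b - a)"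
   by (rule LIMSEQ_le_const2[OF tendsto_rabs[OF tendsto_diff[OF tendsto_diff[OF lim[OF Pb] lim[OF Pa]]
    tendsto_mult[OF tendsto_const limG]]]]) (use step in blast)
  have 2: "abs ((LINT x|m a. generator d (DF (m t)) phi x) - ?G phi) <= c1 * eta"
   by (rule gen[OF a win CB_mono_const[OF phi K'(2)]]) (use le in auto)
  let ?Q = "euler_step d (DF (m t)) (b - a) phi" and ?g = "generator d (DF (m t)) phi"
  have h: "0 <= b - a" "b - a <= 1" using le ab delta(2) by auto
  obtain A where "CB d 3 (K * (1 + A * (b - a))) ?Q" using CB_euler_step[OF d, of M] B phi h by blast
  hence iQ: "integrable (m a) ?Q" by (rule P2_integrable_CB[OF Pa])
  have iphi: "integrable (m a) phi" by (rule P2_integrable_CB[OF Pa phi])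
  have ig: "integrable (m a) ?g" by (rule P2_integrable_linear[OF Pa generator_props[OF B phi]])
  have Yc: "continuous_on (Rd d) (%x. (1 + norm_Rd d x)^2)" by (intro continuous_intros continuous_on_norm_Rd)
  let ?c = "((real d * M)^2 + 4 * (real d)^2 + (real d)^2 * M) * K * ((b - a) * sqrt (b - a))"
  have c: "0 <= ?c" using K M h by simp
  have "abs (\<integral>x. ?Q x - phi x - (b - a) * ?g x \<partial>m a) <= (LINT x|m a. ?c * (1 + norm_Rd d x)^2)"
  proof (rule integral_abs_bound[THEN order_trans], rule integral_mono)
   show "integrable (m a) (%x. abs (?Q x - phi x - (b - a) * ?g x))" using iQ iphi ig by simp
   show "integrable (m a) (%x. ?c * (1 + norm_Rd d x)^2)"
    by (intro integrable_mult_right P2_integrable_quadratic[OF Pa Yc, of 1]) simp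
   show "abs (?Q x - phi x - (b - a) * ?g x) <= ?c * (1 + norm_Rd d x)^2" if "x : space (m a)" for x
    by (rule euler_step_consistency(2)[OF d B phi h]) (use that P2_D(3)[OF Pa] in simp)
  qed
  also have "... = ?c * (LINT x|m a. (1 + norm_Rd d x)^2)" by (rule integral_mult_right_zero)
  also have "... <= ?c * (2 * S + 2)"
  proof (rule mult_left_mono[OF _ c])
   have "eta^2 <= 1" using eta(1,2) by (simp add: power_le_one)
   thus "(LINT x|m a. (1 + norm_Rd d x)^2) <= 2 * S + 2"
    using wasserstein_moment(1)[OF Pt Pa delta0(2)[OF a win]] le unfolding S_def by simp
  qed
  also have "... = (c2 * sqrt (b - a)) * (b - a)" by (simp add: c2_def)
  also have "... <= eps / 2 * (b - a)" by (rule mult_right_mono[OF sq[OF h(1) ab] h(1)])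
  finally have 3: "abs ((LINT x|m a. ?Q x) - (LINT x|m a. phi x) - (b - a) * (LINT x|m a. ?g x)) <= eps / 2 * (b - a)"
   using iQ iphi ig by simp
  have 4: "abs ((b - a) * (LINT x|m a. ?g x) - (b - a) * ?G phi) <= c1 * eta * (b - a)"
   using mult_left_mono[OF 2 h(1)] h(1) by (simp only: abs_mult right_diff_distrib[symmetric] abs_of_nonneg mult.commute)
  have "2 * (c1 * eta * (b - a)) <= eps / 2 * (b - a)" using mult_right_mono[OF eta(3) h(1)] by (simp add: mult_ac)
  moreover have "eps / 2 * (b - a) + eps / 2 * (b - a) = eps * (b - a)" by (simp add: field_simps)
  ultimately show ?thesis using 1 3 4 by linarith
 qed
 show ?thesis using delta main by (intro exI[of _ delta]) blast
qed

end

section \<open>Hypercontractivity along the flow\<close>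

context mean_field_flow
begin

abbreviation "LN mu \<equiv> gibbs_flow.log_norm d (dF mu)"

text \<open>The chain runs backwards: a function at time \<open>b0\<close> is pulled back to one at
  \<open>a0\<close> with nearly the same integral against the flow, while its exponent rises from
  \<open>qb\<close> to \<open>q a0\<close>. The hypothesis on \<open>beta\<close> says that the
  squared mismatch, relative to the distance of the exponent from 1, costs at most
  \<open>kappa\<close> per unit of time. \<open>Bolzano\<close> glues steps whose admissible length
  depends on the time.\<close>

lemma hc_chain:
 assumes mu: "mu : P2 d" and a0: "0 <= a0" "a0 <= b0" and eta: "0 < eta" "eta < 1" and qb: "1 < qb" and kappa: "0 <= kappa"
  and eps: "0 < eps" and c0: "0 < c0" "c0 <= C0"
  and q: "!!s. q s = 1 + (qb - 1) * exp (4 * rho * (1 - eta) * (b0 - s))"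
  and beta: "!!s. a0 <= s ==> s <= b0 ==> (beta s)^2 <= 4 * eta * kappa * (q s - 1)"
  and DFbeta: "!!s x. a0 <= s ==> s <= b0 ==> x : Rd d ==> norm_Rd d (%i. DF (m s) x i - DF mu x i) <= beta s"
  and phi: "CB d 3 K0 phi" "!!x. x : Rd d ==> c0 <= phi x & phi x <= C0"
 shows "EX psi K. CB d 3 K psi & (ALL x:Rd d. c0 <= psi x & psi x <= C0) &
  abs ((LINT x|m b0. phi x) - (LINT x|m a0. psi x)) <= eps * (b0 - a0) &
  LN mu (q a0) psi <= LN mu qb phi + (kappa + eps) * (b0 - a0)"
proof -
 obtain Mb where "gibbs_flow d (dF mu) rho (DF mu) Mb" using gibbs_flow[OF mu] .
 then interpret gf: gibbs_flow d "dF mu" rho "DF mu" Mb .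
 let ?r = "4 * rho * (1 - eta)"
 have r: "0 < ?r" using rho eta by simp
 have q1: "1 < q s" for s unfolding q using qb by simp
 have rmono: "exp (?r * x) <= exp (?r * y)" if "x <= y" for x y using mult_left_mono[OF that less_imp_le[OF r]] by simp
 have qmono: "q s <= q a0" if "a0 <= s" for s
  unfolding q using qb by (intro add_left_mono mult_left_mono rmono) (use that in auto)
 have qstep: "q s = 1 + (q s' - 1) * exp (?r * (s' - s))" for s s'
 proof -
  have "exp (?r * (b0 - s)) = exp (?r * (b0 - s')) * exp (?r * (s' - s))" unfolding exp_add[symmetric] by (simp add: algebra_simps)
  thus ?thesis unfolding q by (simp add: mult.assoc)
 qed
 \<comment> \<open>\<open>q\<close> is largest at \<open>a0\<close>, so \<open>beta'\<close> bounds
   the mismatch on the whole interval; this yields one drift constant \<open>M\<close> and hence one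
   stability constant \<open>A\<close>.\<close>
 define beta' where "beta' = sqrt (4 * eta * kappa * (q a0 - 1))"
 have beta': "norm_Rd d (%i. DF (m s) x i - DF mu x i) <= beta'" if s: "a0 <= s" "s <= b0" and x: "x : Rd d" for s x
 proof -
  have "4 * eta * kappa * (q s - 1) <= 4 * eta * kappa * (q a0 - 1)" using qmono[OF s(1)] eta kappa by (intro mult_left_mono) auto
  hence "beta s <= beta'" unfolding beta'_def using beta[OF s] by (intro real_le_rsqrt) linarith
  with DFbeta[OF s x] show ?thesis by linarith
 qed
 have beta'0: "0 <= beta'" using eta kappa q1[of a0] by (simp add: beta'_def)
 obtain M1 where M1: "drift d M1 (DF mu)" using drift_DF[OF mu] .
 obtain M2 where M2: "0 <= M2" "!!mu i. mu : P2 d ==> i < d ==> LB d 2 M2 (%x. DF mu x i)" using DF_LB by blast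
 define M where "M = M1 + M2 + beta'"
 have M10: "0 <= M1" using M1 by (simp add: drift_def)
 have dr: "drift d M (DF (m s))" if s: "a0 <= s" "s <= b0" for s
  unfolding drift_def
 proof (intro conjI allI impI ballI)
  show "0 <= M" using M10 M2 beta'0 by (simp add: M_def)
  fix j assume j: "j < d"
  have Ps: "m s : P2 d" by (rule m_P2) (use s a0 in simp)
  show "LB d 2 M (%x. DF (m s) x j)"
   by (rule LB_mono[OF M2(2)[OF Ps j] order_refl]) (use M10 beta'0 in \<open>simp add: M_def\<close>)
  fix x assume x: "x : Rd d"
  have "abs (DF mu x j) <= M1 * (1 + norm_Rd d x)" using M1 j x by (simp add: drift_def)
  moreover have "abs (DF (m s) x j - DF mu x j) <= beta'"
   using beta'[OF s x] abs_le_norm_Rd[OF j, of "%i. DF (m s) x i - DF mu x i"] by linarith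
  moreover have "0 <= beta' * norm_Rd d x" "0 <= M2 * (1 + norm_Rd d x)" using beta'0 M2(1) by simp_all
  ultimately show "abs (DF (m s) x j) <= M * (1 + norm_Rd d x)" unfolding M_def distrib_left distrib_right by linarith
 qed
 have M: "0 <= M" using M10 M2 beta'0 by (simp add: M_def)
 obtain A where A: "0 <= A" "!!B phi K delta. drift d M B ==> CB d 3 K phi ==> 0 <= delta ==> delta <= 1 ==>
  CB d 3 (K * (1 + A * delta)) (euler_step d B delta phi)" using CB_euler_step[OF d, of M] by blast
 \<comment> \<open>The budget for the third-order bounds at time \<open>s\<close>. It grows
   backwards in time fast enough to absorb the factors \<open>1 + A * delta\<close> of
   \<open>CB_euler_step\<close>.\<close>
 define Kf where "Kf s = K0 * exp (A * (b0 - s))" for s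
 note K0 = CB_nonneg[OF phi(1)]
 have Kmono: "Kf s <= Kf a0" if "a0 <= s" for s unfolding Kf_def using K0 that by (intro mult_left_mono exp_le_cancel_iff[THEN iffD2] A(1)) auto
 have Kf0: "0 <= Kf s" for s using K0 by (simp add: Kf_def)
 have Kstep: "Kf s' * (1 + A * (s' - s)) <= Kf s" for s s'
 proof -
  have "Kf s' * (1 + A * (s' - s)) <= Kf s' * exp (A * (s' - s))" by (rule mult_left_mono[OF exp_ge_add_one_self Kf0])
  also have "... = K0 * exp (A * (b0 - s') + A * (s' - s))" by (simp only: Kf_def exp_add mult.assoc)
  also have "... = Kf s" by (simp add: Kf_def algebra_simps)
  finally show ?thesis .
 qed
 from gf.hc_step[OF d c0 q1[of a0] eta M Kf0[of a0]]
 obtain A' where A': "0 <= A'" "!!delta B beta u q'. 0 <= delta ==> delta <= 1 ==> drift d M B ==> 0 <= beta ==>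
  (ALL x:Rd d. norm_Rd d (%i. B x i - DF mu x i) <= beta) ==> CB d 3 (Kf a0) u ==> (ALL x:Rd d. c0 <= u x & u x <= C0) ==>
  1 < q' ==> 1 + (q' - 1) * exp (?r * delta) <= q a0 ==>
  LN mu (1 + (q' - 1) * exp (?r * delta)) (euler_step d B delta u)
   <= LN mu q' u + delta * (beta^2 / (4 * eta * (q' - 1))) + A' * (delta * sqrt delta)" by blast
 define P where "P s s' \<longleftrightarrow> (a0 <= s & s' <= b0 --> (ALL phi. CB d 3 (Kf s') phi & (ALL x:Rd d. c0 <= phi x & phi x <= C0) -->
  (EX psi. CB d 3 (Kf s) psi & (ALL x:Rd d. c0 <= psi x & psi x <= C0) &
   abs ((LINT x|m s'. phi x) - (LINT x|m s. psi x)) <= eps * (s' - s) & LN mu (q s) psi <= LN mu (q s') phi + (kappa + eps) * (s' - s))))" for s s'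
 have "P a0 b0"
  using a0(2)
 proof (induction rule: Bolzano)
  case (trans a b c)
  show ?case unfolding P_def
  proof (intro impI allI)
   fix phi assume g: "a0 <= a & c <= b0" and phi: "CB d 3 (Kf c) phi & (ALL x:Rd d. c0 <= phi x & phi x <= C0)"
   have "a0 <= b & c <= b0" "a0 <= a & b <= b0" using g trans(3,4) by auto
   note P1 = trans(1)[unfolded P_def, rule_format, OF this(2)] and P2 = trans(2)[unfolded P_def, rule_format, OF this(1) phi]
   from P2 obtain psi where psi: "CB d 3 (Kf b) psi & (ALL x:Rd d. c0 <= psi x & psi x <= C0)"
    "abs ((LINT x|m c. phi x) - (LINT x|m b. psi x)) <= eps * (c - b)" "LN mu (q b) psi <= LN mu (q c) phi + (kappa + eps) * (c - b)" by blast
   from P1[OF psi(1)] obtain psi' where psi': "CB d 3 (Kf a) psi' & (ALL x:Rd d. c0 <= psi' x & psi' x <= C0)"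
    "abs ((LINT x|m b. psi x) - (LINT x|m a. psi' x)) <= eps * (b - a)" "LN mu (q a) psi' <= LN mu (q b) psi + (kappa + eps) * (b - a)" by blast
   have "abs ((LINT x|m c. phi x) - (LINT x|m a. psi' x)) <= eps * (c - b) + eps * (b - a)" using psi(2) psi'(2) by linarith
   moreover have "LN mu (q a) psi' <= LN mu (q c) phi + ((kappa + eps) * (c - b) + (kappa + eps) * (b - a))" using psi(3) psi'(3) by linarith
   moreover have "eps * (c - b) + eps * (b - a) = eps * (c - a)" "(kappa + eps) * (c - b) + (kappa + eps) * (b - a) = (kappa + eps) * (c - a)"
    by (simp_all add: algebra_simps)
   ultimately show "EX psi. CB d 3 (Kf a) psi & (ALL x:Rd d. c0 <= psi x & psi x <= C0) &
    abs ((LINT x|m c. phi x) - (LINT x|m a. psi x)) <= eps * (c - a) & LN mu (q a) psi <= LN mu (q c) phi + (kappa + eps) * (c - a)"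
    using psi'(1) by (intro exI[of _ psi']) simp
  qed
 next
  case (local t)
  have t0: "0 <= t" using local a0 by simp
  obtain delta1 where delta1: "0 < delta1" "delta1 <= 1" "!!a b phi. 0 <= a ==> a <= t ==> t <= b ==> b - a < delta1 ==> CB d 3 (Kf a0) phi ==>
    abs ((LINT x|m b. phi x) - (LINT x|m a. euler_step d (DF (m t)) (b - a) phi x)) <= eps * (b - a)"
   using weak_consistency[OF t0 Kf0[of a0] eps] by blast
  \<comment> \<open>In one step the exponent is taken at the right end \<open>b\<close>, the
    mismatch at \<open>t\<close>; the resulting ratio \<open>exp (?r * delta)\<close> and the error
    \<open>A' * sqrt delta\<close> are both covered by the slack \<open>eps\<close> once the step is
    short.\<close>
  have "((%delta. kappa * exp (?r * delta) + A' * sqrt delta) \<longlongrightarrow> kappa * exp (?r * 0) + A' * sqrt 0) (at 0)"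
   by (intro tendsto_intros)
  hence "\<forall>\<^sub>F delta in at 0. kappa * exp (?r * delta) + A' * sqrt delta < kappa + eps" by (rule order_tendstoD) (use eps in simp)
  then obtain delta2 where delta2: "0 < delta2" "!!delta. delta ~= 0 ==> abs delta < delta2 ==> kappa * exp (?r * delta) + A' * sqrt delta < kappa + eps"
   unfolding eventually_at by (auto simp: dist_real_def)
  have "P a b" if ab: "a <= t" "t <= b" "b - a < min delta1 delta2" for a b
   unfolding P_def
  proof (intro impI allI)
   fix phi assume g: "a0 <= a & b <= b0" and phi: "CB d 3 (Kf b) phi & (ALL x:Rd d. c0 <= phi x & phi x <= C0)"
   have h: "0 <= b - a" "b - a <= 1" using ab delta1(2) by auto
   have phiK: "CB d 3 (Kf a0) phi" by (rule CB_mono_const[OF conjunct1[OF phi] Kmono]) (use g ab in simp)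
   let ?psi = "euler_step d (DF (m t)) (b - a) phi"
   have 1: "CB d 3 (Kf a) ?psi"
    by (rule CB_mono_const[OF A(2)[OF dr[OF local] conjunct1[OF phi] h] Kstep])
   have 2: "ALL x:Rd d. c0 <= ?psi x & ?psi x <= C0" using euler_step_range[OF d] phi by blast
   have 3: "abs ((LINT x|m b. phi x) - (LINT x|m a. ?psi x)) <= eps * (b - a)"
    by (rule delta1(3)) (use ab g a0 phiK in auto)
   let ?beta = "beta t"
   have "0 <= ?beta" using DFbeta[OF local Rd_restrict] norm_Rd_nonneg by (rule order_trans[rotated])
   moreover have "ALL x:Rd d. norm_Rd d (%i. DF (m t) x i - DF mu x i) <= ?beta" using DFbeta[OF local] by blast
   moreover have "1 + (q b - 1) * exp (?r * (b - a)) <= q a0" using qstep[of a b] qmono[of a] g by simp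
   ultimately have "LN mu (q a) ?psi <= LN mu (q b) phi + (b - a) * (?beta^2 / (4 * eta * (q b - 1))) + A' * ((b - a) * sqrt (b - a))"
    unfolding qstep[of a b] by (intro A'(2) h dr[OF local] phiK conjunct2[OF phi] q1)
   also have "... = LN mu (q b) phi + (b - a) * (?beta^2 / (4 * eta * (q b - 1)) + A' * sqrt (b - a))"
    by (simp only: distrib_left mult_ac add_ac)
   also have "(b - a) * (?beta^2 / (4 * eta * (q b - 1)) + A' * sqrt (b - a)) <= (b - a) * (kappa + eps)"
   proof (cases "b - a = 0")
    case False
    have "?beta^2 <= 4 * eta * kappa * ((q b - 1) * exp (?r * (b - t)))" using beta[OF local] qstep[of t b] by simp
    also have "... <= 4 * eta * kappa * ((q b - 1) * exp (?r * (b - a)))"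
     using eta kappa q1[of b] ab by (intro mult_left_mono rmono) auto
    finally have "?beta^2 / (4 * eta * (q b - 1)) <= kappa * exp (?r * (b - a))"
     using eta q1[of b] by (subst pos_divide_le_eq) (simp_all only: mult_ac, simp)
    moreover have "kappa * exp (?r * (b - a)) + A' * sqrt (b - a) < kappa + eps"
     using False h ab by (intro delta2(2)) auto
    ultimately show ?thesis using h(1) by (intro mult_left_mono) auto
   qed simp
   finally have "LN mu (q a) ?psi <= LN mu (q b) phi + (kappa + eps) * (b - a)" by (simp add: mult.commute)
   with 1 2 3 show "EX psi. CB d 3 (Kf a) psi & (ALL x:Rd d. c0 <= psi x & psi x <= C0) &
    abs ((LINT x|m b. phi x) - (LINT x|m a. psi x)) <= eps * (b - a) & LN mu (q a) psi <= LN mu (q b) phi + (kappa + eps) * (b - a)"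
    by (intro exI[of _ ?psi]) simp
  qed
  thus ?case using delta1(1) delta2(1) by (intro exI[of _ "min delta1 delta2"]) auto
 qed
 moreover have "CB d 3 (Kf b0) phi & (ALL x:Rd d. c0 <= phi x & phi x <= C0)" using phi by (simp add: Kf_def)
 moreover have "q b0 = qb" by (simp add: q)
 ultimately show ?thesis unfolding P_def by (metis order_refl)
qed

end

section \<open>Relative entropy along the flow\<close>

text \<open>By the Donsker--Varadhan formula, \<open>Hle d nu mu x\<close> says that the relative entropy of \<open>mu\<close>
 with respect to \<open>nu\<close> is at most \<open>x\<close>; no density of \<open>mu\<close> is needed.\<close>

definition Hle :: "nat => vec measure => vec measure => real => bool" where
 "Hle d nu mu x \<longleftrightarrow> (ALL g K. CB d 3 K g --> (LINT z|mu. g z) - ln (LINT z|nu. exp (g z)) <= x)"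

lemma Hle_mono: "Hle d nu mu x ==> x <= y ==> Hle d nu mu y"
 unfolding Hle_def by (meson order_trans)

lemma Hle_lim:
 assumes "!!n :: nat. Hle d nu mu (X n)" "X ----> x" shows "Hle d nu mu x"
 using assms unfolding Hle_def by (meson LIMSEQ_le_const)

text \<open>Entropy is the limit of hypercontractivity for exponents \<open>1 / h\<close> tending to
  infinity. The power \<open>1 / h\<close> of \<open>1 + h * g\<close> is at most
  \<open>exp g\<close>, and the pulled back function stays near 1, so its logarithm is an admissible
  test function at time \<open>a\<close> and agrees with the function minus 1 up to order
  \<open>h^2\<close>. Dividing by \<open>h\<close> and letting \<open>h\<close> tend to 0 leaves the
  contraction factor and the accumulated mismatch.\<close>

lemma (in mean_field_flow) Hle_contraction:
 assumes mu: "mu : P2 d" and a: "0 <= a" "a <= b" and eta: "0 < eta" "eta < 1"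
  and beta: "!!s x. a <= s ==> s <= b ==> x : Rd d ==> norm_Rd d (%i. DF (m s) x i - DF mu x i) <= beta"
  and H: "Hle d (hat d dF mu) (m a) x"
 shows "Hle d (hat d dF mu) (m b) (x / exp (4 * rho * (1 - eta) * (b - a)) + beta^2 * (b - a) / (4 * eta))"
 unfolding Hle_def
proof (intro allI impI)
 fix g K assume g: "CB d 3 K g"
 note K = CB_nonneg[OF g]
 have Pa: "m a : P2 d" and Pb: "m b : P2 d" using a by (auto intro: m_P2)
 interpret pa: prob_space "m a" by (rule P2_D(1)[OF Pa])
 interpret pb: prob_space "m b" by (rule P2_D(1)[OF Pb])
 obtain Mb where "gibbs_flow d (dF mu) rho (DF mu) Mb" using gibbs_flow[OF mu] .
 then interpret gf: gibbs_flow d "dF mu" rho "DF mu" Mb .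
 let ?r = "4 * rho * (1 - eta)" and ?nu = "gibbs d (dF mu)"
 define E where "E = exp (?r * (b - a))"
 have E: "0 < E" by (simp add: E_def)
 define L where "L = ln (LINT z|?nu. exp (g z))"
 define I where "I = (LINT z|m b. g z)"
 \<comment> \<open>The bound for fixed \<open>h\<close>: the denominator
   \<open>h + (1 - h) * E\<close> is \<open>h\<close> times the exponent at time \<open>a\<close>,
   and the last summand collects the errors of order \<open>h^2\<close>, namely the slack of
   \<open>hc_chain\<close> (twice) and of \<open>ln psi\<close> against
   \<open>psi - 1\<close>.\<close>
 define f where "f h = L + beta^2 / (4 * eta * (1 - h)) * (b - a) + x / (h + (1 - h) * E) + h * (2 * (b - a) + 2 * K^2)" for h
 have "I <= f h" if h: "0 < h" "h < 1 / (2 * (K + 1))" for h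
 proof -
  have hK: "h * K <= 1 / 2" "h * (K + 1) < 1 / 2"
  proof -
   show "h * (K + 1) < 1 / 2" using h K by (simp add: field_simps)
   thus "h * K <= 1 / 2" using h(1) by (simp add: distrib_left)
  qed
  have h1: "h < 1" using hK(2) mult_nonneg_nonneg[OF less_imp_le[OF h(1)] K] by (simp add: distrib_left)
  let ?phi = "%z. 1 + h * g z" and ?q = "1 / h" and ?kappa = "beta^2 / (4 * eta * (1 / h - 1))"
  have phi: "CB d 3 (1 + abs h * K) ?phi" by (intro CB_add CB_const CB_cmult g) simp
  have hg: "abs (h * g z) <= h * K" if "z : Rd d" for z
   using CB_bound[OF g that] h by (simp add: abs_mult mult_left_mono)
  have q: "1 < ?q" using h h1 by simp
  define qs where "qs s = 1 + (?q - 1) * exp (?r * (b - s))" for s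
  have kappa: "0 <= ?kappa" using eta q by (intro divide_nonneg_nonneg) auto
  have betakappa: "beta^2 <= 4 * eta * ?kappa * (qs s - 1)" if s: "a <= s" "s <= b" for s
  proof -
   have "(?q - 1) * 1 <= qs s - 1" unfolding qs_def using q rho eta s by (simp add: mult_le_cancel_left1)
   hence "?q - 1 <= qs s - 1" by (simp only: mult_1_right)
   hence "4 * eta * ?kappa * (?q - 1) <= 4 * eta * ?kappa * (qs s - 1)"
    by (rule mult_left_mono) (intro mult_nonneg_nonneg kappa, use eta in auto)
   moreover have "4 * eta * ?kappa * (?q - 1) = beta^2" using q eta(1) by (cases "h = 1") auto
   ultimately show ?thesis by linarith
  qed
  have c0: "0 < 1 - h * K" "1 - h * K <= 1 + h * K" using hK h K by auto
  from hc_chain[OF mu a eta q kappa _ c0 qs_def betakappa beta phi, of "h^2"] hg h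
  obtain psi K' where psi: "CB d 3 K' psi" "!!z. z : Rd d ==> 1 - h * K <= psi z & psi z <= 1 + h * K"
   "abs ((LINT z|m b. ?phi z) - (LINT z|m a. psi z)) <= h^2 * (b - a)"
   "LN mu (qs a) psi <= LN mu ?q ?phi + (?kappa + h^2) * (b - a)"
   by (fastforce simp: abs_le_iff)
  have qa: "1 < qs a" using q by (simp add: qs_def)
  obtain K2 where K2: "CB d (Suc 2) K2 (%z. ln (psi z))"
   using CB_ln[of d 2 K' psi, OF _ c0(1) psi(2)] CB_imp_LB[of d 2 K' psi] psi(1) by (auto simp: eval_nat_numeral)
  hence lnC: "CB d 3 K2 (%z. ln (psi z))" by (simp add: eval_nat_numeral)
  \<comment> \<open>The entropy bound at time \<open>a\<close> is tested with
    \<open>qs a * ln psi\<close>; dividing by \<open>qs a\<close> is what shrinks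
    \<open>x\<close>.\<close>
  from H[unfolded Hle_def, rule_format, OF CB_cmult[OF lnC, of "qs a"]]
  have "qs a * (LINT z|m a. ln (psi z)) - ln (LINT z|?nu. exp (qs a * ln (psi z))) <= x" by (simp add: hat_gibbs)
  hence 1: "(LINT z|m a. ln (psi z)) <= LN mu (qs a) psi + x / qs a"
   using qa unfolding gf.log_norm_def by (simp add: field_simps)
  have 2: "LN mu ?q ?phi <= h * L"
  proof -
   have "(LINT z|?nu. exp (?q * ln (?phi z))) <= (LINT z|?nu. exp (g z))"
   proof (rule integral_mono)
    show "integrable ?nu (%z. exp (?q * ln (?phi z)))"
     by (rule gf.integrable_power[OF CB_cont[OF phi] c0(1), of "1 + h * K"]) (use hg h in \<open>auto simp: abs_le_iff\<close>, fastforce)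
    show "integrable ?nu (%z. exp (g z))" by (rule gf.exp_moment_pos(2)[OF g])
    fix z assume "z : space ?nu"
    hence "ln (?phi z) <= h * g z" using hg[of z] hK(1) by (intro ln_add_one_self_le_self2) auto
    thus "exp (?q * ln (?phi z)) <= exp (g z)" using h by (simp add: field_simps)
   qed
   moreover have "0 < (LINT z|?nu. exp (?q * ln (?phi z)))"
    by (rule less_le_trans[OF exp_gt_zero gf.power_mean_bounds(1)[OF CB_cont[OF phi] c0(1), of "1 + h * K"]])
     (use hg h in \<open>auto simp: abs_le_iff\<close>, fastforce)
   ultimately have "ln (LINT z|?nu. exp (?q * ln (?phi z))) <= L" unfolding L_def by simp
   thus ?thesis using h(1) by (simp add: gf.log_norm_def)
  qed
  have 3: "(LINT z|m a. psi z) - 1 - 2 * (h * K)^2 <= (LINT z|m a. ln (psi z))"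
  proof -
   have "(LINT z|m a. psi z - 1 - 2 * (h * K)^2) <= (LINT z|m a. ln (psi z))"
   proof (rule integral_mono)
    show "integrable (m a) (%z. psi z - 1 - 2 * (h * K)^2)" "integrable (m a) (%z. ln (psi z))"
     using P2_integrable_CB[OF Pa psi(1)] P2_integrable_CB[OF Pa lnC] by simp_all
    fix z assume "z : space (m a)"
    hence z: "abs (psi z - 1) <= h * K" using psi(2)[of z] P2_D(3)[OF Pa] by auto
    hence "abs (ln (1 + (psi z - 1)) - (psi z - 1)) <= 2 * (psi z - 1)^2" using hK by (intro abs_ln_one_plus_x_minus_x_bound) auto
    moreover have "(psi z - 1)^2 <= (h * K)^2" using power_mono[OF z abs_ge_zero, of 2] by simp
    ultimately show "psi z - 1 - 2 * (h * K)^2 <= ln (psi z)" by simp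
   qed
   thus ?thesis using P2_integrable_CB[OF Pa psi(1)] by (simp add: pa.prob_space)
  qed
  have "(LINT z|m b. ?phi z) = 1 + h * I" unfolding I_def using P2_integrable_CB[OF Pb g] by (simp add: pb.prob_space)
  hence "h * I <= h^2 * (b - a) + 2 * (h * K)^2 + (h * L + (?kappa + h^2) * (b - a)) + x / qs a"
   using 1 2 3 psi(3,4) by linarith
  also have "... = h * f h"
  proof -
   have "?kappa = h * (beta^2 / (4 * eta * (1 - h)))" using h h1 eta by (simp add: field_simps)
   moreover have "qs a = (h + (1 - h) * E) / h" using h by (simp add: qs_def E_def field_simps)
   ultimately show ?thesis unfolding f_def by (simp add: power2_eq_square algebra_simps)
  qed
  finally show ?thesis using h(1) by simp
 qed
 hence "\<forall>\<^sub>F h in at_right 0. I <= f h" using K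
  by (intro eventually_at_rightI[of 0 "1 / (2 * (K + 1))"]) auto
 moreover have "(f \<longlongrightarrow> L + beta^2 / (4 * eta * (1 - 0)) * (b - a) + x / (0 + (1 - 0) * E) + 0 * (2 * (b - a) + 2 * K^2)) (at_right 0)"
  unfolding f_def by (intro tendsto_intros) (use E eta in auto)
 ultimately have "I <= L + beta^2 / (4 * eta * (1 - 0)) * (b - a) + x / (0 + (1 - 0) * E) + 0 * (2 * (b - a) + 2 * K^2)"
  by (intro tendsto_lowerbound[of f _ "at_right 0"]) auto
 thus "(LINT z|m b. g z) - ln (LINT z|hat d dF mu. exp (g z)) <= x / exp (?r * (b - a)) + beta^2 * (b - a) / (4 * eta)"
  by (simp add: I_def L_def E_def hat_gibbs)
qed

section \<open>Changing the reference measure of the relative entropy\<close>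

lemma (in prob_space) exp_integral_pos:
 fixes g :: "'a => real"
 assumes g: "integrable M (%x. exp (g x))" shows "0 < (LINT x|M. exp (g x))"
proof -
 have "(LINT x|M. exp (g x)) ~= 0"
 proof
  assume "(LINT x|M. exp (g x)) = 0"
  hence "AE x in M. exp (g x) = 0" using g by (subst (asm) integral_nonneg_eq_0_iff_AE) auto
  thus False by simp
 qed
 moreover have "0 <= (LINT x|M. exp (g x))" by (rule Bochner_Integration.integral_nonneg) simp
 ultimately show ?thesis by linarith
qed

lemma (in prob_space) jensen_exp:
 fixes g :: "'a => real"
 assumes g: "integrable M g" "integrable M (%x. exp (g x))" shows "(LINT x|M. g x) <= ln (LINT x|M. exp (g x))"
proof -
 define A where "A = (LINT x|M. exp (g x))"
 have A: "0 < A" using exp_integral_pos[OF g(2)] by (simp add: A_def)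
 have "(LINT x|M. 1 + g x - ln A) <= (LINT x|M. exp (g x) / A)"
 proof (rule integral_mono)
  fix x
  show "1 + g x - ln A <= exp (g x) / A" using exp_ge_add_one_self[of "g x - ln A"] A by (simp add: exp_diff)
 qed (use g in auto)
 thus ?thesis using g A by (simp add: prob_space A_def[symmetric])
qed

lemma (in lsi_gibbs) exp_lip: "lip d L g ==> integrable nu (%x. exp (g x))"
proof -
 assume g: "lip d L g"
 let ?C = "abs (g (restrict (%_. 0) {..<d})) + L"
 have "exp (g x) <= exp ?C * exp (?C * norm_Rd d x)" if "x : Rd d" for x
  using lip_growth[OF g that] by (simp add: exp_add[symmetric] distrib_left)
 thus ?thesis by (intro integrable_growth[of _ "exp ?C" ?C] continuous_intros lip_cont[OF g]) simp
qed

text \<open>Changing the reference measure adds \<open>dF mu - dF mu'\<close> to the test function,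
  which is Lipschitz but unbounded. The sine truncation brings it back into the class used by
  \<open>Hle\<close>; exponential moments of \<open>nu\<close> dominate the limit.\<close>

lemma (in lsi_gibbs) Hle_LB:
 assumes H: "Hle d nu mu x" and mu: "mu : P2 d" and g: "LB d 2 K g" "0 <= K"
 shows "(LINT z|mu. g z) - ln (LINT z|nu. exp (g z)) <= x"
proof -
 interpret prob_space nu by (rule prob_space_gibbs)
 note l = LB_imp_lip[OF g]
 let ?h = "%n z. real (Suc n) * sin (g z / real (Suc n))"
 let ?C = "abs (g (restrict (%_. 0) {..<d})) + K * d"
 have le: "abs (?h n z) <= abs (g z)" for n z by (rule trunc_le) simp
 have lim: "(%n. ?h n z) ----> g z" for z
 proof -
  have "(%n. (g z)^2 * (1 / real (Suc n))) ----> (g z)^2 * 0" by (intro tendsto_mult tendsto_const LIMSEQ_Suc[OF lim_1_over_n])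
  hence "(%n. ?h n z - g z) ----> 0"
   using trunc_close[of "real (Suc _)" "g z"] by (intro Lim_null_comparison[of "%n. ?h n z - g z"]) auto
  thus ?thesis by (simp add: LIM_zero_iff)
 qed
 have CB: "EX K'. CB d 3 K' (?h n)" for n by (rule trunc_CB[OF g(1)]) simp
 have cont: "continuous_on (Rd d) (?h n)" for n using CB CB_cont by blast
 have 1: "(%n. \<integral>z. ?h n z \<partial>mu) ----> (LINT z|mu. g z)"
  using lim le by (intro integral_dominated_convergence[where w = "%z. abs (g z)"] P2_measurable[OF mu] cont lip_cont[OF l]
   integrable_abs P2_integrable_lip[OF mu l]) auto
 have 2: "(%n. \<integral>z. exp (?h n z) \<partial>nu) ----> (LINT z|nu. exp (g z))"
 proof (rule integral_dominated_convergence[where w = "%z. exp ?C * exp (?C * norm_Rd d z)"])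
  show "(%z. exp (g z)) : borel_measurable nu" "!!n. (%z. exp (?h n z)) : borel_measurable nu"
   by (intro measurable_gibbs continuous_on_exp cont lip_cont[OF l])+
  show "integrable nu (%z. exp ?C * exp (?C * norm_Rd d z))"
   by (rule integrable_growth[of _ "exp ?C" ?C]) (auto intro!: continuous_intros continuous_on_norm_Rd)
  show "AE z in nu. (%n. exp (?h n z)) ----> exp (g z)" using lim by (intro AE_I2 tendsto_exp)
  show "AE z in nu. norm (exp (?h n z)) <= exp ?C * exp (?C * norm_Rd d z)" for n
  proof (rule AE_I2)
   fix z assume "z : space nu"
   hence "abs (g z) <= ?C * (1 + norm_Rd d z)" using lip_growth[OF l] by simp
   hence "?h n z <= ?C + ?C * norm_Rd d z" using le[of n z] by (simp add: distrib_left)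
   thus "norm (exp (?h n z)) <= exp ?C * exp (?C * norm_Rd d z)" by (simp add: exp_add[symmetric])
  qed
 qed
 have "(%n. (LINT z|mu. ?h n z) - ln (LINT z|nu. exp (?h n z))) ----> (LINT z|mu. g z) - ln (LINT z|nu. exp (g z))"
  using exp_integral_pos[OF exp_lip[OF l]] by (intro tendsto_diff 1 tendsto_ln 2) auto
 thus ?thesis using H CB unfolding Hle_def by (intro LIMSEQ_le_const2) blast+
qed

context mean_field
begin

text \<open>A single \<open>dF mu\<close> may grow quadratically. In a difference the gradients
  cancel up to \<open>Mmm\<close> times the distance of the measures, which makes the difference
  Lipschitz.\<close>

lemma dF_diff:
 assumes mu: "mu : P2 d" and mu': "mu' : P2 d"
 shows "EX K>=0. LB d 2 K (%x. dF mu x - dF mu' x)"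
  and "lip d (Mmm * wasserstein d 1 mu mu') (%x. dF mu x - dF mu' x)"
proof -
 obtain M where M: "0 <= M" "!!mu i. mu : P2 d ==> i < d ==> LB d 2 M (%x. DF mu x i)" using DF_LB by blast
 let ?w = "%x. dF mu x - dF mu' x" and ?L = "Mmm * wasserstein d 1 mu mu'"
 let ?D = "%i x. DF mu x i - DF mu' x i"
 have L: "0 <= ?L" using Mmm wasserstein_nonneg[OF mu mu'] by simp
 have pd: "has_pd d i ?w (?D i)" if "i < d" for i by (intro has_pd_diff DF_pd that mu mu')
 have bd: "abs (?D i x) <= ?L" if "i < d" "x : Rd d" for i x
  using DF_close[OF that(2) mu mu'] abs_le_norm_Rd[OF that(1), of "%i. ?D i x"] by linarith
 have "CB d 2 (2 * M + ?L) (?D i)" if i: "i < d" for i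
 proof -
  have "CB d (Suc 1) (2 * M + ?L) (?D i)"
  proof (rule CB_SucI)
   show "continuous_on (Rd d) (?D i)" using M(2)[OF _ i] mu mu' by (intro continuous_on_diff) (auto simp: LB_def)
   show "abs (?D i x) <= 2 * M + ?L" if "x : Rd d" for x using bd[OF i that] M(1) by linarith
   fix j assume j: "j < d"
   note p = LB_pd[OF M(2)[OF mu i] j] and p' = LB_pd[OF M(2)[OF mu' i] j]
   have "CB d 2 (M + M) (%x. pd j (%x. DF mu x i) x - pd j (%x. DF mu' x i) x)" by (rule CB_diff[OF p(2) p'(2)])
   hence "CB d 1 (2 * M + ?L) (%x. pd j (%x. DF mu x i) x - pd j (%x. DF mu' x i) x)"
    by (rule CB_mono) (use L in auto)
   with has_pd_diff[OF p(1) p'(1)] show "EX g. has_pd d j (?D i) g & CB d 1 (2 * M + ?L) g" by blast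
  qed
  thus ?thesis by (simp add: eval_nat_numeral)
 qed
 moreover have "continuous_on (Rd d) ?w" using C1 mu mu' by (intro continuous_on_diff C_k_cont[where k = 1]) blast+
 ultimately have LB: "LB d 2 (2 * M + ?L) ?w" unfolding LB_def using pd by blast
 thus "EX K>=0. LB d 2 K ?w" using L M by (intro exI[of _ "2 * M + ?L"]) simp
 show "lip d ?L ?w" unfolding lip_def
 proof (intro conjI ballI L)
  fix x y assume "x : Rd d" "y : Rd d"
  thus "abs (?w x - ?w y) <= ?L * dist_Rd d x y"
  proof (rule grad_imp_lipschitz[OF LB])
   fix x assume x: "x : Rd d"
   have "norm_Rd d (grad d ?w x) = norm_Rd d (%i. ?D i x)"
    by (rule norm_Rd_cong) (simp add: grad_def has_pd_imp_pd[OF pd x])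
   thus "norm_Rd d (grad d ?w x) <= ?L" using DF_close[OF x mu mu'] by simp
  qed
 qed
qed

lemma hat_change:
 assumes mu: "mu : P2 d" and mu': "mu' : P2 d" and f: "continuous_on (Rd d) f"
 defines "w \<equiv> %x. dF mu x - dF mu' x"
 shows "0 < (LINT x|hat d dF mu. exp (w x))"
  "(LINT x|hat d dF mu'. f x) = (LINT x|hat d dF mu. exp (w x) * f x) / (LINT x|hat d dF mu. exp (w x))"
proof -
 interpret A: lsi_gibbs d "dF mu" rho by (rule lsi_gibbs[OF mu])
 interpret B: lsi_gibbs d "dF mu'" rho by (rule lsi_gibbs[OF mu'])
 interpret prob_space "gibbs d (dF mu)" by (rule A.prob_space_gibbs)
 have wl: "lip d (Mmm * wasserstein d 1 mu mu') w" unfolding w_def by (rule dF_diff(2)[OF mu mu'])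
 hence c: "continuous_on (Rd d) (%x. exp (w x))" by (intro continuous_intros lip_cont)
 show "0 < (LINT x|hat d dF mu. exp (w x))" unfolding hat_gibbs by (rule exp_integral_pos[OF A.exp_lip[OF wl]])
 have *: "(LINT x|hat d dF mu. exp (w x) * g x) = (LINT x|lborel_Rd d. exp (- dF mu' x) * g x) / A.Z"
  if g: "continuous_on (Rd d) g" for g
 proof -
  have "(LINT x|hat d dF mu. exp (w x) * g x) = (LINT x|lborel_Rd d. exp (- dF mu x) / A.Z * (exp (w x) * g x))"
   unfolding hat_gibbs by (rule A.integral_gibbs[OF measurable_Rd[OF continuous_on_mult[OF c g]]])
  also have "... = (LINT x|lborel_Rd d. exp (- dF mu' x) * g x / A.Z)"
   by (rule Bochner_Integration.integral_cong) (simp_all add: w_def exp_diff exp_minus field_simps)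
  finally show ?thesis by (simp only: integral_divide_zero)
 qed
 have "(LINT x|hat d dF mu'. f x) = (LINT x|lborel_Rd d. exp (- dF mu' x) / B.Z * f x)"
  unfolding hat_gibbs by (rule B.integral_gibbs[OF measurable_Rd[OF f]])
 also have "... = (LINT x|lborel_Rd d. exp (- dF mu' x) * f x / B.Z)" by simp
 also have "... = (LINT x|lborel_Rd d. exp (- dF mu' x) * f x) / B.Z" by (simp only: integral_divide_zero)
 finally show "(LINT x|hat d dF mu'. f x) = (LINT x|hat d dF mu. exp (w x) * f x) / (LINT x|hat d dF mu. exp (w x))"
  using *[OF f] *[of "%_. 1"] A.Z_pos by (simp add: B.Z_def)
qed

text \<open>The formula for relative entropy when the reference density is multiplied by
  \<open>exp w\<close> and renormalized, obtained in dual form by testing with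
  \<open>g + w\<close>.\<close>

lemma Hle_shift:
 assumes mu: "mu : P2 d" and mu': "mu' : P2 d" and \<sigma>: "\<sigma> : P2 d" and H: "Hle d (hat d dF mu) \<sigma> x"
 defines "w \<equiv> %x. dF mu x - dF mu' x"
 shows "Hle d (hat d dF mu') \<sigma> (x - (LINT z|\<sigma>. w z) + ln (LINT z|hat d dF mu. exp (w z)))"
 unfolding Hle_def
proof (intro allI impI)
 fix g K assume g: "CB d 3 K g"
 interpret A: lsi_gibbs d "dF mu" rho by (rule lsi_gibbs[OF mu])
 interpret prob_space "gibbs d (dF mu)" by (rule A.prob_space_gibbs)
 obtain K' where K': "0 <= K'" "LB d 2 K' w" using dF_diff(1)[OF mu mu'] unfolding w_def by blast
 note w = LB_imp_lip[OF K'(2,1)]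
 have g3: "CB d (Suc 2) K g" using g by (simp add: eval_nat_numeral)
 note K = CB_nonneg[OF g]
 have gw: "LB d 2 (K + K') (%x. g x + w x)" unfolding LB_def
 proof (intro conjI allI impI)
  show "continuous_on (Rd d) (%x. g x + w x)" by (intro continuous_intros CB_cont[OF g] lip_cont[OF w])
  fix i assume i: "i < d"
  note a = CB_pd[OF g3 i] and b = LB_pd[OF K'(2) i]
  show "EX h. has_pd d i (%x. g x + w x) h & CB d 2 (K + K') h"
   using has_pd_add[OF a(1) b(1)] CB_add[OF a(2) b(2)] by blast
 qed
 have "(LINT z|\<sigma>. g z + w z) - ln (LINT z|hat d dF mu. exp (g z + w z)) <= x"
  unfolding hat_gibbs by (rule A.Hle_LB[OF H[unfolded hat_gibbs] \<sigma> gw]) (use K K' in simp)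
 moreover have "(LINT z|\<sigma>. g z + w z) = (LINT z|\<sigma>. g z) + (LINT z|\<sigma>. w z)"
  by (rule Bochner_Integration.integral_add[OF P2_integrable_CB[OF \<sigma> g] P2_integrable_lip[OF \<sigma> w]])
 moreover have "ln (LINT z|hat d dF mu'. exp (g z)) = ln (LINT z|hat d dF mu. exp (g z + w z)) - ln (LINT z|hat d dF mu. exp (w z))"
 proof -
  have "0 < (LINT z|hat d dF mu. exp (g z + w z))"
   unfolding hat_gibbs by (rule exp_integral_pos[OF A.exp_lip[OF LB_imp_lip[OF gw]]]) (use K K' in simp)
  moreover have "(LINT z|hat d dF mu'. exp (g z)) = (LINT z|hat d dF mu. exp (g z + w z)) / (LINT z|hat d dF mu. exp (w z))"
   using hat_change(2)[OF mu mu' continuous_on_exp[OF CB_cont[OF g]]] by (simp add: w_def exp_add mult.commute)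
  ultimately show ?thesis using hat_change(1)[OF mu mu' continuous_on_const] by (simp add: w_def ln_div)
 qed
 ultimately show "(LINT z|\<sigma>. g z) - ln (LINT z|hat d dF mu'. exp (g z)) <= x - (LINT z|\<sigma>. w z) + ln (LINT z|hat d dF mu. exp (w z))"
  by linarith
qed

end

section \<open>Convex combinations of measures and the first variation of F\<close>

lemma sets_mix [simp]: "sets (mix t mu mu') = sets mu"
 by (simp add: mix_def)

lemma space_mix [simp]: "space (mix t mu mu') = space mu"
 by (rule sets_eq_imp_space_eq) simp

lemma nn_integral_mix:
 assumes s: "sets mu = sets mu'" and f: "f : borel_measurable mu"
 shows "(\<integral>\<^sup>+ x. f x \<partial>mix t mu mu') = ennreal (1 - t) * (\<integral>\<^sup>+ x. f x \<partial>mu) + ennreal t * (\<integral>\<^sup>+ x. f x \<partial>mu')"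
 using f
proof (induction rule: borel_measurable_induct)
 have m: "borel_measurable (mix t mu mu') = (borel_measurable mu :: ('a => ennreal) set)"
  "borel_measurable mu' = (borel_measurable mu :: ('a => ennreal) set)" 
  by (rule measurable_cong_sets; simp add: s)+
 have sp: "space mu' = space mu" using sets_eq_imp_space_eq[OF s] by simp
 {
  case (cong f g)
  have "(\<integral>\<^sup>+ x. f x \<partial>nu) = (\<integral>\<^sup>+ x. g x \<partial>nu)" if "space nu = space mu" for nu
   using cong(3) that by (intro nn_integral_cong) simp
  with cong(4) show ?case using sp by simp
 next
  case (set A)
  thus ?case using s by (simp add: emeasure_mix[OF s])
 next
  case (mult u c)
  thus ?case by (simp add: m nn_integral_cmult distrib_left mult.left_commute)
 next
  case (add u v)
  thus ?case by (simp add: m nn_integral_add distrib_left add_ac)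
 next
  case (seq U)
  have 1: "(\<integral>\<^sup>+ x. (SUP i. U i) x \<partial>nu) = (SUP i. \<integral>\<^sup>+ x. U i x \<partial>nu)" if "borel_measurable nu = (borel_measurable mu :: ('a => ennreal) set)" for nu
   unfolding SUP_apply by (rule nn_integral_monotone_convergence_SUP[OF seq(3)]) (use seq(1) that in auto)
  have inc: "incseq (%i. c * (\<integral>\<^sup>+ x. U i x \<partial>nu))" for c and nu :: "'a measure"
   using seq(3) by (auto simp: incseq_def le_fun_def intro!: mult_left_mono nn_integral_mono)
  have "(\<integral>\<^sup>+ x. (SUP i. U i) x \<partial>mix t mu mu') = (SUP i. ennreal (1 - t) * (\<integral>\<^sup>+ x. U i x \<partial>mu) + ennreal t * (\<integral>\<^sup>+ x. U i x \<partial>mu'))"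
   unfolding 1[OF m(1)] seq.IH ..
  also have "... = ennreal (1 - t) * (\<integral>\<^sup>+ x. (SUP i. U i) x \<partial>mu) + ennreal t * (\<integral>\<^sup>+ x. (SUP i. U i) x \<partial>mu')"
   unfolding 1[OF m(2)] 1[OF refl] ennreal_SUP_add[OF inc inc] by (simp only: SUP_mult_left_ennreal)
  finally show ?case .
 }
qed

lemma integral_mix:
 fixes f :: "'a => real"
 assumes s: "sets mu = sets mu'" and f: "integrable mu f" "integrable mu' f" and t: "0 <= t" "t <= 1"
 shows "integrable (mix t mu mu') f" "(LINT x|mix t mu mu'. f x) = (1 - t) * (LINT x|mu. f x) + t * (LINT x|mu'. f x)"
proof -
 have mf: "f : borel_measurable mu" using f by simp
 hence mm: "f : borel_measurable (mix t mu mu')" using measurable_cong_sets[OF sets_mix refl] by blast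
 have n: "(\<integral>\<^sup>+ x. ennreal (g x) \<partial>mix t mu mu') = ennreal ((1 - t) * enn2real (\<integral>\<^sup>+ x. ennreal (g x) \<partial>mu) + t * enn2real (\<integral>\<^sup>+ x. ennreal (g x) \<partial>mu'))"
  if g: "integrable mu g" "integrable mu' g" for g :: "'a => real"
 proof -
  have e: "(\<integral>\<^sup>+ x. ennreal (g x) \<partial>nu) = ennreal (enn2real (\<integral>\<^sup>+ x. ennreal (g x) \<partial>nu))" if "integrable nu g" for nu
   using integrableD(2)[OF that] by (simp add: less_top)
  have "(\<integral>\<^sup>+ x. ennreal (g x) \<partial>mix t mu mu') = ennreal (1 - t) * (\<integral>\<^sup>+ x. ennreal (g x) \<partial>mu) + ennreal t * (\<integral>\<^sup>+ x. ennreal (g x) \<partial>mu')"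
   using g by (intro nn_integral_mix[OF s]) simp
  also have "... = ennreal (1 - t) * ennreal (enn2real (\<integral>\<^sup>+ x. ennreal (g x) \<partial>mu)) + ennreal t * ennreal (enn2real (\<integral>\<^sup>+ x. ennreal (g x) \<partial>mu'))"
   using e[OF g(1)] e[OF g(2)] by simp
  finally show ?thesis using t by (simp add: ennreal_mult ennreal_plus)
 qed
 have fm: "integrable mu (%x. - f x)" "integrable mu' (%x. - f x)" using f by simp_all
 show i: "integrable (mix t mu mu') f" unfolding real_integrable_def using mm n[OF f] n[OF fm] by simp
 show "(LINT x|mix t mu mu'. f x) = (1 - t) * (LINT x|mu. f x) + t * (LINT x|mu'. f x)"
  unfolding real_lebesgue_integral_def[OF i] real_lebesgue_integral_def[OF f(1)] real_lebesgue_integral_def[OF f(2)]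
   n[OF f] n[OF fm] using t by (simp add: right_diff_distrib del: ennreal_plus)
qed

lemma mix_0: "sets mu = sets mu' ==> mix 0 mu mu' = mu"
 by (rule measure_eqI) (simp_all add: emeasure_mix)

lemma mix_mix:
 assumes s: "sets mu = sets mu'" and t: "0 <= s" "s <= 1" "0 <= t" "t <= 1"
 shows "mix s mu (mix t mu mu') = mix (s * t) mu mu'"
proof (rule measure_eqI)
 fix A assume "A : sets (mix s mu (mix t mu mu'))"
 hence A: "A : sets mu" by simp
 have st: "s * t <= 1" using t by (simp add: mult_le_one)
 have "emeasure (mix s mu (mix t mu mu')) A = (ennreal (1 - s) + ennreal s * ennreal (1 - t)) * emeasure mu A + ennreal s * ennreal t * emeasure mu' A"
  using A by (simp add: emeasure_mix[OF s] emeasure_mix[OF sets_mix[symmetric]] distrib_left distrib_right mult.assoc add.assoc)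
 also have "ennreal (1 - s) + ennreal s * ennreal (1 - t) = ennreal ((1 - s) + s * (1 - t))"
  using t by (simp only: ennreal_mult[symmetric] ennreal_plus diff_ge_0_iff_ge mult_nonneg_nonneg)
 also have "(1 - s) + s * (1 - t) = 1 - s * t" by (simp add: right_diff_distrib)
 finally show "emeasure (mix s mu (mix t mu mu')) A = emeasure (mix (s * t) mu mu') A"
  using A t by (simp add: emeasure_mix[OF s] ennreal_mult)
qed simp

lemma mix_P2:
 assumes mu: "mu : P2 d" "mu' : P2 d" and t: "0 <= t" "t <= 1"
 shows "mix t mu mu' : P2 d"
proof -
 have s: "sets mu = sets mu'" using P2_D(2) mu by blast
 have sp: "space mu' = space mu" using sets_eq_imp_space_eq[OF s] by simp
 have e: "emeasure mu (space mu) = 1" "emeasure mu' (space mu) = 1"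
  using prob_space.emeasure_space_1[OF P2_D(1)] mu sp by (force, metis)
 have "emeasure (mix t mu mu') (space mu) = 1"
  using t by (simp add: emeasure_mix[OF s] e ennreal_plus[symmetric] del: ennreal_plus)
 hence "prob_space (mix t mu mu')" by (intro prob_spaceI) simp
 thus ?thesis using integral_mix(1)[OF s P2_D(4)[OF mu(1)] P2_D(4)[OF mu(2)] t] P2_D(2)[OF mu(1)] by (simp add: P2_def)
qed

lemma distr_mix:
 assumes s: "sets mu = sets mu'" and f: "f : measurable mu N"
 shows "distr (mix t mu mu') N f = mix t (distr mu N f) (distr mu' N f)"
proof (rule measure_eqI)
 have f': "f : measurable mu' N" "f : measurable (mix t mu mu') N" using f measurable_cong_sets[OF s refl] measurable_cong_sets[OF sets_mix refl] by blast+
 have sp: "space mu' = space mu" using sets_eq_imp_space_eq[OF s] by simp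
 fix A assume "A : sets (distr (mix t mu mu') N f)"
 hence A: "A : sets N" by simp
 thus "emeasure (distr (mix t mu mu') N f) A = emeasure (mix t (distr mu N f) (distr mu' N f)) A"
  using measurable_sets[OF f A] by (simp add: emeasure_distr f f' emeasure_mix[OF s] emeasure_mix sp)
qed simp

text \<open>The coupling leaves the mass \<open>1 - t\<close> on the diagonal and moves the rest by
  the product coupling. The distance is therefore of order \<open>sqrt t\<close>, enough for
  continuity at the starting point.\<close>

lemma wasserstein_mix:
 assumes mu: "mu : P2 d" and mu': "mu' : P2 d" and t: "0 <= t" "t <= 1"
 shows "wasserstein d 2 mu (mix t mu mu') <= sqrt (t * (LINT z|(mu \<Otimes>\<^sub>M mu'). (dist_Rd d (fst z) (snd z))^2))"
proof -
 let ?D = "%z. ennreal (dist_Rd d (fst z) (snd z) powr 2)"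
 let ?diag = "distr mu (mu \<Otimes>\<^sub>M mu) (%x. (x, x))"
 let ?\<pi> = "mix t ?diag (mu \<Otimes>\<^sub>M mu')"
 have s: "sets mu = sets mu'" using P2_D(2) mu mu' by blast
 have sd: "sets ?diag = sets (mu \<Otimes>\<^sub>M mu')" unfolding sets_distr using s by (intro sets_pair_measure_cong) auto
 have [measurable]: "(%x. (x, x)) : measurable mu (mu \<Otimes>\<^sub>M mu)" by simp
 have [measurable]: "fst : measurable ?diag mu" "snd : measurable ?diag mu" by simp_all
 have dd: "distr ?diag mu fst = mu" "distr ?diag mu snd = mu" by (simp_all add: distr_distr comp_def)
 have pc: "distr (mu \<Otimes>\<^sub>M mu') mu fst = mu" "distr (mu \<Otimes>\<^sub>M mu') mu' snd = mu'"
  using product_coupling[OF mu mu'] by (auto simp: couplings_def)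
 have pcs: "distr (mu \<Otimes>\<^sub>M mu') mu snd = mu'" using pc(2) distr_cong[OF refl s, of "mu \<Otimes>\<^sub>M mu'" snd snd] by simp
 have mm: "mix t mu mu = mu"
  using t by (intro measure_eqI) (simp_all add: emeasure_mix distrib_right[symmetric] ennreal_plus[symmetric] del: ennreal_plus)
 have "sets ?\<pi> = sets (mu \<Otimes>\<^sub>M mix t mu mu')" unfolding sets_mix sets_distr by (intro sets_pair_measure_cong) simp_all
 moreover have "distr ?\<pi> mu fst = mu" by (simp add: distr_mix[OF sd] dd pc mm)
 moreover have "distr ?\<pi> (mix t mu mu') snd = mix t mu mu'"
 proof -
  have "distr ?\<pi> (mix t mu mu') snd = distr ?\<pi> mu snd" by (rule distr_cong) simp_all
  thus ?thesis by (simp add: distr_mix[OF sd] dd pcs)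
 qed
 ultimately have \<pi>: "?\<pi> : couplings mu (mix t mu mu')" by (simp add: couplings_def)
 have mD: "?D : borel_measurable (mu \<Otimes>\<^sub>M mu)" "?D : borel_measurable ?diag"
  using coupling_dist(1)[OF mu mu product_coupling[OF mu mu]] by simp_all
 have "(INF \<pi>\<in>couplings mu (mix t mu mu'). \<integral>\<^sup>+ z. ?D z \<partial>\<pi>) <= (\<integral>\<^sup>+ z. ?D z \<partial>?\<pi>)" by (rule INF_lower[OF \<pi>])
 also have "... = ennreal (1 - t) * (\<integral>\<^sup>+ z. ?D z \<partial>?diag) + ennreal t * (\<integral>\<^sup>+ z. ?D z \<partial>(mu \<Otimes>\<^sub>M mu'))"
  by (rule nn_integral_mix[OF sd mD(2)])
 also have "(\<integral>\<^sup>+ z. ?D z \<partial>?diag) = 0" using mD(1) by (subst nn_integral_distr) simp_all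
 also have "(\<integral>\<^sup>+ z. ?D z \<partial>(mu \<Otimes>\<^sub>M mu')) = ennreal (LINT z|(mu \<Otimes>\<^sub>M mu'). (dist_Rd d (fst z) (snd z))^2)"
  using coupling_cost[OF mu mu' product_coupling[OF mu mu'], of 2] by simp
 finally have "enn2real (INF \<pi>\<in>couplings mu (mix t mu mu'). \<integral>\<^sup>+ z. ?D z \<partial>\<pi>) <= t * (LINT z|(mu \<Otimes>\<^sub>M mu'). (dist_Rd d (fst z) (snd z))^2)"
  using t by (intro enn2real_leI) (auto simp: ennreal_mult[symmetric])
 thus ?thesis unfolding wasserstein_def by (simp add: powr_half_sqrt)
qed

section \<open>First variation of \<open>F\<close> along segments\<close>

context mean_field
begin

lemma dF_cont: "mu : P2 d ==> continuous_on (Rd d) (dF mu)"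
 using C1 by (intro C_k_cont) blast

lemma dF_integrable:
 assumes mu: "mu : P2 d" and \<sigma>: "\<sigma> : P2 d" shows "integrable \<sigma> (dF mu)"
proof -
 obtain c where c: "!!mu' x. mu' : P2 d ==> wasserstein d 2 mu mu' <= 0 ==> x : Rd d ==> abs (dF mu' x) <= c * (1 + (norm_Rd d x)^2)"
  using lfd mu unfolding linear_functional_derivative_def by blast
 interpret prob_space \<sigma> by (rule P2_D(1)[OF \<sigma>])
 have "integrable \<sigma> (%x. c * (1 + (norm_Rd d x)^2))" using P2_D(4)[OF \<sigma>] by simp
 thus ?thesis
  by (rule Bochner_Integration.integrable_bound)
   (use c[OF mu] wasserstein_self[OF mu] P2_measurable[OF \<sigma> dF_cont[OF mu]] P2_D(3)[OF \<sigma>] in \<open>auto intro!: AE_I2 order_trans[OF _ abs_ge_self]\<close>)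
qed

text \<open>The integrand in the defining formula of the linear functional derivative, that is, the
  derivative of \<open>F\<close> along the segment from \<open>mu\<close> to \<open>mu'\<close> at
  parameter \<open>u\<close>.\<close>

definition dirF :: "vec measure => vec measure => real => real" where
 "dirF mu mu' u = (LINT x|mu'. dF (mix u mu mu') x) - (LINT x|mu. dF (mix u mu mu') x)"

lemma dirF_lim:
 assumes mu: "mu : P2 d" and mu': "mu' : P2 d"
 shows "(dirF mu mu' \<longlongrightarrow> dirF mu mu' 0) (at 0 within {0..1})"
proof -
 have s: "sets mu = sets mu'" using P2_D(2) mu mu' by blast
 define D where "D = (LINT z|(mu \<Otimes>\<^sub>M mu'). (dist_Rd d (fst z) (snd z))^2)"
 have D: "0 <= D" unfolding D_def by (rule Bochner_Integration.integral_nonneg) simp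
 note mP = mix_P2[OF mu mu']
 have W: "wasserstein d 2 mu (mix u mu mu') <= sqrt (u * D)" if "u : {0..1}" for u
  using wasserstein_mix[OF mu mu'] that unfolding D_def by simp
 obtain c where c: "!!\<sigma> x. \<sigma> : P2 d ==> wasserstein d 2 mu \<sigma> <= sqrt D ==> x : Rd d ==> abs (dF \<sigma> x) <= c * (1 + (norm_Rd d x)^2)"
  using lfd mu unfolding linear_functional_derivative_def by blast
 have "((%u. \<integral>x. dF (mix u mu mu') x \<partial>\<sigma>) \<longlongrightarrow> (LINT x|\<sigma>. dF mu x)) (at 0 within {0..1})" if \<sigma>: "\<sigma> : P2 d" for \<sigma>
  unfolding tendsto_at_iff_sequentially
 proof (intro allI impI)
  fix X :: "nat => real" assume X: "ALL i. X i : {0..1} - {0}" "X ----> 0"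
  interpret prob_space \<sigma> by (rule P2_D(1)[OF \<sigma>])
  have Pn: "mix (X n) mu mu' : P2 d" for n using mP X(1) by simp
  have "(%n. \<integral>x. dF (mix (X n) mu mu') x \<partial>\<sigma>) ----> (LINT x|\<sigma>. dF mu x)"
  proof (rule integral_dominated_convergence[where w = "%x. c * (1 + (norm_Rd d x)^2)"])
   show "dF mu : borel_measurable \<sigma>" "dF (mix (X n) mu mu') : borel_measurable \<sigma>" for n
    by (intro P2_measurable[OF \<sigma>] dF_cont mu Pn)+
   show "integrable \<sigma> (%x. c * (1 + (norm_Rd d x)^2))" using P2_D(4)[OF \<sigma>] by simp
   show "AE x in \<sigma>. norm (dF (mix (X n) mu mu') x) <= c * (1 + (norm_Rd d x)^2)" for n
   proof (rule AE_I2)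
    fix x assume "x : space \<sigma>"
    moreover have "X n * D <= 1 * D" using X(1) D by (intro mult_right_mono) auto
    hence "wasserstein d 2 mu (mix (X n) mu mu') <= sqrt D" using W[of "X n"] X(1) real_sqrt_le_mono[of "X n * D" D] by (simp del: real_sqrt_le_iff)
    ultimately show "norm (dF (mix (X n) mu mu') x) <= c * (1 + (norm_Rd d x)^2)" using c[OF Pn] P2_D(3)[OF \<sigma>] by simp
   qed
   show "AE x in \<sigma>. (%n. dF (mix (X n) mu mu') x) ----> dF mu x"
   proof (rule AE_I2, rule tendstoI)
    fix x and e :: real assume "x : space \<sigma>" and e: "0 < e"
    hence x: "x : Rd d" using P2_D(3)[OF \<sigma>] by simp
    obtain eta where eta: "0 < eta" "!!\<sigma> x'. \<sigma> : P2 d ==> x' : Rd d ==> wasserstein d 2 mu \<sigma> < eta & dist_Rd d x x' < eta ==> abs (dF \<sigma> x' - dF mu x) < e"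
     using lfd mu x e unfolding linear_functional_derivative_def by meson
    have "(%n. sqrt (X n * D)) ----> sqrt (0 * D)" by (intro tendsto_intros X(2))
    hence "\<forall>\<^sub>F n in sequentially. sqrt (X n * D) < eta" by (rule order_tendstoD) (use eta(1) in simp)
    thus "\<forall>\<^sub>F n in sequentially. dist (dF (mix (X n) mu mu') x) (dF mu x) < e"
    proof (rule eventually_mono)
     fix n assume "sqrt (X n * D) < eta"
     hence "wasserstein d 2 mu (mix (X n) mu mu') < eta" using W[of "X n"] X(1) by auto
     thus "dist (dF (mix (X n) mu mu') x) (dF mu x) < e" using eta Pn x by (simp add: dist_real_def)
    qed
   qed
  qed
  thus "((%u. \<integral>x. dF (mix u mu mu') x \<partial>\<sigma>) \<circ> X) ----> (LINT x|\<sigma>. dF mu x)" by (simp add: comp_def)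
 qed
 thus ?thesis unfolding dirF_def[abs_def] mix_0[OF s] using mu mu' by (intro tendsto_diff)
qed

text \<open>The defining integral formula is applied to the short segment from \<open>mu\<close> to
  \<open>mix t mu mu'\<close>. By \<open>mix_mix\<close> its integrand is
  \<open>t * dirF mu mu' (u * t)\<close>, which \<open>dirF_lim\<close> compares with
  \<open>t * dirF mu mu' 0\<close>.\<close>

lemma first_variation:
 assumes mu: "mu : P2 d" and mu': "mu' : P2 d" and eps: "0 < eps"
 obtains t0 where "0 < t0" "t0 <= 1" "!!t. 0 < t ==> t < t0 ==> abs (F (mix t mu mu') - F mu - t * dirF mu mu' 0) <= t * eps"
proof -
 have s: "sets mu = sets mu'" using P2_D(2) mu mu' by blast
 from tendstoD[OF dirF_lim[OF mu mu'] eps]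
 obtain t1 where t1: "0 < t1" "!!u. u : {0..1} ==> u ~= 0 ==> abs u < t1 ==> abs (dirF mu mu' u - dirF mu mu' 0) < eps"
  unfolding eventually_at by (auto simp: dist_real_def)
 have "abs (F (mix t mu mu') - F mu - t * dirF mu mu' 0) <= t * eps" if t: "0 < t" "t < min t1 1" for t
 proof -
  have t': "0 <= t" "t <= 1" using t by auto
  have P: "mix u mu mu' : P2 d" if "u : {0..1}" for u using mix_P2[OF mu mu'] that by simp
  note Pt = mix_P2[OF mu mu' t']
  let ?f = "%u. (LINT x|mix t mu mu'. dF (mix u mu (mix t mu mu')) x) - (LINT x|mu. dF (mix u mu (mix t mu mu')) x)"
  have eq: "?f u = t * dirF mu mu' (u * t)" if u: "u : cbox 0 1" for u
  proof -
   have ut: "u * t : {0..1}" using u t' by (auto intro: mult_le_one)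
   have m: "mix u mu (mix t mu mu') = mix (u * t) mu mu'" using u by (intro mix_mix[OF s] t') auto
   show ?thesis unfolding m integral_mix(2)[OF s dF_integrable[OF P[OF ut] mu] dF_integrable[OF P[OF ut] mu'] t'] dirF_def
    by (simp add: algebra_simps)
  qed
  have "(?f has_integral (F (mix t mu mu') - F mu)) (cbox 0 1)"
   using lfd mu Pt unfolding linear_functional_derivative_def cbox_interval by blast
  from has_integral_diff[OF this has_integral_const_real[of "t * dirF mu mu' 0" 0 1, folded cbox_interval]]
  have "((%u. ?f u - t * dirF mu mu' 0) has_integral (F (mix t mu mu') - F mu - t * dirF mu mu' 0)) (cbox 0 1)" by simp
  moreover have "norm (?f u - t * dirF mu mu' 0) <= t * eps" if u: "u : cbox 0 1" for u
  proof -
   have "abs (dirF mu mu' (u * t) - dirF mu mu' 0) <= eps"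
   proof (cases "u * t = 0")
    case False
    have "u * t <= 1 * t" using u t' by (intro mult_right_mono) auto
    moreover have "0 <= u * t" using u t' by auto
    ultimately have "0 <= u * t" "u * t <= 1" "abs (u * t) < t1" using t by linarith+
    thus ?thesis using t1(2)[OF _ False] by (simp add: less_imp_le)
   next
    case True
    show ?thesis unfolding True using eps by simp
   qed
   thus ?thesis unfolding eq[OF u] right_diff_distrib[symmetric] using t by (simp add: abs_mult)
  qed
  ultimately show ?thesis
   using has_integral_bound[of "t * eps" "%u. ?f u - t * dirF mu mu' 0" _ 0 1] t' eps by simp
 qed
 thus thesis using t1(1) by (intro that[of "min t1 1"]) auto
qed

lemma convex_first_order:
 assumes mu: "mu : P2 d" and mu': "mu' : P2 d"
 shows "(LINT x|mu'. dF mu x) - (LINT x|mu. dF mu x) <= F mu' - F mu"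
proof (rule field_le_epsilon)
 fix e :: real assume e: "0 < e"
 have s: "sets mu = sets mu'" using P2_D(2) mu mu' by blast
 obtain t0 where t0: "0 < t0" "t0 <= 1" "!!t. 0 < t ==> t < t0 ==> abs (F (mix t mu mu') - F mu - t * dirF mu mu' 0) <= t * e"
  using first_variation[OF mu mu' e] by blast
 let ?t = "t0 / 2"
 have t: "0 < ?t" "?t < t0" "?t : {0..1}" using t0 by auto
 have "?t * dirF mu mu' 0 <= ?t * (F mu' - F mu + e)"
  using t0(3)[OF t(1,2)] convex[rule_format, OF t(3) mu mu'] by (simp add: abs_le_iff field_simps)
 hence "dirF mu mu' 0 <= F mu' - F mu + e" using t(1) by (simp only: mult_le_cancel_left_pos)
 thus "(LINT x|mu'. dF mu x) - (LINT x|mu. dF mu x) <= F mu' - F mu + e" by (simp add: dirF_def mix_0[OF s])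
qed

end

section \<open>The minimizer is a Gibbs measure\<close>

text \<open>Strict convexity of \<open>x * ln x\<close>, with the tangent line at \<open>y\<close>.
  The gap integrates to a relative entropy, and the equality case identifies densities.\<close>

lemma xlnx_tangent:
 fixes x y :: real assumes x: "0 <= x" and y: "0 < y"
 shows "x * ln y + x - y <= x * ln x" "x * ln y + x - y = x * ln x ==> x = y"
proof -
 have *: "x * ln y - x * ln x = x * ln (y / x)" "x * (y / x - 1) = y - x" if "0 < x" using that y by (simp_all add: ln_div algebra_simps)
 show "x * ln y + x - y <= x * ln x"
 proof (cases "x = 0")
  case False
  hence x: "0 < x" using assms by simp
  have "x * ln (y / x) <= x * (y / x - 1)" using x y by (intro mult_left_mono ln_le_minus_one) auto
  thus ?thesis using *[OF x] by linarith
 qed (use y in simp)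
 assume eq: "x * ln y + x - y = x * ln x"
 hence x: "0 < x" using assms by (cases "x = 0") auto
 hence "x * ln (y / x) = x * (y / x - 1)" using eq *[OF x] by linarith
 hence "ln (y / x) = y / x - 1" using x by (simp only: mult_cancel_left) simp
 thus "x = y" using ln_eq_minus_one[of "y / x"] x y by simp
qed

text \<open>The integrable lower bound \<open>- j\<close> excludes infinity minus infinity in
  \<open>neg_entropy\<close>; finiteness of the entropy and integrability of \<open>h * ln h\<close>
  then amount to the same.\<close>

lemma neg_entropy_density:
 assumes \<sigma>: "density (lborel_Rd d) (%x. ennreal (h x)) = \<sigma>" and h: "h : borel_measurable (lborel_Rd d)" "!!x. 0 <= h x"
  and j: "integrable (lborel_Rd d) j" "!!x. x : Rd d ==> - j x <= h x * ln (h x)"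
 shows "integrable (lborel_Rd d) (%x. h x * ln (h x)) ==> neg_entropy d \<sigma> = ereal (LINT x|lborel_Rd d. h x * ln (h x))"
  and "neg_entropy d \<sigma> ~= \<infinity> ==> integrable (lborel_Rd d) (%x. h x * ln (h x))"
proof -
 let ?L = "lborel_Rd d"
 interpret sigma_finite_measure ?L by (rule sigma_finite_lborel_Rd)
 let ?k = "%x. enn2real (RN_deriv ?L \<sigma> x)"
 have ac: "absolutely_continuous ?L \<sigma>" unfolding \<sigma>[symmetric] using h by (intro absolutely_continuousI_density) simp
 have "AE x in ?L. ennreal (h x) = RN_deriv ?L \<sigma> x" using h(1) by (intro RN_deriv_unique[OF _ \<sigma>]) simp
 hence k: "AE x in ?L. ?k x = h x" by eventually_elim (metis enn2real_ennreal h(2))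
 define P N where "P = (\<integral>\<^sup>+ x. ennreal (h x * ln (h x)) \<partial>?L)" and "N = (\<integral>\<^sup>+ x. ennreal (- (h x * ln (h x))) \<partial>?L)"
 have P: "(\<integral>\<^sup>+ x. ennreal (?k x * ln (?k x)) \<partial>?L) = P" "(\<integral>\<^sup>+ x. ennreal (- (?k x * ln (?k x))) \<partial>?L) = N"
  unfolding P_def N_def by (rule nn_integral_cong_AE, use k in eventually_elim, simp)+
 have ne: "neg_entropy d \<sigma> = enn2ereal P - enn2ereal N" using ac by (simp add: neg_entropy_def Let_def P)
 have "N <= (\<integral>\<^sup>+ x. ennreal (j x) \<partial>?L)" unfolding N_def using j(2) by (intro nn_integral_mono ennreal_leI) (auto simp: minus_le_iff)
 hence N: "N ~= \<infinity>" using integrableD(2)[OF j(1)] by (auto simp: top_unique)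
 have int: "integrable ?L (%x. h x * ln (h x)) \<longleftrightarrow> P ~= \<infinity>" unfolding real_integrable_def using h(1) N by (simp add: P_def N_def)
 obtain n where n: "N = ennreal n" "0 <= n" using N by (cases N) auto
 {
  assume i: "integrable ?L (%x. h x * ln (h x))"
  then obtain p where p: "P = ennreal p" "0 <= p" using int by (cases P) auto
  have "(LINT x|?L. h x * ln (h x)) = p - n"
   unfolding real_lebesgue_integral_def[OF i] P_def[symmetric] N_def[symmetric] p n using p n by simp
  thus "neg_entropy d \<sigma> = ereal (LINT x|lborel_Rd d. h x * ln (h x))" unfolding ne p n using p n by simp
 }
 assume "neg_entropy d \<sigma> ~= \<infinity>"
 hence "P ~= \<infinity>" unfolding ne n by auto
 thus "integrable ?L (%x. h x * ln (h x))" using int by simp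
qed

text \<open>Move the minimizer \<open>mu\<close> towards \<open>hat d dF mu\<close>. Convexity of
  \<open>x * ln x\<close> bounds the entropy of the mixture, \<open>first_variation\<close> expands
  \<open>F\<close>, and minimality then forces the relative entropy of \<open>mu\<close> with
  respect to \<open>hat d dF mu\<close> below every \<open>eps\<close>. Hence the two measures
  agree.\<close>

lemma (in mean_field) minimizer_hat:
 assumes min: "free_energy_minimizer d F mu" shows "hat d dF mu = mu"
proof -
 have mu: "mu : P2 d" using min by (simp add: free_energy_minimizer_def)
 interpret A: lsi_gibbs d "dF mu" rho by (rule lsi_gibbs[OF mu])
 let ?L = "lborel_Rd d" and ?nu = "hat d dF mu"
 interpret sigma_finite_measure ?L by (rule sigma_finite_lborel_Rd)
 interpret pm: prob_space mu by (rule P2_D(1)[OF mu])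
 have smu: "sets mu = sets ?L" using P2_D(2)[OF mu] by (simp add: sets_lborel_Rd)
 define f where "f x = exp (- dF mu x) / A.Z" for x
 define l where "l x = - dF mu x - ln A.Z" for x
 have f: "0 < f x" "ln (f x) = l x" for x using A.Z_pos by (simp_all add: f_def l_def ln_div)
 have mf [measurable]: "f : borel_measurable ?L" unfolding f_def[abs_def] using A.mV by simp
 have ml [measurable]: "l : borel_measurable ?L" unfolding l_def[abs_def]
  by (intro measurable_lborel_Rd measurable_Rd continuous_intros dF_cont mu)
 have nu: "density ?L (%x. ennreal (f x)) = ?nu" unfolding hat_gibbs A.gibbs_alt f_def ..
 note nuP = hat_P2[OF mu]
 have int: "integrable ?L h & (LINT x|?L. h x) = 1 & integrable ?L (%x. h x * l x) &
   (LINT x|?L. h x * l x) = - (LINT x|\<sigma>. dF mu x) - ln A.Z"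
  if \<sigma>: "density ?L (%x. ennreal (h x)) = \<sigma>" "\<sigma> : P2 d" and h: "h : borel_measurable ?L" "!!x. 0 <= h x" for h \<sigma>
 proof -
  interpret prob_space \<sigma> by (rule P2_D(1)[OF \<sigma>(2)])
  note d1 = integrable_density[OF _ h(1)] and d2 = integral_density[OF _ h(1)]
  note i = dF_integrable[OF mu \<sigma>(2)]
  have 1: "integrable \<sigma> l" "(LINT x|\<sigma>. l x) = - (LINT x|\<sigma>. dF mu x) - ln A.Z" unfolding l_def using i by (simp_all add: prob_space)
  have 2: "(LINT x|\<sigma>. (1 :: real)) = 1" "integrable \<sigma> (%_. 1 :: real)" by (simp_all add: prob_space)
  show ?thesis using 1 2 d1[of l] d1[of "%_. 1 :: real"] d2[of l] d2[of "%_. 1 :: real"] h(2) unfolding \<sigma>(1) by simp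
 qed
 note fi = int[OF nu nuP mf less_imp_le[OF f(1)]]
 have lower: "- (f x - h x - h x * l x) <= h x * ln (h x)" if "0 <= h x" for h and x :: "nat => real"
  using xlnx_tangent(1)[OF that f(1)[of x]] by (simp add: f(2))
 have ij: "integrable ?L (%x. f x - h x - h x * l x)"
  if "density ?L (%x. ennreal (h x)) = \<sigma>" "\<sigma> : P2 d" "h : borel_measurable ?L" "!!x. 0 <= h x" for h \<sigma>
  using int[OF that] fi by (intro Bochner_Integration.integrable_diff) auto
 have ent: "integrable ?L (%x. h x * ln (h x)) ==> neg_entropy d \<sigma> = ereal (LINT x|?L. h x * ln (h x))"
  "neg_entropy d \<sigma> ~= \<infinity> ==> integrable ?L (%x. h x * ln (h x))"
  if \<sigma>: "density ?L (%x. ennreal (h x)) = \<sigma>" "\<sigma> : P2 d" and h: "h : borel_measurable ?L" "!!x. 0 <= h x" for h \<sigma>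
  using neg_entropy_density[OF \<sigma>(1) h ij[OF \<sigma> h] lower[of h, OF h(2)]] by blast+
 have "integrable ?L (%x. f x * ln (f x))" unfolding f(2) using fi by blast
 from ent(1)[OF nu nuP mf less_imp_le[OF f(1)] this] have "neg_entropy d ?nu ~= \<infinity>" by simp
 moreover have min': "ereal (F mu) + neg_entropy d mu <= ereal (F \<sigma>) + neg_entropy d \<sigma>" if "\<sigma> : P2 d" for \<sigma>
  using min that by (simp add: free_energy_minimizer_def free_energy_def)
 ultimately have ne: "neg_entropy d mu ~= \<infinity>" using min'[OF nuP] by auto
 hence ac: "absolutely_continuous ?L mu" by (auto simp: neg_entropy_def split: if_splits)
 define h where "h x = enn2real (RN_deriv ?L mu x)" for x
 have mh [measurable]: "h : borel_measurable ?L" unfolding h_def[abs_def] by simp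
 have h: "0 <= h x" for x by (simp add: h_def)
 have hmu: "density ?L (%x. ennreal (h x)) = mu"
 proof -
  have "AE x in ?L. RN_deriv ?L mu x ~= \<infinity>" by (rule RN_deriv_finite[OF _ ac smu]) unfold_locales
  hence "AE x in ?L. ennreal (h x) = RN_deriv ?L mu x" by eventually_elim (simp add: h_def less_top)
  hence "density ?L (%x. ennreal (h x)) = density ?L (RN_deriv ?L mu)" by (intro density_cong) auto
  thus ?thesis using density_RN_deriv[OF ac smu] by simp
 qed
 note ih = int[OF hmu mu mh h] and iH = ent(2)[OF hmu mu mh h ne] and eH = ent(1)[OF hmu mu mh h]
 \<comment> \<open>Since \<open>l\<close> is the logarithm of \<open>f\<close>, this is the relative
   entropy of \<open>mu\<close> with respect to its Gibbs measure.\<close>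
 define KL where "KL = (LINT x|?L. h x * ln (h x)) - (LINT x|?L. h x * l x)"
 have "KL <= 0 + eps" if eps: "0 < eps" for eps
 proof -
  obtain t0 where t0: "0 < t0" "t0 <= 1" "!!t. 0 < t ==> t < t0 ==> abs (F (mix t mu ?nu) - F mu - t * dirF mu ?nu 0) <= t * eps"
   using first_variation[OF mu nuP eps] by blast
  define t where "t = t0 / 2"
  have t: "0 < t" "t < t0" "t < 1" using t0 by (auto simp: t_def)
  have ss: "sets mu = sets ?nu" using P2_D(2) mu nuP by blast
  note mP = mix_P2[OF mu nuP less_imp_le[OF t(1)] less_imp_le[OF t(3)]]
  define k where "k x = (1 - t) * h x + t * f x" for x
  have mk [measurable]: "k : borel_measurable ?L" unfolding k_def[abs_def] by simp
  have k: "0 < k x" for x using h[of x] f(1)[of x] t by (auto simp: k_def intro!: add_nonneg_pos)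
  have kmu: "density ?L (%x. ennreal (k x)) = mix t mu ?nu"
  proof (rule measure_eqI)
   fix A assume "A : sets (density ?L (%x. ennreal (k x)))"
   hence A: "A : sets ?L" by simp
   have "emeasure (density ?L (%x. ennreal (k x))) A = (\<integral>\<^sup>+ x. ennreal (1 - t) * (ennreal (h x) * indicator A x) + ennreal t * (ennreal (f x) * indicator A x) \<partial>?L)"
    using A t h f(1) by (subst emeasure_density) (auto intro!: nn_integral_cong simp: k_def ennreal_mult ennreal_plus less_imp_le distrib_right mult.assoc)
   also have "... = ennreal (1 - t) * emeasure mu A + ennreal t * emeasure ?nu A"
    using A emeasure_density[of "%x. ennreal (h x)" ?L A] emeasure_density[of "%x. ennreal (f x)" ?L A]
    unfolding hmu nu by (simp add: nn_integral_add nn_integral_cmult)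
   finally show "emeasure (density ?L (%x. ennreal (k x))) A = emeasure (mix t mu ?nu) A" using A smu by (simp add: emeasure_mix[OF ss])
  qed (simp add: smu)
  note ik = int[OF kmu mP mk less_imp_le[OF k]]
  have up: "k x * ln (k x) <= (1 - t) * (h x * ln (h x)) + t * (f x * l x)" for x
  proof -
   have "(1 - t) * (h x * ln (k x) + h x - k x) + t * (f x * ln (k x) + f x - k x) <= (1 - t) * (h x * ln (h x)) + t * (f x * ln (f x))"
    using t xlnx_tangent(1)[OF h k] xlnx_tangent(1)[OF less_imp_le[OF f(1)] k] by (intro add_mono mult_left_mono) auto
   moreover have "(1 - t) * (h x * ln (k x) + h x - k x) + t * (f x * ln (k x) + f x - k x) = k x * ln (k x) + k x - k x"
    unfolding k_def[of x] by (simp add: algebra_simps)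
   ultimately show ?thesis by (simp add: f(2))
  qed
  have iu: "integrable ?L (%x. (1 - t) * (h x * ln (h x)) + t * (f x * l x))"
   using iH fi by (intro Bochner_Integration.integrable_add integrable_mult_right) auto
  have iK: "integrable ?L (%x. k x * ln (k x))"
  proof (rule Bochner_Integration.integrable_bound)
   show "integrable ?L (%x. abs ((1 - t) * (h x * ln (h x)) + t * (f x * l x)) + abs (f x - k x - k x * l x))"
    by (rule Bochner_Integration.integrable_add[OF integrable_abs[OF iu] integrable_abs[OF ij[OF kmu mP mk less_imp_le[OF k]]]])
   have "abs (k x * ln (k x)) <= abs ((1 - t) * (h x * ln (h x)) + t * (f x * l x)) + abs (f x - k x - k x * l x)" for x
    using up[of x] lower[of k x, OF less_imp_le[OF k]] by linarith
   thus "AE x in ?L. norm (k x * ln (k x)) <= norm (abs ((1 - t) * (h x * ln (h x)) + t * (f x * l x)) + abs (f x - k x - k x * l x))" by simp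
  qed simp
  have "(LINT x|?L. k x * ln (k x)) <= (LINT x|?L. (1 - t) * (h x * ln (h x)) + t * (f x * l x))"
   by (rule integral_mono[OF iK iu up])
  also have "... = (1 - t) * (LINT x|?L. h x * ln (h x)) + t * (LINT x|?L. f x * l x)" using iH fi by simp
  finally have 1: "(LINT x|?L. k x * ln (k x)) <= (1 - t) * (LINT x|?L. h x * ln (h x)) + t * (LINT x|?L. f x * l x)" .
  have 2: "F mu + (LINT x|?L. h x * ln (h x)) <= F (mix t mu ?nu) + (LINT x|?L. k x * ln (k x))"
   using min'[OF mP] unfolding eH[OF iH] ent(1)[OF kmu mP mk less_imp_le[OF k] iK] by simp
  have 3: "dirF mu ?nu 0 = (LINT x|?L. h x * l x) - (LINT x|?L. f x * l x)"
   using ih fi by (simp add: dirF_def mix_0[OF ss])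
  have "t * KL <= t * eps" unfolding KL_def using 1 2 t0(3)[OF t(1,2)] unfolding 3 by (simp add: algebra_simps abs_le_iff)
  thus ?thesis using t(1) by simp
 qed
 hence KL: "KL <= 0" by (rule field_le_epsilon)
 \<comment> \<open>The added \<open>f - h\<close> has integral 0 and makes the integrand pointwise
   nonnegative.\<close>
 let ?g = "%x. h x * ln (h x) - h x * l x - h x + f x"
 have g0: "0 <= ?g x" for x using xlnx_tangent(1)[OF h f(1)[of x], of x] by (simp add: f(2))
 have ig: "integrable ?L ?g" using iH ih fi by (intro Bochner_Integration.integrable_add Bochner_Integration.integrable_diff) auto
 have "(LINT x|?L. ?g x) = KL" using iH ih fi by (simp add: KL_def)
 hence "(LINT x|?L. ?g x) = 0" using KL Bochner_Integration.integral_nonneg[of ?L ?g, OF g0] by linarith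
 hence "AE x in ?L. ?g x = 0" using integral_nonneg_eq_0_iff_AE[OF ig] g0 by simp
 hence "AE x in ?L. h x = f x"
  by eventually_elim (rule xlnx_tangent(2)[OF h f(1)], simp add: f(2))
 hence "density ?L (%x. ennreal (h x)) = density ?L (%x. ennreal (f x))" by (intro density_cong) auto
 thus ?thesis by (simp add: hmu nu)
qed

section \<open>Kantorovich--Rubinstein duality\<close>

text \<open>Marginal constraints are replaced by a quadratic penalty; the first-order conditions at a
 minimizer of the penalized cost directly provide dual feasible potentials \<open>f\<close> and \<open>h\<close>.\<close>

context
 fixes n :: nat and c :: "nat => nat => real" and p q :: "nat => real" and W :: real
 assumes c0: "!!i j. i < n ==> j < n ==> 0 <= c i j" and cd: "!!i. i < n ==> c i i = 0"
  and ct: "!!i j k. i < n ==> j < n ==> k < n ==> c i k <= c i j + c j k"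
  and p: "!!i. i < n ==> 0 <= p i" "(\<Sum>i<n. p i) = 1" and q: "!!i. i < n ==> 0 <= q i" "(\<Sum>i<n. q i) = 1"
  and W: "!!g. (!!i j. i < n ==> j < n ==> g i - g j <= c i j) ==> (\<Sum>i<n. g i * (p i - q i)) <= W"
begin

text \<open>The upper bound 3 provides compactness. A minimizer of the penalized cost stays strictly
  below it, so nonnegativity is the only constraint that can be active.\<close>

definition "plans = PiE UNIV (%x. if x : {..<n} \<times> {..<n} then {0..3 :: real} else {0})"
definition "rsum \<pi> i = (\<Sum>j<n. \<pi> (i, j :: nat) :: real)"
definition "csum \<pi> j = (\<Sum>i<n. \<pi> (i :: nat, j) :: real)"
definition "cost \<pi> = (\<Sum>i<n. \<Sum>j<n. c i j * \<pi> (i, j))"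

lemma compact_plans: "compact plans"
proof -
 have "compactin (product_topology (%_. euclidean) UNIV) plans" unfolding plans_def compactin_PiE by auto
 thus ?thesis by (simp add: euclidean_product_topology)
qed

lemma plan_range: "\<pi> : plans ==> i < n ==> j < n ==> 0 <= \<pi> (i, j) & \<pi> (i, j) <= 3"
 unfolding plans_def by (drule PiE_mem[of _ _ _ "(i, j)"]) auto

text \<open>A c-transform replaces the pair \<open>(f, h)\<close> by \<open>(g, - g)\<close>, where
  \<open>g\<close> is Lipschitz for the cost by the triangle inequality. Neither sum decreases,
  because \<open>p\<close> and \<open>q\<close> are nonnegative and \<open>c i i\<close> is
  0.\<close>

lemma dual_feasible:
 assumes fh: "!!i j. i < n ==> j < n ==> f i + h j <= c i j"
 shows "(\<Sum>i<n. f i * p i) + (\<Sum>j<n. h j * q j) <= W"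
proof -
 have n: "{..<n} ~= {}" using p(2) by auto
 define g where "g i = Min ((%j. c i j - h j) ` {..<n})" for i
 have g_le: "g i <= c i j - h j" if "j < n" for i j unfolding g_def using that by (intro Min_le) auto
 have g_ge: "EX j<n. g i = c i j - h j" for i
 proof -
  have "g i : (%j. c i j - h j) ` {..<n}" unfolding g_def using n by (intro Min_in) auto
  thus ?thesis by auto
 qed
 have "(\<Sum>i<n. g i * (p i - q i)) <= W"
 proof (rule W)
  fix i k assume ik: "i < n" "k < n"
  obtain j where "j < n" "g k = c k j - h j" using g_ge by blast
  thus "g i - g k <= c i k" using g_le[of j i] ct[OF ik(1,2), of j] by simp
 qed
 moreover have "(\<Sum>i<n. f i * p i) <= (\<Sum>i<n. g i * p i)"
 proof (intro sum_mono mult_right_mono)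
  fix i assume "i : {..<n}"
  hence i: "i < n" by simp
  obtain j where "j < n" "g i = c i j - h j" using g_ge by blast
  thus "f i <= g i" using fh[OF i, of j] by simp
  show "0 <= p i" by (rule p(1)[OF i])
 qed
 moreover have "(\<Sum>j<n. h j * q j) <= (\<Sum>j<n. - g j * q j)"
 proof (intro sum_mono mult_right_mono)
  fix j assume "j : {..<n}"
  hence j: "j < n" by simp
  show "h j <= - g j" using g_le[OF j, of j] cd[OF j] by simp
  show "0 <= q j" by (rule q(1)[OF j])
 qed
 ultimately show ?thesis by (simp add: right_diff_distrib sum_subtractf sum_negf)
qed

text \<open>First-order conditions at a minimum on an interval: \<open>D\<close> is nonnegative, and
  0 as soon as a move to the left is possible. With \<open>a\<close> an entry of the plan this is
  complementary slackness.\<close>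

lemma quadratic_min:
 fixes D a b eps :: real
 assumes m: "!!u. - a <= u ==> u <= b ==> 0 <= u * D + u^2 / eps" and eps: "0 < eps" and a: "0 <= a" and b: "0 < b"
 shows "0 <= D" "a * D = 0"
proof -
 have *: "0 <= s * D" if "0 < x" "abs s = 1" "!!u. 0 < u ==> u <= x ==> - a <= s * u & s * u <= b" for s x
 proof (rule ccontr)
  assume "~ 0 <= s * D"
  hence D: "s * D < 0" by simp
  define u where "u = min x (- (s * D) * eps / 2)"
  have u: "0 < u" "u <= x" "u <= - (s * D) * eps / 2" using that D eps by (auto simp: u_def mult_neg_pos)
  have "s^2 = 1" using that(2) by (metis power2_abs one_power2)
  hence "(s * u)^2 = u^2" by (simp add: power_mult_distrib)
  hence "0 <= s * u * D + u^2 / eps" using m[of "s * u"] that(3)[OF u(1,2)] by simp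
  hence "0 <= u * (s * D + u / eps)" by (simp add: power2_eq_square distrib_left mult_ac)
  hence "0 <= s * D + u / eps" using u(1) by (simp add: zero_le_mult_iff)
  moreover have "u / eps <= - (s * D) / 2" using u(3) eps by (simp add: field_simps)
  ultimately show False using D by linarith
 qed
 show D: "0 <= D" using *[of b 1] a b by simp
 show "a * D = 0"
 proof (cases "a = 0")
  case False
  hence "D <= 0" using *[of a "-1"] a b by simp
  thus ?thesis using D by simp
 qed simp
qed

lemma penalized_plan:
 assumes eps: "0 < eps"
 obtains \<pi> where "\<pi> : plans" "cost \<pi> <= W" "!!i. i < n ==> (rsum \<pi> i - p i)^2 <= eps * W" "!!j. j < n ==> (csum \<pi> j - q j)^2 <= eps * W"
proof -
 define \<Phi> where "\<Phi> \<pi> = cost \<pi> + ((\<Sum>i<n. (rsum \<pi> i - p i)^2) + (\<Sum>j<n. (csum \<pi> j - q j)^2)) / (2 * eps)" for \<pi>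
 have z: "(%_. 0) : plans" by (auto simp: plans_def)
 have "continuous_on plans \<Phi>" unfolding \<Phi>_def[abs_def] cost_def rsum_def csum_def
  by (intro continuous_intros continuous_on_subset[OF continuous_on_product_coordinates]) (use eps in auto)
 then obtain \<pi> where \<pi>: "\<pi> : plans" "!!\<pi>'. \<pi>' : plans ==> \<Phi> \<pi> <= \<Phi> \<pi>'"
  using continuous_attains_inf[OF compact_plans] z by blast
 note r = plan_range[OF \<pi>(1)]
 have cost0: "0 <= cost \<pi>" unfolding cost_def using c0 r by (intro sum_nonneg mult_nonneg_nonneg) auto
 have le1: "x i <= 1 & (\<Sum>i<n. (x i)^2) <= 1" if x: "!!i. i < n ==> 0 <= x i" "(\<Sum>i<n. x i) = 1" and "i < n" for x :: "nat => real" and i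
 proof -
  have l: "x i <= 1" if "i < n" for i using member_le_sum[of i "{..<n}" x] x that by auto
  have "(\<Sum>i<n. (x i)^2) <= (\<Sum>i<n. x i)" using l x(1) by (intro sum_mono) (auto simp: power2_eq_square mult_left_le)
  thus ?thesis using l x(2) \<open>i < n\<close> by simp
 qed
 \<comment> \<open>Comparison with the zero plan bounds the sum of squared marginal defects by 2, so
   each row sum, hence each entry, stays below 3.\<close>
 have small: "\<pi> (i, j) < 3" if ij: "i < n" "j < n" for i j
 proof -
  have "(rsum \<pi> i - p i)^2 <= (\<Sum>i<n. (rsum \<pi> i - p i)^2) + (\<Sum>j<n. (csum \<pi> j - q j)^2)"
   using member_le_sum[of i "{..<n}" "%i. (rsum \<pi> i - p i)^2"] ij by (intro add_increasing2 sum_nonneg) auto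
  also have "... / (2 * eps) <= ((\<Sum>i<n. (p i)^2) + (\<Sum>j<n. (q j)^2)) / (2 * eps)"
   using \<pi>(2)[OF z] cost0 unfolding \<Phi>_def by (simp add: cost_def rsum_def csum_def)
  hence "(\<Sum>i<n. (rsum \<pi> i - p i)^2) + (\<Sum>j<n. (csum \<pi> j - q j)^2) <= (\<Sum>i<n. (p i)^2) + (\<Sum>j<n. (q j)^2)"
   using eps by (simp add: divide_le_cancel)
  also have "... <= 2" using le1[OF p ij(1)] le1[OF q ij(1)] by simp
  finally have sq: "(rsum \<pi> i - p i)^2 <= 2" .
  have "rsum \<pi> i < 3"
  proof (rule ccontr)
   assume "~ rsum \<pi> i < 3"
   hence "2 <= rsum \<pi> i - p i" using le1[OF p ij(1)] by simp
   hence "2^2 <= (rsum \<pi> i - p i)^2" by (intro power_mono) auto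
   thus False using sq by simp
  qed
  moreover have "\<pi> (i, j) <= rsum \<pi> i" unfolding rsum_def using r ij by (intro member_le_sum) auto
  ultimately show ?thesis by simp
 qed
 define f h where "f i = (p i - rsum \<pi> i) / eps" and "h j = (q j - csum \<pi> j) / eps" for i j
 \<comment> \<open>One entry of the plan is changed by \<open>u\<close>. This affects one row sum
   and one column sum, so the quadratic part of the penalty changes by
   \<open>u^2 / eps\<close>.\<close>
 have fo: "0 <= c i0 j0 - f i0 - h j0" "\<pi> (i0, j0) * (c i0 j0 - f i0 - h j0) = 0" if ij: "i0 < n" "j0 < n" for i0 j0
 proof -
  let ?D = "c i0 j0 - f i0 - h j0"
  have "0 <= u * ?D + u^2 / eps" if u: "- \<pi> (i0, j0) <= u" "u <= 3 - \<pi> (i0, j0)" for u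
  proof -
   define \<pi>' where "\<pi>' x = \<pi> x + (if x = (i0, j0) then u else 0)" for x
   have "\<pi>' : plans" using \<pi>(1) u ij unfolding plans_def \<pi>'_def PiE_UNIV_domain Pi_iff
    by (auto split: if_splits)
   from \<pi>(2)[OF this] have le: "\<Phi> \<pi> <= \<Phi> \<pi>'" .
   have ro: "rsum \<pi>' i = rsum \<pi> i + (if i = i0 then u else 0)" for i
    using ij by (simp add: rsum_def \<pi>'_def sum.distrib)
   have co: "csum \<pi>' j = csum \<pi> j + (if j = j0 then u else 0)" for j
    using ij by (simp add: csum_def \<pi>'_def sum.distrib)
   have sq: "(\<Sum>i<n. (x i + (if i = k then u else 0) - y i)^2) = (\<Sum>i<n. (x i - y i)^2) + (2 * u * (x k - y k) + u^2)"
    if "k < n" for x y :: "nat => real" and k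
   proof -
    have "(x i + (if i = k then u else 0) - y i)^2 = (x i - y i)^2 + (if i = k then 2 * u * (x k - y k) + u^2 else 0)" for i
     by (simp add: power2_eq_square algebra_simps)
    thus ?thesis using that by (simp add: sum.distrib)
   qed
   have "cost \<pi>' = cost \<pi> + (\<Sum>i<n. \<Sum>j<n. if i = i0 & j = j0 then c i0 j0 * u else 0)"
    unfolding cost_def sum.distrib[symmetric] by (intro sum.cong) (auto simp: \<pi>'_def distrib_left)
   also have "(\<Sum>i<n. \<Sum>j<n. if i = i0 & j = j0 then c i0 j0 * u else 0) = (\<Sum>i<n. if i = i0 then c i0 j0 * u else 0)"
    using ij by (intro sum.cong) auto
   also have "... = c i0 j0 * u" using ij by simp
   finally have cs: "cost \<pi>' = cost \<pi> + c i0 j0 * u" .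
   have "\<Phi> \<pi>' - \<Phi> \<pi> = u * ?D + u^2 / eps"
    unfolding \<Phi>_def cs ro co sq[OF ij(1)] sq[OF ij(2)] f_def h_def using eps by (simp add: field_simps)
   thus ?thesis using le by simp
  qed
  from quadratic_min[OF this eps] r[OF ij] small[OF ij]
  show "0 <= ?D" "\<pi> (i0, j0) * ?D = 0" by auto
 qed
 have "(\<Sum>i<n. f i * p i) + (\<Sum>j<n. h j * q j) <= W"
  by (rule dual_feasible) (use fo(1) in \<open>simp add: algebra_simps\<close>)
 \<comment> \<open>By complementary slackness the cost equals the dual objective at the marginals of
   the plan itself; the two differences below compare these marginals with \<open>p\<close> and
   \<open>q\<close>.\<close>
 moreover have "cost \<pi> = (\<Sum>i<n. f i * rsum \<pi> i) + (\<Sum>j<n. h j * csum \<pi> j)"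
 proof -
  have "cost \<pi> = (\<Sum>i<n. \<Sum>j<n. f i * \<pi> (i, j) + h j * \<pi> (i, j))"
   unfolding cost_def using fo(2) by (intro sum.cong refl) (auto simp: algebra_simps)
  also have "... = (\<Sum>i<n. f i * rsum \<pi> i) + (\<Sum>i<n. \<Sum>j<n. h j * \<pi> (i, j))"
   by (simp add: rsum_def sum.distrib sum_distrib_left)
  also have "(\<Sum>i<n. \<Sum>j<n. h j * \<pi> (i, j)) = (\<Sum>j<n. h j * csum \<pi> j)"
   by (subst sum.swap) (simp add: csum_def sum_distrib_left)
  finally show ?thesis .
 qed
 moreover have "(\<Sum>i<n. f i * p i) - (\<Sum>i<n. f i * rsum \<pi> i) = (\<Sum>i<n. (rsum \<pi> i - p i)^2) / eps"
  unfolding sum_subtractf[symmetric] sum_divide_distrib f_def using eps by (intro sum.cong) (auto simp: field_simps power2_eq_square)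
 moreover have "(\<Sum>j<n. h j * q j) - (\<Sum>j<n. h j * csum \<pi> j) = (\<Sum>j<n. (csum \<pi> j - q j)^2) / eps"
  unfolding sum_subtractf[symmetric] sum_divide_distrib h_def using eps by (intro sum.cong) (auto simp: field_simps power2_eq_square)
 ultimately have main: "cost \<pi> + ((\<Sum>i<n. (rsum \<pi> i - p i)^2) / eps + (\<Sum>j<n. (csum \<pi> j - q j)^2) / eps) <= W" by linarith
 have nn: "0 <= (\<Sum>i<n. (rsum \<pi> i - p i)^2) / eps" "0 <= (\<Sum>j<n. (csum \<pi> j - q j)^2) / eps"
  using eps by (auto intro!: divide_nonneg_nonneg sum_nonneg)
 have fin: "y k <= eps * W" if "(\<Sum>i<n. y i) / eps <= W" "k < n" "!!i. 0 <= y i" for y :: "nat => real" and k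
  using member_le_sum[of k "{..<n}" y] that eps by (simp add: divide_le_eq mult.commute)
 show thesis
 proof (rule that[OF \<pi>(1)])
  show "cost \<pi> <= W" using main nn by linarith
  show "(rsum \<pi> i - p i)^2 <= eps * W" if "i < n" for i
   using fin[of "%i. (rsum \<pi> i - p i)^2"] main nn cost0 that by simp
  show "(csum \<pi> i - q i)^2 <= eps * W" if "i < n" for i
   using fin[of "%i. (csum \<pi> i - q i)^2"] main nn cost0 that by simp
 qed
qed

text \<open>Penalized plans have squared marginal defects at most \<open>eps * W\<close>; these
  vanish in the limit of a convergent subsequence in the compact set of plans.\<close>

lemma finite_kantorovich:
 obtains \<pi> where "!!i j. i < n ==> j < n ==> 0 <= \<pi> (i, j)" "!!i. i < n ==> (\<Sum>j<n. \<pi> (i, j)) = p i"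
  "!!j. j < n ==> (\<Sum>i<n. \<pi> (i, j)) = q j" "(\<Sum>i<n. \<Sum>j<n. c i j * \<pi> (i, j)) <= W"
proof -
 have "EX \<pi>. \<pi> : plans & cost \<pi> <= W & (ALL i<n. (rsum \<pi> i - p i)^2 <= 1 / real (Suc k) * W & (csum \<pi> i - q i)^2 <= 1 / real (Suc k) * W)" for k
  using penalized_plan[of "1 / real (Suc k)"] by (metis of_nat_0_less_iff zero_less_Suc zero_less_divide_1_iff)
 then obtain X where X: "!!k. X k : plans" "!!k. cost (X k) <= W"
  "!!k i. i < n ==> (rsum (X k) i - p i)^2 <= 1 / real (Suc k) * W" "!!k i. i < n ==> (csum (X k) i - q i)^2 <= 1 / real (Suc k) * W"
  by metis
 obtain \<pi> s where \<pi>: "\<pi> : plans" "strict_mono s" "(X \<circ> s) ----> \<pi>"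
  using compact_imp_seq_compact[OF compact_plans] X(1) unfolding seq_compact_def by blast
 have co: "(%k. X (s k) x) ----> \<pi> x" for x
  using continuous_on_tendsto_compose[OF continuous_on_product_coordinates \<pi>(3), of x] by (simp add: comp_def)
 have "(%k. 1 / real (Suc (s k))) ----> 0"
  using LIMSEQ_subseq_LIMSEQ[OF LIMSEQ_Suc[OF lim_1_over_n] \<pi>(2)] by (simp add: comp_def)
 hence e: "(%k. 1 / real (Suc (s k)) * W) ----> 0 * W" by (intro tendsto_intros)
 have eq: "a = b" if "y ----> a" "!!k. (y k - b)^2 <= 1 / real (Suc (s k)) * W" for y and a b :: real
 proof -
  have "(%k. (y k - b)^2) ----> (a - b)^2" by (intro tendsto_intros that)
  from LIMSEQ_le[OF this e] that(2) have "(a - b)^2 <= 0" by auto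
  thus ?thesis by simp
 qed
 show thesis
 proof (rule that)
  show "0 <= \<pi> (i, j)" if "i < n" "j < n" for i j using plan_range[OF \<pi>(1) that] by simp
  show "(\<Sum>j<n. \<pi> (i, j)) = p i" if "i < n" for i
   by (rule eq[OF _ X(3)[OF that, unfolded rsum_def]]) (intro tendsto_sum co)
  show "(\<Sum>i<n. \<pi> (i, j)) = q j" if "j < n" for j
   by (rule eq[OF _ X(4)[OF that, unfolded csum_def]]) (intro tendsto_sum co)
  have "(%k. cost (X (s k))) ----> (\<Sum>i<n. \<Sum>j<n. c i j * \<pi> (i, j))" unfolding cost_def by (intro tendsto_intros co)
  thus "(\<Sum>i<n. \<Sum>j<n. c i j * \<pi> (i, j)) <= W" by (rule LIMSEQ_le_const2) (use X(2) in blast)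
 qed
qed

end

section \<open>Discretization and the duality for general measures\<close>

definition grid :: "nat => real => real" where
 "grid N s = (if \<bar>s\<bar> <= real N then real_of_int \<lfloor>real N * s\<rfloor> / real N else 0)"

text \<open>The quadratic right-hand side covers both the rounding on \<open>[-N, N]\<close> and the
  cut-off outside it, and is integrable by the second moments.\<close>

lemma grid_close: assumes "0 < N" shows "abs (s - grid N s) <= (1 + s^2) / real N"
proof (cases "abs s <= real N")
 case True
 have "s - grid N s = (real N * s - real_of_int \<lfloor>real N * s\<rfloor>) / real N" using True assms by (simp add: grid_def field_simps)
 also have "abs (...) <= 1 / real N"
 proof -
  have "abs (real N * s - real_of_int \<lfloor>real N * s\<rfloor>) <= 1" by linarith
  thus ?thesis by (simp add: divide_right_mono)
 qed
 also have "... <= (1 + s^2) / real N" by (simp add: divide_right_mono)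
 finally show ?thesis .
next
 case False
 hence "abs s * real N <= abs s * abs s" by (intro mult_left_mono) auto
 hence "abs s * real N <= 1 + s^2" by (simp add: power2_eq_square)
 thus ?thesis using False assms by (simp add: grid_def le_divide_eq)
qed

lemma finite_grid: "finite (range (grid N))"
proof (rule finite_subset)
 let ?B = "insert 0 ((%k. real_of_int k / real N) ` {- int (N * N)..int (N * N)})"
 show "range (grid N) \<subseteq> ?B"
 proof
  fix v assume "v : range (grid N)"
  then obtain s where v: "v = grid N s" by auto
  show "v : ?B"
  proof (cases "abs s <= real N")
   case True
   have "abs (real N * s) <= real N * real N" using True by (simp add: abs_mult mult_left_mono)
   hence "\<lfloor>real N * s\<rfloor> : {- int (N * N)..int (N * N)}" by (auto simp: le_floor_iff floor_le_iff)
   thus ?thesis using True by (auto simp: v grid_def)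
  qed (simp add: v grid_def)
 qed
qed simp

lemma measurable_grid [measurable]: "grid N : borel_measurable borel"
 unfolding grid_def[abs_def] by measurable

lemma lip_approx_P2:
 assumes f: "lip d 1 f"
 obtains g K where "!!n. CB d 3 (K n) (g n)" "!!n x. x : Rd d ==> norm_Rd d (grad d (g n) x) <= 1"
  "!!x. x : Rd d ==> (%n. g n x) ----> f x" "!!\<sigma>. \<sigma> : P2 d ==> (%n. \<integral>x. g n x \<partial>\<sigma>) ----> (LINT x|\<sigma>. f x)"
proof -
 obtain g K where g: "!!n. CB d 3 (K n) (g n)" "!!n x. x : Rd d ==> norm_Rd d (grad d (g n) x) <= 1"
  "!!n x. x : Rd d ==> abs (g n x) <= abs (f x) + 1" "!!x. x : Rd d ==> (%n. g n x) ----> f x"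
  using lip_approx[OF f] by blast
 have lim: "(%n. \<integral>x. g n x \<partial>\<sigma>) ----> (LINT x|\<sigma>. f x)" if \<sigma>: "\<sigma> : P2 d" for \<sigma>
 proof (rule integral_dominated_convergence[where w = "%x. abs (f x) + 1"])
  interpret prob_space \<sigma> by (rule P2_D(1)[OF \<sigma>])
  show "f : borel_measurable \<sigma>" "!!n. g n : borel_measurable \<sigma>"
   by (intro P2_measurable[OF \<sigma>] lip_cont[OF f] CB_cont[OF g(1)])+
  show "integrable \<sigma> (%x. abs (f x) + 1)" using P2_integrable_lip[OF \<sigma> f] by simp
  show "AE x in \<sigma>. (%n. g n x) ----> f x" "!!n. AE x in \<sigma>. norm (g n x) <= abs (f x) + 1"
   by (rule AE_I2, use g P2_D(3)[OF \<sigma>] in simp)+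
 qed
 show thesis by (rule that[OF g(1,2,4) lim])
qed

text \<open>Points are rounded to a finite grid and the finite duality is applied to the cell
  masses. The resulting table is spread out as a density with respect to the product measure that is
  constant on pairs of cells, which keeps the marginals exact; the rounding error disappears as
  \<open>N\<close> grows.\<close>

lemma kantorovich_rubinstein:
 assumes mu: "mu : P2 d" and nu: "nu : P2 d"
  and H: "!!g K. CB d 3 K g ==> (!!x. x : Rd d ==> norm_Rd d (grad d g x) <= 1) ==> (LINT x|mu. g x) - (LINT x|nu. g x) <= w"
 shows "wasserstein d 1 mu nu <= w"
proof -
 interpret A: prob_space mu by (rule P2_D(1)[OF mu])
 interpret B: prob_space nu by (rule P2_D(1)[OF nu])
 interpret P: pair_prob_space mu nu ..
 have [measurable_cong]: "sets mu = sets (borel_Rd d)" "sets nu = sets (borel_Rd d)" using P2_D(2) mu nu by auto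
 note sp = P2_D(3)[OF mu] P2_D(3)[OF nu]
 have lipH: "(LINT x|mu. f x) - (LINT x|nu. f x) <= w" if f: "lip d 1 f" for f
 proof -
  obtain g K where g: "!!n. CB d 3 (K n) (g n)" "!!n x. x : Rd d ==> norm_Rd d (grad d (g n) x) <= 1"
   and lim: "!!\<sigma>. \<sigma> : P2 d ==> (%n. \<integral>x. g n x \<partial>\<sigma>) ----> (LINT x|\<sigma>. f x)"
   by (rule lip_approx_P2[OF f]) blast
  show ?thesis by (rule LIMSEQ_le_const2[OF tendsto_diff[OF lim[OF mu] lim[OF nu]]]) (use H g in blast)
 qed
 define D where "D = 2 * real d + (LINT x|mu. (norm_Rd d x)^2) + (LINT x|nu. (norm_Rd d x)^2)"
 have le: "wasserstein d 1 mu nu <= w + 2 * (D / real N)" if N: "0 < N" for N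
 proof -
  define T where "T x = (\<lambda>i\<in>{..<d}. grid N (x i))" for x
  define E where "E x = (real d + (norm_Rd d x)^2) / real N" for x
  have TRd: "T x : Rd d" for x unfolding T_def by (rule Rd_restrict)
  have TE: "dist_Rd d x (T x) <= E x" for x
  proof -
   have "dist_Rd d x (T x) <= (\<Sum>i<d. abs (x i - T x i))" unfolding dist_Rd_def by (rule norm_Rd_le_sum)
   also have "... <= (\<Sum>i<d. (1 + (x i)^2) / real N)" by (intro sum_mono) (simp add: T_def grid_close[OF N])
   also have "... = E x" by (simp add: E_def norm_Rd_power2 sum_divide_distrib[symmetric] sum.distrib)
   finally show ?thesis .
  qed
  have iE: "integrable mu E" "integrable nu E" unfolding E_def[abs_def] using P2_D(4) mu nu by auto
  have ED: "(LINT x|mu. E x) + (LINT x|nu. E x) = D / real N"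
   unfolding E_def D_def using P2_D(4)[OF mu] P2_D(4)[OF nu] by (simp add: A.prob_space B.prob_space add_divide_distrib)
  have fin: "finite (range T)"
  proof (rule finite_subset)
   show "range T \<subseteq> PiE {..<d} (%_. range (grid N))"
    unfolding T_def by (intro image_subsetI restrict_PiE_iff[THEN iffD2]) simp
  qed (intro finite_PiE finite_grid finite_lessThan)
  obtain y where y: "bij_betw y {0..<card (range T)} (range T)" using ex_bij_betw_nat_finite[OF fin] by blast
  define n where "n = card (range T)"
  define J where "J x = inv_into {0..<n} y (T x)" for x
  have J: "J x < n" "y (J x) = T x" for x
  proof -
   have "T x : y ` {0..<n}" using bij_betw_imp_surj_on[OF y] by (simp add: n_def)
   from inv_into_into[OF this] f_inv_into_f[OF this] show "J x < n" "y (J x) = T x" by (simp_all add: J_def)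
  qed
  have yT: "i < n ==> y i : range T" for i using bij_betw_apply[OF y] by (simp add: n_def)
  have yJ: "T x = y i \<longleftrightarrow> J x = i" if "i < n" for x i
   using J[of x] that bij_betw_imp_inj_on[OF y] by (metis atLeastLessThan_iff inj_onD le0 n_def)
  have yRd: "i < n ==> y i : Rd d" for i using yT[of i] TRd by (metis imageE)
  have mJ [measurable]: "J : measurable (borel_Rd d) (count_space UNIV)"
  proof -
   have "J -` {i} \<inter> space (borel_Rd d) : sets (borel_Rd d)" for i
   proof (cases "i < n")
    case True
    have "{x \<in> space (borel_Rd d). grid N (x j) = v} : sets (borel_Rd d)" if "j < d" for j v
    proof -
     note [measurable] = measurable_coord_Rd[OF that]
     show ?thesis by measurable
    qed
    hence "{x \<in> space (borel_Rd d). ALL j:{..<d}. grid N (x j) = y i j} : sets (borel_Rd d)"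
     by (intro sets.sets_Collect_finite_All) auto
    moreover have "J x = i \<longleftrightarrow> (ALL j:{..<d}. grid N (x j) = y i j)" for x
     unfolding yJ[OF True, symmetric]
    proof
     assume "T x = y i"
     thus "ALL j:{..<d}. grid N (x j) = y i j" by (metis T_def restrict_apply)
    next
     assume "ALL j:{..<d}. grid N (x j) = y i j"
     thus "T x = y i" by (intro Rd_eqI[OF TRd yRd[OF True]]) (simp add: T_def)
    qed
    hence "J -` {i} \<inter> space (borel_Rd d) = {x \<in> space (borel_Rd d). ALL j:{..<d}. grid N (x j) = y i j}" by auto
    ultimately show ?thesis by simp
   next
    case False
    hence "J -` {i} \<inter> space (borel_Rd d) = {}" using J(1) by auto
    thus ?thesis by (simp only: sets.empty_sets)
   qed
   thus ?thesis by (subst measurable_count_space_eq2_countable) auto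
  qed
  define p q where "p i = measure mu {x \<in> space mu. J x = i}" and "q i = measure nu {x \<in> space nu. J x = i}" for i
  have int: "integrable \<sigma> (%x. g (J x)) & (LINT x|\<sigma>. g (J x)) = (\<Sum>i<n. g i * measure \<sigma> {x \<in> space \<sigma>. J x = i})"
   if "prob_space \<sigma>" "sets \<sigma> = sets (borel_Rd d)" for \<sigma> and g :: "nat => real"
  proof -
   interpret prob_space \<sigma> by fact
   note [measurable_cong] = that(2)
   have m: "{x \<in> space \<sigma>. J x = i} : sets \<sigma>" for i by measurable
   have e: "g (J x) = (\<Sum>i<n. g i * indicator {x \<in> space \<sigma>. J x = i} x)" if "x : space \<sigma>" for x
    using J(1)[of x] that by (subst sum.remove[of _ "J x"]) (auto simp: indicator_def)
   have m': "integrable \<sigma> (%x. g i * indicator {x \<in> space \<sigma>. J x = i} x)" for i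
    by (intro integrable_mult_right integrable_real_indicator m) (simp add: emeasure_eq_measure)
   have "integrable \<sigma> (%x. \<Sum>i<n. g i * indicator {x \<in> space \<sigma>. J x = i} x)" by (intro Bochner_Integration.integrable_sum m')
   moreover have "(LINT x|\<sigma>. g (J x)) = (LINT x|\<sigma>. (\<Sum>i<n. g i * indicator {x \<in> space \<sigma>. J x = i} x))"
    by (rule Bochner_Integration.integral_cong[OF refl e])
   moreover have "... = (\<Sum>i<n. \<integral>x. g i * indicator {x \<in> space \<sigma>. J x = i} x \<partial>\<sigma>)" by (rule Bochner_Integration.integral_sum[OF m'])
   moreover have "(LINT x|\<sigma>. g i * indicator {x \<in> space \<sigma>. J x = i} x) = g i * prob {x \<in> space \<sigma>. J x = i}" for i
    using m by simp
   ultimately show ?thesis using Bochner_Integration.integrable_cong[OF refl e, of \<sigma>] by simp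
  qed
  note intA = int[OF P2_D(1,2)[OF mu], folded p_def] and intB = int[OF P2_D(1,2)[OF nu], folded q_def]
  have nnJ: "(\<integral>\<^sup>+ x. ennreal (g (J x)) \<partial>mu) = ennreal (\<Sum>i<n. g i * p i)" "(\<integral>\<^sup>+ x. ennreal (g (J x)) \<partial>nu) = ennreal (\<Sum>i<n. g i * q i)"
   if "!!i. i < n ==> 0 <= g i" for g
   using intA[of g] intB[of g] J(1) that by (auto simp: nn_integral_eq_integral)
  have p: "!!i. 0 <= p i" "(\<Sum>i<n. p i) = 1" using intA[of "%_. 1"] by (auto simp: p_def A.prob_space)
  have q: "!!i. 0 <= q i" "(\<Sum>i<n. q i) = 1" using intB[of "%_. 1"] by (auto simp: q_def B.prob_space)
  have n: "{..<n} ~= {}" using p(2) by auto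
  let ?c = "%i j. dist_Rd d (y i) (y j)"
  have dual: "(\<Sum>i<n. g i * (p i - q i)) <= w + D / real N" if g: "!!i j. i < n ==> j < n ==> g i - g j <= ?c i j" for g
  proof -
   \<comment> \<open>McShane extension of the grid function to a 1-Lipschitz function on the whole
     space, to which \<open>lipH\<close> applies at the price of the rounding error.\<close>
   define f where "f x = Min ((%i. g i + dist_Rd d x (y i)) ` {..<n})" for x
   have f_le: "f x <= g i + dist_Rd d x (y i)" if "i < n" for i x unfolding f_def using that by (intro Min_le) auto
   have f_ge: "EX i<n. f x = g i + dist_Rd d x (y i)" for x
   proof -
    have "f x : (%i. g i + dist_Rd d x (y i)) ` {..<n}" unfolding f_def using n by (intro Min_in) auto
    thus ?thesis by auto
   qed
   have f1: "f x <= f z + dist_Rd d x z" for x z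
   proof -
    obtain i where "i < n" "f z = g i + dist_Rd d z (y i)" using f_ge by blast
    thus ?thesis using f_le[of i x] dist_Rd_triangle[of d x "y i" z] by simp
   qed
   have f: "lip d 1 f" unfolding lip_def using f1 by (auto simp: abs_le_iff) (metis diff_le_eq add.commute dist_Rd_commute)+
   have fT: "f (T x) = g (J x)" for x
   proof (rule antisym)
    show "f (T x) <= g (J x)" using f_le[OF J(1), of "T x" x] by (simp add: J(2))
    obtain i where i: "i < n" "f (T x) = g i + dist_Rd d (T x) (y i)" using f_ge by blast
    thus "g (J x) <= f (T x)" using g[OF J(1) i(1), of x] by (simp add: J(2))
   qed
   have "(LINT x|mu. g (J x)) <= (LINT x|mu. f x + E x)"
   proof (rule integral_mono)
    show "g (J x) <= f x + E x" for x using f1[of "T x" x] TE[of x] by (simp add: fT dist_Rd_commute)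
   qed (use intA iE P2_integrable_lip[OF mu f] in auto)
   moreover have "(LINT x|nu. f x - E x) <= (LINT x|nu. g (J x))"
   proof (rule integral_mono)
    show "f x - E x <= g (J x)" for x using f1[of x "T x"] TE[of x] by (simp add: fT)
   qed (use intB iE P2_integrable_lip[OF nu f] in auto)
   ultimately show ?thesis
    using lipH[OF f] ED iE P2_integrable_lip[OF mu f] P2_integrable_lip[OF nu f] intA[of g] intB[of g]
    by (simp add: right_diff_distrib sum_subtractf)
  qed
  obtain \<pi> where \<pi>: "!!i j. i < n ==> j < n ==> 0 <= \<pi> (i, j)" "!!i. i < n ==> (\<Sum>j<n. \<pi> (i, j)) = p i"
   "!!j. j < n ==> (\<Sum>i<n. \<pi> (i, j)) = q j" "(\<Sum>i<n. \<Sum>j<n. ?c i j * \<pi> (i, j)) <= w + D / real N"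
   using finite_kantorovich[where c = ?c and p = p and q = q and n = n, OF _ _ dist_Rd_triangle p(1) p(2) q(1) q(2) dual] by auto
  \<comment> \<open>Where \<open>p i\<close> or \<open>q j\<close> is 0 the quotient is 0 by the
    convention for division; \<open>z\<close> shows that \<open>\<pi>\<close> vanishes there too, so
    no mass is lost.\<close>
  define k where "k i j = \<pi> (i, j) / (p i * q j)" for i j
  have k0: "i < n ==> j < n ==> 0 <= k i j" for i j unfolding k_def using \<pi>(1) p(1) q(1) by simp
  have z: "p i = 0 | q j = 0 ==> \<pi> (i, j) = 0" if ij: "i < n" "j < n" for i j
  proof -
   have "\<pi> (i, j) <= p i" unfolding \<pi>(2)[OF ij(1), symmetric] using \<pi>(1) ij by (intro member_le_sum) auto
   moreover have "\<pi> (i, j) <= q j" unfolding \<pi>(3)[OF ij(2), symmetric] using \<pi>(1) ij by (intro member_le_sum[of i _ "%i. \<pi> (i, j)"]) auto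
   ultimately show "p i = 0 | q j = 0 ==> \<pi> (i, j) = 0" using \<pi>(1)[OF ij] by auto
  qed
  have k1: "(\<Sum>j<n. k i j * q j) = 1" if "i < n" "p i ~= 0" for i
  proof -
   have "(\<Sum>j<n. k i j * q j) = (\<Sum>j<n. \<pi> (i, j) / p i)" using z[OF that(1)] by (intro sum.cong) (auto simp: k_def)
   thus ?thesis using \<pi>(2) that by (simp add: sum_divide_distrib[symmetric])
  qed
  have k2: "(\<Sum>i<n. k i j * p i) = 1" if "j < n" "q j ~= 0" for j
  proof -
   have "(\<Sum>i<n. k i j * p i) = (\<Sum>i<n. \<pi> (i, j) / q j)" using z[OF _ that(1)] by (intro sum.cong) (auto simp: k_def)
   thus ?thesis using \<pi>(3) that by (simp add: sum_divide_distrib[symmetric])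
  qed
  have ae: "AE x in mu. p (J x) ~= 0" "AE x in nu. q (J x) ~= 0"
  proof -
   let ?g = "%p i. if p i = 0 then 1 else (0 :: real)"
   have s: "(\<Sum>i<n. ?g p i * p i) = 0" for p :: "nat => real" by (intro sum.neutral) simp
   have "(\<integral>\<^sup>+ x. ennreal (?g p (J x)) \<partial>mu) = ennreal (\<Sum>i<n. ?g p i * p i)" by (rule nnJ(1)) simp
   hence "AE x in mu. ennreal (?g p (J x)) = 0" unfolding s ennreal_0 by (subst (asm) nn_integral_0_iff_AE) simp_all
   thus "AE x in mu. p (J x) ~= 0" by eventually_elim (metis ennreal_eq_0_iff not_one_le_zero)
   have "(\<integral>\<^sup>+ x. ennreal (?g q (J x)) \<partial>nu) = ennreal (\<Sum>i<n. ?g q i * q i)" by (rule nnJ(2)) simp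
   hence "AE x in nu. ennreal (?g q (J x)) = 0" unfolding s ennreal_0 by (subst (asm) nn_integral_0_iff_AE) simp_all
   thus "AE x in nu. q (J x) ~= 0" by eventually_elim (metis ennreal_eq_0_iff not_one_le_zero)
  qed
  define K where "K z = k (J (fst z)) (J (snd z))" for z
  have mk [measurable]: "(%z. h (J (fst z)) (J (snd z))) : borel_measurable (mu \<Otimes>\<^sub>M nu)" for h :: "nat => nat => real"
   by (rule measurable_compose_countable[of "%i z. h i (J (snd z))" _ _ "%z. J (fst z)"]) measurable
  have mK [measurable]: "K : borel_measurable (mu \<Otimes>\<^sub>M nu)" unfolding K_def[abs_def] by measurable
  have K0: "0 <= K z" for z unfolding K_def by (intro k0 J)
  define G where "G = density (mu \<Otimes>\<^sub>M nu) (%z. ennreal (K z))"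
  have "distr G mu fst = mu"
  proof (rule measure_eqI)
   fix A assume "A : sets (distr G mu fst)"
   hence [measurable]: "A : sets mu" by simp
   have "emeasure (distr G mu fst) A = (\<integral>\<^sup>+ z. ennreal (K z) * indicator A (fst z) \<partial>(mu \<Otimes>\<^sub>M nu))"
    unfolding G_def by (subst emeasure_distr, simp, simp, subst emeasure_density) (auto intro!: nn_integral_cong simp: indicator_def)
   also have "... = (\<integral>\<^sup>+ x. \<integral>\<^sup>+ x'. ennreal (K (x, x')) * indicator A x \<partial>nu \<partial>mu)" by (subst B.nn_integral_fst[symmetric]) simp_all
   also have "... = (\<integral>\<^sup>+ x. indicator A x \<partial>mu)"
   proof (rule nn_integral_cong_AE, use ae(1) in eventually_elim)
    fix x assume "p (J x) ~= 0"
    thus "(\<integral>\<^sup>+ x'. ennreal (K (x, x')) * indicator A x \<partial>nu) = indicator A x"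
     using nnJ(2)[of "k (J x)"] k0[OF J(1)] k1[OF J(1)] by (simp add: nn_integral_multc K_def)
   qed
   finally show "emeasure (distr G mu fst) A = emeasure mu A" by simp
  qed simp
  moreover have "distr G nu snd = nu"
  proof (rule measure_eqI)
   fix A assume "A : sets (distr G nu snd)"
   hence [measurable]: "A : sets nu" by simp
   have "emeasure (distr G nu snd) A = (\<integral>\<^sup>+ z. ennreal (K z) * indicator A (snd z) \<partial>(mu \<Otimes>\<^sub>M nu))"
    unfolding G_def by (subst emeasure_distr, simp, simp, subst emeasure_density) (auto intro!: nn_integral_cong simp: indicator_def)
   also have "... = (\<integral>\<^sup>+ x'. \<integral>\<^sup>+ x. ennreal (K (x, x')) * indicator A x' \<partial>mu \<partial>nu)" by (subst P.nn_integral_snd[symmetric]) simp_all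
   also have "... = (\<integral>\<^sup>+ x'. indicator A x' \<partial>nu)"
   proof (rule nn_integral_cong_AE, use ae(2) in eventually_elim)
    fix x' assume "q (J x') ~= 0"
    thus "(\<integral>\<^sup>+ x. ennreal (K (x, x')) * indicator A x' \<partial>mu) = indicator A x'"
     using nnJ(1)[of "%i. k i (J x')"] k0[OF _ J(1)] k2[OF J(1)] by (simp add: nn_integral_multc K_def)
   qed
   finally show "emeasure (distr G nu snd) A = emeasure nu A" by simp
  qed simp
  ultimately have G: "G : couplings mu nu" by (simp add: couplings_def G_def)
  interpret Q: prob_space G by (rule coupling_facts(5)[OF mu nu G])
  let ?C = "%z. ?c (J (fst z)) (J (snd z))"
  have bounded: "EX b. ALL i<n. ALL j<n. abs (h i j) <= b" for h :: "nat => nat => real"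
   by (rule exI[of _ "\<Sum>i<n. \<Sum>j<n. abs (h i j)"])
    (auto intro!: order_trans[OF member_le_sum[of _ "{..<n}" "%j. abs (h _ j)"] member_le_sum[of _ "{..<n}" "%i. \<Sum>j<n. abs (h i j)"]] sum_nonneg)
  have Ci: "integrable G ?C"
  proof -
   obtain b where "!!i j. i < n ==> j < n ==> abs (?c i j) <= b" using bounded[of ?c] by blast
   thus ?thesis using J(1) by (intro Q.integrable_const_bound[where B = b]) (auto simp: G_def)
  qed
  have "(LINT z|G. ?C z) = (LINT z|(mu \<Otimes>\<^sub>M nu). K z * ?C z)"
   unfolding G_def using K0 by (subst integral_density) auto
  also have "... = (\<integral>x. \<integral>x'. K (x, x') * ?c (J x) (J x') \<partial>nu \<partial>mu)"
  proof -
   obtain b where "!!i j. i < n ==> j < n ==> abs (k i j * ?c i j) <= b" using bounded[of "%i j. k i j * ?c i j"] by blast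
   hence "integrable (mu \<Otimes>\<^sub>M nu) (%z. K z * ?C z)"
    using J(1) by (intro P.integrable_const_bound[where B = b]) (auto simp: K_def)
   from P.integral_fst'[OF this] show ?thesis by simp
  qed
  also have "... = (\<Sum>i<n. (\<Sum>j<n. k i j * ?c i j * q j) * p i)"
   using intB[of "%j. k (J _) j * ?c (J _) j"] intA[of "%i. \<Sum>j<n. k i j * ?c i j * q j"] by (simp add: K_def)
  also have "... = (\<Sum>i<n. \<Sum>j<n. ?c i j * \<pi> (i, j))"
   unfolding sum_distrib_right using z by (intro sum.cong refl) (auto simp: k_def)
  finally have C: "(LINT z|G. ?C z) <= w + D / real N" using \<pi>(4) by simp
  note ci = coupling_integral[OF mu nu G]
  have "wasserstein d 1 mu nu <= (LINT z|G. dist_Rd d (fst z) (snd z))" by (rule wasserstein1_le[OF mu nu G])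
  also have "... <= (LINT z|G. E (fst z) + E (snd z) + ?C z)"
  proof (rule integral_mono)
   show "dist_Rd d (fst z) (snd z) <= E (fst z) + E (snd z) + ?C z" for z
    using dist_Rd_triangle[of d "fst z" "snd z" "T (fst z)"] dist_Rd_triangle[of d "T (fst z)" "snd z" "T (snd z)"]
     TE[of "fst z"] TE[of "snd z"] by (simp add: J(2) dist_Rd_commute)
  qed (use coupling_dist(2)[OF mu nu G] ci(3)[OF iE(1)] ci(4)[OF iE(2)] Ci in auto)
  also have "... = D / real N + (LINT z|G. ?C z)"
   using ci(3)[OF iE(1)] ci(4)[OF iE(2)] Ci ci(1)[of E] ci(2)[of E] iE ED by simp
  finally show ?thesis using C by simp
 qed
 have "(%N. w + 2 * (D * (1 / real (Suc N)))) ----> w + 2 * (D * 0)"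
  by (intro tendsto_add tendsto_mult tendsto_const LIMSEQ_Suc[OF lim_1_over_n])
 hence "wasserstein d 1 mu nu <= w + 2 * (D * 0)"
  by (rule LIMSEQ_le_const) (use le[of "Suc _"] in auto)
 thus ?thesis by simp
qed

section \<open>Decay of the free energy\<close>

text \<open>Entropy is tested with multiples of a 1-Lipschitz function, whose exponential moments
  are Gaussian by the Herbst argument. Optimizing the multiple bounds differences of means, and
  duality turns this into the distance.\<close>

lemma (in lsi_gibbs) transport_entropy:
 assumes H: "Hle d nu \<sigma> x" and \<sigma>: "\<sigma> : P2 d"
 shows "0 <= x" "wasserstein d 1 \<sigma> nu <= sqrt (x / rho)"
proof -
 interpret prob_space nu by (rule prob_space_gibbs)
 have "CB d 3 0 (%_. 0)" by (rule CB_const) simp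
 from H[unfolded Hle_def, rule_format, OF this] show x: "0 <= x" using prob_space by simp
 show "wasserstein d 1 \<sigma> nu <= sqrt (x / rho)"
 proof (rule kantorovich_rubinstein[OF \<sigma> gibbs_P2])
  fix g K assume g: "CB d 3 K g" and grad: "!!x. x : Rd d ==> norm_Rd d (grad d g x) <= 1"
  define D where "D = (LINT x|\<sigma>. g x) - (LINT x|nu. g x)"
  \<comment> \<open>The maximizer of \<open>theta * D - theta^2 / (4 * rho)\<close>.\<close>
  define theta where "theta = 2 * rho * D"
  have g3: "CB d (Suc 2) K g" using g by (simp add: eval_nat_numeral)
  have "(LINT x|nu. exp (theta * g x)) <= exp (theta * (LINT x|nu. g x) + theta^2 / (4 * rho))" by (rule herbst_CB[OF g3 grad])
  hence "ln (LINT x|nu. exp (theta * g x)) <= theta * (LINT x|nu. g x) + theta^2 / (4 * rho)"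
   using exp_moment_pos(1)[OF CB_cmult[OF g, of theta]] by (metis exp_gt_zero ln_exp ln_le_cancel_iff)
  moreover have "theta * (LINT x|\<sigma>. g x) - ln (LINT x|nu. exp (theta * g x)) <= x"
   using H[unfolded Hle_def, rule_format, OF CB_cmult[OF g, of theta]] by simp
  ultimately have "theta * D - theta^2 / (4 * rho) <= x" by (simp add: D_def right_diff_distrib)
  moreover have "theta * D - theta^2 / (4 * rho) = rho * D^2" using rho by (simp add: theta_def power2_eq_square)
  ultimately have "D^2 <= x / rho" using rho by (simp add: le_divide_eq mult.commute)
  thus "(LINT x|\<sigma>. g x) - (LINT x|nu. g x) <= sqrt (x / rho)" unfolding D_def[symmetric] by (rule real_le_rsqrt)
 qed
qed

locale mean_field_limit = mean_field_flow +
 fixes minf :: "vec measure"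
 assumes min: "free_energy_minimizer d F minf"
begin

lemma minf: "minf : P2 d" "hat d dF minf = minf" "gibbs d (dF minf) = minf"
 using min minimizer_hat[OF min] by (auto simp: free_energy_minimizer_def hat_gibbs)

text \<open>The Bregman distance of \<open>F\<close> at \<open>minf\<close>. The linear part of the
  energy difference is already contained in the relative entropy with respect to the Gibbs measure
  \<open>minf\<close>; this is what is left.\<close>

definition excess :: "vec measure => real" where
 "excess \<sigma> = F \<sigma> - F minf - ((LINT x|\<sigma>. dF minf x) - (LINT x|minf. dF minf x))"

lemma excess_nonneg: "\<sigma> : P2 d ==> 0 <= excess \<sigma>"
 using convex_first_order[OF minf(1)] by (simp add: excess_def)

text \<open>Convexity at \<open>\<sigma>\<close> bounds the Bregman distance by its symmetrized
  form, a difference of means of \<open>dF \<sigma> - dF minf\<close>. This function is Lipschitz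
  with a constant proportional to the distance, which therefore appears squared.\<close>

lemma excess_le:
 assumes \<sigma>: "\<sigma> : P2 d" shows "excess \<sigma> <= Mmm * (wasserstein d 1 \<sigma> minf)^2"
proof -
 let ?w = "%x. dF \<sigma> x - dF minf x"
 have "excess \<sigma> <= (LINT x|\<sigma>. ?w x) - (LINT x|minf. ?w x)"
  using convex_first_order[OF \<sigma> minf(1)] dF_integrable[OF \<sigma>] dF_integrable[OF minf(1)] \<sigma> minf(1) by (simp add: excess_def)
 also have "... <= (Mmm * wasserstein d 1 \<sigma> minf) * wasserstein d 1 \<sigma> minf"
  using lip_wasserstein[OF \<sigma> minf(1) dF_diff(2)[OF \<sigma> minf(1)]] by linarith
 finally show ?thesis by (simp add: power2_eq_square)
qed

lemma dF_mean: "\<sigma> : P2 d ==> mu : P2 d ==> mu' : P2 d ==>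
  (LINT x|\<sigma>. dF mu x - dF mu' x) = (LINT x|\<sigma>. dF mu x) - (LINT x|\<sigma>. dF mu' x)"
 using dF_integrable by simp

text \<open>\<open>Hle d minf (m t) (x - excess (m t))\<close> says that the free energy of \<open>m t\<close> exceeds its
 minimum by at most \<open>x\<close>.  The functional \<open>R\<close> in the proof is the change of this excess when
 the reference measure \<open>minf\<close> is replaced by \<open>hat d dF (m b)\<close>.\<close>

lemma free_energy_step:
 assumes a: "0 <= a" "a <= b" and eta: "0 < eta" "eta < 1"
  and beta: "!!s x. a <= s ==> s <= b ==> x : Rd d ==> norm_Rd d (%i. DF (m s) x i - DF (m b) x i) <= beta"
  and H: "Hle d minf (m a) (x - excess (m a))"
 shows "Hle d minf (m b) (x / exp (4 * rho * (1 - eta) * (b - a)) + beta^2 * (b - a) / (4 * eta) - excess (m b))"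
proof -
 let ?E = "exp (4 * rho * (1 - eta) * (b - a))" and ?B = "beta^2 * (b - a) / (4 * eta)"
 have Pa: "m a : P2 d" and Pb: "m b : P2 d" using a by (auto intro: m_P2)
 note Pi = minf(1)
 let ?w = "%x. dF minf x - dF (m b) x"
 let ?A = "\<integral>x. exp (?w x) \<partial>minf"
 define R where "R \<sigma> = excess \<sigma> + (LINT x|\<sigma>. ?w x) - ln ?A" for \<sigma>
 have "Hle d (hat d dF (m b)) (m a) (x - excess (m a) - (LINT x|m a. ?w x) + ln ?A)"
  using Hle_shift[OF Pi Pb Pa] H by (simp add: minf(2))
 also have "x - excess (m a) - (LINT x|m a. ?w x) + ln ?A = x - R (m a)" by (simp add: R_def)
 finally have "Hle d (hat d dF (m b)) (m b) ((x - R (m a)) / ?E + ?B)"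
  by (intro Hle_contraction[OF Pb a eta beta])
 from Hle_shift[OF Pb Pi Pb this]
 have "Hle d minf (m b) ((x - R (m a)) / ?E + ?B - (LINT z|m b. dF (m b) z - dF minf z) + ln (LINT z|hat d dF (m b). exp (dF (m b) z - dF minf z)))"
  by (simp add: minf(2))
 moreover have "(LINT z|m b. dF (m b) z - dF minf z) = - (LINT z|m b. ?w z)" by (simp add: dF_mean Pb Pi)
 moreover have "ln (LINT z|hat d dF (m b). exp (dF (m b) z - dF minf z)) = - ln ?A"
 proof -
  have c: "continuous_on (Rd d) (%z. exp (dF (m b) z - dF minf z))" by (intro continuous_intros dF_cont Pb Pi)
  interpret prob_space minf by (rule P2_D(1)[OF Pi])
  show ?thesis using hat_change[OF Pi Pb c] by (simp add: minf(2) exp_add[symmetric] prob_space ln_div)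
 qed
 ultimately have 1: "Hle d minf (m b) ((x - R (m a)) / ?E + ?B - excess (m b) + R (m b))"
  by (simp add: R_def algebra_simps)
 \<comment> \<open>Up to constants \<open>R \<sigma>\<close> is \<open>F \<sigma>\<close> minus the
   mean of \<open>dF (m b)\<close> under \<open>\<sigma>\<close>, which convexity makes smallest at
   \<open>m b\<close>.\<close>
 have R1: "R (m b) <= R (m a)"
  using convex_first_order[OF Pb Pa] by (simp add: R_def excess_def dF_mean Pa Pb Pi)
 \<comment> \<open>The sign is needed to compare \<open>R (m b)\<close> with
   \<open>R (m a) / ?E\<close>: dividing a nonpositive number by a factor of at least 1 increases
   it.\<close>
 have R0: "R (m b) <= 0"
 proof -
  interpret A: lsi_gibbs d "dF minf" rho by (rule lsi_gibbs[OF Pi])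
  interpret prob_space minf by (rule P2_D(1)[OF Pi])
  have "(LINT x|minf. ?w x) <= ln ?A"
   using A.exp_lip[OF dF_diff(2)[OF Pi Pb]] dF_integrable[OF Pi Pi] dF_integrable[OF Pb Pi] by (intro jensen_exp) (simp_all add: minf(3))
  thus ?thesis using convex_first_order[OF Pb Pi] by (simp add: R_def excess_def dF_mean Pb Pi)
 qed
 have E: "1 <= ?E" using rho eta a by simp
 have "R (m b) <= R (m b) / ?E" using mult_left_mono_neg[OF E R0] by (simp add: le_divide_eq)
 also have "... <= R (m a) / ?E" using R1 by (intro divide_right_mono) auto
 finally show ?thesis by (intro Hle_mono[OF 1]) (simp add: diff_divide_distrib)
qed

text \<open>On short intervals the mismatch with the reference \<open>m b\<close> is at most
  \<open>2 * sqrt (eps * eta)\<close>, exactly what makes the error in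
  \<open>free_energy_step\<close> equal to \<open>eps * (b - a)\<close>. Bisection adds these errors
  up to at most \<open>eps * t\<close>, and \<open>eps\<close> and \<open>eta\<close> tend to 0
  together.\<close>

lemma free_energy_decay:
 assumes H: "Hle d minf (m 0) (x - excess (m 0))" and t: "0 <= t"
 shows "Hle d minf (m t) (x / exp (4 * rho * t) - excess (m t))"
proof -
 have step: "Hle d minf (m t) (x / exp (4 * rho * (1 - eta) * t) + eps * t - excess (m t))"
  if eta: "0 < eta" "eta < 1" and eps: "0 < eps" for eta eps
 proof -
  let ?r = "4 * rho * (1 - eta)"
  have r: "0 < ?r" using rho eta by simp
  define P where "P a b \<longleftrightarrow> (0 <= a --> (ALL x. Hle d minf (m a) (x - excess (m a)) -->
   Hle d minf (m b) (x / exp (?r * (b - a)) + eps * (b - a) - excess (m b))))" for a b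
  have "P 0 t"
   using t
  proof (induction rule: Bolzano)
   case (trans a b c)
   show ?case unfolding P_def
   proof (intro impI allI)
    fix x assume a: "0 <= a" and H: "Hle d minf (m a) (x - excess (m a))"
    have b: "0 <= b" using a trans(3) by simp
    have "Hle d minf (m c) ((x / exp (?r * (b - a)) + eps * (b - a)) / exp (?r * (c - b)) + eps * (c - b) - excess (m c))"
     by (rule trans(2)[unfolded P_def, rule_format, OF b trans(1)[unfolded P_def, rule_format, OF a H]])
    moreover have "exp (?r * (b - a)) * exp (?r * (c - b)) = exp (?r * (c - a))" unfolding exp_add[symmetric] by (simp add: algebra_simps)
    moreover have "eps * (b - a) / exp (?r * (c - b)) <= eps * (b - a)"
    proof -
     have "1 <= exp (?r * (c - b))" using mult_nonneg_nonneg[OF less_imp_le[OF r], of "c - b"] trans(4) by simp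
     hence "eps * (b - a) / exp (?r * (c - b)) <= eps * (b - a) / 1" using trans(3) eps by (intro divide_left_mono) auto
     thus ?thesis by simp
    qed
    ultimately show "Hle d minf (m c) (x / exp (?r * (c - a)) + eps * (c - a) - excess (m c))"
     by (elim Hle_mono) (simp add: add_divide_distrib right_diff_distrib)
   qed
  next
   case (local t)
   \<comment> \<open>The denominator \<open>Mmm + 1\<close> keeps \<open>w\<close> positive also
     when \<open>Mmm\<close> is 0.\<close>
   define w where "w = sqrt (eps * eta) / (Mmm + 1)"
   have w: "0 < w" using Mmm eps eta by (simp add: w_def)
   have "Mmm * w <= (Mmm + 1) * w" using w by simp
   also have "... = sqrt (eps * eta)" using Mmm by (simp add: w_def)
   finally have Mw: "2 * (Mmm * w) <= 2 * sqrt (eps * eta)" by simp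
   obtain delta where delta: "0 < delta" "!!s. 0 <= s ==> abs (s - t) < delta ==> wasserstein d 2 (m s) (m t) < w"
    using m_continuous[OF local(1) w] by blast
   have "P a b" if ab: "a <= t" "t <= b" "b - a < delta" for a b
    unfolding P_def
   proof (intro impI allI)
    fix x assume a: "0 <= a" and H: "Hle d minf (m a) (x - excess (m a))"
    have le: "a <= b" using ab by simp
    have near: "dist_Rd d (DF (m s) z) (DF (m t) z) <= Mmm * w" if s: "a <= s" "s <= b" and z: "z : Rd d" for s z
    proof -
     have s0: "0 <= s" using a s by simp
     have "abs (s - t) < delta" using s ab by linarith
     hence "wasserstein d 1 (m s) (m t) <= w"
      using delta(2)[OF s0] wasserstein1_le_2[OF m_P2[OF s0] m_P2[OF local(1)]] by linarith
     hence "Mmm * wasserstein d 1 (m s) (m t) <= Mmm * w" using Mmm by (intro mult_left_mono)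
     moreover have "dist_Rd d (DF (m s) z) (DF (m t) z) <= Mmm * wasserstein d 1 (m s) (m t)"
      using DF_lip z m_P2[OF s0] m_P2[OF local(1)] by blast
     ultimately show ?thesis by linarith
    qed
    have "norm_Rd d (%i. DF (m s) z i - DF (m b) z i) <= 2 * sqrt (eps * eta)" if "a <= s" "s <= b" "z : Rd d" for s z
     using near[OF that] near[OF le order_refl that(3)] dist_Rd_triangle[of d "DF (m s) z" "DF (m b) z" "DF (m t) z"] Mw
     by (simp add: dist_Rd_commute[of d "DF (m t) z"]) (simp add: dist_Rd_def)
    from free_energy_step[OF a le eta this H]
    show "Hle d minf (m b) (x / exp (?r * (b - a)) + eps * (b - a) - excess (m b))"
     using eps eta by (simp add: power_mult_distrib)
   qed
   thus ?case using delta(1) by blast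
  qed
  thus ?thesis using H unfolding P_def by simp
 qed
 \<comment> \<open>The shift by two keeps \<open>?e n\<close> strictly below 1, as required of
   \<open>eta\<close>.\<close>
 let ?e = "%n. 1 / real (Suc (Suc n))"
 have e: "?e ----> 0" by (rule LIMSEQ_Suc[OF LIMSEQ_Suc[OF lim_1_over_n]])
 have "(%n. x / exp (4 * rho * (1 - ?e n) * t) + ?e n * t - excess (m t)) ----> x / exp (4 * rho * (1 - 0) * t) + 0 * t - excess (m t)"
  by (intro tendsto_intros e) simp
 hence "Hle d minf (m t) (x / exp (4 * rho * (1 - 0) * t) + 0 * t - excess (m t))"
  by (rule Hle_lim[rotated]) (intro step; simp)
 thus ?thesis by simp
qed

end

section \<open>Exponential moments and concentration\<close>

lemma exp_CB:
 assumes g: "CB d 3 K g" shows "EX K'. CB d 3 K' (%x. exp (theta * g x))"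
proof -
 have "CB d (Suc 2) (abs theta * K) (%x. theta * g x)" using CB_cmult[OF g, of theta] by (simp add: eval_nat_numeral)
 note L = CB_imp_LB[OF this] and bd = CB_bound[OF this]
 have "EX K'. CB d (Suc 2) K' (%x. (%_. exp) (0 :: nat) (theta * g x))"
 proof (rule CB_comp_compact[where S = "{- (abs theta * K)..abs theta * K}", OF _ _ _ L])
  show "theta * g x : {- (abs theta * K)..abs theta * K}" if "x : Rd d" for x using bd[OF that] by (simp add: abs_le_iff)
 qed (auto intro!: derivative_eq_intros)
 thus ?thesis by (simp add: eval_nat_numeral)
qed

text \<open>A pointwise form of Hoelder's inequality with three factors, from the tangent of the
  logarithm at the weighted mean \<open>S\<close>.\<close>

lemma weighted_am_gm:
 fixes x y z \<alpha> beta gamma :: real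
 assumes pos: "0 < x" "0 < y" "0 < z" and w: "0 <= \<alpha>" "0 <= beta" "0 <= gamma" "\<alpha> + beta + gamma = 1"
 shows "exp (\<alpha> * ln x + beta * ln y + gamma * ln z) <= \<alpha> * x + beta * y + gamma * z"
proof -
 define S where "S = \<alpha> * x + beta * y + gamma * z"
 define v where "v = min x (min y z)"
 have v: "0 < v" "v <= x" "v <= y" "v <= z" using pos by (auto simp: v_def)
 have "\<alpha> * v + beta * v + gamma * v <= S" unfolding S_def using w v by (intro add_mono mult_left_mono) auto
 moreover have "\<alpha> * v + beta * v + gamma * v = v" unfolding distrib_right[symmetric] w(4) by simp
 ultimately have S: "0 < S" using v by linarith
 have l: "ln v <= ln S + v / S - 1" if "0 < v" for v
  using ln_le_minus_one[of "v / S"] S that by (simp add: ln_div)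
 have "\<alpha> * ln x + beta * ln y + gamma * ln z <= \<alpha> * (ln S + x / S - 1) + beta * (ln S + y / S - 1) + gamma * (ln S + z / S - 1)"
  using w l pos by (intro add_mono mult_left_mono) auto
 also have "... = (\<alpha> + beta + gamma) * (ln S - 1) + (\<alpha> * x + beta * y + gamma * z) / S" by (simp add: algebra_simps add_divide_distrib)
 also have "... = ln S" unfolding S_def[symmetric] w(4) using S by simp
 finally show ?thesis using S unfolding S_def[symmetric] by (metis exp_le_cancel_iff exp_ln)
qed

context mean_field_limit
begin

context
 fixes h0 :: "vec => real" and p0 :: real
 assumes ac: "absolutely_continuous minf (m 0)" and h0: "h0 = (%x. enn2real (RN_deriv minf (m 0) x))"
  and p0: "1 < p0" and Lp: "in_Lp p0 minf h0"
begin

definition "K0 = (LINT x|minf. h0 x powr p0)"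
text \<open>A bound for the relative entropy of \<open>m 0\<close> with respect to
  \<open>minf\<close>, by Jensen's inequality for the logarithm of \<open>h0\<close> to the power
  \<open>p0 - 1\<close>; see \<open>Hle_initial\<close>.\<close>

definition "H0 = ln K0 / (p0 - 1)"
text \<open>A bound for the initial free energy above its minimum: the relative entropy contributes
  \<open>H0\<close>, the excess at most \<open>Mmm\<close> times a squared distance that is at most
  \<open>H0 / rho\<close>.\<close>

definition "x0 = H0 * (1 + Mmm / rho)"

lemma h0_facts:
 shows h0_nonneg: "0 <= h0 x" and h0_meas: "h0 : borel_measurable minf"
  and h0_int: "integrable minf h0" "(LINT x|minf. h0 x) = 1" "integrable minf (%x. h0 x powr p0)"
  and m0_integral: "!!f :: vec => real. continuous_on (Rd d) f ==> (LINT x|m 0. f x) = (LINT x|minf. h0 x * f x)"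
   "!!f :: vec => real. continuous_on (Rd d) f ==> integrable (m 0) f ==> integrable minf (%x. h0 x * f x)"
  and K0_pos: "0 < K0"
proof -
 have P0: "m 0 : P2 d" by (rule m_P2) simp
 interpret A: prob_space minf by (rule P2_D(1)[OF minf(1)])
 interpret B: prob_space "m 0" by (rule P2_D(1)[OF P0])
 have s: "sets (m 0) = sets minf" using P2_D(2) P0 minf(1) by simp
 show nn: "0 <= h0 x" for x by (simp add: h0)
 show mh: "h0 : borel_measurable minf" unfolding h0 by simp
 have "AE x in minf. RN_deriv minf (m 0) x ~= \<infinity>" by (rule A.RN_deriv_finite[OF _ ac s]) unfold_locales
 hence "AE x in minf. ennreal (h0 x) = RN_deriv minf (m 0) x" by eventually_elim (simp add: h0 less_top)
 hence "density minf (%x. ennreal (h0 x)) = density minf (RN_deriv minf (m 0))" using mh by (intro density_cong) auto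
 hence de: "density minf (%x. ennreal (h0 x)) = m 0" using A.density_RN_deriv[OF ac s] by simp
 show eq: "(LINT x|m 0. f x) = (LINT x|minf. h0 x * f x)" if "continuous_on (Rd d) f" for f :: "vec => real"
  unfolding de[symmetric] using P2_measurable[OF minf(1) that] mh nn by (subst integral_density) auto
 show ig: "integrable minf (%x. h0 x * f x)" if "continuous_on (Rd d) f" "integrable (m 0) f" for f :: "vec => real"
  using that(2) unfolding de[symmetric] using P2_measurable[OF minf(1) that(1)] mh nn by (subst (asm) integrable_density) auto
 show i: "integrable minf h0" and one: "(LINT x|minf. h0 x) = 1"
  using ig[of "%_. 1"] eq[of "%_. 1"] by (simp_all add: B.prob_space)
 show ip: "integrable minf (%x. h0 x powr p0)" using Lp nn by (simp add: in_Lp_def)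
 have "K0 ~= 0"
 proof
  assume "K0 = 0"
  hence "AE x in minf. h0 x powr p0 = 0" using integral_nonneg_eq_0_iff_AE[OF ip] by (simp add: K0_def)
  hence "AE x in minf. h0 x = 0" by eventually_elim simp
  hence "(LINT x|minf. h0 x) = (LINT x|minf. 0)" using mh by (intro integral_cong_AE) auto
  thus False using one by simp
 qed
 moreover have "0 <= K0" unfolding K0_def by (rule Bochner_Integration.integral_nonneg) simp
 ultimately show "0 < K0" by simp
qed

text \<open>Two tangent inequalities for the exponential, weighted by \<open>h0 z\<close>: one
  trades \<open>g\<close> for \<open>exp g\<close>, the other the logarithm of \<open>h0\<close> for
  its power \<open>p0\<close>. The shifts by \<open>ln a\<close> and \<open>ln K0\<close> make both
  exponential terms integrate to 1.\<close>

lemma Hle_initial: "Hle d minf (m 0) H0"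
 unfolding Hle_def
proof (intro allI impI)
 fix g K assume g: "CB d 3 K g"
 interpret A: lsi_gibbs d "dF minf" rho by (rule lsi_gibbs[OF minf(1)])
 interpret prob_space minf by (rule P2_D(1)[OF minf(1)])
 have P0: "m 0 : P2 d" by (rule m_P2) simp
 define a where "a = (LINT z|minf. exp (g z))"
 have a: "0 < a" "integrable minf (%z. exp (g z))" using A.exp_moment_pos[OF g] by (auto simp: a_def minf(3))
 let ?j = "%z. exp (g z) / a - h0 z + h0 z * ln a + (h0 z powr p0 / K0 - h0 z + h0 z * ln K0) / (p0 - 1)"
 have "(LINT z|minf. h0 z * g z) <= (LINT z|minf. ?j z)"
 proof (rule integral_mono)
  show "integrable minf (%z. h0 z * g z)" by (rule m0_integral(2)[OF CB_cont[OF g] P2_integrable_CB[OF P0 g]])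
  show "integrable minf ?j" using a h0_int by simp
  fix z
  show "h0 z * g z <= ?j z"
  proof (cases "h0 z = 0")
   case True
   thus ?thesis using a by simp
  next
   case False
   hence h: "0 < h0 z" using h0_nonneg[of z] by simp
   let ?l = "ln (h0 z)"
   have "h0 z * (1 + (g z - ln a - ?l)) <= h0 z * exp (g z - ln a - ?l)" using h by (intro mult_left_mono exp_ge_add_one_self) simp
   also have "... = exp (g z) / a" using h a by (simp add: exp_diff)
   finally have 1: "h0 z * g z <= exp (g z) / a - h0 z + h0 z * ln a + h0 z * ?l" by (simp add: algebra_simps)
   have "h0 z * (1 + ((p0 - 1) * ?l - ln K0)) <= h0 z * exp ((p0 - 1) * ?l - ln K0)" using h by (intro mult_left_mono exp_ge_add_one_self) simp
   also have "... = h0 z powr p0 / K0"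
   proof -
    have "h0 z powr p0 = exp (?l + (p0 - 1) * ?l)" using h by (simp add: powr_def algebra_simps)
    thus ?thesis using h K0_pos by (simp add: exp_diff exp_add)
   qed
   finally have "h0 z * ?l * (p0 - 1) <= h0 z powr p0 / K0 - h0 z + h0 z * ln K0" by (simp add: algebra_simps)
   hence "h0 z * ?l <= (h0 z powr p0 / K0 - h0 z + h0 z * ln K0) / (p0 - 1)" using p0 by (simp add: le_divide_eq)
   with 1 show ?thesis by linarith
  qed
 qed
 also have "... = ln a + H0" using a h0_int K0_pos by (simp add: a_def[symmetric] K0_def[symmetric] H0_def)
 finally show "(LINT z|m 0. g z) - ln (LINT z|minf. exp (g z)) <= H0" by (simp add: m0_integral(1)[OF CB_cont[OF g]] a_def)
qed

text \<open>\<open>excess_le\<close> and \<open>transport_entropy\<close> at time 0 make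
  \<open>x0\<close> admissible in \<open>free_energy_decay\<close>. At time \<open>t\<close> the
  nonnegative excess is dropped and \<open>transport_entropy\<close> turns entropy into
  distance.\<close>

lemma decay:
 shows H0_nonneg: "0 <= H0" and x0_nonneg: "0 <= x0"
  and W1_decay: "!!t. 0 <= t ==> wasserstein d 1 (m t) minf <= sqrt (x0 / exp (4 * rho * t) / rho)"
proof -
 interpret A: lsi_gibbs d "dF minf" rho by (rule lsi_gibbs[OF minf(1)])
 note T = A.transport_entropy[unfolded minf(3)]
 have P0: "m 0 : P2 d" by (rule m_P2) simp
 show H0: "0 <= H0" by (rule T(1)[OF Hle_initial P0])
 show "0 <= x0" using H0 Mmm rho by (simp add: x0_def)
 have "(wasserstein d 1 (m 0) minf)^2 <= (sqrt (H0 / rho))^2"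
  by (rule power_mono[OF T(2)[OF Hle_initial P0] wasserstein_nonneg[OF P0 minf(1)]])
 hence "Mmm * (wasserstein d 1 (m 0) minf)^2 <= Mmm * (H0 / rho)" using H0 rho Mmm by (intro mult_left_mono) simp_all
 hence "excess (m 0) <= Mmm * (H0 / rho)" using excess_le[OF P0] by linarith
 hence "Hle d minf (m 0) (x0 - excess (m 0))" by (intro Hle_mono[OF Hle_initial]) (simp add: x0_def algebra_simps)
 note D = free_energy_decay[OF this]
 fix t :: real assume t: "0 <= t"
 have "Hle d minf (m t) (x0 / exp (4 * rho * t))"
  by (rule Hle_mono[OF D[OF t]]) (use excess_nonneg[OF m_P2[OF t]] in simp)
 thus "wasserstein d 1 (m t) minf <= sqrt (x0 / exp (4 * rho * t) / rho)" by (rule T(2)[OF _ m_P2[OF t]])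
qed

text \<open>Hoelder's inequality for \<open>h0 * psi\<close> under \<open>minf\<close>. The
  condition on \<open>q\<close> says that its conjugate exponent is at most \<open>p0\<close>, so
  the norm of \<open>h0\<close> interpolates between its mass 1 and its \<open>p0\<close>-th
  moment.\<close>

lemma holder_initial:
 assumes psi: "CB d 3 K psi" and c: "0 < c" "!!x. x : Rd d ==> c <= psi x & psi x <= C" and q: "1 < q" "1 <= (q - 1) * (p0 - 1)"
 shows "(LINT x|m 0. psi x) <= exp (LN minf q psi + H0 / (q - 1))"
proof -
 obtain Mb where "gibbs_flow d (dF minf) rho (DF minf) Mb" using gibbs_flow[OF minf(1)] .
 then interpret gf: gibbs_flow d "dF minf" rho "DF minf" Mb .
 interpret prob_space minf by (rule P2_D(1)[OF minf(1)])
 define Q where "Q = (LINT x|minf. exp (q * ln (psi x)))"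
 have iQ: "integrable minf (%x. exp (q * ln (psi x)))" and Q: "0 < Q"
  using gf.integrable_power[OF CB_cont[OF psi] c, of q] less_le_trans[OF exp_gt_zero gf.power_mean_bounds(1)[OF CB_cont[OF psi] c, of q]] q
  by (auto simp: minf(3) Q_def)
 have L: "LN minf q psi = ln Q / q" by (simp add: gf.log_norm_def minf(3) Q_def)
 \<comment> \<open>The weights \<open>1 / q\<close>, \<open>beta\<close> and \<open>gamma\<close> of
   \<open>psi^q\<close>, \<open>h0\<close> and \<open>h0^p0\<close> add up to 1;
   \<open>gamma\<close> is fixed by requiring that \<open>h0\<close> occurs with power 1 in the
   product.\<close>
 define gamma where "gamma = 1 / (q * (p0 - 1))"
 define beta where "beta = 1 - 1 / q - gamma"
 have gamma: "0 <= gamma" "gamma * (p0 - 1) = 1 / q" using q p0 by (auto simp: gamma_def)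
 have "1 / (p0 - 1) <= q - 1" using q p0 by (simp add: pos_divide_le_eq)
 hence "1 / (p0 - 1) / q <= (q - 1) / q" using q by (intro divide_right_mono) auto
 hence beta: "0 <= beta" unfolding beta_def gamma_def using q by (simp add: diff_divide_distrib mult.commute)
 let ?u = "%x. exp (q * ln (psi x))" and ?c = "exp (ln Q / q + gamma * ln K0)"
 let ?j = "%x. ?c * (1 / q * (?u x / Q) + beta * h0 x + gamma * (h0 x powr p0 / K0))"
 have P0: "m 0 : P2 d" by (rule m_P2) simp
 have "(LINT x|minf. h0 x * psi x) <= (LINT x|minf. ?j x)"
 proof (rule integral_mono)
  show "integrable minf (%x. h0 x * psi x)" by (rule m0_integral(2)[OF CB_cont[OF psi] P2_integrable_CB[OF P0 psi]])
  show "integrable minf ?j" using iQ h0_int by simp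
  fix x assume "x : space minf"
  hence psix: "0 < psi x" using c P2_D(3)[OF minf(1)] by force
  show "h0 x * psi x <= ?j x"
  proof (cases "h0 x = 0")
   case True
   thus ?thesis using Q q by (simp add: less_imp_le)
  next
   case False
   hence h: "0 < h0 x" using h0_nonneg[of x] by simp
   have "exp (1 / q * ln (?u x / Q) + beta * ln (h0 x) + gamma * ln (h0 x powr p0 / K0)) <= 1 / q * (?u x / Q) + beta * h0 x + gamma * (h0 x powr p0 / K0)"
    by (rule weighted_am_gm) (use h Q K0_pos q beta gamma in \<open>auto simp: beta_def\<close>)
   from mult_left_mono[OF this, of ?c]
   have "exp (ln Q / q + gamma * ln K0 + (1 / q * ln (?u x / Q) + beta * ln (h0 x) + gamma * ln (h0 x powr p0 / K0))) <= ?j x"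
    by (simp only: exp_add[symmetric] less_imp_le[OF exp_gt_zero] True_implies_equals)
   also have "ln Q / q + gamma * ln K0 + (1 / q * ln (?u x / Q) + beta * ln (h0 x) + gamma * ln (h0 x powr p0 / K0))
    = ln (psi x) + (beta + gamma + gamma * (p0 - 1)) * ln (h0 x)"
    using Q K0_pos h q(1) by (simp add: ln_div ln_powr field_simps)
   also have "... = ln (h0 x * psi x)" unfolding gamma(2) using h psix by (simp add: beta_def ln_mult)
   finally show ?thesis using h psix by simp
  qed
 qed
 also have "... = ?c * (1 / q + beta + gamma)" using iQ h0_int Q K0_pos by (simp add: Q_def[symmetric] K0_def[symmetric])
 also have "... = ?c" by (simp add: beta_def)
 also have "gamma * ln K0 = H0 / q" by (simp add: gamma_def H0_def)
 also have "exp (ln Q / q + H0 / q) <= exp (LN minf q psi + H0 / (q - 1))"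
  unfolding L using q H0_nonneg by (simp add: frac_le)
 finally show ?thesis by (simp add: m0_integral(1)[OF CB_cont[OF psi]])
qed

text \<open>The first summand is the mismatch rate \<open>kappa\<close> of \<open>moment_CB\<close>
  times the duration, the second the price of the initial density. Both carry the reciprocal of the
  exponent at time 0 minus 1, which grows exponentially with \<open>t\<close>.\<close>

definition "gain eta qb t = Mmm^2 * x0 / (4 * eta * rho * (qb - 1) * exp (4 * rho * (1 - eta) * t)) * t + H0 / ((qb - 1) * exp (4 * rho * (1 - eta) * t))"

text \<open>The function \<open>exp (theta * g)\<close> is pulled back to time 0, where
  \<open>holder_initial\<close> applies; its norm at the final exponent \<open>qb\<close> is
  estimated by the Herbst argument under \<open>minf\<close>.\<close>

lemma moment_CB:
 assumes eta: "0 < eta" "eta < 1" and qb: "1 < qb" and t: "0 <= t" and q: "1 <= (qb - 1) * exp (4 * rho * (1 - eta) * t) * (p0 - 1)"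
  and g: "CB d 3 K g" "!!x. x : Rd d ==> norm_Rd d (grad d g x) <= 1"
 shows "(LINT x|m t. exp (theta * g x)) <= exp (theta * (LINT x|minf. g x) + qb * theta^2 / (4 * rho) + gain eta qb t)"
proof -
 obtain Mb where "gibbs_flow d (dF minf) rho (DF minf) Mb" using gibbs_flow[OF minf(1)] .
 then interpret gf: gibbs_flow d "dF minf" rho "DF minf" Mb .
 let ?r = "4 * rho * (1 - eta)" and ?phi = "%x. exp (theta * g x)"
 have r: "0 < ?r" "?r <= 4 * rho" using rho eta by auto
 define qs where "qs s = 1 + (qb - 1) * exp (?r * (t - s))" for s
 \<comment> \<open>The squared mismatch decays like \<open>exp (- 4 * rho * s)\<close>, while
   \<open>qs s - 1\<close> decays only like \<open>exp (- ?r * s)\<close>. Their ratio is largest at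
   \<open>s = 0\<close>, and \<open>kappa\<close> is that value divided by
   \<open>4 * eta\<close>.\<close>
 define kappa where "kappa = Mmm^2 * x0 / (4 * eta * rho * (qb - 1) * exp (?r * t))"
 define beta where "beta s = Mmm * sqrt (x0 / exp (4 * rho * s) / rho)" for s
 have kappa: "0 <= kappa" unfolding kappa_def using x0_nonneg eta rho qb by simp
 have betakappa: "(beta s)^2 <= 4 * eta * kappa * (qs s - 1)" if "0 <= s" "s <= t" for s
 proof -
  have "exp (?r * (t - s)) * exp (?r * s) = exp (?r * t)" unfolding exp_add[symmetric] by (simp add: algebra_simps)
  hence "4 * eta * kappa * (qs s - 1) = Mmm^2 * (x0 / rho) / exp (?r * s)"
   unfolding kappa_def qs_def using eta rho qb by (simp add: field_simps)
  moreover have "(beta s)^2 = Mmm^2 * (x0 / rho) / exp (4 * rho * s)" unfolding beta_def using x0_nonneg rho by (simp add: power_mult_distrib)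
  moreover have "Mmm^2 * (x0 / rho) / exp (4 * rho * s) <= Mmm^2 * (x0 / rho) / exp (?r * s)"
   using x0_nonneg rho mult_right_mono[OF r(2) that(1)] by (intro divide_left_mono) auto
  ultimately show ?thesis by linarith
 qed
 have DFbeta: "norm_Rd d (%i. DF (m s) x i - DF minf x i) <= beta s" if "0 <= s" "s <= t" "x : Rd d" for s x
  using DF_close[OF that(3) m_P2[OF that(1)] minf(1)] mult_left_mono[OF W1_decay[OF that(1)] Mmm] by (simp add: beta_def)
 obtain K' where phi: "CB d 3 K' ?phi" using exp_CB[OF g(1)] by blast
 let ?c = "exp (- (abs theta * K))" and ?C = "exp (abs theta * K)"
 have c: "0 < ?c" "?c <= ?C" using CB_nonneg[OF g(1)] by (auto intro: order_trans[of _ 0])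
 have range: "?c <= ?phi x & ?phi x <= ?C" if "x : Rd d" for x
 proof -
  have "abs (theta * g x) <= abs theta * K" unfolding abs_mult using CB_bound[OF g(1) that] by (intro mult_left_mono) auto
  thus ?thesis by (simp add: abs_le_iff)
 qed
 have g3: "CB d (Suc 2) K g" using g(1) by (simp add: eval_nat_numeral)
 have L: "LN minf qb ?phi <= theta * (LINT x|minf. g x) + qb * theta^2 / (4 * rho)"
 proof -
  have "(LINT x|minf. exp (qb * theta * g x)) <= exp (qb * theta * (LINT x|minf. g x) + (qb * theta)^2 / (4 * rho))"
   using gf.herbst_CB[OF g3 g(2), of "qb * theta"] by (simp add: minf(3))
  hence "ln (LINT x|minf. exp (qb * theta * g x)) <= qb * theta * (LINT x|minf. g x) + (qb * theta)^2 / (4 * rho)"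
   using gf.exp_moment_pos(1)[OF CB_cmult[OF g(1), of "qb * theta"]] by (simp add: minf(3)) (metis exp_gt_zero ln_exp ln_le_cancel_iff)
  also have "... = (theta * (LINT x|minf. g x) + qb * theta^2 / (4 * rho)) * qb" by (simp add: power2_eq_square algebra_simps)
  finally show ?thesis using qb by (simp add: gf.log_norm_def minf(3) mult.assoc pos_divide_le_eq)
 qed
 define G where "G = theta * (LINT x|minf. g x) + qb * theta^2 / (4 * rho)"
 have "(LINT x|m t. ?phi x) <= exp (G + (kappa + eps) * t + H0 / (qs 0 - 1)) + eps * t" if eps: "0 < eps" for eps
 proof -
  obtain psi K'' where psi: "CB d 3 K'' psi" "!!x. x : Rd d ==> ?c <= psi x & psi x <= ?C"
   "abs ((LINT x|m t. ?phi x) - (LINT x|m 0. psi x)) <= eps * (t - 0)" "LN minf (qs 0) psi <= LN minf qb ?phi + (kappa + eps) * (t - 0)"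
   using hc_chain[OF minf(1) order_refl t eta qb kappa eps c qs_def betakappa DFbeta phi range] by blast
  have "1 < qs 0" using qb by (simp add: qs_def)
  moreover have "1 <= (qs 0 - 1) * (p0 - 1)" using q by (simp add: qs_def)
  ultimately have "(LINT x|m 0. psi x) <= exp (LN minf (qs 0) psi + H0 / (qs 0 - 1))" by (intro holder_initial[OF psi(1) c(1) psi(2)])
  also have "... <= exp (G + (kappa + eps) * t + H0 / (qs 0 - 1))" using psi(4) L by (simp add: G_def)
  finally show ?thesis using psi(3) by simp
 qed
 hence "\<forall>\<^sub>F eps in at_right 0. (LINT x|m t. ?phi x) <= exp (G + (kappa + eps) * t + H0 / (qs 0 - 1)) + eps * t"
  by (intro eventually_at_rightI[of 0 1]) auto
 moreover have "((%eps. exp (G + (kappa + eps) * t + H0 / (qs 0 - 1)) + eps * t) \<longlongrightarrow> exp (G + (kappa + 0) * t + H0 / (qs 0 - 1)) + 0 * t) (at_right 0)"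
  by (intro tendsto_add tendsto_exp tendsto_mult tendsto_const tendsto_ident_at)
 ultimately have "(LINT x|m t. ?phi x) <= exp (G + (kappa + 0) * t + H0 / (qs 0 - 1)) + 0 * t"
  by (intro tendsto_lowerbound[where F = "at_right 0"]) auto
 thus ?thesis by (simp add: gain_def kappa_def G_def qs_def add.assoc)
qed

lemma tail_bound:
 assumes eta: "0 < eta" "eta < 1" and qb: "1 < qb" and t: "0 <= t" and q: "1 <= (qb - 1) * exp (4 * rho * (1 - eta) * t) * (p0 - 1)"
  and f: "lip d 1 f" and s: "0 <= s"
 shows "measure (m t) {x \<in> Rd d. s <= f x - (LINT x|minf. f x)} <= exp (- (rho / qb) * s^2 + gain eta qb t)"
proof -
 \<comment> \<open>The minimizer of Chernoff's exponent
   \<open>qb * theta^2 / (4 * rho) - theta * s\<close>.\<close>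
 define theta where "theta = 2 * (rho / qb) * s"
 have theta: "0 <= theta" using s rho qb by (simp add: theta_def)
 note Pt = m_P2[OF t]
 interpret prob_space "m t" by (rule P2_D(1)[OF Pt])
 obtain g K where g: "!!n. CB d 3 (K n) (g n)" "!!n x. x : Rd d ==> norm_Rd d (grad d (g n) x) <= 1"
   "!!x. x : Rd d ==> (%n. g n x) ----> f x"
  and lim: "!!\<sigma>. \<sigma> : P2 d ==> (%n. \<integral>x. g n x \<partial>\<sigma>) ----> (LINT x|\<sigma>. f x)"
  by (rule lip_approx_P2[OF f]) blast
 have mf: "f : borel_measurable (m t)" by (rule P2_measurable[OF Pt lip_cont[OF f]])
 define e where "e = theta * (LINT x|minf. f x) + qb * theta^2 / (4 * rho) + gain eta qb t"
 have E: "integrable (m t) (%x. exp (theta * f x)) & (LINT x|m t. exp (theta * f x)) <= exp e"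
 proof (rule fatou_bound)
  show "integrable (m t) (%x. exp (theta * g n x))" for n using exp_CB[OF g(1)] P2_integrable_CB[OF Pt] by blast
  show "(LINT x|m t. exp (theta * g n x)) <= exp (theta * (LINT x|minf. g n x) + qb * theta^2 / (4 * rho) + gain eta qb t)" for n
   by (rule moment_CB[OF eta qb t q g(1,2)])
  show "(%n. exp (theta * (LINT x|minf. g n x) + qb * theta^2 / (4 * rho) + gain eta qb t)) ----> exp e"
   unfolding e_def by (intro tendsto_intros lim minf(1))
  show "(%n. exp (theta * g n x)) ----> exp (theta * f x)" if "x : space (m t)" for x
   using that P2_D(3)[OF Pt] by (intro tendsto_intros g(3)) simp
 qed (use mf in auto)
 let ?S = "{x \<in> space (m t). s <= f x - (LINT x|minf. f x)}"
 let ?b = "exp (- theta * ((LINT x|minf. f x) + s))"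
 have S: "?S : sets (m t)" using mf by measurable
 have "measure (m t) ?S = (LINT x|m t. indicator ?S x)" using S by simp
 also have "... <= (LINT x|m t. ?b * exp (theta * f x))"
 proof (rule integral_mono)
  show "integrable (m t) (%x. indicator ?S x :: real)" using S by (intro integrable_real_indicator) (simp_all add: emeasure_eq_measure)
  show "integrable (m t) (%x. ?b * exp (theta * f x))" using E by simp
  fix x
  have "1 <= ?b * exp (theta * f x)" if "x : ?S"
  proof -
   have "0 <= theta * (f x - ((LINT x|minf. f x) + s))" using that theta by (intro mult_nonneg_nonneg) auto
   thus ?thesis unfolding exp_add[symmetric] by (simp add: algebra_simps)
  qed
  thus "indicator ?S x <= ?b * exp (theta * f x)" by (auto simp: indicator_def)
 qed
 also have "... = ?b * (LINT x|m t. exp (theta * f x))" by simp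
 also have "... <= ?b * exp e" using E by (intro mult_left_mono) auto
 also have "... = exp (- (rho / qb) * s^2 + gain eta qb t)"
 proof -
  have "- theta * s + qb * theta^2 / (4 * rho) = - (rho / qb) * s^2" using rho qb by (simp add: theta_def field_simps power2_eq_square)
  thus ?thesis unfolding exp_add[symmetric] e_def by (simp add: algebra_simps)
 qed
 finally show ?thesis using P2_D(3)[OF Pt] by simp
qed

end

end

section \<open>The concentration inequality\<close>

text \<open>\<open>H\<close> is \<open>H0\<close> expressed through the norm, whose
  \<open>p0\<close>-th power is \<open>K0\<close>, and \<open>x\<close> is \<open>x0\<close>. The
  three summands pay for moving the mean from \<open>minf\<close> to \<open>m t\<close>, for the
  drift mismatch, and for the initial density.\<close>

definition conc_const :: "real => real => real => real => real => real" where
 "conc_const rho' rho Mmm p0 N = (let H = p0 / (p0 - 1) * ln N; x = H * (1 + Mmm / rho); rho1 = (rho + rho') / 2; k = rho / rho1 - 1; eta = 1 - rho1 / rho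
   in rho1^2 * (x / rho) / (rho1 - rho') + Mmm^2 * x / (4 * eta * rho * k) / (4 * (rho1 - rho')) + H / k)"

text \<open>The time from which the exponent reached at time 0 satisfies the hypothesis of
  \<open>holder_initial\<close>; a negative value means that it always does.\<close>

definition conc_time :: "real => real => real => real" where
 "conc_time rho' rho p0 = (let rho1 = (rho + rho') / 2 in - ln ((rho / rho1 - 1) * (p0 - 1)) / (4 * rho1))"

text \<open>The choices of \<open>qb\<close> and \<open>eta\<close> turn both the Gaussian rate
  \<open>rho / qb\<close> and the decay rate \<open>rho * (1 - eta)\<close> into the midpoint
  \<open>rho1\<close> of \<open>rho'\<close> and \<open>rho\<close>. The gap
  \<open>rho1 - rho'\<close> then absorbs the factor \<open>t\<close> in \<open>gain\<close> and the
  cross term from shifting the mean.\<close>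

lemma (in mean_field_limit) concentration:
 assumes ac: "absolutely_continuous minf (m 0)" and h0: "h0 = (%x. enn2real (RN_deriv minf (m 0) x))"
  and p0: "1 < p0" and Lp: "in_Lp p0 minf h0" and rho': "0 < rho'" "rho' < rho"
  and f: "lip d 1 f" and t: "0 <= t" "conc_time rho' rho p0 <= t" and r: "0 <= r"
 shows "measure (m t) {x \<in> Rd d. abs (f x - (LINT y|m t. f y)) >= r}
  <= 2 * exp (- rho' * r^2 + conc_const rho' rho Mmm p0 (Lp_norm p0 minf h0) * exp (- 4 * rho' * t) * (r + 1))"
proof -
 note A = ac h0 p0 Lp
 note Pt = m_P2[OF t(1)]
 interpret prob_space "m t" by (rule P2_D(1)[OF Pt])
 define rho1 where "rho1 = (rho + rho') / 2"
 define eta where "eta = 1 - rho1 / rho"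
 define qb where "qb = rho / rho1"
 define H where "H = H0 h0 p0"
 define x where "x = x0 h0 p0"
 define e where "e = exp (- 4 * rho' * t)"
 define E where "E = exp (4 * rho * (1 - eta) * t)"
 have rho1: "rho' < rho1" "rho1 < rho" "0 < rho1" using rho' by (auto simp: rho1_def)
 have eta: "0 < eta" "eta < 1" and qb: "1 < qb" using rho1 rho by (auto simp: eta_def qb_def)
 have E_eq: "E = exp (4 * rho1 * t)" using rho by (simp add: E_def eta_def)
 have qd: "rho / qb = rho1" using rho rho1 by (simp add: qb_def)
 have H: "0 <= H" and x: "0 <= x" "x = H * (1 + Mmm / rho)" using H0_nonneg[OF A] x0_nonneg[OF A] by (auto simp: H_def x_def x0_def[OF A])
 have HN: "H = p0 / (p0 - 1) * ln (Lp_norm p0 minf h0)"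
 proof -
  have "Lp_norm p0 minf h0 = K0 h0 p0 powr (1 / p0)"
   unfolding Lp_norm_def K0_def[OF A] by (simp add: abs_of_nonneg[OF h0_nonneg[OF A]])
  thus ?thesis using K0_pos[OF A] p0 by (simp add: H_def H0_def[OF A] ln_powr)
 qed
 define C1 where "C1 = rho1^2 * (x / rho) / (rho1 - rho')"
 define C2 where "C2 = Mmm^2 * x / (4 * eta * rho * (qb - 1)) / (4 * (rho1 - rho')) + H / (qb - 1)"
 have C: "conc_const rho' rho Mmm p0 (Lp_norm p0 minf h0) = C1 + C2"
  unfolding conc_const_def Let_def HN[symmetric] x(2)[symmetric] rho1_def[symmetric] eta_def[symmetric] qb_def[symmetric] C1_def C2_def by simp
 have Cnn: "0 <= C1" "0 <= C2" using rho1 eta qb rho x H by (auto simp: C1_def C2_def)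
 have q: "1 <= (qb - 1) * exp (4 * rho * (1 - eta) * t) * (p0 - 1)"
 proof -
  let ?y = "(qb - 1) * (p0 - 1)"
  have y: "0 < ?y" using qb p0 by simp
  have "- ln ?y <= t * (4 * rho1)" using t(2) rho1(3) unfolding conc_time_def Let_def rho1_def[symmetric] qb_def[symmetric] by (simp add: minus_divide_left pos_divide_le_eq del: divide_minus_left minus_divide_left[symmetric])
  hence "exp (- ln ?y) <= E" unfolding E_eq by (simp add: mult_ac)
  hence "1 / ?y <= E" using y by (simp add: exp_minus field_simps)
  thus ?thesis using y unfolding E_def[symmetric] by (simp add: pos_divide_le_eq mult_ac)
 qed
 \<comment> \<open>The factor \<open>t\<close> is traded for rate: \<open>y * exp (- y) <= 1\<close>
   with \<open>y = 4 * (rho1 - rho') * t\<close>.\<close>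
 have E1: "1 / E <= e" "t / E <= e / (4 * (rho1 - rho'))"
 proof -
  have "1 / E = exp (- (4 * rho1 * t))" by (simp add: E_eq exp_minus field_simps)
  also have "... = e * exp (- (4 * (rho1 - rho') * t))" unfolding e_def exp_add[symmetric] by (simp add: algebra_simps)
  finally have 1: "1 / E = e * exp (- (4 * (rho1 - rho') * t))" .
  have z: "0 <= 4 * (rho1 - rho') * t" using rho1 t by simp
  show "1 / E <= e" unfolding 1 using z by (simp add: e_def)
  have "4 * (rho1 - rho') * t * exp (- (4 * (rho1 - rho') * t)) <= 1"
  proof -
   have "4 * (rho1 - rho') * t <= exp (4 * (rho1 - rho') * t)" using exp_ge_add_one_self[of "4 * (rho1 - rho') * t"] by linarith
   thus ?thesis by (simp add: exp_minus pos_divide_le_eq divide_inverse[symmetric])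
  qed
  hence "t * exp (- (4 * (rho1 - rho') * t)) <= 1 / (4 * (rho1 - rho'))" using rho1 by (simp add: pos_le_divide_eq mult_ac)
  from mult_left_mono[OF this, of e] have "e * (t * exp (- (4 * (rho1 - rho') * t))) <= e / (4 * (rho1 - rho'))" by (simp add: e_def)
  moreover have "t / E = t * (1 / E)" by simp
  ultimately show "t / E <= e / (4 * (rho1 - rho'))" unfolding 1 by (simp add: mult_ac)
 qed
 have gain: "gain h0 p0 eta qb t <= C2 * e"
 proof -
  let ?B = "Mmm^2 * x / (4 * eta * rho * (qb - 1))"
  have B: "0 <= ?B" "0 <= H / (qb - 1)" using x H eta rho qb by auto
  have "gain h0 p0 eta qb t = ?B * (t / E) + H / (qb - 1) * (1 / E)"
   by (simp add: gain_def[OF A] x_def H_def E_def)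
  also have "... <= ?B * (e / (4 * (rho1 - rho'))) + H / (qb - 1) * e" by (intro add_mono mult_left_mono E1 B)
  also have "... = C2 * e" by (simp add: C2_def distrib_right)
  finally show ?thesis .
 qed
 define \<Delta> where "\<Delta> = sqrt (x / exp (4 * rho * t) / rho)"
 have \<Delta>: "0 <= \<Delta>" "\<Delta>^2 <= x / rho * e"
 proof -
  show "0 <= \<Delta>" using x rho by (simp add: \<Delta>_def)
  have "exp (- (4 * rho * t)) <= e" unfolding e_def using rho' t by (simp add: mult_right_mono)
  hence "x / rho * exp (- (4 * rho * t)) <= x / rho * e" using x rho by (intro mult_left_mono) auto
  moreover have "\<Delta>^2 = x / rho * exp (- (4 * rho * t))" unfolding \<Delta>_def using x(1) rho by (simp add: exp_minus divide_inverse mult_ac)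
  ultimately show "\<Delta>^2 <= x / rho * e" by simp
 qed
 have shift: "abs ((LINT y|m t. f y) - (LINT y|minf. f y)) <= \<Delta>"
  using lip_wasserstein[OF Pt minf(1) f] W1_decay[OF A t(1)] by (simp add: \<Delta>_def x_def)
 \<comment> \<open>Young's inequality for the cross term of \<open>(r - \<Delta>)^2\<close>; its
   quadratic part uses up the gap between \<open>rho1\<close> and \<open>rho'\<close>.\<close>
 have young: "2 * rho1 * (r * \<Delta>) <= (rho1 - rho') * r^2 + C1 * e" and small: "rho' * \<Delta>^2 <= C1 * e"
 proof -
  have p: "0 < rho1 - rho'" using rho1 by simp
  have c: "rho1^2 * \<Delta>^2 / (rho1 - rho') <= C1 * e"
   using mult_left_mono[OF \<Delta>(2), of "rho1^2 / (rho1 - rho')"] p by (simp add: C1_def mult_ac)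
  have "0 <= ((rho1 - rho') * r - rho1 * \<Delta>)^2 / (rho1 - rho')" using p by simp
  also have "... = (rho1 - rho') * r^2 - 2 * rho1 * (r * \<Delta>) + rho1^2 * \<Delta>^2 / (rho1 - rho')"
   using p by (simp add: power2_eq_square field_simps)
  finally show "2 * rho1 * (r * \<Delta>) <= (rho1 - rho') * r^2 + C1 * e" using c by linarith
  have "rho' * (rho1 - rho') <= rho1 * rho1" using rho1 rho' by (intro mult_mono) auto
  hence "rho' <= rho1^2 / (rho1 - rho')" using p by (simp add: pos_le_divide_eq power2_eq_square)
  from mult_right_mono[OF this, of "\<Delta>^2"] show "rho' * \<Delta>^2 <= C1 * e" using c by simp
 qed
 have e: "0 < e" by (simp add: e_def)
 have goal: "?thesis" if le: "measure (m t) {x \<in> Rd d. abs (f x - (LINT y|m t. f y)) >= r} <= 2 * exp (- rho' * r^2 + (C1 + C2) * e)"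
 proof -
  have "(C1 + C2) * e * 1 <= (C1 + C2) * e * (r + 1)" using Cnn e r by (intro mult_left_mono) auto
  hence "2 * exp (- rho' * r^2 + (C1 + C2) * e) <= 2 * exp (- rho' * r^2 + (C1 + C2) * e * (r + 1))" by simp
  thus ?thesis using le unfolding C e_def by linarith
 qed
 show ?thesis
 \<comment> \<open>For \<open>r\<close> within the possible shift of the mean the right-hand side is
   at least 2, so the bound is trivial; otherwise the tail is taken around the mean of
   \<open>minf\<close> at the reduced radius \<open>r - \<Delta>\<close>.\<close>
 proof (cases "r <= \<Delta>")
  case True
  hence "rho' * r^2 <= rho' * \<Delta>^2" using r rho' by (intro mult_left_mono power_mono) auto
  hence "0 <= - rho' * r^2 + (C1 + C2) * e" using small mult_nonneg_nonneg[OF Cnn(2) less_imp_le[OF e]] by (simp add: distrib_right)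
  hence "1 <= exp (- rho' * r^2 + (C1 + C2) * e)" by simp
  thus ?thesis using prob_le_1[of "{x \<in> Rd d. abs (f x - (LINT y|m t. f y)) >= r}"] by (intro goal) linarith
 next
  case False
  let ?s = "r - \<Delta>"
  let ?T = "%f. {x \<in> Rd d. ?s <= f x - (LINT x|minf. f x)}"
  have mf: "lip d 1 g ==> ?T g : sets (m t)" for g
   using P2_measurable[OF Pt lip_cont] unfolding P2_D(3)[OF Pt, symmetric] by measurable
  have f': "lip d 1 (%x. - f x)" using f by (simp add: lip_def abs_minus_commute)
  have "{x \<in> Rd d. abs (f x - (LINT y|m t. f y)) >= r} \<subseteq> ?T f \<union> ?T (%x. - f x)"
   using shift by (auto simp: abs_le_iff abs_if split: if_splits)
  hence "measure (m t) {x \<in> Rd d. abs (f x - (LINT y|m t. f y)) >= r} <= measure (m t) (?T f \<union> ?T (%x. - f x))"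
   using mf[OF f] mf[OF f'] by (intro finite_measure_mono) auto
  also have "... <= measure (m t) (?T f) + measure (m t) (?T (%x. - f x))" by (rule measure_Un_le[OF mf[OF f] mf[OF f']])
  also have "... <= 2 * exp (- rho1 * ?s^2 + C2 * e)"
  proof -
   have "measure (m t) (?T g) <= exp (- rho1 * ?s^2 + C2 * e)" if "lip d 1 g" for g
   proof -
    have "measure (m t) (?T g) <= exp (- rho1 * ?s^2 + gain h0 p0 eta qb t)"
     using tail_bound[OF A eta qb t(1) q that, of ?s] False unfolding qd by simp
    also have "... <= exp (- rho1 * ?s^2 + C2 * e)" using gain by simp
    finally show ?thesis .
   qed
   from this[OF f] this[OF f'] show ?thesis by linarith
  qed
  also have "... <= 2 * exp (- rho' * r^2 + (C1 + C2) * e)"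
  proof -
   have "- rho1 * ?s^2 = - rho1 * r^2 + 2 * rho1 * (r * \<Delta>) - rho1 * \<Delta>^2" by (simp add: power2_diff algebra_simps)
   moreover have "0 <= rho1 * \<Delta>^2" using rho1 by simp
   ultimately have "- rho1 * ?s^2 + C2 * e <= - rho' * r^2 + (C1 + C2) * e" using young by (simp add: algebra_simps)
   thus ?thesis by simp
  qed
  finally show ?thesis by (rule goal)
 qed
qed

theorem theorem2p5:
  shows "\<exists>(C :: real \<Rightarrow> real \<Rightarrow> real \<Rightarrow> real \<Rightarrow> real \<Rightarrow> real) (\<tau> :: real \<Rightarrow> real \<Rightarrow> real \<Rightarrow> real).
    \<forall>(d :: nat) (F :: (nat \<Rightarrow> real) measure \<Rightarrow> real)
     (\<delta>F :: (nat \<Rightarrow> real) measure \<Rightarrow> (nat \<Rightarrow> real) \<Rightarrow> real)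
     (DF :: (nat \<Rightarrow> real) measure \<Rightarrow> (nat \<Rightarrow> real) \<Rightarrow> (nat \<Rightarrow> real))
     (Mmm :: real) (Mmx :: real) (\<rho> :: real)
     (m :: real \<Rightarrow> (nat \<Rightarrow> real) measure) (minf :: (nat \<Rightarrow> real) measure)
     (h0 :: (nat \<Rightarrow> real) \<Rightarrow> real) (p0 :: real) (\<rho>' :: real).
      d \<ge> 1 \<and>
      linear_functional_derivative d F \<delta>F \<and>
      (\<forall>\<mu>\<in>P2 d. C_k d 1 (\<delta>F \<mu>)) \<and>
      DF = intrinsic_derivative d \<delta>F \<and>
      Mmm \<ge> 0 \<and> Mmx \<ge> 0 \<and> \<rho> > 0 \<and>
      (\<forall>t\<in>{0..1}. \<forall>\<mu>\<in>P2 d. \<forall>\<mu>'\<in>P2 d. F (mix t \<mu> \<mu>') \<le> (1 - t) * F \<mu> + t * F \<mu>') \<and>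
      (\<forall>x\<in>Rd d. \<forall>\<mu>\<in>P2 d. \<forall>\<mu>'\<in>P2 d.
         dist_Rd d (DF \<mu> x) (DF \<mu>' x) \<le> Mmm * wasserstein d 1 \<mu> \<mu>') \<and>
      (\<forall>\<mu>\<in>P2 d. integrable (lborel_Rd d) (\<lambda>x. exp (- \<delta>F \<mu> x)) \<and>
         (\<forall>f. C1_bounded d f \<longrightarrow>
            \<rho> * Ent (hat d \<delta>F \<mu>) (\<lambda>x. (f x)\<^sup>2)
              \<le> (\<integral>x. (norm_Rd d (grad d f x))\<^sup>2 \<partial>hat d \<delta>F \<mu>))) \<and>
      (\<forall>\<mu>\<in>P2 d. \<forall>x\<in>Rd d. deriv_norm d 1 (DF \<mu>) x \<le> Mmx) \<and>
      (\<forall>\<mu>\<in>P2 d. \<forall>i<d. C_k d 3 (\<lambda>x. DF \<mu> x i)) \<and>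
      (\<forall>k\<in>{2, 3}. \<exists>B. \<forall>\<mu>\<in>P2 d. \<forall>x\<in>Rd d. deriv_norm d k (DF \<mu>) x \<le> B) \<and>
      fokker_planck_solution d DF m \<and>
      free_energy_minimizer d F minf \<and>
      absolutely_continuous minf (m 0) \<and>
      h0 = (\<lambda>x. enn2real (RN_deriv minf (m 0) x)) \<and>
      p0 > 1 \<and> in_Lp p0 minf h0 \<and>
      0 < \<rho>' \<and> \<rho>' < \<rho>
      \<longrightarrow>
      (\<forall>f :: (nat \<Rightarrow> real) \<Rightarrow> real. (\<forall>x\<in>Rd d. \<forall>y\<in>Rd d. \<bar>f x - f y\<bar> \<le> dist_Rd d x y) \<longrightarrow>
        (\<forall>t r. t \<ge> 0 \<and> t \<ge> \<tau> \<rho>' \<rho> p0 \<and> r \<ge> 0 \<longrightarrow>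
          measure (m t) {x\<in>Rd d. \<bar>f x - (\<integral>y. f y \<partial>m t)\<bar> \<ge> r}
            \<le> 2 * exp (- \<rho>' * r\<^sup>2
                + C \<rho>' \<rho> Mmm p0 (Lp_norm p0 minf h0) * exp (- 4 * \<rho>' * t) * (r + 1))))"
proof (intro exI[of _ conc_const] exI[of _ conc_time] allI impI, elim conjE)
 fix d F dF DF Mmm Mmx rho m minf h0 p0 rho' f and t r :: real
 assume "d >= (1 :: nat)" "linear_functional_derivative d F dF" "ALL mu:P2 d. C_k d 1 (dF mu)" "DF = intrinsic_derivative d dF"
  "Mmm >= 0" "rho > 0" "ALL t:{0..1}. ALL mu:P2 d. ALL mu':P2 d. F (mix t mu mu') <= (1 - t) * F mu + t * F mu'"
  "ALL x:Rd d. ALL mu:P2 d. ALL mu':P2 d. dist_Rd d (DF mu x) (DF mu' x) <= Mmm * wasserstein d 1 mu mu'"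
  "ALL mu:P2 d. integrable (lborel_Rd d) (%x. exp (- dF mu x)) & (ALL f. C1_bounded d f -->
    rho * Ent (hat d dF mu) (%x. (f x)^2) <= (LINT x|hat d dF mu. (norm_Rd d (grad d f x))^2))"
  "ALL mu:P2 d. ALL x:Rd d. deriv_norm d 1 (DF mu) x <= Mmx" "ALL mu:P2 d. ALL i<d. C_k d 3 (%x. DF mu x i)"
  "ALL k:{2, 3}. EX B. ALL mu:P2 d. ALL x:Rd d. deriv_norm d k (DF mu) x <= B"
  "fokker_planck_solution d DF m" "free_energy_minimizer d F minf"
 then interpret mean_field_limit d F dF DF Mmm Mmx rho m minf by unfold_locales
 assume a: "absolutely_continuous minf (m 0)" "h0 = (%x. enn2real (RN_deriv minf (m 0) x))" "p0 > 1" "in_Lp p0 minf h0"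
  "0 < rho'" "rho' < rho" and f: "ALL x:Rd d. ALL y:Rd d. abs (f x - f y) <= dist_Rd d x y"
  and t: "t >= 0" "t >= conc_time rho' rho p0" "r >= 0"
 have "lip d 1 f" using f by (simp add: lip_def)
 from concentration[OF a this t]
 show "measure (m t) {x\<in>Rd d. abs (f x - (LINT y|m t. f y)) >= r}
   <= 2 * exp (- rho' * r^2 + conc_const rho' rho Mmm p0 (Lp_norm p0 minf h0) * exp (- 4 * rho' * t) * (r + 1))" .
qed

end
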